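(* Let $d,n_S,n_U\ge1$, $\sigma>0$, $r>0$, $\rho>0$, $\delta\in(0,1)$. Let $X_S\in\mathbb{R}^{n_S\times d}$ be fixed with $\hat\Sigma_S:=X_S^\top X_S/n_S$ invertible, and let $\mathbf{y}_S=X_S\boldsymbol{\beta}^*+\mathbf{z}$, $\mathbf{z}\sim\mathcal{N}(0,\sigma^2I_{n_S})$, $\boldsymbol{\beta}^*\in\mathcal{B}:=\{\boldsymbol{\beta}:\|\boldsymbol{\beta}\|_2\le r\}$. Let $p_T$ be a mean-zero $\rho^2$-subgaussian distribution on $\mathbb{R}^d$ with second-moment matrix $\Sigma_T=\mathbb{E}_{p_T}[\mathbf{x}\mathbf{x}^\top]$, and let $X_U\in\mathbb{R}^{n_U\times d}$ have i.i.d. rows drawn from $p_T$, independent of everything else; put $\hat\Sigma_U:=X_U^\top X_U/n_U$. Let $\hat C$ be (the $C$-component of) an optimal solution of $$\min_{C\in\mathbb{R}^{d\times d},\,\tau\in\mathbb{R}}\ r^2\tau+\frac{\sigma^2}{n_S}\operatorname{Tr}\big(C\hat\Sigma_S^{-1}C^\top\hat\Sigma_U\big)\quad\text{s.t.}\quad (C-I)^\top\hat\Sigma_U(C-I)\preceq\tau I,$$ and let $\hat{\boldsymbol{\beta}}(\mathbf{y}_S):=\hat C\hat\Sigma_S^{-1}X_S^\top\mathbf{y}_S/n_S$. Define $L_{\mathcal{B}}(\hat{\boldsymbol{\beta}}):=\max_{\boldsymbol{\beta}^*\in\mathcal{B}}\mathbb{E}_{\mathbf{z}}\|\Sigma_T^{1/2}(\hat{\boldsymbol{\beta}}(\mathbf{y}_S)-\boldsymbol{\beta}^*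 )\|_2^2$, $R_L(\mathcal{B}):=\inf_{A\in\mathbb{R}^{d\times n_S}}L_{\mathcal{B}}(\mathbf{y}_S\mapsto A\mathbf{y}_S)$ and $R_N(\mathcal{B}):=\inf_{\hat{\boldsymbol{\beta}}\text{ measurable}}L_{\mathcal{B}}(\hat{\boldsymbol{\beta}})$. Suppose $n_U\ge c_0\,\rho^4(d+\log(1/\delta))$ for a sufficiently large absolute constant $c_0$. Then, with probability at least $1-\delta$ over $X_U$ (for the fixed $X_S$), $$L_{\mathcal{B}}(\hat{\boldsymbol{\beta}})\le\Big(1+O\Big(\sqrt{\tfrac{\rho^4(d+\log(1/\delta))}{n_U}}\Big)\Big)R_L(\mathcal{B}),$$ and if in addition $\Sigma_T$ commutes with $\hat\Sigma_S$ or $\Sigma_T$ has rank $1$, $$L_{\mathcal{B}}(\hat{\boldsymbol{\beta}})\le\Big(1.25+O\Big(\sqrt{\tfrac{\rho^4(d+\log(1/\delta))}{n_U}}\Big)\Big)R_N(\mathcal{B}),$$ where $O(\cdot)$ hides absolute constants.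
   Context: A mean-zero distribution $p$ on $\mathbb{R}^d$ with second-moment matrix $\Sigma$ is called $\rho^2$-subgaussian if, writing $\mathbf{x}=\Sigma^{1/2}\bar{\mathbf{x}}$ for $\mathbf{x}\sim p$ (the whitened vector $\bar{\mathbf{x}}$), for every unit vector $\mathbf{v}$ and every $s\in\mathbb{R}$ one has $\mathbb{E}[e^{s\,\mathbf{v}^\top(\bar{\mathbf{x}}-\mathbb{E}\bar{\mathbf{x}})}]\le e^{s^2\rho^2/2}$. *)

theory Defs
  imports "HOL-Probability.Probability"
begin

text \<open>Finite-dimensional linear algebra with explicit dimensions.
  Vectors in R^n are functions nat => real of which only the coordinates i < n matter;
  matrices are functions nat => nat => real of which only the entries (i,j) with
  i < rows, j < cols matter.\<close>

definition idm :: "nat \<Rightarrow> nat \<Rightarrow> real" where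
  "idm i j = (if i = j then 1 else 0)"

definition mmul :: "nat \<Rightarrow> (nat \<Rightarrow> nat \<Rightarrow> real) \<Rightarrow> (nat \<Rightarrow> nat \<Rightarrow> real) \<Rightarrow> (nat \<Rightarrow> nat \<Rightarrow> real)" where
  "mmul k A B = (\<lambda>i j. \<Sum>l<k. A i l * B l j)"

definition mtr :: "(nat \<Rightarrow> nat \<Rightarrow> real) \<Rightarrow> (nat \<Rightarrow> nat \<Rightarrow> real)" where
  "mtr A = (\<lambda>i j. A j i)"

definition mv :: "nat \<Rightarrow> (nat \<Rightarrow> nat \<Rightarrow> real) \<Rightarrow> (nat \<Rightarrow> real) \<Rightarrow> (nat \<Rightarrow> real)" where
  "mv k A x = (\<lambda>i. \<Sum>j<k. A i j * x j)"

definition mtrace :: "nat \<Rightarrow> (nat \<Rightarrow> nat \<Rightarrow> real) \<Rightarrow> real" where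
  "mtrace n A = (\<Sum>i<n. A i i)"

definition sqnorm :: "nat \<Rightarrow> (nat \<Rightarrow> real) \<Rightarrow> real" where
  "sqnorm n x = (\<Sum>i<n. (x i)\<^sup>2)"

definition loewner_le :: "nat \<Rightarrow> (nat \<Rightarrow> nat \<Rightarrow> real) \<Rightarrow> (nat \<Rightarrow> nat \<Rightarrow> real) \<Rightarrow> bool" where
  "loewner_le n A B \<longleftrightarrow> (\<forall>x. (\<Sum>i<n. \<Sum>j<n. x i * (B i j - A i j) * x j) \<ge> 0)"

definition msym :: "nat \<Rightarrow> (nat \<Rightarrow> nat \<Rightarrow> real) \<Rightarrow> bool" where
  "msym n A \<longleftrightarrow> (\<forall>i<n. \<forall>j<n. A i j = A j i)"

definition mpsd :: "nat \<Rightarrow> (nat \<Rightarrow> nat \<Rightarrow> real) \<Rightarrow> bool" where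
  "mpsd n A \<longleftrightarrow> msym n A \<and> loewner_le n (\<lambda>i j. 0) A"

definition is_inv :: "nat \<Rightarrow> (nat \<Rightarrow> nat \<Rightarrow> real) \<Rightarrow> (nat \<Rightarrow> nat \<Rightarrow> real) \<Rightarrow> bool" where
  "is_inv n A B \<longleftrightarrow> (\<forall>i<n. \<forall>j<n. mmul n A B i j = idm i j \<and> mmul n B A i j = idm i j)"

definition minvertible :: "nat \<Rightarrow> (nat \<Rightarrow> nat \<Rightarrow> real) \<Rightarrow> bool" where
  "minvertible n A \<longleftrightarrow> (\<exists>B. is_inv n A B)"

text \<open>The inverse (entries outside the n x n block set to 0 to make it unique).\<close>
definition minv :: "nat \<Rightarrow> (nat \<Rightarrow> nat \<Rightarrow> real) \<Rightarrow> (nat \<Rightarrow> nat \<Rightarrow> real)" where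
  "minv n A = (THE B. is_inv n A B \<and> (\<forall>i j. \<not> (i < n \<and> j < n) \<longrightarrow> B i j = 0))"

definition msqrt :: "nat \<Rightarrow> (nat \<Rightarrow> nat \<Rightarrow> real) \<Rightarrow> (nat \<Rightarrow> nat \<Rightarrow> real)" where
  "msqrt n A = (THE S. mpsd n S \<and> (\<forall>i<n. \<forall>j<n. mmul n S S i j = A i j)
                     \<and> (\<forall>i j. \<not> (i < n \<and> j < n) \<longrightarrow> S i j = 0))"

definition mrank :: "nat \<Rightarrow> nat \<Rightarrow> (nat \<Rightarrow> nat \<Rightarrow> real) \<Rightarrow> nat" where
  "mrank m n A = Max {card J | J. J \<subseteq> {..<n} \<and>
      (\<forall>c. (\<forall>i<m. (\<Sum>j\<in>J. c j * A i j) = 0) \<longrightarrow> (\<forall>j\<in>J. c j = 0))}"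

definition emp_cov :: "nat \<Rightarrow> (nat \<Rightarrow> nat \<Rightarrow> real) \<Rightarrow> (nat \<Rightarrow> nat \<Rightarrow> real)" where
  "emp_cov n X = (\<lambda>i j. (\<Sum>k<n. X k i * X k j) / real n)"

definition Rn :: "nat \<Rightarrow> (nat \<Rightarrow> real) measure" where
  "Rn n = PiM {..<n} (\<lambda>_. borel)"

definition second_moment :: "(nat \<Rightarrow> real) measure \<Rightarrow> (nat \<Rightarrow> nat \<Rightarrow> real)" where
  "second_moment P = (\<lambda>i j. \<integral>x. x i * x j \<partial>P)"

definition mean_zero_l2 :: "nat \<Rightarrow> (nat \<Rightarrow> real) measure \<Rightarrow> bool" where
  "mean_zero_l2 d P \<longleftrightarrow> prob_space P \<and> sets P = sets (Rn d) \<and>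
     (\<forall>i<d. integrable P (\<lambda>x. x i) \<and> (\<integral>x. x i \<partial>P) = 0) \<and>
     (\<forall>i<d. \<forall>j<d. integrable P (\<lambda>x. x i * x j))"

text \<open>rho^2-subgaussian: writing x = Sigma^{1/2} xbar (whitened vector xbar), for every unit v
  and every s, E exp(s v^T (xbar - E xbar)) \<le> exp(s^2 rho^2 / 2).\<close>
definition subgaussian :: "nat \<Rightarrow> real \<Rightarrow> (nat \<Rightarrow> real) measure \<Rightarrow> bool" where
  "subgaussian d \<rho> P \<longleftrightarrow>
     (\<exists>xbar :: (nat \<Rightarrow> real) \<Rightarrow> (nat \<Rightarrow> real).
        (\<forall>i<d. integrable P (\<lambda>x. xbar x i)) \<and>
        (AE x in P. \<forall>i<d. x i = mv d (msqrt d (second_moment P)) (xbar x) i) \<and>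
        (\<forall>v s. sqnorm d v = 1 \<longrightarrow>
           (\<integral>\<^sup>+x. ennreal (exp (s * (\<Sum>i<d. v i * (xbar x i - (\<integral>y. xbar y i \<partial>P))))) \<partial>P)
             \<le> ennreal (exp (s\<^sup>2 * \<rho>\<^sup>2 / 2))))"

definition gauss_noise :: "nat \<Rightarrow> real \<Rightarrow> (nat \<Rightarrow> real) measure" where
  "gauss_noise n \<sigma> = PiM {..<n} (\<lambda>_. density lborel (normal_density 0 \<sigma>))"

definition worst_risk :: "nat \<Rightarrow> nat \<Rightarrow> (nat \<Rightarrow> nat \<Rightarrow> real) \<Rightarrow> real \<Rightarrow> real \<Rightarrow>
    (nat \<Rightarrow> nat \<Rightarrow> real) \<Rightarrow> ((nat \<Rightarrow> real) \<Rightarrow> (nat \<Rightarrow> real)) \<Rightarrow> ennreal" where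
  "worst_risk d nS XS \<sigma> r SigT est =
     (SUP \<beta> \<in> {\<beta>. sqrt (sqnorm d \<beta>) \<le> r}.
        \<integral>\<^sup>+z. ennreal (sqnorm d (mv d (msqrt d SigT)
                 (\<lambda>i. est (restrict (\<lambda>k. mv d XS \<beta> k + z k) {..<nS}) i - \<beta> i)))
          \<partial>gauss_noise nS \<sigma>)"

definition linear_minimax :: "nat \<Rightarrow> nat \<Rightarrow> (nat \<Rightarrow> nat \<Rightarrow> real) \<Rightarrow> real \<Rightarrow> real \<Rightarrow>
    (nat \<Rightarrow> nat \<Rightarrow> real) \<Rightarrow> ennreal" where
  "linear_minimax d nS XS \<sigma> r SigT = (INF A. worst_risk d nS XS \<sigma> r SigT (mv nS A))"

definition minimax :: "nat \<Rightarrow> nat \<Rightarrow> (nat \<Rightarrow> nat \<Rightarrow> real) \<Rightarrow> real \<Rightarrow> real \<Rightarrow>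
    (nat \<Rightarrow> nat \<Rightarrow> real) \<Rightarrow> ennreal" where
  "minimax d nS XS \<sigma> r SigT =
     (INF est \<in> {est. \<forall>i<d. (\<lambda>y. est y i) \<in> borel_measurable (Rn nS)}.
        worst_risk d nS XS \<sigma> r SigT est)"

definition sdp_obj :: "nat \<Rightarrow> nat \<Rightarrow> real \<Rightarrow> real \<Rightarrow> (nat \<Rightarrow> nat \<Rightarrow> real) \<Rightarrow> (nat \<Rightarrow> nat \<Rightarrow> real) \<Rightarrow>
    (nat \<Rightarrow> nat \<Rightarrow> real) \<Rightarrow> real \<Rightarrow> real" where
  "sdp_obj d nS \<sigma> r SigS SigU C \<tau> =
     r\<^sup>2 * \<tau> + \<sigma>\<^sup>2 / real nS * mtrace d (mmul d (mmul d (mmul d C (minv d SigS)) (mtr C)) SigU)"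

definition sdp_feasible :: "nat \<Rightarrow> (nat \<Rightarrow> nat \<Rightarrow> real) \<Rightarrow> (nat \<Rightarrow> nat \<Rightarrow> real) \<Rightarrow> real \<Rightarrow> bool" where
  "sdp_feasible d SigU C \<tau> \<longleftrightarrow>
     (let D = (\<lambda>i j. C i j - idm i j) in
      loewner_le d (mmul d (mmul d (mtr D) SigU) D) (\<lambda>i j. \<tau> * idm i j))"

definition sdp_optimal :: "nat \<Rightarrow> nat \<Rightarrow> real \<Rightarrow> real \<Rightarrow> (nat \<Rightarrow> nat \<Rightarrow> real) \<Rightarrow> (nat \<Rightarrow> nat \<Rightarrow> real) \<Rightarrow>
    (nat \<Rightarrow> nat \<Rightarrow> real) \<Rightarrow> real \<Rightarrow> bool" where
  "sdp_optimal d nS \<sigma> r SigS SigU C \<tau> \<longleftrightarrow>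
     sdp_feasible d SigU C \<tau> \<and>
     (\<forall>C' \<tau>'. sdp_feasible d SigU C' \<tau>' \<longrightarrow>
        sdp_obj d nS \<sigma> r SigS SigU C \<tau> \<le> sdp_obj d nS \<sigma> r SigS SigU C' \<tau>')"

definition sdp_estimator :: "nat \<Rightarrow> nat \<Rightarrow> (nat \<Rightarrow> nat \<Rightarrow> real) \<Rightarrow> (nat \<Rightarrow> nat \<Rightarrow> real) \<Rightarrow>
    (nat \<Rightarrow> real) \<Rightarrow> (nat \<Rightarrow> real)" where
  "sdp_estimator d nS XS C y =
     mv nS (\<lambda>i j. mmul d (mmul d C (minv d (emp_cov nS XS))) (mtr XS) i j / real nS) y"

end

theory Submission
  imports Defs
begin

text \<open>A covering argument over a lattice net gives, with probability \<open>1 - \<delta>\<close>, the relative bound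
  \<open>\<bar>u\<^sup>T (\<Sigma>U - \<Sigma>T) u\<bar> \<le> \<eta> u\<^sup>T \<Sigma>T u\<close> for all \<open>u\<close>, with \<open>\<eta> = 260 eps\<close>. The risk of a linear estimator splits into bias
  and variance, both quadratic forms in \<open>\<Sigma>T\<close>, and the linear minimax risk is the value of the semidefinite
  program for \<open>\<Sigma>T\<close>; replacing \<open>\<Sigma>T\<close> by \<open>\<Sigma>U\<close> therefore costs a factor \<open>(1 + \<eta>) / (1 - \<eta>) \<le> 1 + 4 \<eta>\<close>.

  For the nonlinear bound, both special cases reduce the problem to bounded normal means: in the commuting
  case the simultaneous eigenbasis and water filling single out a hyperrectangle whose linear risk is the
  linear minimax risk, in the rank-one case a single segment does. On a segment of signal-to-noise ratio \<open>t\<close>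
  the linear risk is \<open>t / (1 + t)\<close> and explicit finitely supported priors show that every estimator has risk at
  least \<open>4/5\<close> of that; a product of these priors treats the hyperrectangle.\<close>

section \<open>Gaussian noise\<close>

text \<open>Two obstacles shape the argument. The target second-moment matrix may be singular, so an
  additive deviation bound would be useless: the data are whitened on its range only, and almost
  surely they have no component in its kernel. The factor 5/4 is the reciprocal of 4/5, and the
  nonlinear minimax risk on an interval has no closed form. The Bayes risk of a finitely supported
  prior is a Gaussian integral of a quotient of exponential sums. Either the prior makes the
  quotient cancel, or the reciprocal of the denominator \<open>g\<close> is replaced by its tangent
  minorant \<open>2 * w - w\<^sup>2 * g\<close>; only Gaussian integrals of exponentials remain in
  both cases, and the claim becomes an inequality between exponentials of multiples of
  \<open>t\<close>. Two monotonicities reduce it to finitely many checks: a prior on a smaller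
  interval also serves a larger one, and \<open>t / (1 + t)\<close> increases to 1. Short cells with
  Taylor certificates handle moderate \<open>t\<close>, where there is little slack. In several
  dimensions nothing new is estimated: a known offset of the data never matters, so product priors
  act one coordinate at a time.\<close>

definition std_gauss :: "real measure" where
  "std_gauss = density lborel std_normal_density"

lemma prob_space_std_gauss: "prob_space std_gauss"
  unfolding std_gauss_def by (rule prob_space_normal_density) simp

lemma sets_std_gauss [measurable_cong, simp]: "sets std_gauss = sets borel"
  by (simp add: std_gauss_def)

text \<open>Completing the square: the tilted standard normal density is a multiple of a normal
  density of precision \<open>1 + 2 * \<theta>\<close>, and the hypothesis is exactly the positivity
  of that precision. Every Gaussian integral of the lower bounds reduces to this.\<close>

lemma std_gauss_exp_aux:
  assumes "\<theta> > -1/2"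
  shows "std_normal_density u * exp (\<mu> * u - \<theta> * u\<^sup>2)
    = exp (\<mu>\<^sup>2 / (2 * (1 + 2 * \<theta>))) / sqrt (1 + 2 * \<theta>)
      * normal_density (\<mu> / (1 + 2 * \<theta>)) (1 / sqrt (1 + 2 * \<theta>)) u"
proof -
  define p where "p = 1 + 2 * \<theta>"
  have p: "p > 0" using assms by (simp add: p_def)
  have \<theta>: "\<theta> = (p - 1) / 2" by (simp add: p_def)
  have "- u\<^sup>2 / 2 + (\<mu> * u - \<theta> * u\<^sup>2) = \<mu>\<^sup>2 / (2 * p) - (u - \<mu> / p)\<^sup>2 / (2 * (1 / sqrt p)\<^sup>2)"
    using p unfolding \<theta> by (simp add: field_simps power2_eq_square)
  then have "exp (- u\<^sup>2 / 2) * exp (\<mu> * u - \<theta> * u\<^sup>2)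
      = exp (\<mu>\<^sup>2 / (2 * p)) * exp (- (u - \<mu> / p)\<^sup>2 / (2 * (1 / sqrt p)\<^sup>2))"
    by (simp add: exp_add[symmetric])
  moreover have "sqrt (2 * pi * (1 / sqrt p)\<^sup>2) = sqrt (2 * pi) / sqrt p"
    using p by (simp add: real_sqrt_mult real_sqrt_divide power_divide)
  ultimately show ?thesis
    using p unfolding std_normal_density_def normal_density_def p_def[symmetric]
    by (simp add: field_simps)
qed

lemma std_gauss_exp:
  assumes "\<theta> > -1/2"
  shows "integrable std_gauss (\<lambda>u. exp (\<mu> * u - \<theta> * u\<^sup>2))"
    and "(\<integral>u. exp (\<mu> * u - \<theta> * u\<^sup>2) \<partial>std_gauss)
      = exp (\<mu>\<^sup>2 / (2 * (1 + 2 * \<theta>))) / sqrt (1 + 2 * \<theta>)"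
proof -
  show "integrable std_gauss (\<lambda>u. exp (\<mu> * u - \<theta> * u\<^sup>2))"
    unfolding std_gauss_def using assms
    by (subst integrable_real_density) (simp_all add: std_gauss_exp_aux)
  show "(\<integral>u. exp (\<mu> * u - \<theta> * u\<^sup>2) \<partial>std_gauss)
      = exp (\<mu>\<^sup>2 / (2 * (1 + 2 * \<theta>))) / sqrt (1 + 2 * \<theta>)"
    unfolding std_gauss_def using assms
    by (subst integral_real_density) (simp_all add: std_gauss_exp_aux)
qed

lemma prob_space_gauss_coord: "\<sigma> > 0 \<Longrightarrow> prob_space (density lborel (normal_density 0 \<sigma>))"
  by (rule prob_space_normal_density)

lemma product_prob_space_gauss:
  "\<sigma> > 0 \<Longrightarrow> product_prob_space (\<lambda>_::nat. density lborel (normal_density 0 \<sigma>))"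
  by (intro product_prob_spaceI prob_space_gauss_coord)

lemma prob_space_gauss_noise: "\<sigma> > 0 \<Longrightarrow> prob_space (gauss_noise n \<sigma>)"
  unfolding gauss_noise_def by (intro prob_space_PiM prob_space_gauss_coord)

lemma sets_gauss_noise [measurable_cong]: "sets (gauss_noise n \<sigma>) = sets (Rn n)"
  unfolding gauss_noise_def Rn_def by (intro sets_PiM_cong) auto

lemma space_gauss_noise: "space (gauss_noise n \<sigma>) = extensional {..<n}"
  unfolding gauss_noise_def by (simp add: space_PiM PiE_def)

lemma measurable_gauss_coord [measurable]: "k < n \<Longrightarrow> (\<lambda>z. z k) \<in> borel_measurable (gauss_noise n \<sigma>)"
  unfolding measurable_cong_sets[OF sets_gauss_noise refl] Rn_def by measurable

section \<open>Translations of Gaussian noise\<close>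

lemma cameron_martin_rectangle:
  assumes \<sigma>: "\<sigma> > 0" and A: "A \<in> sets borel"
  shows "(\<integral>\<^sup>+z. ennreal (exp (c * z / \<sigma>\<^sup>2 - c\<^sup>2 / (2 * \<sigma>\<^sup>2))) * indicator A z
            \<partial>density lborel (normal_density 0 \<sigma>))
    = emeasure (density lborel (normal_density 0 \<sigma>)) ((\<lambda>z. c + z) -` A)"
proof -
  have [measurable]: "A \<in> sets borel" by fact
  have [measurable]: "((\<lambda>z. c + z) -` A) \<in> sets borel"
    using measurable_sets[of "\<lambda>z. c + z" borel borel A] A by simp
  have *: "normal_density 0 \<sigma> z * exp (c * z / \<sigma>\<^sup>2 - c\<^sup>2 / (2 * \<sigma>\<^sup>2)) = normal_density 0 \<sigma> (z - c)" for z
  proof -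
    have "- (z - 0)\<^sup>2 / (2 * \<sigma>\<^sup>2) + (c * z / \<sigma>\<^sup>2 - c\<^sup>2 / (2 * \<sigma>\<^sup>2)) = - (z - c - 0)\<^sup>2 / (2 * \<sigma>\<^sup>2)"
      using \<sigma> by (simp add: field_simps power2_eq_square)
    then show ?thesis
      unfolding normal_density_def by (simp add: exp_add[symmetric])
  qed
  have "(\<integral>\<^sup>+z. ennreal (exp (c * z / \<sigma>\<^sup>2 - c\<^sup>2 / (2 * \<sigma>\<^sup>2))) * indicator A z
            \<partial>density lborel (normal_density 0 \<sigma>))
     = (\<integral>\<^sup>+z. ennreal (normal_density 0 \<sigma> (z - c)) * indicator A z \<partial>lborel)"
    by (subst nn_integral_density)
       (auto intro!: nn_integral_cong simp: *[symmetric] ennreal_mult mult.assoc[symmetric])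
  also have "\<dots> = (\<integral>\<^sup>+z. ennreal (normal_density 0 \<sigma> z) * indicator A (c + z) \<partial>lborel)"
    by (subst nn_integral_real_affine[where c = 1 and t = c]) auto
  also have "\<dots> = (\<integral>\<^sup>+z. ennreal (normal_density 0 \<sigma> z) * indicator ((\<lambda>z. c + z) -` A) z \<partial>lborel)"
    by (intro nn_integral_cong) (auto simp: indicator_def)
  also have "\<dots> = emeasure (density lborel (normal_density 0 \<sigma>)) ((\<lambda>z. c + z) -` A)"
    by (subst emeasure_density) auto
  finally show ?thesis .
qed

text \<open>Both measures are identified with one product of shifted one-dimensional normals by
  testing on boxes, where the indicator and the density factorise over the coordinates.\<close>

lemma cameron_martin_distr:
  assumes \<sigma>: "\<sigma> > 0"
  shows "distr (gauss_noise n \<sigma>) (Rn n) (\<lambda>z. restrict (\<lambda>k. c k + z k) {..<n})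
    = density (gauss_noise n \<sigma>)
        (\<lambda>z. \<Prod>k<n. ennreal (exp (c k * z k / \<sigma>\<^sup>2 - (c k)\<^sup>2 / (2 * \<sigma>\<^sup>2))))"
    (is "?D = ?E")
proof -
  let ?N = "density lborel (normal_density 0 \<sigma>)"
  let ?f = "\<lambda>k z. ennreal (exp (c k * z / \<sigma>\<^sup>2 - (c k)\<^sup>2 / (2 * \<sigma>\<^sup>2)))"
  interpret P: product_prob_space "\<lambda>_::nat. ?N" by (rule product_prob_space_gauss[OF \<sigma>])
  have pr: "prob_space (distr ?N borel (\<lambda>z. c k + z))" for k
    using prob_space_gauss_coord[OF \<sigma>] by (intro prob_space.prob_space_distr) auto
  interpret Q: product_prob_space "\<lambda>k. distr ?N borel (\<lambda>z. c k + z)"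
    by (intro product_prob_spaceI pr)
  have meas [measurable]: "(\<lambda>z. restrict (\<lambda>k. c k + z k) {..<n}) \<in> measurable (gauss_noise n \<sigma>) (Rn n)"
    unfolding Rn_def by (intro measurable_restrict) measurable
  have sets_A: "Pi\<^sub>E {..<n} A \<in> sets (Rn n)" if "\<And>i. i \<in> {..<n} \<Longrightarrow> A i \<in> sets borel" for A
    unfolding Rn_def using that by (intro sets_PiM_I_finite) auto
  have vim: "((\<lambda>z. c k + z) -` B) \<in> sets borel" if "B \<in> sets borel" for k B
    using measurable_sets[of "\<lambda>z. c k + z" borel borel B] that by simp
  have "?D = PiM {..<n} (\<lambda>k. distr ?N borel (\<lambda>z. c k + z))"
  proof (rule Q.PiM_eqI)
    show "sets ?D = sets (PiM {..<n} (\<lambda>k. distr ?N borel (\<lambda>z. c k + z)))"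
      unfolding sets_distr Rn_def by (intro sets_PiM_cong) auto
    fix A assume A: "\<And>i. i \<in> {..<n} \<Longrightarrow> A i \<in> sets (distr ?N borel (\<lambda>z. c i + z))"
    then have A': "\<And>i. i \<in> {..<n} \<Longrightarrow> A i \<in> sets borel" by simp
    have "emeasure ?D (Pi\<^sub>E {..<n} A) = emeasure (gauss_noise n \<sigma>) 
        ((\<lambda>z. restrict (\<lambda>k. c k + z k) {..<n}) -` Pi\<^sub>E {..<n} A \<inter> space (gauss_noise n \<sigma>))"
      by (rule emeasure_distr[OF meas sets_A]) (use A' in auto)
    also have "(\<lambda>z. restrict (\<lambda>k. c k + z k) {..<n}) -` Pi\<^sub>E {..<n} A \<inter> space (gauss_noise n \<sigma>)
        = Pi\<^sub>E {..<n} (\<lambda>k. (\<lambda>z. c k + z) -` A k)"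
      by (auto simp: space_gauss_noise PiE_def Pi_def)
    also have "emeasure (gauss_noise n \<sigma>) \<dots> = (\<Prod>k<n. emeasure ?N ((\<lambda>z. c k + z) -` A k))"
      unfolding gauss_noise_def by (rule P.emeasure_PiM) (use A' vim in auto)
    also have "\<dots> = (\<Prod>k<n. emeasure (distr ?N borel (\<lambda>z. c k + z)) (A k))"
      by (intro prod.cong refl, subst emeasure_distr) (use A' in auto)
    finally show "emeasure ?D (Pi\<^sub>E {..<n} A) = (\<Prod>k\<in>{..<n}. emeasure (distr ?N borel (\<lambda>z. c k + z)) (A k))" .
  qed simp
  moreover have "?E = PiM {..<n} (\<lambda>k. distr ?N borel (\<lambda>z. c k + z))"
  proof (rule Q.PiM_eqI)
    show "sets ?E = sets (PiM {..<n} (\<lambda>k. distr ?N borel (\<lambda>z. c k + z)))"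
      unfolding sets_density sets_gauss_noise Rn_def by (intro sets_PiM_cong) auto
    fix A assume A: "\<And>i. i \<in> {..<n} \<Longrightarrow> A i \<in> sets (distr ?N borel (\<lambda>z. c i + z))"
    then have A': "\<And>i. i \<in> {..<n} \<Longrightarrow> A i \<in> sets borel" by simp
    have ind: "indicator (Pi\<^sub>E {..<n} A) z = (\<Prod>k<n. indicator (A k) (z k) :: ennreal)"
      if z: "z \<in> space (gauss_noise n \<sigma>)" for z
    proof (cases "z \<in> Pi\<^sub>E {..<n} A")
      case True then show ?thesis by (auto simp: PiE_def Pi_def)
    next
      case False
      then obtain k where "k < n" "z k \<notin> A k"
        using z by (auto simp: space_gauss_noise PiE_def Pi_def)
      then have "(\<Prod>k<n. indicator (A k) (z k) :: ennreal) = 0"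
        by (intro prod_zero bexI[of _ k]) auto
      with False show ?thesis by simp
    qed
    have "emeasure ?E (Pi\<^sub>E {..<n} A)
        = (\<integral>\<^sup>+z. (\<Prod>k<n. ?f k (z k)) * indicator (Pi\<^sub>E {..<n} A) z \<partial>gauss_noise n \<sigma>)"
      by (rule emeasure_density) (use sets_A A' in \<open>auto simp: sets_gauss_noise\<close>)
    also have "\<dots> = (\<integral>\<^sup>+z. (\<Prod>k<n. ?f k (z k) * indicator (A k) (z k)) \<partial>gauss_noise n \<sigma>)"
      by (intro nn_integral_cong) (simp add: ind prod.distrib)
    also have "\<dots> = (\<Prod>k<n. \<integral>\<^sup>+z. ?f k z * indicator (A k) z \<partial>?N)"
      unfolding gauss_noise_def
      by (rule P.product_nn_integral_prod) (use A' in auto)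
    also have "\<dots> = (\<Prod>k<n. emeasure (distr ?N borel (\<lambda>z. c k + z)) (A k))"
    proof (intro prod.cong refl)
      fix k assume k: "k \<in> {..<n}"
      show "(\<integral>\<^sup>+z. ?f k z * indicator (A k) z \<partial>?N) = emeasure (distr ?N borel (\<lambda>z. c k + z)) (A k)"
        by (subst cameron_martin_rectangle[OF \<sigma> A'[OF k]], subst emeasure_distr) (use A'[OF k] in auto)
    qed
    finally show "emeasure ?E (Pi\<^sub>E {..<n} A) = (\<Prod>k\<in>{..<n}. emeasure (distr ?N borel (\<lambda>z. c k + z)) (A k))" .
  qed simp
  ultimately show ?thesis by simp
qed

text \<open>In this form a risk under mean \<open>c\<close> becomes a likelihood-weighted risk under
  mean zero, so that the risks at different points of a prior can be added under a single integral
  and compared pointwise in \<open>z\<close>.\<close>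

lemma cameron_martin:
  assumes \<sigma>: "\<sigma> > 0" and [measurable]: "f \<in> borel_measurable (Rn n)"
  shows "(\<integral>\<^sup>+z. f (restrict (\<lambda>k. c k + z k) {..<n}) \<partial>gauss_noise n \<sigma>)
    = (\<integral>\<^sup>+z. ennreal (exp ((\<Sum>k<n. c k * z k) / \<sigma>\<^sup>2 - (\<Sum>k<n. (c k)\<^sup>2) / (2 * \<sigma>\<^sup>2))) * f z
        \<partial>gauss_noise n \<sigma>)"
proof -
  have meas [measurable]: "(\<lambda>z. restrict (\<lambda>k. c k + z k) {..<n}) \<in> measurable (gauss_noise n \<sigma>) (Rn n)"
    unfolding Rn_def by (intro measurable_restrict) measurable
  have "(\<integral>\<^sup>+z. f (restrict (\<lambda>k. c k + z k) {..<n}) \<partial>gauss_noise n \<sigma>)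
     = (\<integral>\<^sup>+z. f z \<partial>distr (gauss_noise n \<sigma>) (Rn n) (\<lambda>z. restrict (\<lambda>k. c k + z k) {..<n}))"
    by (subst nn_integral_distr) auto
  also have "\<dots> = (\<integral>\<^sup>+z. (\<Prod>k<n. ennreal (exp (c k * z k / \<sigma>\<^sup>2 - (c k)\<^sup>2 / (2 * \<sigma>\<^sup>2)))) * f z \<partial>gauss_noise n \<sigma>)"
    unfolding cameron_martin_distr[OF \<sigma>]
    by (subst nn_integral_density) (auto simp: measurable_cong_sets[OF sets_gauss_noise refl])
  also have "\<dots> = (\<integral>\<^sup>+z. ennreal (exp ((\<Sum>k<n. c k * z k) / \<sigma>\<^sup>2 - (\<Sum>k<n. (c k)\<^sup>2) / (2 * \<sigma>\<^sup>2))) * f z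
        \<partial>gauss_noise n \<sigma>)"
    by (intro nn_integral_cong)
       (simp add: prod_ennreal exp_sum[symmetric] sum_subtractf sum_divide_distrib)
  finally show ?thesis .
qed

section \<open>Linear functionals of Gaussian noise\<close>

lemma gauss_coord_distributed:
  assumes \<sigma>: "\<sigma> > 0" and k: "k < n"
  shows "distributed (gauss_noise n \<sigma>) lborel (\<lambda>z. z k) (normal_density 0 \<sigma>)"
proof -
  let ?N = "density lborel (normal_density 0 \<sigma>)"
  have "distr (gauss_noise n \<sigma>) ?N (\<lambda>z. z k) = ?N"
    unfolding gauss_noise_def
    by (rule distr_PiM_component[OF prob_space_gauss_coord[OF \<sigma>]]) (use k in auto)
  then have "distr (gauss_noise n \<sigma>) lborel (\<lambda>z. z k) = ?N"
    by (subst (asm) distr_cong[OF refl, of ?N lborel]) auto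
  then show ?thesis using k unfolding distributed_def by auto
qed

lemma gauss_indep:
  assumes \<sigma>: "\<sigma> > 0" and n: "n > 0"
  shows "prob_space.indep_vars (gauss_noise n \<sigma>) (\<lambda>_. borel) (\<lambda>k z. z k) {..<n}"
proof -
  let ?N = "density lborel (normal_density 0 \<sigma>)"
  interpret prob_space "gauss_noise n \<sigma>" by (rule prob_space_gauss_noise[OF \<sigma>])
  have "distr (gauss_noise n \<sigma>) (\<Pi>\<^sub>M k\<in>{..<n}. borel) (\<lambda>z. \<lambda>k\<in>{..<n}. z k)
      = distr (gauss_noise n \<sigma>) (gauss_noise n \<sigma>) (\<lambda>z. z)"
    by (rule distr_cong) (auto simp: sets_gauss_noise Rn_def space_gauss_noise extensional_restrict)
  also have "\<dots> = gauss_noise n \<sigma>" by (rule distr_id)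
  also have "\<dots> = (\<Pi>\<^sub>M k\<in>{..<n}. distr (gauss_noise n \<sigma>) borel (\<lambda>z. z k))"
  proof -
    have "distr (gauss_noise n \<sigma>) borel (\<lambda>z. z k) = ?N" if "k < n" for k
      using gauss_coord_distributed[OF \<sigma> that] unfolding distributed_def
      by (metis distr_cong sets_lborel)
    then show ?thesis
      unfolding gauss_noise_def by (intro PiM_cong) (auto simp: gauss_noise_def[symmetric])
  qed
  finally show ?thesis
    using n by (subst indep_vars_iff_distr_eq_PiM') auto
qed

lemma gauss_linear_distributed:
  assumes \<sigma>: "\<sigma> > 0" and w: "(\<Sum>k<n. (w k)\<^sup>2) > 0"
  shows "distributed (gauss_noise n \<sigma>) lborel
    (\<lambda>z. (\<Sum>k<n. w k * z k) / (\<sigma> * sqrt (\<Sum>k<n. (w k)\<^sup>2))) std_normal_density"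
proof -
  interpret prob_space "gauss_noise n \<sigma>" by (rule prob_space_gauss_noise[OF \<sigma>])
  \<comment> \<open>The summation rule for independent normals wants strictly positive standard
    deviations, so vanishing weights are first removed from the index set.\<close>
  define I where "I = {k. k < n \<and> w k \<noteq> 0}"
  have fin: "finite I" unfolding I_def by auto
  have s1: "(\<Sum>k<n. f k) = (\<Sum>k\<in>I. f k)" if "\<And>k. w k = 0 \<Longrightarrow> f k = 0" for f :: "nat \<Rightarrow> real"
    using that by (intro sum.mono_neutral_right) (auto simp: I_def)
  have ne: "I \<noteq> {}" using w by (auto simp: s1)
  have n: "n > 0" using ne by (auto simp: I_def)
  have "indep_vars (\<lambda>_. borel) (\<lambda>k z. z k) I"
    by (rule indep_vars_subset[OF gauss_indep[OF \<sigma> n]]) (auto simp: I_def)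
  then have "indep_vars (\<lambda>_. borel) (\<lambda>k z. w k * z k) I"
    by (rule indep_vars_compose2[where Y = "\<lambda>k x. w k * x"]) auto
  moreover have "distributed (gauss_noise n \<sigma>) lborel (\<lambda>z. w k * z k) (normal_density 0 (\<bar>w k\<bar> * \<sigma>))"
    if "k \<in> I" for k
    using normal_density_affine[OF gauss_coord_distributed[OF \<sigma>, of k n], where \<alpha> = "w k" and \<beta> = 0] that \<sigma>
    by (auto simp: I_def)
  ultimately have "distributed (gauss_noise n \<sigma>) lborel (\<lambda>z. \<Sum>k\<in>I. w k * z k)
      (normal_density (\<Sum>k\<in>I. 0) (sqrt (\<Sum>k\<in>I. (\<bar>w k\<bar> * \<sigma>)\<^sup>2)))"
    using \<sigma> by (intro sum_indep_normal fin ne) (auto simp: I_def)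
  moreover have "sqrt (\<Sum>k\<in>I. (\<bar>w k\<bar> * \<sigma>)\<^sup>2) = \<sigma> * sqrt (\<Sum>k<n. (w k)\<^sup>2)"
    using \<sigma> by (simp add: s1 power_mult_distrib sum_distrib_right[symmetric] real_sqrt_mult)
  ultimately have "distributed (gauss_noise n \<sigma>) lborel (\<lambda>z. \<Sum>k<n. w k * z k)
      (normal_density 0 (\<sigma> * sqrt (\<Sum>k<n. (w k)\<^sup>2)))"
    by (simp add: s1)
  from iffD1[OF normal_standard_normal_convert this] show ?thesis
    using \<sigma> w by simp
qed

lemma gauss_linear_nn_integral:
  assumes \<sigma>: "\<sigma> > 0" and w: "(\<Sum>k<n. (w k)\<^sup>2) > 0" and [measurable]: "f \<in> borel_measurable borel"
  shows "(\<integral>\<^sup>+z. f ((\<Sum>k<n. w k * z k) / (\<sigma> * sqrt (\<Sum>k<n. (w k)\<^sup>2))) \<partial>gauss_noise n \<sigma>)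
    = (\<integral>\<^sup>+u. f u \<partial>std_gauss)"
proof -
  have *: "(\<lambda>z. (\<Sum>k<n. w k * z k) / (\<sigma> * sqrt (\<Sum>k<n. (w k)\<^sup>2))) \<in> measurable (gauss_noise n \<sigma>) lborel"
    and d: "distr (gauss_noise n \<sigma>) lborel (\<lambda>z. (\<Sum>k<n. w k * z k) / (\<sigma> * sqrt (\<Sum>k<n. (w k)\<^sup>2)))
      = std_gauss"
    using gauss_linear_distributed[OF \<sigma> w] unfolding distributed_def std_gauss_def by auto
  show ?thesis unfolding d[symmetric] by (subst nn_integral_distr[OF *]) auto
qed

lemma std_gauss_second_moment:
  "(\<integral>\<^sup>+u. ennreal ((m + s * u)\<^sup>2) \<partial>std_gauss) = ennreal (m\<^sup>2 + s\<^sup>2)"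
proof -
  have i: "integrable lborel (\<lambda>x. std_normal_density x)"
      "integrable lborel (\<lambda>x. std_normal_density x * x)"
      "integrable lborel (\<lambda>x. std_normal_density x * x\<^sup>2)"
    using integrable_std_normal_moment[of 1] integrable_std_normal_moment[of 2] by auto
  have v1: "(\<integral>x. std_normal_density x * x \<partial>lborel) = 0"
    using has_bochner_integral_integral_eq[OF normal_moment_nz_1[of 1 0]] by simp
  have v2: "(\<integral>x. std_normal_density x * x\<^sup>2 \<partial>lborel) = 1"
    using integral_std_normal_moment_even[of 1] by simp
  have e: "std_normal_density x * (m + s * x)\<^sup>2
      = m\<^sup>2 * std_normal_density x + 2 * m * s * (std_normal_density x * x) + s\<^sup>2 * (std_normal_density x * x\<^sup>2)" for x
    by (simp add: power2_eq_square algebra_simps)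
  have "(\<integral>\<^sup>+u. ennreal ((m + s * u)\<^sup>2) \<partial>std_gauss)
      = (\<integral>\<^sup>+x. ennreal (std_normal_density x * (m + s * x)\<^sup>2) \<partial>lborel)"
    unfolding std_gauss_def by (subst nn_integral_density) (auto simp: ennreal_mult)
  also have "\<dots> = ennreal (\<integral>x. std_normal_density x * (m + s * x)\<^sup>2 \<partial>lborel)"
  proof (rule nn_integral_eq_integral)
    show "integrable lborel (\<lambda>x. std_normal_density x * (m + s * x)\<^sup>2)"
      unfolding e using i by auto
  qed auto
  also have "(\<integral>x. std_normal_density x * (m + s * x)\<^sup>2 \<partial>lborel) = m\<^sup>2 + s\<^sup>2"
    using i by (simp add: e v1 v2)
  finally show ?thesis .
qed

lemma gauss_affine_second_moment:
  assumes \<sigma>: "\<sigma> > 0"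
  shows "(\<integral>\<^sup>+z. ennreal ((m + (\<Sum>k<n. w k * z k))\<^sup>2) \<partial>gauss_noise n \<sigma>)
    = ennreal (m\<^sup>2 + \<sigma>\<^sup>2 * (\<Sum>k<n. (w k)\<^sup>2))"
proof (cases "(\<Sum>k<n. (w k)\<^sup>2) = 0")
  case True
  then have "\<And>k. k < n \<Longrightarrow> w k = 0"
    by (subst (asm) sum_nonneg_eq_0_iff) auto
  then show ?thesis
    using prob_space.emeasure_space_1[OF prob_space_gauss_noise[OF \<sigma>]] by (simp add: True)
next
  case False
  then have w: "(\<Sum>k<n. (w k)\<^sup>2) > 0" by (simp add: sum_nonneg order.strict_iff_order)
  define s where "s = \<sigma> * sqrt (\<Sum>k<n. (w k)\<^sup>2)"
  have s: "s > 0" using \<sigma> w by (simp add: s_def)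
  have "(\<integral>\<^sup>+z. ennreal ((m + (\<Sum>k<n. w k * z k))\<^sup>2) \<partial>gauss_noise n \<sigma>)
      = (\<integral>\<^sup>+z. ennreal ((m + s * ((\<Sum>k<n. w k * z k) / (\<sigma> * sqrt (\<Sum>k<n. (w k)\<^sup>2))))\<^sup>2) \<partial>gauss_noise n \<sigma>)"
    using s unfolding s_def[symmetric] by simp
  also have "\<dots> = (\<integral>\<^sup>+u. ennreal ((m + s * u)\<^sup>2) \<partial>std_gauss)"
    by (rule gauss_linear_nn_integral[OF \<sigma> w]) measurable
  also have "\<dots> = ennreal (m\<^sup>2 + \<sigma>\<^sup>2 * (\<Sum>k<n. (w k)\<^sup>2))"
    using w by (simp add: std_gauss_second_moment s_def power_mult_distrib)
  finally show ?thesis .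
qed

section \<open>Symmetric matrices\<close>

definition ip :: "nat \<Rightarrow> (nat \<Rightarrow> real) \<Rightarrow> (nat \<Rightarrow> real) \<Rightarrow> real" where
  "ip n x y = (\<Sum>i<n. x i * y i)"

text \<open>Vectors are total functions on the naturals. Fixing the irrelevant coordinates to zero
  makes the unit sphere compact and lets an eigenvector equation be an equality of functions;
  \<open>tv\<close> is the matrix action that respects this convention.\<close>

definition vsupp :: "nat \<Rightarrow> (nat \<Rightarrow> real) set" where
  "vsupp n = {x. \<forall>i\<ge>n. x i = 0}"

definition tv :: "nat \<Rightarrow> (nat \<Rightarrow> nat \<Rightarrow> real) \<Rightarrow> (nat \<Rightarrow> real) \<Rightarrow> (nat \<Rightarrow> real)" where
  "tv n A x = (\<lambda>i. if i < n then mv n A x i else 0)"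

lemma sqnorm_ip: "sqnorm n x = ip n x x"
  by (simp add: sqnorm_def ip_def power2_eq_square)

lemma ip_commute: "ip n x y = ip n y x"
  by (simp add: ip_def mult.commute)

lemma ip_add_left: "ip n (\<lambda>i. x i + y i) z = ip n x z + ip n y z"
  by (simp add: ip_def algebra_simps sum.distrib)

lemma ip_scale_left: "ip n (\<lambda>i. c * x i) z = c * ip n x z"
  by (simp add: ip_def algebra_simps sum_distrib_left)

lemma ip_add_right: "ip n z (\<lambda>i. x i + y i) = ip n z x + ip n z y"
  by (simp add: ip_def algebra_simps sum.distrib)

lemma ip_scale_right: "ip n z (\<lambda>i. c * x i) = c * ip n z x"
  by (simp add: ip_def algebra_simps sum_distrib_left)

lemma ip_diff_left: "ip n (\<lambda>i. x i - y i) z = ip n x z - ip n y z"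
  by (simp add: ip_def algebra_simps sum_subtractf)

lemma ip_diff_right: "ip n z (\<lambda>i. x i - y i) = ip n z x - ip n z y"
  by (simp add: ip_def algebra_simps sum_subtractf)

lemma ip_sum_left: "ip n (\<lambda>i. \<Sum>k\<in>K. f k i) z = (\<Sum>k\<in>K. ip n (f k) z)"
  unfolding ip_def sum_distrib_right by (rule sum.swap)

lemma ip_sum_right: "ip n z (\<lambda>i. \<Sum>k\<in>K. f k i) = (\<Sum>k\<in>K. ip n z (f k))"
  unfolding ip_def sum_distrib_left by (rule sum.swap)

lemma ip_cong: "(\<And>i. i < n \<Longrightarrow> x i = x' i) \<Longrightarrow> (\<And>i. i < n \<Longrightarrow> y i = y' i) \<Longrightarrow> ip n x y = ip n x' y'"
  unfolding ip_def by (intro sum.cong) auto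

lemma sqnorm_cong: "(\<And>i. i < n \<Longrightarrow> x i = x' i) \<Longrightarrow> sqnorm n x = sqnorm n x'"
  unfolding sqnorm_def by (intro sum.cong) auto

lemma sqnorm_nonneg [simp]: "sqnorm n x \<ge> 0"
  by (simp add: sqnorm_def sum_nonneg)

lemma ip_self_nonneg [simp]: "ip n x x \<ge> 0"
  by (simp flip: sqnorm_ip)

lemma sqnorm_eq_0_iff: "sqnorm n x = 0 \<longleftrightarrow> (\<forall>i<n. x i = 0)"
  unfolding sqnorm_def by (subst sum_nonneg_eq_0_iff) auto

lemma sqnorm_scale: "sqnorm n (\<lambda>i. c * x i) = c\<^sup>2 * sqnorm n x"
  by (simp add: sqnorm_def power_mult_distrib sum_distrib_left)

lemma ip_cauchy_schwarz: "(ip n x y)\<^sup>2 \<le> sqnorm n x * sqnorm n y"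
  unfolding ip_def sqnorm_def by (rule Cauchy_Schwarz_ineq_sum)

lemma ip_unit: "j < n \<Longrightarrow> ip n x (\<lambda>i. if i = j then 1 else 0) = x j"
  by (simp add: ip_def if_distrib cong: if_cong)

lemma ip_tv_left: "ip n (tv n A x) y = ip n (mv n A x) y"
  by (rule ip_cong) (auto simp: tv_def)

lemma ip_tv_right: "ip n y (tv n A x) = ip n y (mv n A x)"
  by (rule ip_cong) (auto simp: tv_def)

lemma mv_adjoint: "ip n (mv m A x) y = ip m x (mv n (mtr A) y)"
  unfolding ip_def mv_def mtr_def sum_distrib_left sum_distrib_right
  by (subst sum.swap) (simp add: mult_ac)

lemma mv_sym_adjoint: "msym n A \<Longrightarrow> ip n (mv n A x) y = ip n x (mv n A y)"
  unfolding mv_adjoint by (intro ip_cong refl) (auto simp: mv_def mtr_def msym_def intro!: sum.cong)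

lemma mv_add: "mv n A (\<lambda>i. x i + y i) = (\<lambda>i. mv n A x i + mv n A y i)"
  by (simp add: mv_def algebra_simps sum.distrib)

lemma mv_diff: "mv n A (\<lambda>i. x i - y i) = (\<lambda>i. mv n A x i - mv n A y i)"
  by (simp add: mv_def algebra_simps sum_subtractf)

lemma mv_scale: "mv n A (\<lambda>i. c * x i) = (\<lambda>i. c * mv n A x i)"
  by (simp add: mv_def algebra_simps sum_distrib_left)

lemma mv_sum: "mv n A (\<lambda>i. \<Sum>k\<in>K. f k i) = (\<lambda>i. \<Sum>k\<in>K. mv n A (f k) i)"
  unfolding mv_def sum_distrib_left by (subst sum.swap) simp

lemma mv_cong: "(\<And>i. i < n \<Longrightarrow> x i = y i) \<Longrightarrow> mv n A x = mv n A y"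
  unfolding mv_def by (intro ext sum.cong) auto

lemma mv_mmul: "mv n (mmul k A B) x = mv k A (mv n B x)"
  unfolding mv_def mmul_def sum_distrib_left sum_distrib_right
  by (subst sum.swap) (simp add: mult_ac)

lemma mv_cong_mat: "(\<And>i j. i < n \<Longrightarrow> j < n \<Longrightarrow> A i j = B i j) \<Longrightarrow> i < n \<Longrightarrow> mv n A x i = mv n B x i"
  unfolding mv_def by (intro sum.cong) auto

lemma sum_sum_ip: "(\<Sum>i<n. \<Sum>j<n. x i * A i j * x j) = ip n x (mv n A x)"
  by (simp add: ip_def mv_def sum_distrib_left mult_ac)

text \<open>The first-order condition at a maximum: near zero a linear term outgrows any quadratic
  one. Testing \<open>s = a / c\<close> with a positive \<open>c\<close> above \<open>b\<close>
  already gives the contradiction.\<close>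

lemma linear_coefficient_zero:
  fixes a b :: real
  assumes "\<And>s. 2 * s * a \<le> s\<^sup>2 * b"
  shows "a = 0"
proof (rule ccontr)
  assume "a \<noteq> 0"
  define c where "c = \<bar>b\<bar> + 1"
  have c: "c > 0" "b < c" by (auto simp: c_def)
  have "2 * (a / c) * a \<le> (a / c)\<^sup>2 * b" by (rule assms)
  also have "\<dots> \<le> (a / c)\<^sup>2 * c" using c by (intro mult_left_mono) auto
  also have "\<dots> = (a / c) * a" using c by (simp add: power2_eq_square)
  finally have "(a / c) * a \<le> 0" by simp
  then have "a\<^sup>2 \<le> 0" using c by (simp add: power2_eq_square field_simps)
  with \<open>a \<noteq> 0\<close> show False by simp
qed

text \<open>The function type carries the product topology, in which the cube with sides
  \<open>{-1..1}\<close> is compact by Tychonoff; the sphere is a closed subset of it.\<close>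

lemma compact_unit_sphere: "compact {x \<in> vsupp n. ip n x x = 1}"
proof -
  have "compactin (product_topology (\<lambda>_::nat. euclidean) UNIV) (Pi\<^sub>E UNIV (\<lambda>_. {-1..1::real}))"
    by (subst compactin_PiE) (simp only: compactin_euclidean_iff compact_Icc, blast)
  then have "compact (Pi\<^sub>E UNIV (\<lambda>_::nat. {-1..1::real}))"
    by (simp only: euclidean_product_topology compactin_euclidean_iff)
  moreover have "closed {x \<in> vsupp n. ip n x x = 1}"
  proof -
    have "closed {x::nat \<Rightarrow> real. x i = 0}" for i
      by (intro closed_Collect_eq continuous_intros) auto
    then have "closed (\<Inter>i\<in>{n..}. {x::nat \<Rightarrow> real. x i = 0})"
      by (intro closed_INT) auto
    moreover have "(\<Inter>i\<in>{n..}. {x::nat \<Rightarrow> real. x i = 0}) = vsupp n"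
      by (auto simp: vsupp_def)
    moreover have "closed {x. ip n x x = 1}"
      unfolding ip_def by (intro closed_Collect_eq continuous_intros) auto
    moreover have "{x \<in> vsupp n. ip n x x = 1} = vsupp n \<inter> {x. ip n x x = 1}" by auto
    ultimately show ?thesis by (simp only: closed_Int)
  qed
  moreover have "{x \<in> vsupp n. ip n x x = 1} \<subseteq> Pi\<^sub>E UNIV (\<lambda>_. {-1..1})"
  proof
    fix x assume x: "x \<in> {x \<in> vsupp n. ip n x x = 1}"
    have "\<bar>x i\<bar> \<le> 1" for i
    proof (cases "i < n")
      case True
      have "(x i)\<^sup>2 \<le> (\<Sum>i<n. (x i)\<^sup>2)" using True by (intro member_le_sum) auto
      also have "\<dots> = 1" using x by (simp add: ip_def power2_eq_square)
      finally show ?thesis by (simp add: abs_square_le_1)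
    next
      case False then show ?thesis using x by (auto simp: vsupp_def)
    qed
    then show "x \<in> Pi\<^sub>E UNIV (\<lambda>_. {-1..1})" by (auto simp: abs_le_iff minus_le_iff)
  qed
  ultimately have "compact (Pi\<^sub>E UNIV (\<lambda>_. {-1..1}) \<inter> {x \<in> vsupp n. ip n x x = 1})"
    by (intro compact_Int_closed)
  also have "Pi\<^sub>E UNIV (\<lambda>_. {-1..1}) \<inter> {x \<in> vsupp n. ip n x x = 1} = {x \<in> vsupp n. ip n x x = 1}"
    by (rule Int_absorb1) fact
  finally show ?thesis .
qed

text \<open>A maximiser of the Rayleigh quotient over an invariant subspace is an eigenvector.\<close>

lemma eigenvector_in_subspace:
  assumes sym: "msym n A" and sub: "V \<subseteq> vsupp n" and clo: "closed V"
    and add: "\<And>x y s. x \<in> V \<Longrightarrow> y \<in> V \<Longrightarrow> (\<lambda>i. x i + s * y i) \<in> V"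
    and inv: "\<And>x. x \<in> V \<Longrightarrow> tv n A x \<in> V"
    and nz: "x1 \<in> V" "ip n x1 x1 \<noteq> 0" and zero: "(\<lambda>i. 0) \<in> V"
  obtains x la where "x \<in> V" "ip n x x = 1" "tv n A x = (\<lambda>i. la * x i)"
proof -
  define S where "S = {x \<in> vsupp n. ip n x x = 1} \<inter> V"
  have compS: "compact S" unfolding S_def by (intro compact_Int_closed compact_unit_sphere clo)
  have scale: "(\<lambda>i. s * x i) \<in> V" if "x \<in> V" for s x
    using add[OF zero that, of s] by simp
  have normalize: "(\<lambda>i. (1 / sqrt (ip n x x)) * x i) \<in> S" if "x \<in> V" "ip n x x \<noteq> 0" for x
  proof -
    have "ip n x x > 0" using that(2) by (simp add: order.strict_iff_order)
    then have "ip n (\<lambda>i. (1 / sqrt (ip n x x)) * x i) (\<lambda>i. (1 / sqrt (ip n x x)) * x i) = 1"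
      unfolding ip_scale_left ip_scale_right by (simp add: field_simps)
    moreover have "(\<lambda>i. (1 / sqrt (ip n x x)) * x i) \<in> V" by (rule scale[OF that(1)])
    ultimately show ?thesis using sub unfolding S_def by blast
  qed
  have "S \<noteq> {}" using normalize[OF nz] by auto
  moreover have "continuous_on S (\<lambda>x. ip n x (mv n A x))"
    unfolding ip_def mv_def by (intro continuous_intros) (auto intro: continuous_on_subset[OF continuous_on_product_coordinates])
  ultimately obtain x0 where x0: "x0 \<in> S" and max: "\<And>y. y \<in> S \<Longrightarrow> ip n y (mv n A y) \<le> ip n x0 (mv n A x0)"
    using continuous_attains_sup[OF compS] by blast
  define M where "M = ip n x0 (mv n A x0)"
  have x0V: "x0 \<in> V" and x0n: "ip n x0 x0 = 1" using x0 by (auto simp: S_def)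
  have bound: "ip n y (mv n A y) \<le> M * ip n y y" if "y \<in> V" for y
  proof (cases "ip n y y = 0")
    case True
    then have "\<forall>i<n. y i = 0" using sqnorm_eq_0_iff[of n y] by (simp add: sqnorm_ip)
    then show ?thesis by (simp add: ip_def)
  next
    case False
    then have p: "ip n y y > 0" by (simp add: order.strict_iff_order)
    define c where "c = 1 / sqrt (ip n y y)"
    have "c\<^sup>2 * ip n y (mv n A y) \<le> M"
      using max[OF normalize[OF that False]]
      unfolding M_def[symmetric] c_def[symmetric] mv_scale ip_scale_left ip_scale_right
      by (simp add: power2_eq_square mult.assoc)
    moreover have "c\<^sup>2 = 1 / ip n y y" using p by (simp add: c_def power_divide)
    ultimately show ?thesis using p by (simp add: field_simps)
  qed
  define w where "w = (\<lambda>i. tv n A x0 i + (-M) * x0 i)"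
  have wV: "w \<in> V" unfolding w_def by (rule add[OF inv[OF x0V] x0V])
  have ww: "ip n w w = ip n w (mv n A x0) - M * ip n w x0"
  proof -
    have "ip n w w = ip n w (\<lambda>i. mv n A x0 i + (-M) * x0 i)"
      by (rule ip_cong) (auto simp: w_def tv_def)
    then show ?thesis unfolding ip_add_right ip_scale_right by simp
  qed
  \<comment> \<open>Perturbing the maximiser along the residual \<open>w\<close> itself makes the
    coefficient of the linear term the squared norm of \<open>w\<close>, which must therefore
    vanish.\<close>
  have "2 * s * ip n w w \<le> s\<^sup>2 * (M * ip n w w - ip n w (mv n A w))" for s
  proof -
    have sw: "ip n x0 (mv n A w) = ip n w (mv n A x0)"
      using mv_sym_adjoint[OF sym, of x0 w] by (simp add: ip_commute)
    have "ip n (\<lambda>i. x0 i + s * w i) (mv n A (\<lambda>i. x0 i + s * w i))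
        \<le> M * ip n (\<lambda>i. x0 i + s * w i) (\<lambda>i. x0 i + s * w i)"
      by (rule bound[OF add[OF x0V wV]])
    then have "M + 2 * s * ip n w (mv n A x0) + s\<^sup>2 * ip n w (mv n A w)
        \<le> M * (1 + 2 * s * ip n w x0 + s\<^sup>2 * ip n w w)"
      unfolding mv_add mv_scale ip_add_left ip_add_right ip_scale_left ip_scale_right
      using x0n sw M_def ip_commute[of n x0 w]
      by (simp add: power2_eq_square algebra_simps)
    then show ?thesis unfolding ww by (simp add: algebra_simps)
  qed
  then have "ip n w w = 0" by (rule linear_coefficient_zero)
  then have "\<forall>i<n. w i = 0" using sqnorm_eq_0_iff[of n w] by (simp add: sqnorm_ip)
  then have "tv n A x0 = (\<lambda>i. M * x0 i)"
    using x0V sub by (intro ext) (auto simp: w_def tv_def vsupp_def subset_iff not_less)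
  with x0V x0n that show ?thesis by blast
qed

section \<open>Orthonormal systems and simultaneous diagonalisation\<close>

definition orthonormal :: "nat \<Rightarrow> nat \<Rightarrow> (nat \<Rightarrow> nat \<Rightarrow> real) \<Rightarrow> bool" where
  "orthonormal n k e \<longleftrightarrow> (\<forall>i<k. \<forall>j<k. ip n (e i) (e j) = (if i = j then 1 else 0))"

lemma orthonormal_residual:
  assumes "orthonormal n k e"
  shows "ip n (\<lambda>i. x i - (\<Sum>l<k. ip n x (e l) * e l i)) (\<lambda>i. x i - (\<Sum>l<k. ip n x (e l) * e l i))
    = ip n x x - (\<Sum>l<k. (ip n x (e l))\<^sup>2)"
    and "m < k \<Longrightarrow> ip n (\<lambda>i. x i - (\<Sum>l<k. ip n x (e l) * e l i)) (e m) = 0"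
proof -
  have o: "ip n (e l) (e m) = (if l = m then 1 else 0)" if "l < k" "m < k" for l m
    using assms that by (auto simp: orthonormal_def)
  have sm: "ip n (\<lambda>i. \<Sum>l<k. ip n x (e l) * e l i) (e m) = ip n x (e m)" if "m < k" for m
  proof -
    have "ip n (\<lambda>i. \<Sum>l<k. ip n x (e l) * e l i) (e m) = (\<Sum>l<k. if l = m then ip n x (e l) else 0)"
      unfolding ip_sum_left ip_scale_left using that by (intro sum.cong) (auto simp: o)
    then show ?thesis using that by simp
  qed
  have sx: "ip n (\<lambda>i. \<Sum>l<k. ip n x (e l) * e l i) x = (\<Sum>l<k. (ip n x (e l))\<^sup>2)"
    unfolding ip_sum_left ip_scale_left by (simp add: power2_eq_square ip_commute)
  have ss: "ip n (\<lambda>i. \<Sum>l<k. ip n x (e l) * e l i) (\<lambda>i. \<Sum>l<k. ip n x (e l) * e l i) = (\<Sum>l<k. (ip n x (e l))\<^sup>2)"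
    by (subst ip_sum_right) (simp add: ip_scale_right sm power2_eq_square)
  show "ip n (\<lambda>i. x i - (\<Sum>l<k. ip n x (e l) * e l i)) (\<lambda>i. x i - (\<Sum>l<k. ip n x (e l) * e l i))
    = ip n x x - (\<Sum>l<k. (ip n x (e l))\<^sup>2)"
    unfolding ip_diff_left ip_diff_right using sx ss ip_commute[of n x "\<lambda>i. \<Sum>l<k. ip n x (e l) * e l i"] by simp
  show "ip n (\<lambda>i. x i - (\<Sum>l<k. ip n x (e l) * e l i)) (e m) = 0" if "m < k"
    unfolding ip_diff_left using sm[OF that] by simp
qed

text \<open>A trace count that plays the role of dimension theory: for \<open>k < n\<close> some
  standard unit vector has a nonzero residual, and for \<open>k = n\<close> all residuals
  vanish.\<close>

lemma orthonormal_unit_sum: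
  assumes "orthonormal n k e"
  shows "(\<Sum>j<n. \<Sum>l<k. (e l j)\<^sup>2) = real k"
proof -
  have "(\<Sum>j<n. \<Sum>l<k. (e l j)\<^sup>2) = (\<Sum>l<k. \<Sum>j<n. (e l j)\<^sup>2)" by (rule sum.swap)
  also have "\<dots> = (\<Sum>l<k. 1)"
    using assms by (intro sum.cong) (auto simp: orthonormal_def ip_def power2_eq_square)
  finally show ?thesis by simp
qed

text \<open>The residuals of the \<open>n\<close> standard unit vectors have squared norms that sum
  to \<open>n - n = 0\<close>, so each unit vector equals its expansion; the claim is one coordinate
  of that expansion.\<close>

lemma orthonormal_complete:
  assumes "orthonormal n n e" "i < n" "j < n"
  shows "(\<Sum>l<n. e l i * e l j) = (if i = j then 1 else 0)"
proof -
  define u where "u j = (\<lambda>i::nat. if i = j then 1 else 0 :: real)" for j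
  define r where "r j = (\<lambda>i. u j i - (\<Sum>l<n. ip n (u j) (e l) * e l i))" for j
  have ue: "ip n (u j) (e l) = e l j" if "j < n" for j l
    using ip_unit[OF that, of "e l"] by (simp add: u_def ip_commute)
  have uu: "ip n (u j) (u j) = 1" if "j < n" for j
    using ip_unit[OF that, of "u j"] by (simp add: u_def)
  have rr: "ip n (r j) (r j) = 1 - (\<Sum>l<n. (e l j)\<^sup>2)" if "j < n" for j
    unfolding r_def orthonormal_residual(1)[OF assms(1)] using that by (simp add: uu ue)
  have "(\<Sum>j<n. ip n (r j) (r j)) = (\<Sum>j<n. 1 - (\<Sum>l<n. (e l j)\<^sup>2))"
    by (intro sum.cong) (auto simp: rr)
  also have "\<dots> = 0" using orthonormal_unit_sum[OF assms(1)] by (simp add: sum_subtractf)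
  finally have "\<forall>j<n. ip n (r j) (r j) = 0" by (subst (asm) sum_nonneg_eq_0_iff) auto
  then have "sqnorm n (r j) = 0" using assms by (simp add: sqnorm_ip)
  then have "r j i = 0" using assms by (simp add: sqnorm_eq_0_iff)
  then have "u j i = (\<Sum>l<n. e l i * e l j)" using assms by (simp add: r_def ue mult.commute)
  then show ?thesis by (simp add: u_def)
qed

text \<open>Eigenvectors are found one at a time. The orthogonal complement \<open>V\<close> of the
  previous ones is invariant under both matrices; inside it the eigenspace \<open>V2\<close> of
  \<open>A\<close> is invariant under \<open>B\<close> because the matrices commute, so an
  eigenvector of \<open>B\<close> in \<open>V2\<close> is a common one. With \<open>B = A\<close>
  this is the ordinary spectral theorem.\<close>

theorem simultaneous_spectral:
  assumes A: "msym n A" and B: "msym n B"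
    and comm: "\<forall>i<n. \<forall>j<n. mmul n A B i j = mmul n B A i j"
  obtains e la \<mu> where "orthonormal n n e"
    "\<And>k i. k < n \<Longrightarrow> i < n \<Longrightarrow> mv n A (e k) i = la k * e k i"
    "\<And>k i. k < n \<Longrightarrow> i < n \<Longrightarrow> mv n B (e k) i = \<mu> k * e k i"
proof -
  have tt: "tv n A (tv n B x) = tv n B (tv n A x)" for x
  proof
    fix i
    have "mv n A (tv n B x) = mv n A (mv n B x)" "mv n B (tv n A x) = mv n B (mv n A x)"
      by (auto intro!: mv_cong simp: tv_def)
    moreover have "mv n A (mv n B x) i = mv n B (mv n A x) i" if "i < n"
      unfolding mv_mmul[symmetric] using that comm by (intro mv_cong_mat) auto
    ultimately show "tv n A (tv n B x) i = tv n B (tv n A x) i" by (simp add: tv_def)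
  qed
  have tvadd: "tv n C (\<lambda>i. x i + s * y i) = (\<lambda>i. tv n C x i + s * tv n C y i)" for C x y s
    by (auto simp: tv_def mv_add mv_scale)
  have tvsc: "tv n C (\<lambda>i. s * y i) = (\<lambda>i. s * tv n C y i)" for C y s
    by (auto simp: tv_def mv_scale)
  have tvsupp: "tv n C x \<in> vsupp n" for C x by (auto simp: tv_def vsupp_def)
  have closupp: "closed (vsupp n)"
  proof -
    have "closed {x::nat \<Rightarrow> real. x i = 0}" for i
      by (intro closed_Collect_eq continuous_intros) auto
    then have "closed (\<Inter>i\<in>{n..}. {x::nat \<Rightarrow> real. x i = 0})"
      by (intro closed_INT) auto
    moreover have "(\<Inter>i\<in>{n..}. {x::nat \<Rightarrow> real. x i = 0}) = vsupp n"
      by (auto simp: vsupp_def)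
    ultimately show ?thesis by simp
  qed
  have "\<exists>e la \<mu>. orthonormal n k e \<and> (\<forall>l<k. e l \<in> vsupp n \<and> tv n A (e l) = (\<lambda>i. la l * e l i)
      \<and> tv n B (e l) = (\<lambda>i. \<mu> l * e l i))" if "k \<le> n" for k
    using that
  proof (induction k)
    case 0 then show ?case by (simp add: orthonormal_def)
  next
    case (Suc k)
    then obtain e la \<mu> where on: "orthonormal n k e" and es: "\<And>l. l < k \<Longrightarrow> e l \<in> vsupp n"
      and eA: "\<And>l. l < k \<Longrightarrow> tv n A (e l) = (\<lambda>i. la l * e l i)"
      and eB: "\<And>l. l < k \<Longrightarrow> tv n B (e l) = (\<lambda>i. \<mu> l * e l i)" by auto
    define V where "V = {x \<in> vsupp n. \<forall>l<k. ip n x (e l) = 0}"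
    have closV: "closed V"
    proof -
      have "V = vsupp n \<inter> (\<Inter>l\<in>{..<k}. {x. ip n x (e l) = 0})" by (auto simp: V_def)
      moreover have "closed {x. ip n x (e l) = 0}" for l
        unfolding ip_def by (intro closed_Collect_eq continuous_intros) auto
      ultimately show ?thesis using closupp by (auto intro!: closed_Int closed_INT)
    qed
    have addV: "(\<lambda>i. x i + s * y i) \<in> V" if "x \<in> V" "y \<in> V" for x y s
      using that by (auto simp: V_def vsupp_def ip_add_left ip_scale_left)
    have invV: "tv n C x \<in> V" if "x \<in> V" and C: "msym n C" "\<And>l. l < k \<Longrightarrow> tv n C (e l) = (\<lambda>i. \<nu> l * e l i)" for x C \<nu>
    proof -
      have "ip n (tv n C x) (e l) = 0" if "l < k" for l
      proof -
        have "ip n (tv n C x) (e l) = ip n x (tv n C (e l))"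
          unfolding ip_tv_left ip_tv_right by (rule mv_sym_adjoint[OF C(1)])
        also have "\<dots> = 0" using that \<open>x \<in> V\<close> by (simp add: C(2) ip_scale_right V_def)
        finally show ?thesis .
      qed
      then show ?thesis using tvsupp by (auto simp: V_def)
    qed
    \<comment> \<open>With fewer than \<open>n\<close> vectors the trace count leaves a coordinate
      whose unit vector is not exhausted; its residual \<open>x1\<close> shows that \<open>V\<close>
      is nontrivial.\<close>
    obtain j where j: "j < n" "(\<Sum>l<k. (e l j)\<^sup>2) < 1"
    proof (rule ccontr)
      assume "\<not> thesis"
      then have "\<And>j. j < n \<Longrightarrow> 1 \<le> (\<Sum>l<k. (e l j)\<^sup>2)" using that by (meson not_less)
      then have "(\<Sum>j<n. 1) \<le> (\<Sum>j<n. \<Sum>l<k. (e l j)\<^sup>2)" by (intro sum_mono) auto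
      then show False using orthonormal_unit_sum[OF on] Suc.prems by simp
    qed
    define u where "u = (\<lambda>i::nat. if i = j then 1 else 0 :: real)"
    define x1 where "x1 = (\<lambda>i. u i - (\<Sum>l<k. ip n u (e l) * e l i))"
    have ue: "ip n u (e l) = e l j" for l
      using ip_unit[OF j(1), of "e l"] by (simp add: u_def ip_commute)
    have uu: "ip n u u = 1" using ip_unit[OF j(1), of u] by (simp add: u_def)
    have "ip n x1 x1 = 1 - (\<Sum>l<k. (e l j)\<^sup>2)"
      unfolding x1_def by (subst orthonormal_residual(1)[OF on]) (simp add: ue uu)
    then have x1n: "ip n x1 x1 \<noteq> 0" using j(2) by simp
    have x1V: "x1 \<in> V"
      unfolding V_def using orthonormal_residual(2)[OF on] es j(1)
      by (auto simp: x1_def vsupp_def u_def intro!: sum.neutral)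
    have zV: "(\<lambda>i. 0) \<in> V" by (auto simp: V_def vsupp_def ip_def)
    obtain x2 la' where x2: "x2 \<in> V" "ip n x2 x2 = 1" "tv n A x2 = (\<lambda>i. la' * x2 i)"
      by (rule eigenvector_in_subspace[OF A _ closV addV _ x1V x1n zV])
         (use invV A eA in \<open>auto simp: V_def\<close>)
    define V2 where "V2 = {x \<in> V. tv n A x = (\<lambda>i. la' * x i)}"
    have closV2: "closed V2"
    proof -
      have "V2 = V \<inter> (\<Inter>i\<in>{..<n}. {x. mv n A x i = la' * x i})"
        by (auto simp: V2_def V_def tv_def vsupp_def fun_eq_iff)
      moreover have "closed {x. mv n A x i = la' * x i}" for i
        unfolding mv_def by (intro closed_Collect_eq continuous_intros) auto
      ultimately show ?thesis using closV by (auto intro!: closed_Int closed_INT)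
    qed
    have invV2: "tv n B x \<in> V2" if "x \<in> V2" for x
    proof -
      have "tv n B x \<in> V" using that invV[OF _ B eB] by (auto simp: V2_def)
      moreover have "tv n A (tv n B x) = (\<lambda>i. la' * tv n B x i)"
        unfolding tt using that by (simp add: V2_def tvsc)
      ultimately show ?thesis by (simp add: V2_def)
    qed
    have addV2: "(\<lambda>i. x i + s * y i) \<in> V2" if "x \<in> V2" "y \<in> V2" for x y s
      using that addV by (auto simp: V2_def tvadd algebra_simps)
    have zV2: "(\<lambda>i. 0) \<in> V2" using zV by (auto simp: V2_def tv_def mv_def)
    have x2V2: "x2 \<in> V2" "ip n x2 x2 \<noteq> 0" using x2 by (auto simp: V2_def)
    obtain x3 \<mu>' where x3: "x3 \<in> V2" "ip n x3 x3 = 1" "tv n B x3 = (\<lambda>i. \<mu>' * x3 i)"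
      by (rule eigenvector_in_subspace[OF B _ closV2 addV2 invV2 x2V2 zV2])
         (auto simp: V2_def V_def)
    define e' where "e' = e(k := x3)"
    have orth1: "ip n x3 (e l) = 0" if "l < k" for l
      using x3(1) that by (simp add: V2_def V_def)
    have orth2: "ip n (e l) x3 = 0" if "l < k" for l
      using orth1[OF that] ip_commute[of n "e l" x3] by simp
    have "orthonormal n (Suc k) e'"
      unfolding orthonormal_def
    proof (intro allI impI)
      fix i j assume "i < Suc k" "j < Suc k"
      then show "ip n (e' i) (e' j) = (if i = j then 1 else 0)"
        using on x3(2) orth1 orth2 by (cases "i = k"; cases "j = k") (auto simp: e'_def orthonormal_def)
    qed
    moreover have "\<forall>l<Suc k. e' l \<in> vsupp n \<and> tv n A (e' l) = (\<lambda>i. (la(k := la')) l * e' l i)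
      \<and> tv n B (e' l) = (\<lambda>i. (\<mu>(k := \<mu>')) l * e' l i)"
      using es eA eB x3 by (auto simp: e'_def less_Suc_eq V2_def V_def)
    ultimately show ?case by blast
  qed
  from this[of n] obtain e la \<mu> where *: "orthonormal n n e"
    "\<forall>l<n. e l \<in> vsupp n \<and> tv n A (e l) = (\<lambda>i. la l * e l i) \<and> tv n B (e l) = (\<lambda>i. \<mu> l * e l i)"
    by auto
  have "mv n A (e k) i = la k * e k i" "mv n B (e k) i = \<mu> k * e k i" if "k < n" "i < n" for k i
  proof -
    have "tv n A (e k) = (\<lambda>i. la k * e k i)" "tv n B (e k) = (\<lambda>i. \<mu> k * e k i)"
      using * that by auto
    from fun_cong[OF this(1), of i] fun_cong[OF this(2), of i]
    show "mv n A (e k) i = la k * e k i" "mv n B (e k) i = \<mu> k * e k i"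
      using that by (simp_all add: tv_def)
  qed
  with *(1) that show ?thesis by blast
qed

section \<open>One-dimensional priors\<close>

text \<open>\<open>bayes_lb \<gamma> v\<close>: some finitely supported prior on \<open>[-sqrt \<gamma>, sqrt \<gamma>]\<close> has Bayes risk at least
  \<open>v\<close> for estimating a normal mean with unit variance. The posterior risk (relative to the likelihood
  under mean zero) only has to dominate an integrable function \<open>h\<close>.\<close>

definition bayes_lb :: "real \<Rightarrow> real \<Rightarrow> bool" where
  "bayes_lb \<gamma> v \<longleftrightarrow> (\<exists>S W h. finite S \<and> S \<subseteq> {-1..1::real} \<and> (\<forall>m\<in>S. 0 \<le> W m) \<and> (\<Sum>m\<in>S. W m) = 1
     \<and> integrable std_gauss h \<and> v \<le> (\<integral>u. h u \<partial>std_gauss)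
     \<and> (\<forall>u e. h u \<le> (\<Sum>m\<in>S. W m * exp (sqrt \<gamma> * m * u - \<gamma> * m\<^sup>2 / 2) * (e - sqrt \<gamma> * m)\<^sup>2)))"

text \<open>A prior on a short interval is also a prior on a longer one. Supports are stored
  relative to the half-width, hence the rescaling by \<open>sqrt \<gamma> / sqrt \<gamma>'\<close>;
  the absolute positions, and with them \<open>h\<close>, stay the same.\<close>

lemma bayes_lb_mono:
  assumes "bayes_lb \<gamma> v" "0 < \<gamma>" "\<gamma> \<le> \<gamma>'" "v' \<le> v"
  shows "bayes_lb \<gamma>' v'"
proof -
  obtain S W h where *: "finite S" "S \<subseteq> {-1..1}" "\<forall>m\<in>S. 0 \<le> W m" "(\<Sum>m\<in>S. W m) = 1"
     "integrable std_gauss h" "v \<le> (\<integral>u. h u \<partial>std_gauss)"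
     and h: "\<And>u e. h u \<le> (\<Sum>m\<in>S. W m * exp (sqrt \<gamma> * m * u - \<gamma> * m\<^sup>2 / 2) * (e - sqrt \<gamma> * m)\<^sup>2)"
    using assms(1) unfolding bayes_lb_def by blast
  define c where "c = sqrt \<gamma> / sqrt \<gamma>'"
  have c: "0 < c" "c \<le> 1" using assms by (auto simp: c_def)
  have sc: "sqrt \<gamma>' * c = sqrt \<gamma>" using assms by (simp add: c_def)
  have gc: "\<gamma>' * c\<^sup>2 = \<gamma>" using assms by (simp add: c_def power_divide)
  have inj: "inj_on (\<lambda>m. c * m) S" using c by (auto simp: inj_on_def)
  show ?thesis
    unfolding bayes_lb_def
  proof (intro exI conjI)
    show "finite ((\<lambda>m. c * m) ` S)" using * by auto
    show "(\<lambda>m. c * m) ` S \<subseteq> {-1..1}"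
    proof
      fix x assume "x \<in> (\<lambda>m. c * m) ` S"
      then obtain m where m: "m \<in> S" "x = c * m" by auto
      then have "\<bar>m\<bar> \<le> 1" using *(2) by (auto simp: abs_le_iff)
      then have "\<bar>c * m\<bar> \<le> 1" using c by (simp add: abs_mult mult_le_one)
      then show "x \<in> {-1..1}" using m by (simp add: abs_le_iff)
    qed
    show "\<forall>m\<in>(\<lambda>m. c * m) ` S. 0 \<le> W (m / c)" using * c by auto
    show "(\<Sum>m\<in>(\<lambda>m. c * m) ` S. W (m / c)) = 1"
      using * c by (subst sum.reindex[OF inj]) simp
    show "integrable std_gauss h" by fact
    show "v' \<le> (\<integral>u. h u \<partial>std_gauss)" using * assms by simp
    show "\<forall>u e. h u \<le> (\<Sum>m\<in>(\<lambda>m. c * m) ` S. W (m / c) * exp (sqrt \<gamma>' * m * u - \<gamma>' * m\<^sup>2 / 2) * (e - sqrt \<gamma>' * m)\<^sup>2)"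
    proof (intro allI)
      fix u e
      have "(\<Sum>m\<in>(\<lambda>m. c * m) ` S. W (m / c) * exp (sqrt \<gamma>' * m * u - \<gamma>' * m\<^sup>2 / 2) * (e - sqrt \<gamma>' * m)\<^sup>2)
        = (\<Sum>m\<in>S. W m * exp (sqrt \<gamma> * m * u - \<gamma> * m\<^sup>2 / 2) * (e - sqrt \<gamma> * m)\<^sup>2)"
      proof (subst sum.reindex[OF inj], unfold o_def, rule sum.cong[OF refl])
        fix m
        have "sqrt \<gamma>' * (c * m) = sqrt \<gamma> * m" "\<gamma>' * (c * m)\<^sup>2 = \<gamma> * m\<^sup>2" "c * m / c = m"
          using c by (simp_all only: power_mult_distrib mult.assoc[symmetric] sc gc) simp
        then show "W (c * m / c) * exp (sqrt \<gamma>' * (c * m) * u - \<gamma>' * (c * m)\<^sup>2 / 2) * (e - sqrt \<gamma>' * (c * m))\<^sup>2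
            = W m * exp (sqrt \<gamma> * m * u - \<gamma> * m\<^sup>2 / 2) * (e - sqrt \<gamma> * m)\<^sup>2"
          by (simp only:)
      qed
      with h[of u e] show "h u \<le> (\<Sum>m\<in>(\<lambda>m. c * m) ` S. W (m / c) * exp (sqrt \<gamma>' * m * u - \<gamma>' * m\<^sup>2 / 2) * (e - sqrt \<gamma>' * m)\<^sup>2)"
        by (simp only:)
    qed
  qed
qed

text \<open>The minorants \<open>h\<close> of posterior risks may be negative, and
  \<open>ennreal\<close> truncates them at zero. Passing to the positive part only increases the
  integral, so nothing is lost.\<close>

lemma nn_integral_ge_integral:
  fixes h :: "'a \<Rightarrow> real"
  assumes "integrable M h" "\<And>x. x \<in> space M \<Longrightarrow> ennreal (h x) \<le> f x"
  shows "ennreal (\<integral>x. h x \<partial>M) \<le> (\<integral>\<^sup>+x. f x \<partial>M)"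
proof -
  have i: "integrable M (\<lambda>x. max 0 (h x))" using assms(1) by auto
  have "ennreal (\<integral>x. h x \<partial>M) \<le> ennreal (\<integral>x. max 0 (h x) \<partial>M)"
    using assms(1) i by (intro ennreal_leI integral_mono) auto
  also have "\<dots> = (\<integral>\<^sup>+x. ennreal (max 0 (h x)) \<partial>M)"
    by (rule nn_integral_eq_integral[symmetric, OF i]) auto
  also have "\<dots> \<le> (\<integral>\<^sup>+x. f x \<partial>M)"
    using assms(2) by (intro nn_integral_mono) (auto simp: max_def split: if_splits)
  finally show ?thesis .
qed

text \<open>Along a line \<open>y0 + \<theta> w\<close> the data enter only through \<open>w \<cdot> z\<close>, by the Cameron-Martin formula.\<close>

lemma bayes_segment:
  assumes lb: "bayes_lb \<gamma> v" and \<sigma>: "\<sigma> > 0" and b: "b > 0" and w: "(\<Sum>k<n. (w k)\<^sup>2) > 0"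
    and \<gamma>: "\<gamma> = b\<^sup>2 * (\<Sum>k<n. (w k)\<^sup>2) / \<sigma>\<^sup>2"
  obtains S W where "finite S" "S \<subseteq> {-1..1::real}" "\<And>m. m \<in> S \<Longrightarrow> 0 \<le> W m" "(\<Sum>m\<in>S. W m) = 1"
    "\<And>(g :: (nat \<Rightarrow> real) \<Rightarrow> real) y0. g \<in> borel_measurable (Rn n) \<Longrightarrow>
      ennreal (b\<^sup>2 / \<gamma> * v) \<le> (\<Sum>m\<in>S. ennreal (W m) *
        (\<integral>\<^sup>+z. ennreal ((g (restrict (\<lambda>k. y0 k + b * m * w k + z k) {..<n}) - b * m)\<^sup>2) \<partial>gauss_noise n \<sigma>))"
proof -
  define q where "q = (\<Sum>k<n. (w k)\<^sup>2)"
  define s where "s = \<sigma> * sqrt q"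
  have q: "q > 0" using w by (simp add: q_def)
  have s: "s > 0" using \<sigma> q by (simp add: s_def)
  have sq: "q = s\<^sup>2 / \<sigma>\<^sup>2" using \<sigma> q by (simp add: s_def power_mult_distrib)
  have \<gamma>': "\<gamma> = (b * s / \<sigma>\<^sup>2)\<^sup>2"
    unfolding \<gamma> q_def[symmetric] sq using \<sigma> by (simp add: power_mult_distrib power_divide field_simps power2_eq_square)
  have \<gamma>0: "\<gamma> > 0" unfolding \<gamma>' using b s \<sigma> by simp
  have sg: "sqrt \<gamma> = b * s / \<sigma>\<^sup>2" unfolding \<gamma>' using b s \<sigma> by (intro real_sqrt_unique) auto
  obtain S W h where *: "finite S" "S \<subseteq> {-1..1}" "\<forall>m\<in>S. 0 \<le> W m" "(\<Sum>m\<in>S. W m) = 1"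
     "integrable std_gauss h" "v \<le> (\<integral>u. h u \<partial>std_gauss)"
     and h: "\<And>u e. h u \<le> (\<Sum>m\<in>S. W m * exp (sqrt \<gamma> * m * u - \<gamma> * m\<^sup>2 / 2) * (e - sqrt \<gamma> * m)\<^sup>2)"
    using lb unfolding bayes_lb_def by blast
  have [measurable]: "h \<in> borel_measurable borel" using *(5) by (auto dest: borel_measurable_integrable)
  show ?thesis
  proof (rule that[OF *(1,2) _ *(4)])
    show "\<And>m. m \<in> S \<Longrightarrow> 0 \<le> W m" using * by auto
    fix g :: "(nat \<Rightarrow> real) \<Rightarrow> real" and y0 assume gm [measurable]: "g \<in> borel_measurable (Rn n)"
    have [measurable]: "(\<lambda>z. restrict (\<lambda>k. y0 k + z k) {..<n}) \<in> measurable (Rn n) (Rn n)"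
      unfolding Rn_def by (intro measurable_restrict) measurable
    \<comment> \<open>The known offset \<open>y0\<close> is absorbed into the estimator; this is why
      one prior works for all offsets at once.\<close>
    define f where "f = (\<lambda>z. g (restrict (\<lambda>k. y0 k + z k) {..<n}))"
    have fm [measurable]: "f \<in> borel_measurable (Rn n)" unfolding f_def by measurable
    define L where "L m z = exp (b * m * (\<Sum>k<n. w k * z k) / \<sigma>\<^sup>2 - b\<^sup>2 * m\<^sup>2 * q / (2 * \<sigma>\<^sup>2))" for m and z :: "nat \<Rightarrow> real"
    have Lm [measurable]: "L m \<in> borel_measurable (gauss_noise n \<sigma>)" for m
      unfolding L_def by measurable
    have shift: "(\<integral>\<^sup>+z. ennreal ((g (restrict (\<lambda>k. y0 k + b * m * w k + z k) {..<n}) - b * m)\<^sup>2) \<partial>gauss_noise n \<sigma>)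
      = (\<integral>\<^sup>+z. ennreal (L m z * (f z - b * m)\<^sup>2) \<partial>gauss_noise n \<sigma>)" for m
    proof -
      have "restrict (\<lambda>k. y0 k + b * m * w k + z k) {..<n}
        = restrict (\<lambda>k. y0 k + restrict (\<lambda>k. b * m * w k + z k) {..<n} k) {..<n}" for z
        by (auto simp: restrict_def)
      then have "(\<integral>\<^sup>+z. ennreal ((g (restrict (\<lambda>k. y0 k + b * m * w k + z k) {..<n}) - b * m)\<^sup>2) \<partial>gauss_noise n \<sigma>)
        = (\<integral>\<^sup>+z. ennreal ((f (restrict (\<lambda>k. b * m * w k + z k) {..<n}) - b * m)\<^sup>2) \<partial>gauss_noise n \<sigma>)"
        by (simp add: f_def)
      also have "\<dots> = (\<integral>\<^sup>+z. ennreal (exp ((\<Sum>k<n. b * m * w k * z k) / \<sigma>\<^sup>2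
          - (\<Sum>k<n. (b * m * w k)\<^sup>2) / (2 * \<sigma>\<^sup>2))) * ennreal ((f z - b * m)\<^sup>2) \<partial>gauss_noise n \<sigma>)"
        by (rule cameron_martin[OF \<sigma>, where f = "\<lambda>z. ennreal ((f z - b * m)\<^sup>2)"]) measurable
      also have "\<dots> = (\<integral>\<^sup>+z. ennreal (L m z * (f z - b * m)\<^sup>2) \<partial>gauss_noise n \<sigma>)"
        unfolding L_def q_def
        by (intro nn_integral_cong) (simp add: ennreal_mult power_mult_distrib sum_distrib_left mult.assoc)
      finally show ?thesis .
    qed
    define U where "U z = (\<Sum>k<n. w k * z k) / s" for z :: "nat \<Rightarrow> real"
    have LU: "L m z = exp (sqrt \<gamma> * m * U z - \<gamma> * m\<^sup>2 / 2)" for m z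
    proof -
      have "sqrt \<gamma> * m * U z = b * m * (\<Sum>k<n. w k * z k) / \<sigma>\<^sup>2" using s by (simp add: sg U_def)
      moreover have "\<gamma> * m\<^sup>2 / 2 = b\<^sup>2 * m\<^sup>2 * q / (2 * \<sigma>\<^sup>2)" by (simp add: \<gamma> q_def mult_ac)
      ultimately show ?thesis by (simp add: L_def)
    qed
    \<comment> \<open>Guessing \<open>b * m\<close> by \<open>f z\<close> amounts to guessing
      \<open>sqrt \<gamma> * m\<close> by \<open>sqrt \<gamma> / b * f z\<close>. The change of
      scale costs the factor \<open>b\<^sup>2 / \<gamma>\<close>.\<close>
    have key: "b\<^sup>2 / \<gamma> * h (U z) \<le> (\<Sum>m\<in>S. W m * (L m z * (f z - b * m)\<^sup>2))" for z
    proof -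
      have "h (U z) \<le> (\<Sum>m\<in>S. W m * L m z * (sqrt \<gamma> / b * f z - sqrt \<gamma> * m)\<^sup>2)"
        unfolding LU by (rule h)
      also have "\<dots> = (\<Sum>m\<in>S. \<gamma> / b\<^sup>2 * (W m * (L m z * (f z - b * m)\<^sup>2)))"
      proof (intro sum.cong refl)
        fix m
        have "sqrt \<gamma> / b * f z - sqrt \<gamma> * m = sqrt \<gamma> / b * (f z - b * m)"
          using b by (simp add: field_simps)
        then have "(sqrt \<gamma> / b * f z - sqrt \<gamma> * m)\<^sup>2 = \<gamma> / b\<^sup>2 * (f z - b * m)\<^sup>2"
          using \<gamma>0 by (simp add: power_mult_distrib power_divide)
        then show "W m * L m z * (sqrt \<gamma> / b * f z - sqrt \<gamma> * m)\<^sup>2 = \<gamma> / b\<^sup>2 * (W m * (L m z * (f z - b * m)\<^sup>2))"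
          by simp
      qed
      also have "\<dots> = \<gamma> / b\<^sup>2 * (\<Sum>m\<in>S. W m * (L m z * (f z - b * m)\<^sup>2))"
        by (simp only: sum_distrib_left)
      finally have "b\<^sup>2 / \<gamma> * h (U z) \<le> b\<^sup>2 / \<gamma> * (\<gamma> / b\<^sup>2 * (\<Sum>m\<in>S. W m * (L m z * (f z - b * m)\<^sup>2)))"
        using b \<gamma>0 by (intro mult_left_mono) auto
      then show ?thesis using b \<gamma>0 by simp
    qed
    have "ennreal (b\<^sup>2 / \<gamma> * v) \<le> ennreal (\<integral>u. b\<^sup>2 / \<gamma> * h u \<partial>std_gauss)"
      using *(5,6) b \<gamma>0 by (intro ennreal_leI) (simp add: divide_right_mono mult_left_mono)
    also have "\<dots> \<le> (\<integral>\<^sup>+u. ennreal (b\<^sup>2 / \<gamma> * h u) \<partial>std_gauss)"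
      by (rule nn_integral_ge_integral) (use *(5) in auto)
    also have "\<dots> = (\<integral>\<^sup>+z. ennreal (b\<^sup>2 / \<gamma> * h (U z)) \<partial>gauss_noise n \<sigma>)"
      unfolding U_def s_def q_def by (rule gauss_linear_nn_integral[symmetric, OF \<sigma> w]) measurable
    also have "\<dots> \<le> (\<integral>\<^sup>+z. (\<Sum>m\<in>S. ennreal (W m) * ennreal (L m z * (f z - b * m)\<^sup>2)) \<partial>gauss_noise n \<sigma>)"
    proof (rule nn_integral_mono)
      fix z
      have "ennreal (b\<^sup>2 / \<gamma> * h (U z)) \<le> ennreal (\<Sum>m\<in>S. W m * (L m z * (f z - b * m)\<^sup>2))"
        by (rule ennreal_leI[OF key])
      also have "\<dots> = (\<Sum>m\<in>S. ennreal (W m) * ennreal (L m z * (f z - b * m)\<^sup>2))"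
        using *(3) by (subst sum_ennreal[symmetric]) (auto simp: ennreal_mult L_def intro!: sum.cong mult_nonneg_nonneg)
      finally show "ennreal (b\<^sup>2 / \<gamma> * h (U z)) \<le> (\<Sum>m\<in>S. ennreal (W m) * ennreal (L m z * (f z - b * m)\<^sup>2))" .
    qed
    also have "\<dots> = (\<Sum>m\<in>S. \<integral>\<^sup>+z. ennreal (W m) * ennreal (L m z * (f z - b * m)\<^sup>2) \<partial>gauss_noise n \<sigma>)"
      by (rule nn_integral_sum) (auto simp: measurable_cong_sets[OF sets_gauss_noise refl, THEN sym] intro!: borel_measurable_times_ennreal)
    also have "\<dots> = (\<Sum>m\<in>S. ennreal (W m) * (\<integral>\<^sup>+z. ennreal (L m z * (f z - b * m)\<^sup>2) \<partial>gauss_noise n \<sigma>))"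
      by (intro sum.cong refl nn_integral_cmult) measurable
    finally show "ennreal (b\<^sup>2 / \<gamma> * v) \<le> (\<Sum>m\<in>S. ennreal (W m) *
        (\<integral>\<^sup>+z. ennreal ((g (restrict (\<lambda>k. y0 k + b * m * w k + z k) {..<n}) - b * m)\<^sup>2) \<partial>gauss_noise n \<sigma>))"
      unfolding shift .
  qed
qed

text \<open>Allows support points to be listed with repetitions, as happens when they are sums of
  two grid points; weights at equal positions are merged.\<close>

lemma bayes_lbI_indexed:
  fixes pos :: "'i \<Rightarrow> real"
  assumes "finite I" "\<And>i. i \<in> I \<Longrightarrow> \<bar>pos i\<bar> \<le> 1" "\<And>i. i \<in> I \<Longrightarrow> 0 \<le> V i" "(\<Sum>i\<in>I. V i) = 1"
    "integrable std_gauss h" "v \<le> (\<integral>u. h u \<partial>std_gauss)"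
    and h: "\<And>u e. h u \<le> (\<Sum>i\<in>I. V i * exp (sqrt \<gamma> * pos i * u - \<gamma> * (pos i)\<^sup>2 / 2) * (e - sqrt \<gamma> * pos i)\<^sup>2)"
  shows "bayes_lb \<gamma> v"
proof -
  define W where "W m = (\<Sum>i\<in>{i\<in>I. pos i = m}. V i)" for m
  have grp: "(\<Sum>m\<in>pos ` I. W m * F m) = (\<Sum>i\<in>I. V i * F (pos i))" for F :: "real \<Rightarrow> real"
  proof -
    have "(\<Sum>i\<in>I. V i * F (pos i)) = (\<Sum>m\<in>pos ` I. \<Sum>i\<in>{i\<in>I. pos i = m}. V i * F (pos i))"
      by (rule sum.image_gen) fact
    also have "\<dots> = (\<Sum>m\<in>pos ` I. W m * F m)"
      unfolding W_def sum_distrib_right by (intro sum.cong) auto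
    finally show ?thesis by simp
  qed
  show ?thesis
    unfolding bayes_lb_def
  proof (intro exI conjI)
    show "finite (pos ` I)" "integrable std_gauss h" "v \<le> (\<integral>u. h u \<partial>std_gauss)" using assms by auto
    show "pos ` I \<subseteq> {-1..1}" using assms(2) by (auto simp: abs_le_iff minus_le_iff)
    show "\<forall>m\<in>pos ` I. 0 \<le> W m" using assms(3) by (auto simp: W_def intro!: sum_nonneg)
    show "(\<Sum>m\<in>pos ` I. W m) = 1" using grp[of "\<lambda>_. 1"] assms(4) by simp
    show "\<forall>u e. h u \<le> (\<Sum>m\<in>pos ` I. W m * exp (sqrt \<gamma> * m * u - \<gamma> * m\<^sup>2 / 2) * (e - sqrt \<gamma> * m)\<^sup>2)"
    proof (intro allI)
      fix u e
      show "h u \<le> (\<Sum>m\<in>pos ` I. W m * exp (sqrt \<gamma> * m * u - \<gamma> * m\<^sup>2 / 2) * (e - sqrt \<gamma> * m)\<^sup>2)"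
        using h[of u e] grp[of "\<lambda>m. exp (sqrt \<gamma> * m * u - \<gamma> * m\<^sup>2 / 2) * (e - sqrt \<gamma> * m)\<^sup>2"]
        by (simp add: mult.assoc)
    qed
  qed
qed

lemma std_gauss_cosh:
  assumes "\<theta> \<ge> 0" "t \<ge> 0"
  shows "has_bochner_integral std_gauss (\<lambda>u. cosh (k * sqrt t * u) * exp (- \<theta> * u\<^sup>2))
    (exp (k\<^sup>2 * t / (2 * (1 + 2 * \<theta>))) / sqrt (1 + 2 * \<theta>))"
proof -
  have \<theta>: "\<theta> > -1/2" using assms by simp
  have e: "cosh (k * sqrt t * u) * exp (- \<theta> * u\<^sup>2)
      = (exp ((k * sqrt t) * u - \<theta> * u\<^sup>2) + exp ((- (k * sqrt t)) * u - \<theta> * u\<^sup>2)) / 2" for u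
    unfolding cosh_def by (simp add: exp_diff exp_minus field_simps)
  have "(k * sqrt t)\<^sup>2 = k\<^sup>2 * t" "(- (k * sqrt t))\<^sup>2 = k\<^sup>2 * t" using assms by (simp_all add: power_mult_distrib)
  then show ?thesis
    unfolding has_bochner_integral_iff e
    using std_gauss_exp[OF \<theta>, of "k * sqrt t"] std_gauss_exp[OF \<theta>, of "- (k * sqrt t)"]
    by simp
qed

lemma cosh_multiples:
  fixes y :: real
  shows "cosh (2 * y) = 2 * (cosh y)\<^sup>2 - 1" "cosh (3 * y) = 4 * (cosh y) ^ 3 - 3 * cosh y"
    "cosh (4 * y) = 8 * (cosh y) ^ 4 - 8 * (cosh y)\<^sup>2 + 1"
proof -
  have s: "sinh y ^ 2 = (cosh y)\<^sup>2 - 1" by (simp add: cosh_square_eq)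
  show 2: "cosh (2 * y) = 2 * (cosh y)\<^sup>2 - 1" by (simp add: cosh_double s)
  have "cosh (3 * y) = cosh (2 * y + y)" by simp
  also have "\<dots> = cosh (2 * y) * cosh y + 2 * (sinh y ^ 2) * cosh y"
    unfolding cosh_add sinh_double by (simp add: power2_eq_square)
  also have "\<dots> = 4 * (cosh y) ^ 3 - 3 * cosh y"
    unfolding 2 s by (simp add: algebra_simps power2_eq_square power3_eq_cube)
  finally show "cosh (3 * y) = 4 * (cosh y) ^ 3 - 3 * cosh y" .
  have s2: "sinh (2*y) ^ 2 = (cosh (2*y))\<^sup>2 - 1" by (simp add: cosh_square_eq)
  have "cosh (4 * y) = cosh (2 * (2 * y))" by simp
  also have "\<dots> = 2 * (cosh (2 * y))\<^sup>2 - 1" unfolding cosh_double[of "2*y"] s2 by simp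
  also have "\<dots> = 8 * (cosh y) ^ 4 - 8 * (cosh y)\<^sup>2 + 1"
    unfolding 2 by (simp add: power2_eq_square power4_eq_xxxx algebra_simps)
  finally show "cosh (4 * y) = 8 * (cosh y) ^ 4 - 8 * (cosh y)\<^sup>2 + 1" .
qed

text \<open>For the prior with generating function \<open>g = (c + a)\<^sup>2 + b\<close> in \<open>c = cosh (sqrt t u / 2)\<close> the only part of the
  posterior risk that is not an exponential polynomial is a multiple of \<open>s\<^sup>2 / g\<close>. It is bounded below by
  \<open>1/g \<ge> 2w - w\<^sup>2 g\<close>, which is integrable in closed form for Gaussian \<open>w\<close>.\<close>

lemma five_point_pointwise:
  fixes a b c s e \<nu> w :: real
  assumes cs: "c\<^sup>2 = 1 + s\<^sup>2" and b: "b \<ge> 0" and pos: "(c + a)\<^sup>2 + b > 0"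
  shows "e\<^sup>2 * ((c + a)\<^sup>2 + b) - 4 * e * \<nu> * s * (c + a) + \<nu>\<^sup>2 * (2 * c\<^sup>2 + 2 * s\<^sup>2 + 2 * a * c)
    \<ge> \<nu>\<^sup>2 * (2 + 2 * a * c + 4 * b * s\<^sup>2 * (2 * w - w\<^sup>2 * ((c + a)\<^sup>2 + b)))"
proof -
  define g where "g = (c + a)\<^sup>2 + b"
  have g: "g > 0" using pos by (simp add: g_def)
  \<comment> \<open>Completes the square in the estimate \<open>e\<close>; the minimiser
    \<open>2 * \<nu> * s * (c + a) / g\<close> is the posterior mean.\<close>
  have "0 \<le> (e * g - 2 * \<nu> * s * (c + a))\<^sup>2" by simp
  also have "\<dots> = g * (e\<^sup>2 * g - 4 * e * \<nu> * s * (c + a) + 4 * \<nu>\<^sup>2 * s\<^sup>2) - 4 * \<nu>\<^sup>2 * s\<^sup>2 * b"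
    unfolding g_def by (simp add: power2_eq_square algebra_simps)
  finally have 1: "4 * \<nu>\<^sup>2 * s\<^sup>2 * b * (1 / g) \<le> e\<^sup>2 * g - 4 * e * \<nu> * s * (c + a) + 4 * \<nu>\<^sup>2 * s\<^sup>2"
    using g by (simp add: field_simps)
  have "0 \<le> (1 - w * g)\<^sup>2" by simp
  then have 2: "2 * w - w\<^sup>2 * g \<le> 1 / g" using g by (simp add: field_simps power2_eq_square)
  have "4 * \<nu>\<^sup>2 * s\<^sup>2 * b * (2 * w - w\<^sup>2 * g) \<le> 4 * \<nu>\<^sup>2 * s\<^sup>2 * b * (1 / g)"
    using b by (intro mult_left_mono[OF 2]) auto
  with 1 have "4 * \<nu>\<^sup>2 * s\<^sup>2 * b * (2 * w - w\<^sup>2 * g) \<le> e\<^sup>2 * g - 4 * e * \<nu> * s * (c + a) + 4 * \<nu>\<^sup>2 * s\<^sup>2" by linarith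
  then show ?thesis unfolding g_def[symmetric] cs by (simp add: algebra_simps)
qed

text \<open>The prior sits at 0, at plus or minus 1/2 and at plus or minus 1 times
  \<open>sqrt t\<close>. Its weights contain \<open>exp (t / 8)\<close> and
  \<open>exp (t / 2)\<close> to cancel the normalisation of the likelihood at the nonzero points, so
  that the marginal likelihood is \<open>((c + a)\<^sup>2 + b) / N\<close>. With
  \<open>w = \<beta> * exp (- \<theta> * u\<^sup>2)\<close>, the numbers \<open>A\<close> and
  \<open>Q\<close> are the standard normal integrals of
  \<open>s\<^sup>2 * exp (- \<theta> * u\<^sup>2)\<close> and of
  \<open>s\<^sup>2 * exp (- 2 * \<theta> * u\<^sup>2)\<close> times
  \<open>(c + a)\<^sup>2 + b\<close>, expanded in hyperbolic cosines.\<close>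

lemma five_point_bound:
  fixes t a b \<theta> \<beta> :: real
  assumes t: "t > 0" and a: "a \<ge> 0" and b: "b \<ge> 0" and \<theta>: "\<theta> \<ge> 0"
  defines "p \<equiv> 1 + 2 * \<theta>" and "q \<equiv> 1 + 4 * \<theta>" and "m \<equiv> a\<^sup>2 + b + 1/2"
  defines "A \<equiv> (exp (t / (2 * p)) - 1) / (2 * sqrt p)"
    and "Q \<equiv> (exp (4 * t / (2 * q)) / 2 + 2 * a * exp ((3/2)\<^sup>2 * t / (2 * q)) + (2 * m - 1) * exp (t / (2 * q))
        - 2 * a * exp ((1/2)\<^sup>2 * t / (2 * q)) + 1/2 - 2 * m) / (4 * sqrt q)"
  shows "bayes_lb t (t * (1 + a * exp (t / 8) + 2 * b * (2 * \<beta> * A - \<beta>\<^sup>2 * Q))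
      / (exp (t / 2) + 4 * a * exp (t / 8) + 1 + 2 * a\<^sup>2 + 2 * b))"
proof -
  define \<tau> where "\<tau> = sqrt t"
  have \<tau>: "\<tau> > 0" "\<tau>\<^sup>2 = t" using t by (auto simp: \<tau>_def)
  define N where "N = exp (t / 2) / 2 + 2 * a * exp (t / 8) + 1/2 + a\<^sup>2 + b"
  have N: "N > 0" unfolding N_def using a b by (intro add_pos_nonneg add_nonneg_pos) auto
  define V :: "nat \<Rightarrow> real" where "V i = (if i = 0 then (1/2 + a\<^sup>2 + b) / N
      else if i \<le> 2 then a * exp (t / 8) / N else exp (t / 2) / 4 / N)" for i
  define pos :: "nat \<Rightarrow> real" where "pos i = (if i = 0 then 0 else if i = 1 then 1/2 else if i = 2 then -1/2
      else if i = 3 then 1 else -1)" for i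
  define F where "F k \<eta> u = cosh (k * sqrt t * u) * exp (- \<eta> * u\<^sup>2)" for k \<eta> u :: real
  define E where "E k \<eta> = exp (k\<^sup>2 * t / (2 * (1 + 2 * \<eta>))) / sqrt (1 + 2 * \<eta>)" for k \<eta> :: real
  have FE: "has_bochner_integral std_gauss (F k \<eta>) (E k \<eta>)" if "\<eta> \<ge> 0" for k \<eta>
    unfolding F_def E_def using that t by (intro std_gauss_cosh) auto
  define h where "h u = t / (4 * N) * (2 * F 0 0 u + 2 * a * F (1/2) 0 u + 4 * b * (\<beta> * (F 1 \<theta> u - F 0 \<theta> u)
      - \<beta>\<^sup>2 / 4 * (F 2 (2 * \<theta>) u / 2 + 2 * a * F (3/2) (2 * \<theta>) u + (2 * m - 1) * F 1 (2 * \<theta>) u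
        - 2 * a * F (1/2) (2 * \<theta>) u + (1/2 - 2 * m) * F 0 (2 * \<theta>) u)))" for u
  have hb: "has_bochner_integral std_gauss h
     (t / (4 * N) * (2 * E 0 0 + 2 * a * E (1/2) 0 + 4 * b * (\<beta> * (E 1 \<theta> - E 0 \<theta>)
      - \<beta>\<^sup>2 / 4 * (E 2 (2 * \<theta>) / 2 + 2 * a * E (3/2) (2 * \<theta>) + (2 * m - 1) * E 1 (2 * \<theta>)
        - 2 * a * E (1/2) (2 * \<theta>) + (1/2 - 2 * m) * E 0 (2 * \<theta>)))))"
    unfolding h_def using \<theta>
    by (intro has_bochner_integral_mult_right has_bochner_integral_add has_bochner_integral_diff
        has_bochner_integral_divide_zero FE) auto
  have I5: "{..<5} = {0, 1, 2, 3, 4::nat}" by auto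
  show ?thesis
  proof (rule bayes_lbI_indexed[where I = "{..<5::nat}" and pos = pos and V = V and h = h])
    show "finite {..<5::nat}" by simp
    show "\<bar>pos i\<bar> \<le> 1" for i by (simp add: pos_def)
    show "0 \<le> V i" for i using N a b by (simp add: V_def)
    show "(\<Sum>i<5. V i) = 1"
    proof -
      have "(\<Sum>i<5. V i) = ((1/2 + a\<^sup>2 + b) + a * exp (t / 8) + a * exp (t / 8) + exp (t / 2) / 4 + exp (t / 2) / 4) / N"
        unfolding I5 V_def by (simp add: add_divide_distrib)
      also have "(1/2 + a\<^sup>2 + b) + a * exp (t / 8) + a * exp (t / 8) + exp (t / 2) / 4 + exp (t / 2) / 4 = N"
        by (simp add: N_def)
      finally show ?thesis using N by simp
    qed
    show "integrable std_gauss h" using hb by (simp add: has_bochner_integral_iff)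
    have "(\<integral>u. h u \<partial>std_gauss) = t / (4 * N) * (2 + 2 * a * exp (t / 8) + 4 * b * (2 * \<beta> * A - \<beta>\<^sup>2 * Q))"
    proof -
      have "E 0 0 = 1" "E (1/2) 0 = exp (t / 8)" by (simp_all add: E_def power2_eq_square)
      moreover have "\<beta> * (E 1 \<theta> - E 0 \<theta>) = 2 * \<beta> * A"
        by (simp add: E_def A_def p_def diff_divide_distrib)
      moreover have "(E 2 (2 * \<theta>) / 2 + 2 * a * E (3/2) (2 * \<theta>) + (2 * m - 1) * E 1 (2 * \<theta>)
        - 2 * a * E (1/2) (2 * \<theta>) + (1/2 - 2 * m) * E 0 (2 * \<theta>)) = 4 * Q"
      proof -
        define r where "r = sqrt q"
        have "r > 0" using \<theta> by (simp add: r_def q_def)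
        moreover have "E 2 (2 * \<theta>) = exp (4 * t / (2 * q)) / r" "E (3/2) (2 * \<theta>) = exp ((3/2)\<^sup>2 * t / (2 * q)) / r"
          "E 1 (2 * \<theta>) = exp (t / (2 * q)) / r" "E (1/2) (2 * \<theta>) = exp ((1/2)\<^sup>2 * t / (2 * q)) / r"
          "E 0 (2 * \<theta>) = 1 / r"
          by (simp_all add: E_def r_def q_def)
        ultimately show ?thesis
          unfolding Q_def r_def[symmetric] by (simp add: add_divide_distrib diff_divide_distrib)
      qed
      ultimately show ?thesis using has_bochner_integral_integral_eq[OF hb] by simp
    qed
    also have "\<dots> = t * (1 + a * exp (t / 8) + 2 * b * (2 * \<beta> * A - \<beta>\<^sup>2 * Q)) / (2 * N)"
      using N by (simp add: field_simps)
    also have "2 * N = exp (t / 2) + 4 * a * exp (t / 8) + 1 + 2 * a\<^sup>2 + 2 * b" by (simp add: N_def)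
    finally show "t * (1 + a * exp (t / 8) + 2 * b * (2 * \<beta> * A - \<beta>\<^sup>2 * Q))
      / (exp (t / 2) + 4 * a * exp (t / 8) + 1 + 2 * a\<^sup>2 + 2 * b) \<le> (\<integral>u. h u \<partial>std_gauss)" by simp
    fix u e :: real
    define y where "y = \<tau> * u / 2"
    define c where "c = cosh y"
    define s where "s = sinh y"
    define w where "w = \<beta> * exp (- \<theta> * u\<^sup>2)"
    define \<nu> where "\<nu> = \<tau> / 2"
    have cs: "c\<^sup>2 = 1 + s\<^sup>2" by (simp add: c_def s_def cosh_square_eq)
    have c1: "c > 0" by (simp add: c_def)
    have w2: "w\<^sup>2 = \<beta>\<^sup>2 * exp (- (2 * \<theta>) * u\<^sup>2)"
      by (simp add: w_def power_mult_distrib exp_double[symmetric] mult.assoc)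
    have k: "cosh (0 * sqrt t * u) = 1" "cosh (1/2 * sqrt t * u) = c" "cosh (1 * sqrt t * u) = 2 * c\<^sup>2 - 1"
        "cosh (3/2 * sqrt t * u) = 4 * c ^ 3 - 3 * c" "cosh (2 * sqrt t * u) = 8 * c ^ 4 - 8 * c\<^sup>2 + 1"
      using cosh_multiples[of y] by (simp_all add: c_def y_def \<tau>_def mult_ac)
    have h_eq: "h u = (\<nu>\<^sup>2 * (2 + 2 * a * c + 4 * b * s\<^sup>2 * (2 * w - w\<^sup>2 * ((c + a)\<^sup>2 + b)))) / N"
    proof -
      have s2: "s\<^sup>2 = c\<^sup>2 - 1" using cs by simp
      have f1: "\<nu>\<^sup>2 = t / 4" using \<tau> by (simp add: \<nu>_def power_divide)
      have f2: "2 * F 0 0 u + 2 * a * F (1/2) 0 u = 2 + 2 * a * c" unfolding F_def k by simp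
      have f3: "\<beta> * (F 1 \<theta> u - F 0 \<theta> u) = s\<^sup>2 * (2 * w)"
        unfolding F_def k s2 w_def by (simp add: algebra_simps)
      have f4: "\<beta>\<^sup>2 / 4 * (F 2 (2 * \<theta>) u / 2 + 2 * a * F (3/2) (2 * \<theta>) u + (2 * m - 1) * F 1 (2 * \<theta>) u
        - 2 * a * F (1/2) (2 * \<theta>) u + (1/2 - 2 * m) * F 0 (2 * \<theta>) u) = s\<^sup>2 * (w\<^sup>2 * ((c + a)\<^sup>2 + b))"
        unfolding F_def k s2 w2 m_def
        by (simp add: field_simps power2_eq_square power3_eq_cube power4_eq_xxxx)
      show ?thesis unfolding h_def f1 f2 f3 f4 using N by (simp add: field_simps)
    qed
    have "(\<Sum>i<5. V i * exp (sqrt t * pos i * u - t * (pos i)\<^sup>2 / 2) * (e - sqrt t * pos i)\<^sup>2)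
       = (e\<^sup>2 * ((c + a)\<^sup>2 + b) - 4 * e * \<nu> * s * (c + a) + \<nu>\<^sup>2 * (2 * c\<^sup>2 + 2 * s\<^sup>2 + 2 * a * c)) / N"
    proof -
      define x where "x = exp y"
      have x: "x > 0" by (simp add: x_def)
      have cx: "c = (x + 1 / x) / 2" "s = (x - 1 / x) / 2"
        by (simp_all add: c_def s_def cosh_def sinh_def x_def exp_minus field_simps)
      have arg: "sqrt t * pos 0 * u - t * (pos 0)\<^sup>2 / 2 = 0"
        "sqrt t * pos 1 * u - t * (pos 1)\<^sup>2 / 2 = y - t / 8"
        "sqrt t * pos 2 * u - t * (pos 2)\<^sup>2 / 2 = - y - t / 8"
        "sqrt t * pos 3 * u - t * (pos 3)\<^sup>2 / 2 = (y + y) - t / 2"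
        "sqrt t * pos 4 * u - t * (pos 4)\<^sup>2 / 2 = - (y + y) - t / 2"
        by (simp_all add: pos_def y_def \<tau>_def power2_eq_square)
      have wt: "V 0 * exp 0 = (1/2 + a\<^sup>2 + b) / N" "V 1 * exp (y - t / 8) = a * x / N"
        "V 2 * exp (- y - t / 8) = a / x / N" "V 3 * exp ((y + y) - t / 2) = x\<^sup>2 / 4 / N"
        "V 4 * exp (- (y + y) - t / 2) = 1 / x\<^sup>2 / 4 / N"
        unfolding exp_diff exp_minus exp_add x_def[symmetric] by (simp_all add: V_def power2_eq_square field_simps)
      have pp: "sqrt t * pos 0 = 0" "sqrt t * pos 1 = \<nu>" "sqrt t * pos 2 = - \<nu>" "sqrt t * pos 3 = 2 * \<nu>"
        "sqrt t * pos 4 = - (2 * \<nu>)"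
        by (simp_all add: pos_def \<nu>_def \<tau>_def)
      have "(\<Sum>i<5. V i * exp (sqrt t * pos i * u - t * (pos i)\<^sup>2 / 2) * (e - sqrt t * pos i)\<^sup>2)
        = V 0 * exp (sqrt t * pos 0 * u - t * (pos 0)\<^sup>2 / 2) * (e - sqrt t * pos 0)\<^sup>2
        + V 1 * exp (sqrt t * pos 1 * u - t * (pos 1)\<^sup>2 / 2) * (e - sqrt t * pos 1)\<^sup>2
        + V 2 * exp (sqrt t * pos 2 * u - t * (pos 2)\<^sup>2 / 2) * (e - sqrt t * pos 2)\<^sup>2
        + V 3 * exp (sqrt t * pos 3 * u - t * (pos 3)\<^sup>2 / 2) * (e - sqrt t * pos 3)\<^sup>2
        + V 4 * exp (sqrt t * pos 4 * u - t * (pos 4)\<^sup>2 / 2) * (e - sqrt t * pos 4)\<^sup>2"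
        unfolding I5 by simp
      also have "\<dots> = ((1/2 + a\<^sup>2 + b) * e\<^sup>2 + a * x * (e - \<nu>)\<^sup>2 + a / x * (e + \<nu>)\<^sup>2
            + x\<^sup>2 / 4 * (e - 2 * \<nu>)\<^sup>2 + 1 / x\<^sup>2 / 4 * (e + 2 * \<nu>)\<^sup>2) / N"
        unfolding arg unfolding wt unfolding pp by (simp add: add_divide_distrib distrib_right)
      also have "\<dots> = (e\<^sup>2 * ((c + a)\<^sup>2 + b) - 4 * e * \<nu> * s * (c + a) + \<nu>\<^sup>2 * (2 * c\<^sup>2 + 2 * s\<^sup>2 + 2 * a * c)) / N"
      proof -
        define x' where "x' = 1 / x"
        have xx: "x * x' = 1" using x by (simp add: x'_def)
        have c2: "c\<^sup>2 = (x\<^sup>2 + x'\<^sup>2) / 4 + 1/2" and s2: "s\<^sup>2 = (x\<^sup>2 + x'\<^sup>2) / 4 - 1/2"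
          and sc: "s * c = (x\<^sup>2 - x'\<^sup>2) / 4"
          unfolding cx x'_def[symmetric] using xx by (simp_all add: power2_eq_square field_simps)
        have "e\<^sup>2 * ((c + a)\<^sup>2 + b) - 4 * e * \<nu> * s * (c + a) + \<nu>\<^sup>2 * (2 * c\<^sup>2 + 2 * s\<^sup>2 + 2 * a * c)
          = e\<^sup>2 * (c\<^sup>2 + 2 * a * c + a\<^sup>2 + b) - 4 * e * \<nu> * (s * c) - 4 * e * \<nu> * a * s + \<nu>\<^sup>2 * (2 * c\<^sup>2 + 2 * s\<^sup>2 + 2 * a * c)"
          by (simp add: power2_eq_square algebra_simps)
        also have "\<dots> = (1/2 + a\<^sup>2 + b) * e\<^sup>2 + a * x * (e - \<nu>)\<^sup>2 + a * x' * (e + \<nu>)\<^sup>2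
            + x\<^sup>2 / 4 * (e - 2 * \<nu>)\<^sup>2 + x'\<^sup>2 / 4 * (e + 2 * \<nu>)\<^sup>2"
          unfolding c2 s2 sc unfolding cx x'_def[symmetric] by (simp add: power2_eq_square field_simps)
        finally show ?thesis by (simp add: x'_def power_divide)
      qed
      finally show ?thesis .
    qed
    also have "\<dots> \<ge> h u"
      unfolding h_eq
      by (intro divide_right_mono five_point_pointwise cs b)
         (use N c1 a b in \<open>auto intro!: add_pos_nonneg\<close>)
    finally show "h u \<le> (\<Sum>i<5. V i * exp (sqrt t * pos i * u - t * (pos i)\<^sup>2 / 2) * (e - sqrt t * pos i)\<^sup>2)" .
  qed
qed

text \<open>For equal weights at both endpoints the posterior risk is
  \<open>t * exp (- t / 2) / cosh (sqrt t * u)\<close>. The reciprocal of the hyperbolic cosine is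
  again replaced by a tangent, with \<open>w\<close> proportional to
  \<open>exp (- u\<^sup>2 / 2)\<close>.\<close>

lemma two_point_bound:
  fixes t :: real
  assumes t: "t > 0"
  shows "bayes_lb t (t * (sqrt 3 / 2) * exp (- (2 * t / 3)))"
proof -
  \<comment> \<open>Maximises the resulting quadratic \<open>2 * \<beta> / sqrt 2 - \<beta>\<^sup>2
    * exp (t / 6) / sqrt 3\<close>.\<close>
  define \<beta> where "\<beta> = sqrt 3 / sqrt 2 * exp (- (t / 6))"
  define F where "F k \<eta> u = cosh (k * sqrt t * u) * exp (- \<eta> * u\<^sup>2)" for k \<eta> u :: real
  define h where "h u = t * exp (- (t / 2)) * (2 * \<beta> * F 0 (1/2) u - \<beta>\<^sup>2 * F 1 1 u)" for u
  have hb: "has_bochner_integral std_gauss h (t * exp (- (t / 2)) *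
      (2 * \<beta> * (exp (0\<^sup>2 * t / (2 * (1 + 2 * (1/2)))) / sqrt (1 + 2 * (1/2)))
       - \<beta>\<^sup>2 * (exp (1\<^sup>2 * t / (2 * (1 + 2 * 1))) / sqrt (1 + 2 * 1))))"
    unfolding h_def F_def using t
    by (intro has_bochner_integral_mult_right has_bochner_integral_diff std_gauss_cosh) auto
  have val: "t * exp (- (t / 2)) *
      (2 * \<beta> * (exp (0\<^sup>2 * t / (2 * (1 + 2 * (1/2)))) / sqrt (1 + 2 * (1/2)))
       - \<beta>\<^sup>2 * (exp (1\<^sup>2 * t / (2 * (1 + 2 * 1))) / sqrt (1 + 2 * 1))) = t * (sqrt 3 / 2) * exp (- (2 * t / 3))"
  proof -
    have 1: "2 * \<beta> * (exp (0\<^sup>2 * t / (2 * (1 + 2 * (1/2)))) / sqrt (1 + 2 * (1/2))) = sqrt 3 * exp (- (t / 6))"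
      by (simp add: \<beta>_def field_simps)
    have 2: "\<beta>\<^sup>2 * (exp (1\<^sup>2 * t / (2 * (1 + 2 * 1))) / sqrt (1 + 2 * 1)) = (sqrt 3 / 2) * exp (- (t / 6))"
      by (simp add: \<beta>_def power_mult_distrib power_divide exp_minus power2_eq_square field_simps)
    have 3: "exp (- (t / 2)) * exp (- (t / 6)) = exp (- (2 * t / 3))"
      by (simp add: exp_add[symmetric])
    show ?thesis unfolding 1 2 3[symmetric] by (simp add: algebra_simps)
  qed
  have I2: "{..<2} = {0, 1::nat}" by auto
  define pos where "pos i = (if i = 0 then 1 else -1 :: real)" for i :: nat
  show ?thesis
  proof (rule bayes_lbI_indexed[where I = "{..<2::nat}" and pos = pos and V = "\<lambda>_. 1/2" and h = h])
    show "integrable std_gauss h" using hb by (simp add: has_bochner_integral_iff)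
    show "t * (sqrt 3 / 2) * exp (- (2 * t / 3)) \<le> (\<integral>u. h u \<partial>std_gauss)"
      using has_bochner_integral_integral_eq[OF hb] unfolding val by simp
    fix u e :: real
    define y where "y = sqrt t * u"
    define w where "w = \<beta> * exp (- (u\<^sup>2 / 2))"
    define c where "c = cosh y"
    define s where "s = sinh y"
    have c: "c > 0" by (simp add: c_def)
    have cs: "c\<^sup>2 = 1 + s\<^sup>2" by (simp add: c_def s_def cosh_square_eq)
    have s2: "s\<^sup>2 = c\<^sup>2 - 1" using cs by simp
    have "w\<^sup>2 = \<beta>\<^sup>2 * exp (- (u\<^sup>2))"
      by (simp add: w_def power_mult_distrib exp_double[symmetric])
    then have h_eq: "h u = exp (- (t / 2)) * (t * (2 * w - w\<^sup>2 * c))"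
      by (simp add: h_def F_def c_def y_def w_def)
    have "0 \<le> (1 - w * c)\<^sup>2" by simp
    then have 2: "2 * w - w\<^sup>2 * c \<le> 1 / c" using c by (simp add: field_simps power2_eq_square)
    have "0 \<le> (e * c - sqrt t * s)\<^sup>2" by simp
    also have "\<dots> = e\<^sup>2 * c\<^sup>2 - 2 * e * c * (sqrt t * s) + t * s\<^sup>2"
      using t by (simp add: power2_diff power_mult_distrib)
    also have "\<dots> = c * (e\<^sup>2 * c - 2 * e * sqrt t * s + t * c) - t"
      unfolding s2 by (simp add: power2_eq_square algebra_simps)
    finally have "t * (1 / c) \<le> e\<^sup>2 * c - 2 * e * sqrt t * s + t * c"
      using c by (simp add: field_simps)
    with mult_left_mono[OF 2, of t] t have "t * (2 * w - w\<^sup>2 * c) \<le> e\<^sup>2 * c - 2 * e * sqrt t * s + t * c"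
      by linarith
    then have "h u \<le> exp (- (t / 2)) * (e\<^sup>2 * c - 2 * e * sqrt t * s + t * c)"
      unfolding h_eq by (intro mult_left_mono) auto
    also have "\<dots> = 1/2 * exp (y - t / 2) * (e - sqrt t)\<^sup>2 + 1/2 * exp (- y - t / 2) * (e + sqrt t)\<^sup>2"
    proof -
      have cc: "c = (exp y + exp (- y)) / 2" and ss: "s = (exp y - exp (- y)) / 2"
        by (simp_all add: c_def s_def cosh_def sinh_def field_simps)
      have sq: "(e - sqrt t)\<^sup>2 = e\<^sup>2 - 2 * e * sqrt t + t" "(e + sqrt t)\<^sup>2 = e\<^sup>2 + 2 * e * sqrt t + t"
        using t by (simp_all add: power2_eq_square algebra_simps)
      have ex: "exp (y - t / 2) = exp y * exp (- (t / 2))" "exp (- y - t / 2) = exp (- y) * exp (- (t / 2))"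
        by (simp_all add: exp_add[symmetric])
      show ?thesis unfolding sq ex unfolding cc ss by (simp add: field_simps)
    qed
    also have "\<dots> = (\<Sum>i<2. 1/2 * exp (sqrt t * pos i * u - t * (pos i)\<^sup>2 / 2) * (e - sqrt t * pos i)\<^sup>2)"
      unfolding I2 by (simp add: pos_def y_def)
    finally show "h u \<le> (\<Sum>i<2. 1/2 * exp (sqrt t * pos i * u - t * (pos i)\<^sup>2 / 2) * (e - sqrt t * pos i)\<^sup>2)" .
  qed (auto simp: pos_def)
qed

text \<open>If the generating function is a perfect square \<open>H\<^sup>2\<close>, the posterior risk is \<open>2HH'' - 2H'\<^sup>2\<close>, an exponential
  polynomial, so that the Bayes risk has a closed form.\<close>

lemma square_prior_bound:
  fixes f :: "nat \<Rightarrow> real" and d :: real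
  assumes n: "n \<ge> 2" and f: "\<And>k. f k > 0" and d: "d > 0"
  defines "K \<equiv> {..<n} \<times> {..<n}"
  defines "y \<equiv> \<lambda>(k, l). f k * f l * exp (- (d / 2 * (real k - real l)\<^sup>2))"
  shows "bayes_lb ((real n - 1)\<^sup>2 * d) (d * (\<Sum>(k, l)\<in>K. (real k - real l)\<^sup>2 * y (k, l)) / (\<Sum>x\<in>K. y x))"
proof -
  define \<delta> where "\<delta> = sqrt d"
  have \<delta>: "\<delta> > 0" "\<delta>\<^sup>2 = d" using d by (auto simp: \<delta>_def)
  have n1: "real n - 1 > 0" using n by simp
  have st: "sqrt ((real n - 1)\<^sup>2 * d) = (real n - 1) * \<delta>"
    using n1 by (simp add: real_sqrt_mult \<delta>_def)
  define \<nu> where "\<nu> k = \<delta> * (real k - (real n - 1) / 2)" for k :: nat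
  have fin: "finite K" by (simp add: K_def)
  define N where "N = (\<Sum>x\<in>K. y x)"
  have ypos: "y x > 0" for x using f by (auto simp: y_def split: prod.split)
  have "(0, 0) \<in> K" using n by (simp add: K_def)
  then have N: "N > 0" unfolding N_def by (intro sum_pos fin ypos) auto
  define pos where "pos = (\<lambda>(k, l). (real k + real l - (real n - 1)) / (real n - 1))"
  have posv: "sqrt ((real n - 1)\<^sup>2 * d) * pos (k, l) = \<nu> k + \<nu> l" for k l
    unfolding st pos_def \<nu>_def using n1 by (simp add: field_simps)
  have posv2: "(real n - 1)\<^sup>2 * d * (pos (k, l))\<^sup>2 = (\<nu> k + \<nu> l)\<^sup>2" for k l
    unfolding posv[symmetric] using d by (simp add: power_mult_distrib)
  have nud: "(\<nu> k - \<nu> l)\<^sup>2 = d * (real k - real l)\<^sup>2" for k l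
    unfolding \<nu>_def \<delta>(2)[symmetric] by (simp add: power2_eq_square algebra_simps)
  \<comment> \<open>By the parallelogram law the coupling factor in \<open>y\<close> and the
    normalisation of the likelihood combine to a product. This makes the marginal likelihood the
    square of the sum of all \<open>a u k\<close>, up to \<open>N\<close>.\<close>
  have e1: "exp (- (d / 2 * (real k - real l)\<^sup>2)) * exp (- ((\<nu> k + \<nu> l)\<^sup>2 / 2)) = exp (- (\<nu> k)\<^sup>2) * exp (- (\<nu> l)\<^sup>2)" for k l
  proof -
    have "- (d / 2 * (real k - real l)\<^sup>2) - (\<nu> k + \<nu> l)\<^sup>2 / 2 = - (\<nu> k - \<nu> l)\<^sup>2 / 2 - (\<nu> k + \<nu> l)\<^sup>2 / 2"
      unfolding nud by simp
    also have "\<dots> = - (\<nu> k)\<^sup>2 - (\<nu> l)\<^sup>2" by (simp add: power2_eq_square field_simps)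
    finally show ?thesis by (simp add: exp_add[symmetric])
  qed
  define a where "a u k = f k * exp (- (\<nu> k)\<^sup>2) * exp (\<nu> k * u)" for u k
  have ya: "y (k, l) * exp ((\<nu> k + \<nu> l) * u - (\<nu> k + \<nu> l)\<^sup>2 / 2) = a u k * a u l" for u k l
  proof -
    have "exp ((\<nu> k + \<nu> l) * u - (\<nu> k + \<nu> l)\<^sup>2 / 2) = exp (\<nu> k * u) * exp (\<nu> l * u) * exp (- ((\<nu> k + \<nu> l)\<^sup>2 / 2))"
      by (simp add: exp_add[symmetric] algebra_simps)
    then have "y (k, l) * exp ((\<nu> k + \<nu> l) * u - (\<nu> k + \<nu> l)\<^sup>2 / 2)
       = f k * f l * exp (\<nu> k * u) * exp (\<nu> l * u) *
         (exp (- (d / 2 * (real k - real l)\<^sup>2)) * exp (- ((\<nu> k + \<nu> l)\<^sup>2 / 2)))"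
      by (simp add: y_def)
    also have "\<dots> = a u k * a u l" unfolding e1 a_def by simp
    finally show ?thesis .
  qed
  define h where "h u = (\<Sum>(k, l)\<in>K. y (k, l) / N * (\<nu> k - \<nu> l)\<^sup>2 * exp (- ((\<nu> k + \<nu> l)\<^sup>2 / 2)) * exp ((\<nu> k + \<nu> l) * u - 0 * u\<^sup>2))" for u
  have int: "has_bochner_integral std_gauss (\<lambda>u. exp (c * u - 0 * u\<^sup>2)) (exp (c\<^sup>2 / 2))" for c
    using std_gauss_exp[of 0 c] by (simp add: has_bochner_integral_iff)
  have hb: "has_bochner_integral std_gauss h (\<Sum>x\<in>K. y x / N * (\<nu> (fst x) - \<nu> (snd x))\<^sup>2 * exp (- ((\<nu> (fst x) + \<nu> (snd x))\<^sup>2 / 2))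
         * exp ((\<nu> (fst x) + \<nu> (snd x))\<^sup>2 / 2))"
    unfolding h_def case_prod_beta prod.collapse
    by (intro has_bochner_integral_sum has_bochner_integral_mult_right int)
  show ?thesis
  proof (rule bayes_lbI_indexed[where I = K and pos = pos and V = "\<lambda>x. y x / N" and h = h])
    show "finite K" by fact
    show "\<bar>pos i\<bar> \<le> 1" if "i \<in> K" for i
      using that n1 by (auto simp: K_def pos_def abs_le_iff field_simps)
    show "0 \<le> y i / N" for i using ypos[of i] N by simp
    show "(\<Sum>i\<in>K. y i / N) = 1" using N by (simp add: sum_divide_distrib[symmetric] N_def[symmetric])
    show "integrable std_gauss h" using hb by (simp add: has_bochner_integral_iff)
    have "(\<integral>u. h u \<partial>std_gauss) = (\<Sum>x\<in>K. y x / N * (\<nu> (fst x) - \<nu> (snd x))\<^sup>2 * exp (- ((\<nu> (fst x) + \<nu> (snd x))\<^sup>2 / 2))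
         * exp ((\<nu> (fst x) + \<nu> (snd x))\<^sup>2 / 2))"
      by (rule has_bochner_integral_integral_eq[OF hb])
    also have "\<dots> = (\<Sum>x\<in>K. d / N * ((real (fst x) - real (snd x))\<^sup>2 * y x))"
      by (intro sum.cong refl) (simp add: mult.assoc exp_add[symmetric] nud)
    also have "\<dots> = d * (\<Sum>(k, l)\<in>K. (real k - real l)\<^sup>2 * y (k, l)) / N"
      unfolding sum_distrib_left[symmetric] by (simp add: case_prod_beta)
    finally show "d * (\<Sum>(k, l)\<in>K. (real k - real l)\<^sup>2 * y (k, l)) / (\<Sum>x\<in>K. y x) \<le> (\<integral>u. h u \<partial>std_gauss)"
      by (simp add: N_def)
    fix u e :: real
    have hK: "h u = (\<Sum>(k, l)\<in>K. a u k * a u l * (\<nu> k - \<nu> l)\<^sup>2) / N"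
      unfolding h_def sum_divide_distrib
    proof (intro sum.cong refl)
      fix x assume "x \<in> K"
      obtain k l where x: "x = (k, l)" by (cases x)
      have sp: "exp ((\<nu> k + \<nu> l) * u - (\<nu> k + \<nu> l)\<^sup>2 / 2)
          = exp (- ((\<nu> k + \<nu> l)\<^sup>2 / 2)) * exp ((\<nu> k + \<nu> l) * u - 0 * u\<^sup>2)"
        by (simp add: exp_add[symmetric])
      show "(case x of (k, l) \<Rightarrow> y (k, l) / N * (\<nu> k - \<nu> l)\<^sup>2 * exp (- ((\<nu> k + \<nu> l)\<^sup>2 / 2)) * exp ((\<nu> k + \<nu> l) * u - 0 * u\<^sup>2))
        = (case x of (k, l) \<Rightarrow> a u k * a u l * (\<nu> k - \<nu> l)\<^sup>2) / N"
        unfolding x prod.case ya[symmetric] sp by simp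
    qed
    have rK: "(\<Sum>x\<in>K. y x / N * exp (sqrt ((real n - 1)\<^sup>2 * d) * pos x * u - (real n - 1)\<^sup>2 * d * (pos x)\<^sup>2 / 2)
          * (e - sqrt ((real n - 1)\<^sup>2 * d) * pos x)\<^sup>2)
       = (\<Sum>(k, l)\<in>K. a u k * a u l * (e - (\<nu> k + \<nu> l))\<^sup>2) / N"
      unfolding sum_divide_distrib
    proof (intro sum.cong refl)
      fix x assume "x \<in> K"
      obtain k l where x: "x = (k, l)" by (cases x)
      show "y x / N * exp (sqrt ((real n - 1)\<^sup>2 * d) * pos x * u - (real n - 1)\<^sup>2 * d * (pos x)\<^sup>2 / 2)
          * (e - sqrt ((real n - 1)\<^sup>2 * d) * pos x)\<^sup>2
        = (case x of (k, l) \<Rightarrow> a u k * a u l * (e - (\<nu> k + \<nu> l))\<^sup>2) / N"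
        unfolding x posv posv2 prod.case ya[symmetric] by simp
    qed
    \<comment> \<open>Termwise \<open>(e - p - q)\<^sup>2 - (p - q)\<^sup>2 = (e - 2 * p) * (e - 2 *
      q)\<close>, so the double sum factorises into a square.\<close>
    have "(\<Sum>(k, l)\<in>K. a u k * a u l * (e - (\<nu> k + \<nu> l))\<^sup>2) - (\<Sum>(k, l)\<in>K. a u k * a u l * (\<nu> k - \<nu> l)\<^sup>2)
      = (\<Sum>(k, l)\<in>K. (a u k * (e - 2 * \<nu> k)) * (a u l * (e - 2 * \<nu> l)))"
      unfolding sum_subtractf[symmetric]
      by (intro sum.cong refl) (auto simp: power2_eq_square algebra_simps)
    also have "\<dots> = (\<Sum>k<n. a u k * (e - 2 * \<nu> k))\<^sup>2"
      unfolding K_def sum.cartesian_product[symmetric] power2_eq_square sum_product ..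
    also have "\<dots> \<ge> 0" by simp
    finally show "h u \<le> (\<Sum>x\<in>K. y x / N * exp (sqrt ((real n - 1)\<^sup>2 * d) * pos x * u - (real n - 1)\<^sup>2 * d * (pos x)\<^sup>2 / 2)
          * (e - sqrt ((real n - 1)\<^sup>2 * d) * pos x)\<^sup>2)"
      unfolding hK rK using N by (simp add: divide_right_mono)
  qed
qed

section \<open>Numerical verification of the constant 4/5\<close>

text \<open>The Lagrange remainder has the even order eight, hence a sign: the truncation is a lower
  bound for negative arguments as well.\<close>

lemma exp_taylor_lower: "1 + x + x\<^sup>2 / 2 + x ^ 3 / 6 + x ^ 4 / 24 + x ^ 5 / 120 + x ^ 6 / 720 + x ^ 7 / 5040 \<le> exp (x::real)"
proof -
  obtain t where "exp x = (\<Sum>m<8. x ^ m / fact m) + exp t / fact 8 * x ^ 8"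
    using Maclaurin_exp_le[of x 8] by blast
  moreover have "exp t / fact 8 * x ^ 8 \<ge> 0" by simp
  ultimately show ?thesis by (simp add: eval_nat_numeral)
qed

lemma exp_taylor_lower3: "1 + x + x\<^sup>2 / 2 + x ^ 3 / 6 \<le> exp (x::real)"
proof -
  obtain t where "exp x = (\<Sum>m<4. x ^ m / fact m) + exp t / fact 4 * x ^ 4"
    using Maclaurin_exp_le[of x 4] by blast
  moreover have "exp t / fact 4 * x ^ 4 \<ge> 0" by simp
  ultimately show ?thesis by (simp add: eval_nat_numeral)
qed

definition exp8 :: "real \<Rightarrow> real" where
  "exp8 x = 1 + x + x\<^sup>2 / 2 + x ^ 3 / 6 + x ^ 4 / 24 + x ^ 5 / 120 + x ^ 6 / 720 + x ^ 7 / 5040"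

text \<open>Dividing the argument by 8 and taking the eighth power keeps the short Taylor polynomial
  accurate. Upper bounds come from lower bounds at the negated argument.\<close>

lemma exp_ge_num: "0 \<le> exp8 (x / 8) \<Longrightarrow> r \<le> exp8 (x / 8) ^ 8 \<Longrightarrow> r \<le> exp x"
proof -
  assume a: "0 \<le> exp8 (x / 8)" "r \<le> exp8 (x / 8) ^ 8"
  have "exp8 (x / 8) ^ 8 \<le> exp (x / 8) ^ 8"
    using a exp_taylor_lower[of "x / 8"] by (intro power_mono) (auto simp: exp8_def)
  also have "\<dots> = exp x" by (simp add: exp_of_nat_mult[symmetric])
  finally show ?thesis using a by simp
qed

lemma exp_le_num: "0 < exp8 (- x / 8) \<Longrightarrow> 1 \<le> r * exp8 (- x / 8) ^ 8 \<Longrightarrow> exp x \<le> r"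
proof -
  assume a: "0 < exp8 (- x / 8)" "1 \<le> r * exp8 (- x / 8) ^ 8"
  have r: "r > 0"
    using a by (metis less_le_trans zero_less_one zero_less_mult_pos2 zero_less_power)
  have "exp8 (- x / 8) ^ 8 \<le> exp (- x)"
    using exp_ge_num[of "- x" "exp8 (- x / 8) ^ 8"] a by simp
  then have "r * exp8 (- x / 8) ^ 8 \<le> r * exp (- x)" using r by simp
  with a have "1 \<le> r * exp (- x)" by simp
  then show ?thesis by (simp add: exp_minus field_simps)
qed

text \<open>The coefficient 1/16 is \<open>(3/2) / fact 4\<close>, with 3/2 bounding
  \<open>exp (2/5)\<close> in the remainder.\<close>

lemma exp_quartic_upper: "\<bar>x\<bar> \<le> 2/5 \<Longrightarrow> exp (x::real) \<le> 1 + x + x\<^sup>2 / 2 + x ^ 3 / 6 + x ^ 4 / 16"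
proof -
  assume x: "\<bar>x\<bar> \<le> 2/5"
  obtain t where t: "\<bar>t\<bar> \<le> \<bar>x\<bar>" and e: "exp x = (\<Sum>m<4. x ^ m / fact m) + exp t / fact 4 * x ^ 4"
    using Maclaurin_exp_le[of x 4] by blast
  have "exp t \<le> exp (2/5)" using t x by simp
  also have "\<dots> \<le> 3/2" by (rule exp_le_num) (simp_all add: exp8_def power_divide)
  finally have "exp t / fact 4 * x ^ 4 \<le> (3/2) / fact 4 * x ^ 4"
    by (intro mult_right_mono divide_right_mono) auto
  then show ?thesis unfolding e by (simp add: eval_nat_numeral)
qed

text \<open>Polynomials in \<open>h\<close> as coefficient lists, constant term first. With explicit
  rational entries the simplifier evaluates sums, multiples and the bound \<open>pabs\<close> by
  plain arithmetic.\<close>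

fun pe :: "real list \<Rightarrow> real \<Rightarrow> real" where
  "pe [] h = 0"
| "pe (c # cs) h = c + h * pe cs h"

fun padd :: "real list \<Rightarrow> real list \<Rightarrow> real list" where
  "padd [] bs = bs"
| "padd as [] = as"
| "padd (a # as) (b # bs) = (a + b) # padd as bs"

definition psc :: "real \<Rightarrow> real list \<Rightarrow> real list" where
  "psc c = map (\<lambda>a. c * a)"

fun pabs :: "real list \<Rightarrow> real \<Rightarrow> real" where
  "pabs [] H = 0"
| "pabs (c # cs) H = \<bar>c\<bar> + H * pabs cs H"

lemma pe_padd [simp]: "pe (padd as bs) h = pe as h + pe bs h"
  by (induction as bs rule: padd.induct) (auto simp: algebra_simps)

lemma pe_psc [simp]: "pe (psc c as) h = c * pe as h"
  by (induction as) (auto simp: psc_def algebra_simps)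

lemma pe_abs: "\<bar>h\<bar> \<le> H \<Longrightarrow> \<bar>pe cs h\<bar> \<le> pabs cs H"
proof (induction cs)
  case (Cons c cs)
  have "\<bar>h * pe cs h\<bar> \<le> H * pabs cs H"
    unfolding abs_mult using Cons by (intro mult_mono) auto
  then show ?case using abs_triangle_ineq[of c "h * pe cs h"] by simp
qed simp

text \<open>\<open>plow\<close> and \<open>pup\<close> list the coefficients, in powers of
  \<open>h\<close>, of the cubic lower and the quartic upper Taylor bound of
  \<open>E * exp (h * l)\<close>.\<close>

definition plow :: "real \<Rightarrow> real \<Rightarrow> real list" where
  "plow E l = [E, E * l, E * l\<^sup>2 / 2, E * l ^ 3 / 6]"

definition pup :: "real \<Rightarrow> real \<Rightarrow> real list" where
  "pup E l = [E, E * l, E * l\<^sup>2 / 2, E * l ^ 3 / 6, E * l ^ 4 / 16]"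

lemma exp_ge_plow: "0 \<le> E \<Longrightarrow> E \<le> exp (tc * l) \<Longrightarrow> pe (plow E l) h \<le> exp ((tc + h) * l)"
proof -
  assume E: "0 \<le> E" "E \<le> exp (tc * l)"
  have "pe (plow E l) h = E * (1 + h * l + (h * l)\<^sup>2 / 2 + (h * l) ^ 3 / 6)"
    by (simp add: plow_def power2_eq_square power3_eq_cube algebra_simps)
  also have "\<dots> \<le> E * exp (h * l)"
    using E exp_taylor_lower3[of "h * l"] by (intro mult_left_mono) auto
  also have "\<dots> \<le> exp (tc * l) * exp (h * l)" using E by (intro mult_right_mono) auto
  finally show ?thesis by (simp add: exp_add[symmetric] algebra_simps)
qed

lemma exp_le_pup: "exp (tc * l) \<le> E \<Longrightarrow> \<bar>h * l\<bar> \<le> 2/5 \<Longrightarrow> exp ((tc + h) * l) \<le> pe (pup E l) h"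
proof -
  assume E: "exp (tc * l) \<le> E" and h: "\<bar>h * l\<bar> \<le> 2/5"
  have "exp ((tc + h) * l) = exp (tc * l) * exp (h * l)" by (simp add: exp_add[symmetric] algebra_simps)
  also have "\<dots> \<le> E * exp (h * l)" using E by (intro mult_right_mono) auto
  also have "\<dots> \<le> E * (1 + h * l + (h * l)\<^sup>2 / 2 + (h * l) ^ 3 / 6 + (h * l) ^ 4 / 16)"
    using h E by (intro mult_left_mono exp_quartic_upper) (auto intro: order_trans[OF exp_ge_zero])
  also have "\<dots> = pe (pup E l) h"
    by (simp add: pup_def power2_eq_square power3_eq_cube power4_eq_xxxx algebra_simps)
  finally show ?thesis .
qed

text \<open>On an interval of squared half-width \<open>t\<close>, with unit noise,
  \<open>t / (1 + t)\<close> is the minimax risk of linear estimators; some prior is to force 4/5 of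
  it on all estimators.\<close>

abbreviation good :: "real \<Rightarrow> bool" where
  "good t \<equiv> bayes_lb t (4/5 * t / (1 + t))"

text \<open>\<open>t = tc + h\<close>; all exponentials are replaced by Taylor polynomials in \<open>h\<close> around \<open>tc\<close>, and the
  resulting polynomial is compared with the absolute values of its coefficients.\<close>

definition cellpoly :: "real \<Rightarrow> real \<Rightarrow> real \<Rightarrow> real \<Rightarrow> real \<Rightarrow> real \<Rightarrow> real \<Rightarrow>
    real list \<Rightarrow> real list \<Rightarrow> real list \<Rightarrow> real list \<Rightarrow> real list \<Rightarrow> real list \<Rightarrow> real list \<Rightarrow> real list" where
  "cellpoly tc a b \<beta> s1 s2 m P1 P2 P3 P4 P5 P6 P7 =
    (let I = padd [1] (padd (psc a P2) (psc (2 * b) (padd (psc (\<beta> * s1) (padd P3 [-1]))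
           (psc (- (\<beta>\<^sup>2 * s2 / 4)) (padd (psc (1/2) P4) (padd (psc (2 * a) P6) (padd (psc (2 * m - 1) P5)
             (padd (psc (- 2 * a) P7) [1/2 - 2 * m]))))))))
     in padd (psc (1 + tc) I) (padd (0 # I) (psc (- (4/5)) (padd P1 (padd (psc (4 * a) P2) [1 + 2 * a\<^sup>2 + 2 * b])))))"

text \<open>Each exponential is bounded from the side on which it enters the inequality, and
  \<open>s1\<close>, \<open>s2\<close> are rational substitutes for
  \<open>1 / sqrt (1 + 2 * \<theta>)\<close> from below and
  \<open>1 / sqrt (1 + 4 * \<theta>)\<close> from above. The exponential \<open>exp (t / 8)\<close>
  occurs on both sides; its net coefficient is \<open>(1 + t - 16/5) * a\<close>, which explains the
  alternative \<open>a = 0\<close> or \<open>t\<close> at least 11/5.\<close>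

lemma cell:
  fixes tc H a b \<beta> \<theta> s1 s2 E1 E2 E3 E4 E5 E6 E7 t :: real
  assumes ab: "0 \<le> a" "0 \<le> b" "0 \<le> \<theta>" "0 \<le> \<beta>" and tc: "1 + H \<le> tc" "a = 0 \<or> 11/5 + H \<le> tc"
    and H: "\<bar>t - tc\<bar> \<le> H" "H \<le> 2/5"
    and r3: "r3 = 1 / (2 * (1 + 2 * \<theta>))" and r5: "r5 = 1 / (2 * (1 + 4 * \<theta>))"
    and s1: "0 < s1" "s1\<^sup>2 * (1 + 2 * \<theta>) \<le> 1" and s2: "0 < s2" "1 \<le> s2\<^sup>2 * (1 + 4 * \<theta>)"
    and E1: "exp (tc * (1/2)) \<le> E1" and E2: "0 \<le> E2" "E2 \<le> exp (tc * (1/8))"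
    and E3: "0 \<le> E3" "E3 \<le> exp (tc * r3)" and E4: "exp (tc * (4 * r5)) \<le> E4"
    and E5: "exp (tc * r5) \<le> E5" and E6: "exp (tc * (9/4 * r5)) \<le> E6"
    and E7: "0 \<le> E7" "E7 \<le> exp (tc * (1/4 * r5))"
    and r5H: "H * (4 * r5) \<le> 2/5" 
    and m: "m = a\<^sup>2 + b + 1/2"
    and pos: "\<exists>c cs. cellpoly tc a b \<beta> s1 s2 m (pup E1 (1/2)) (plow E2 (1/8)) (plow E3 r3) (pup E4 (4 * r5)) (pup E5 r5)
      (pup E6 (9/4 * r5)) (plow E7 (1/4 * r5)) = c # cs \<and> H * pabs cs H \<le> c"
  shows "good t"
proof -
  define h where "h = t - tc"
  have t: "t = tc + h" by (simp add: h_def)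
  have h: "\<bar>h\<bar> \<le> H" using H by (simp add: h_def)
  have t2: "t \<ge> 1" using h tc unfolding t by linarith
  have t3: "a = 0 \<or> t \<ge> 11/5" using h tc unfolding t by linarith
  have r5': "0 < r5" using ab r5 by simp
  have sm: "\<bar>h * l\<bar> \<le> 2/5" if "0 \<le> l" "l \<le> 4 * r5" for l
  proof -
    have "\<bar>h * l\<bar> \<le> H * (4 * r5)" unfolding abs_mult using that h by (intro mult_mono) auto
    with r5H show ?thesis by simp
  qed
  have sm1: "\<bar>h * (1/2)\<bar> \<le> 2/5" using h H by simp
  define p where "p = 1 + 2 * \<theta>"
  define q where "q = 1 + 4 * \<theta>"
  have pq: "p > 0" "q > 0" using ab by (auto simp: p_def q_def)
  have s1': "s1 \<le> 1 / sqrt p"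
  proof -
    have "(s1 * sqrt p)\<^sup>2 \<le> 1\<^sup>2" using s1 pq by (simp add: power_mult_distrib p_def)
    then have "s1 * sqrt p \<le> 1" by (rule power2_le_imp_le) simp
    then show ?thesis using pq by (simp add: field_simps)
  qed
  have s2': "1 / sqrt q \<le> s2"
  proof -
    have "1\<^sup>2 \<le> (s2 * sqrt q)\<^sup>2" using s2 pq by (simp add: power_mult_distrib q_def)
    then have "1 \<le> s2 * sqrt q" by (rule power2_le_imp_le) (use s2 pq in simp)
    then show ?thesis using pq by (simp add: field_simps)
  qed
  define P1 where "P1 = pe (pup E1 (1/2)) h"
  define P2 where "P2 = pe (plow E2 (1/8)) h"
  define P3 where "P3 = pe (plow E3 r3) h"
  define P4 where "P4 = pe (pup E4 (4 * r5)) h"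
  define P5 where "P5 = pe (pup E5 r5) h"
  define P6 where "P6 = pe (pup E6 (9/4 * r5)) h"
  define P7 where "P7 = pe (plow E7 (1/4 * r5)) h"
  have b1: "exp (t / 2) \<le> P1" using exp_le_pup[OF E1 sm1] by (simp add: t P1_def)
  have b2: "P2 \<le> exp (t / 8)" using exp_ge_plow[OF E2] by (simp add: t P2_def)
  have b3: "P3 \<le> exp (t / (2 * p))" using exp_ge_plow[OF E3] by (simp add: t P3_def r3 p_def)
  have b4: "exp (4 * t / (2 * q)) \<le> P4"
    using exp_le_pup[OF E4 sm] r5' by (simp add: t P4_def r5 q_def mult_ac)
  have b5: "exp (t / (2 * q)) \<le> P5" using exp_le_pup[OF E5 sm[of r5]] r5' by (simp add: t P5_def r5[symmetric] q_def[symmetric]) (simp add: r5 q_def)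
  have b6: "exp ((3/2)\<^sup>2 * t / (2 * q)) \<le> P6"
  proof -
    have "exp ((tc + h) * (9/4 * r5)) \<le> P6" unfolding P6_def by (rule exp_le_pup[OF E6 sm]) (use r5' in auto)
    moreover have "(tc + h) * (9/4 * r5) = (3/2)\<^sup>2 * t / (2 * q)" by (simp add: t r5 q_def power2_eq_square)
    ultimately show ?thesis by (simp only:)
  qed
  have b7: "P7 \<le> exp ((1/2)\<^sup>2 * t / (2 * q))" using exp_ge_plow[OF E7] by (simp add: t P7_def r5 q_def power2_eq_square)
  define m' where "m' = a\<^sup>2 + b + 1/2"
  define A where "A = (exp (t / (2 * p)) - 1) / (2 * sqrt p)"
  define Q0 where "Q0 = exp (4 * t / (2 * q)) / 2 + 2 * a * exp ((3/2)\<^sup>2 * t / (2 * q)) + (2 * m - 1) * exp (t / (2 * q))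
        - 2 * a * exp ((1/2)\<^sup>2 * t / (2 * q)) + 1/2 - 2 * m"
  have Q0le: "Q0 \<le> 1/2 * P4 + (2 * a * P6 + ((2 * m - 1) * P5 + ((- 2 * a) * P7 + (1/2 - 2 * m))))"
  proof -
    have "2 * a * exp ((3/2)\<^sup>2 * t / (2 * q)) \<le> 2 * a * P6" using b6 ab by (intro mult_left_mono) auto
    moreover have "(2 * m - 1) * exp (t / (2 * q)) \<le> (2 * m - 1) * P5" using b5 ab m by (intro mult_left_mono) auto
    moreover have "2 * a * P7 \<le> 2 * a * exp ((1/2)\<^sup>2 * t / (2 * q))" using b7 ab by (intro mult_left_mono) auto
    ultimately show ?thesis using b4 unfolding Q0_def by simp
  qed
  \<comment> \<open>Replacing \<open>1 / sqrt q\<close> by the larger \<open>s2\<close> is sound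
    only because the factor \<open>Q0\<close> is nonnegative.\<close>
  have Q0pos: "0 \<le> Q0"
  proof -
    have e1: "1 \<le> exp (4 * t / (2 * q))" "1 \<le> exp (t / (2 * q))" using t2 pq by auto
    have "exp ((1/2)\<^sup>2 * t / (2 * q)) \<le> exp ((3/2)\<^sup>2 * t / (2 * q))"
      using t2 pq by (simp add: power2_eq_square divide_right_mono)
    then have "2 * a * exp ((1/2)\<^sup>2 * t / (2 * q)) \<le> 2 * a * exp ((3/2)\<^sup>2 * t / (2 * q))"
      using ab by (intro mult_left_mono) auto
    moreover have "(2 * m - 1) * 1 \<le> (2 * m - 1) * exp (t / (2 * q))" using e1 ab m by (intro mult_left_mono) auto
    moreover have "0 \<le> x / 2 + v + w - u + 1/2 - 2 * m"
      if "u \<le> v" "(2 * m - 1) * 1 \<le> w" "1 \<le> x" for x u v w :: real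
      using that by simp
    ultimately show ?thesis using e1(1) unfolding Q0_def by blast
  qed
  have Ale: "s1 / 2 * (P3 - 1) \<le> A"
  proof -
    have "0 \<le> exp (t / (2 * p)) - 1" using t2 pq by simp
    then have "s1 * (exp (t / (2 * p)) - 1) \<le> 1 / sqrt p * (exp (t / (2 * p)) - 1)"
      using s1' by (intro mult_right_mono)
    moreover have "s1 * (P3 - 1) \<le> s1 * (exp (t / (2 * p)) - 1)" using b3 s1 by simp
    moreover have "A = 1/2 * (1 / sqrt p * (exp (t / (2 * p)) - 1))" by (simp add: A_def)
    ultimately show ?thesis by linarith
  qed
  have Qle: "Q0 / (4 * sqrt q) \<le> s2 / 4 * Q0"
    using mult_right_mono[OF s2' Q0pos] by simp
  define R where "R = \<beta> * s1 * (P3 + (-1)) + (- (\<beta>\<^sup>2 * s2 / 4)) * (1/2 * P4 + (2 * a * P6 + ((2 * m - 1) * P5 + ((- 2 * a) * P7 + (1/2 - 2 * m)))))"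
  have R: "R \<le> 2 * \<beta> * A - \<beta>\<^sup>2 * (Q0 / (4 * sqrt q))"
  proof -
    have "2 * \<beta> * (s1 / 2 * (P3 - 1)) \<le> 2 * \<beta> * A" using Ale ab by (intro mult_left_mono) auto
    moreover have "\<beta>\<^sup>2 * (Q0 / (4 * sqrt q)) \<le> \<beta>\<^sup>2 * (s2 / 4 * Q0)" using Qle by (intro mult_left_mono) auto
    moreover have "\<beta>\<^sup>2 * s2 / 4 * Q0 \<le> \<beta>\<^sup>2 * s2 / 4 * (1/2 * P4 + (2 * a * P6 + ((2 * m - 1) * P5 + ((- 2 * a) * P7 + (1/2 - 2 * m)))))"
      using Q0le s2 by (intro mult_left_mono) auto
    ultimately show ?thesis unfolding R_def by (simp add: algebra_simps)
  qed
  define Z where "Z = exp (t / 2) + 4 * a * exp (t / 8) + 1 + 2 * a\<^sup>2 + 2 * b"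
  have Z: "Z > 0" unfolding Z_def using ab by (intro add_pos_nonneg) auto
  have main: "4/5 * Z \<le> (1 + t) * (1 + a * exp (t / 8) + 2 * b * (2 * \<beta> * A - \<beta>\<^sup>2 * (Q0 / (4 * sqrt q))))"
  proof -
    obtain c cs where cp: "cellpoly tc a b \<beta> s1 s2 m (pup E1 (1/2)) (plow E2 (1/8)) (plow E3 r3) (pup E4 (4 * r5)) (pup E5 r5)
      (pup E6 (9/4 * r5)) (plow E7 (1/4 * r5)) = c # cs" and c: "H * pabs cs H \<le> c" using pos by blast
    have "\<bar>h * pe cs h\<bar> \<le> H * pabs cs H" unfolding abs_mult using pe_abs[OF h] h by (intro mult_mono) auto
    then have "0 \<le> pe (c # cs) h" using c by (simp add: abs_le_iff)
    also have "pe (c # cs) h = (1 + t) * (1 + (a * P2 + 2 * b * R)) - 4/5 * (P1 + (4 * a * P2 + (1 + 2 * a\<^sup>2 + 2 * b)))"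
    proof -
      define I where "I = padd [1] (padd (psc a (plow E2 (1/8))) (psc (2 * b) (padd (psc (\<beta> * s1) (padd (plow E3 r3) [-1]))
           (psc (- (\<beta>\<^sup>2 * s2 / 4)) (padd (psc (1/2) (pup E4 (4 * r5))) (padd (psc (2 * a) (pup E6 (9/4 * r5)))
             (padd (psc (2 * m - 1) (pup E5 r5)) (padd (psc (- 2 * a) (plow E7 (1/4 * r5))) [1/2 - 2 * m]))))))))"
      define X where "X = 1 + (a * P2 + 2 * b * R)"
      define Y where "Y = P1 + (4 * a * P2 + (1 + 2 * a\<^sup>2 + 2 * b))"
      have I: "pe I h = X"
        unfolding I_def X_def R_def P1_def P2_def P3_def P4_def P5_def P6_def P7_def
        by (simp only: pe_padd pe_psc pe.simps mult_zero_right add_0_right)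
      have "pe (c # cs) h = (1 + tc) * pe I h + (0 + h * pe I h) + (- (4/5)) * Y"
        unfolding cp[symmetric] cellpoly_def Let_def I_def[symmetric] Y_def P1_def P2_def
        by (simp only: pe_padd pe_psc pe.simps mult_zero_right add_0_right add.assoc)
      also have "\<dots> = (1 + t) * X - 4/5 * Y" unfolding I t by (simp add: algebra_simps)
      finally show ?thesis unfolding X_def Y_def .
    qed
    finally have 1: "4/5 * (P1 + (4 * a * P2 + (1 + 2 * a\<^sup>2 + 2 * b))) \<le> (1 + t) * (1 + (a * P2 + 2 * b * R))" by simp
    define R' where "R' = 2 * \<beta> * A - \<beta>\<^sup>2 * (Q0 / (4 * sqrt q))"
    define x where "x = exp (t / 8)"
    define k where "k = 1 + 2 * a\<^sup>2 + 2 * b"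
    have 2: "(1 + t) * (2 * b * R) \<le> (1 + t) * (2 * b * R')"
      using R ab t2 unfolding R'_def by (intro mult_left_mono) auto
    have 3: "(1 + t - 16/5) * a * P2 \<le> (1 + t - 16/5) * a * x"
      using b2 ab t3 unfolding x_def by (cases "a = 0") (auto intro!: mult_left_mono)
    have "(1 + t) * (1 + a * x + v) - 4/5 * (e + 4 * a * x + k)
      = ((1 + t) * (1 + (a * P2 + u)) - 4/5 * (P1 + (4 * a * P2 + k))) + ((1 + t) * v - (1 + t) * u)
        + ((1 + t - 16/5) * a * x - (1 + t - 16/5) * a * P2) + 4/5 * (P1 - e)" for u v e
      by (simp add: algebra_simps diff_divide_distrib)
    note id = this
    have "4/5 * (exp (t / 2) + 4 * a * x + k) \<le> (1 + t) * (1 + a * x + 2 * b * R')"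
    proof -
      have "0 \<le> (1 + t) * (1 + (a * P2 + 2 * b * R)) - 4/5 * (P1 + (4 * a * P2 + k))"
        using 1 unfolding k_def by (simp only: diff_ge_0_iff_ge)
      moreover have "0 \<le> (1 + t) * (2 * b * R') - (1 + t) * (2 * b * R)" using 2 by (simp only: diff_ge_0_iff_ge)
      moreover have "0 \<le> (1 + t - 16/5) * a * x - (1 + t - 16/5) * a * P2" using 3 by (simp only: diff_ge_0_iff_ge)
      moreover have "0 \<le> 4/5 * (P1 - exp (t / 2))" using b1 by simp
      ultimately have "0 \<le> (1 + t) * (1 + a * x + 2 * b * R') - 4/5 * (exp (t / 2) + 4 * a * x + k)"
        unfolding id[of "2 * b * R'" "exp (t / 2)" "2 * b * R"] by (intro add_nonneg_nonneg)
      then show ?thesis by (simp only: diff_ge_0_iff_ge)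
    qed
    then show ?thesis unfolding Z_def R'_def x_def k_def by (simp only: add.assoc)
  qed
  define X where "X = 1 + a * exp (t / 8) + 2 * b * (2 * \<beta> * A - \<beta>\<^sup>2 * (Q0 / (4 * sqrt q)))"
  have t0: "t > 0" using t2 by simp
  have bl: "bayes_lb t (t * X / Z)"
    unfolding X_def Z_def A_def Q0_def
    by (rule five_point_bound[OF t0 ab(1-3), of \<beta>, folded p_def q_def m])
  have "4/5 * t / (1 + t) = t * (4/5 * Z) / ((1 + t) * Z)" using Z t2 by simp
  also have "\<dots> \<le> t * ((1 + t) * X) / ((1 + t) * Z)"
    using main Z t0 unfolding X_def[symmetric] by (intro divide_right_mono mult_left_mono) auto
  also have "\<dots> = t * X / Z" using t0 by simp
  finally show ?thesis by (rule bayes_lb_mono[OF bl t0 order_refl])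
qed

section \<open>Certified cells covering \<open>t\<close> from 54/25 to 41/5\<close>

lemma exp_ge_num_rounded: "0 \<le> r0 \<Longrightarrow> r0 \<le> exp8 (x / 8) \<Longrightarrow> r \<le> r0 ^ 8 \<Longrightarrow> r \<le> exp x"
  by (rule exp_ge_num) (auto intro: order_trans power_mono)

lemma exp_le_num_rounded: "0 < r0 \<Longrightarrow> r0 \<le> exp8 (- x / 8) \<Longrightarrow> 1 \<le> r * r0 ^ 8 \<Longrightarrow> exp x \<le> r"
proof (rule exp_le_num)
  assume a: "0 < r0" "r0 \<le> exp8 (- x / 8)" "1 \<le> r * r0 ^ 8"
  show "0 < exp8 (- x / 8)" using a by simp
  have "r > 0"
    using a by (metis less_le_trans zero_less_one zero_less_mult_pos2 zero_less_power)
  then have "r * r0 ^ 8 \<le> r * exp8 (- x / 8) ^ 8" using a by (intro mult_left_mono power_mono) auto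
  with a show "1 \<le> r * exp8 (- x / 8) ^ 8" by simp
qed

lemma case_list_nonempty: "(case L of c # cs \<Rightarrow> H * pabs cs H \<le> c | [] \<Rightarrow> False) \<Longrightarrow> \<exists>c cs. L = c # cs \<and> H * pabs cs H \<le> c"
  by (cases L) auto

text \<open>The case \<open>a = 0\<close>, in which the points at plus or minus 1/2 carry no mass,
  with \<open>\<theta> = 3/8\<close>. The constants 2/7 and 1/5 are the resulting exponent rates,
  and 7559/10000 and 63246/100000 round \<open>1 / sqrt (7/4)\<close> down and
  \<open>1 / sqrt (5/2)\<close> up.\<close>

lemma cell_small:
  fixes lo hi t tc H b \<beta> E1 E3 E4 E5 x1 x3 x4 x5 :: real
  assumes lo: "lo \<le> t" and hi: "t \<le> hi" and lh: "lo = tc - H" "hi = tc + H"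
    and b: "0 \<le> b" and \<beta>: "0 \<le> \<beta>" and tc: "1 + H \<le> tc" and H: "H \<le> 2/5" and E3: "0 \<le> E3"
    and e1: "0 < x1" "x1 \<le> exp8 (- (tc * (1/2)) / 8)" "1 \<le> E1 * x1 ^ 8"
    and e3: "0 \<le> x3" "x3 \<le> exp8 (tc * (2/7) / 8)" "E3 \<le> x3 ^ 8"
    and e4: "0 < x4" "x4 \<le> exp8 (- (tc * (4 * (1/5))) / 8)" "1 \<le> E4 * x4 ^ 8"
    and e5: "0 < x5" "x5 \<le> exp8 (- (tc * (1/5)) / 8)" "1 \<le> E5 * x5 ^ 8"
    and r: "H * (4 * (1/5)) \<le> 2/5"
    and pos: "case cellpoly tc 0 b \<beta> (7559/10000) (63246/100000) (b + 1/2) (pup E1 (1/2)) [] (plow E3 (2/7)) (pup E4 (4 * (1/5)))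
        (pup E5 (1/5)) [] [] of c # cs \<Rightarrow> H * pabs cs H \<le> c | [] \<Rightarrow> False"
  shows "good t"
proof -
  have cp: "cellpoly tc 0 b \<beta> (7559/10000) (63246/100000) (b + 1/2) (pup E1 (1/2)) [] (plow E3 (2/7)) (pup E4 (4 * (1/5)))
        (pup E5 (1/5)) [] [] = cellpoly tc 0 b \<beta> (7559/10000) (63246/100000) (b + 1/2) (pup E1 (1/2)) (plow 0 (1/8))
        (plow E3 (2/7)) (pup E4 (4 * (1/5))) (pup E5 (1/5)) (pup (exp (tc * (9/4 * (1/5)))) (9/4 * (1/5))) (plow 0 (1/4 * (1/5)))"
    by (simp add: cellpoly_def Let_def psc_def pup_def plow_def)
  have *: "\<bar>t - tc\<bar> \<le> H" using lo hi lh by (simp add: abs_le_iff)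
  have c: "(7559/10000)\<^sup>2 * (1 + 2 * (3/8)) \<le> (1::real)" "(1::real) \<le> (63246/100000)\<^sup>2 * (1 + 4 * (3/8))"
    "2/7 = 1 / (2 * (1 + 2 * (3/8::real)))" "1/5 = 1 / (2 * (1 + 4 * (3/8::real)))"
    "(0::real) \<le> 3/8" "(0::real) < 7559/10000" "(0::real) < 63246/100000" "(0::real) \<le> 0" "b + 1/2 = 0\<^sup>2 + b + 1/2"
    by (simp_all add: power_divide)
  show ?thesis
    by (rule cell[OF c(8) b c(5) \<beta> tc disjI1[OF refl] * H c(3,4,6,1,7,2) exp_le_num_rounded[OF e1] c(8) exp_ge_zero
          E3 exp_ge_num_rounded[OF e3] exp_le_num_rounded[OF e4] exp_le_num_rounded[OF e5] order_refl c(8) exp_ge_zero r c(9) case_list_nonempty[OF pos, unfolded cp]])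
qed

text \<open>The full five-point prior with \<open>\<theta> = 5/12\<close>, giving the rates 3/11 and
  3/16; 7385/10000 and 61238/100000 round \<open>1 / sqrt (11/6)\<close> down and
  \<open>1 / sqrt (8/3)\<close> up.\<close>

lemma cell_large:
  fixes lo hi t tc H a b \<beta> E1 E2 E3 E4 E5 E6 E7 x1 x2 x3 x4 x5 x6 x7 :: real
  assumes lo: "lo \<le> t" and hi: "t \<le> hi" and lh: "lo = tc - H" "hi = tc + H"
    and a: "0 \<le> a" and b: "0 \<le> b" and \<beta>: "0 \<le> \<beta>" and tc: "1 + H \<le> tc" "11/5 + H \<le> tc" and H: "H \<le> 2/5"
    and E: "0 \<le> E2" "0 \<le> E3" "0 \<le> E7"
    and e1: "0 < x1" "x1 \<le> exp8 (- (tc * (1/2)) / 8)" "1 \<le> E1 * x1 ^ 8"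
    and e2: "0 \<le> x2" "x2 \<le> exp8 (tc * (1/8) / 8)" "E2 \<le> x2 ^ 8"
    and e3: "0 \<le> x3" "x3 \<le> exp8 (tc * (3/11) / 8)" "E3 \<le> x3 ^ 8"
    and e4: "0 < x4" "x4 \<le> exp8 (- (tc * (4 * (3/16))) / 8)" "1 \<le> E4 * x4 ^ 8"
    and e5: "0 < x5" "x5 \<le> exp8 (- (tc * (3/16)) / 8)" "1 \<le> E5 * x5 ^ 8"
    and e6: "0 < x6" "x6 \<le> exp8 (- (tc * (9/4 * (3/16))) / 8)" "1 \<le> E6 * x6 ^ 8"
    and e7: "0 \<le> x7" "x7 \<le> exp8 (tc * (1/4 * (3/16)) / 8)" "E7 \<le> x7 ^ 8"
    and r: "H * (4 * (3/16)) \<le> 2/5"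
    and pos: "case cellpoly tc a b \<beta> (7385/10000) (61238/100000) (a\<^sup>2 + b + 1/2) (pup E1 (1/2)) (plow E2 (1/8)) (plow E3 (3/11))
        (pup E4 (4 * (3/16))) (pup E5 (3/16)) (pup E6 (9/4 * (3/16))) (plow E7 (1/4 * (3/16))) of c # cs \<Rightarrow> H * pabs cs H \<le> c | [] \<Rightarrow> False"
  shows "good t"
proof -
  have *: "\<bar>t - tc\<bar> \<le> H" using lo hi lh by (simp add: abs_le_iff)
  have c: "(7385/10000)\<^sup>2 * (1 + 2 * (5/12)) \<le> (1::real)" "(1::real) \<le> (61238/100000)\<^sup>2 * (1 + 4 * (5/12))"
    "3/11 = 1 / (2 * (1 + 2 * (5/12::real)))" "3/16 = 1 / (2 * (1 + 4 * (5/12::real)))"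
    "(0::real) \<le> 5/12" "(0::real) < 7385/10000" "(0::real) < 61238/100000"
    by (simp_all add: power_divide)
  show ?thesis
    by (rule cell[OF a b c(5) \<beta> tc(1) disjI2[OF tc(2)] * H c(3,4,6,1,7,2) exp_le_num_rounded[OF e1] E(1) exp_ge_num_rounded[OF e2]
          E(2) exp_ge_num_rounded[OF e3] exp_le_num_rounded[OF e4] exp_le_num_rounded[OF e5] exp_le_num_rounded[OF e6] E(3) exp_ge_num_rounded[OF e7] r refl case_list_nonempty[OF pos]])
qed

lemmas cell_simps = exp8_def power_divide cellpoly_def Let_def psc_def pup_def plow_def

text \<open>In every cell the explicit values begin with the midpoint and half-width of the interval
  and the parameters of prior and tangent (\<open>b\<close>, \<open>\<beta>\<close>, from the ninth
  cell on preceded by \<open>a\<close>). The others are rational bounds for the exponentials at the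
  midpoint and for the eighth roots, or reciprocal eighth roots, that certify them.\<close>

lemma cell_1: assumes "54/25 \<le> t" "t \<le> 233/100" shows "good t"
  by (rule cell_small[OF assms, of "449/200" "17/200" "111/500" "767/1000" "18991/10000" "4345433/5000000" "15363/5000" "2166961/2000000" "1597831/2000000" "3766/625" "9454209/10000000" "3917/2500"];
      simp add: cell_simps)

lemma cell_2: assumes "233/100 \<le> t" "t \<le> 5/2" shows "good t"
  by (rule cell_small[OF assms, of "483/200" "17/200" "167/500" "7/10" "19937/10000" "4299507/5000000" "8363/2500" "2725197/2500000" "981811/1250000" "34517/5000" "4707057/5000000" "1621/1000"];
      simp add: cell_simps)

lemma cell_3: assumes "5/2 \<le> t" "t \<le> 137/50" shows "good t"
  by (rule cell_small[OF assms, of "131/50" "3/25" "61/125" "627/1000" "21139/10000" "4244771/5000000" "18531/5000" "1098089/1000000" "769511/1000000" "10167/1250" "936599/1000000" "2111/1250"];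
      simp add: cell_simps)

lemma cell_4: assumes "137/50 \<le> t" "t \<le> 301/100" shows "good t"
  by (rule cell_small[OF assms, of "23/8" "27/200" "713/1000" "273/500" "22737/10000" "522207/625000" "21051/5000" "11081351/10000000" "1500273/2000000" "49871/5000" "1163309/1250000" "4443/2500"];
      simp add: cell_simps)

lemma cell_5: assumes "301/100 \<le> t" "t \<le> 333/100" shows "good t"
  by (rule cell_small[OF assms, of "317/100" "4/25" "128/125" "58/125" "1546/625" "8202673/10000000" "48793/10000" "5599359/5000000" "7283307/10000000" "126291/10000" "9238089/10000000" "4713/2500"];
      simp add: cell_simps)

lemma cell_6: assumes "333/100 \<le> t" "t \<le> 369/100" shows "good t"
  by (rule cell_small[OF assms, of "351/100" "9/50" "1463/1000" "48/125" "1363/500" "1606041/2000000" "11567/2000" "2833883/2500000" "7039837/10000000" "20721/1250" "4579949/5000000" "10089/5000"];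
      simp add: cell_simps)

lemma cell_7: assumes "369/100 \<le> t" "t \<le> 81/20" shows "good t"
  by (rule cell_small[OF assms, of "387/100" "9/50" "1023/500" "157/500" "30213/10000" "7851543/10000000" "69241/10000" "2296443/2000000" "679091/1000000" "110547/5000" "9077829/10000000" "4337/2000"];
      simp add: cell_simps)

lemma cell_8: assumes "81/20 \<le> t" "t \<le> 219/50" shows "good t"
  by (rule cell_small[OF assms, of "843/200" "33/200" "2737/1000" "259/1000" "33343/10000" "960507/1250000" "82277/10000" "1453071/1250000" "6560619/10000000" "36421/1250" "8999869/10000000" "11617/5000"];
      simp add: cell_simps)

lemma cell_9: assumes "219/50 \<le> t" "t \<le> 119/25" shows "good t"
  by (rule cell_large[OF assms, of "457/100" "19/100" "41/125" "2761/1000" "113/500" "2213/1250" "4347/1250" "3097/2500" "7515443/10000000" "98257/10000" "5370087/5000000" "11685871/10000000" "3257631/5000000" "76999/2500" "4492137/5000000" "11779/5000" "3929223/5000000" "17189/2500" "1027139/1000000"];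
      simp add: cell_simps)

lemma cell_10: assumes "119/25 \<le> t" "t \<le> 131/25" shows "good t"
  by (rule cell_large[OF assms, of "5" "6/25" "78/125" "327/100" "173/1000" "9341/5000" "39103/10000" "12641/10000" "1829039/2500000" "4873/400" "5406289/5000000" "11858437/10000000" "6257839/10000000" "106303/2500" "1111773/1250000" "1596/625" "1536451/2000000" "82431/10000" "5148651/5000000"];
      simp add: cell_simps)

lemma cell_11: assumes "131/25 \<le> t" "t \<le> 293/50" shows "good t"
  by (rule cell_large[OF assms, of "111/20" "31/100" "303/250" "3303/1000" "121/1000" "5003/2500" "5679/1250" "12971/10000" "883617/1250000" "160387/10000" "10905899/10000000" "37759/31250" "2971673/5000000" "642321/10000" "2195067/2500000" "2831/1000" "93283/125000" "103959/10000" "516527/500000"];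
      simp add: cell_simps)

lemma cell_12: assumes "293/50 \<le> t" "t \<le> 33/5" shows "good t"
  by (rule cell_large[OF assms, of "623/100" "37/100" "499/250" "739/250" "83/1000" "21787/10000" "54689/10000" "13391/10000" "6774801/10000000" "45067/2000" "1377799/1250000" "2473251/2000000" "139407/250000" "213931/2000" "4320721/5000000" "402/125" "224993/312500" "277/20" "10371783/10000000"];
      simp add: cell_simps)

lemma cell_13: assumes "33/5 \<le> t" "t \<le> 37/5" shows "good t"
  by (rule cell_large[OF assms, of "7" "2/5" "2847/1000" "3093/1000" "7/125" "5997/2500" "67469/10000" "13883/10000" "1614121/2500000" "82789/2500" "5577903/5000000" "99181/78125" "5187923/10000000" "1905689/10000" "8486889/10000000" "7431/2000" "6913281/10000000" "95829/5000" "10418683/10000000"];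
      simp add: cell_simps)

lemma cell_14: assumes "37/5 \<le> t" "t \<le> 41/5" shows "good t"
  by (rule cell_large[OF assms, of "39/5" "2/5" "3847/1000" "477/125" "19/500" "26511/10000" "83919/10000" "7207/5000" "3070799/5000000" "19761/400" "88251/78125" "3261541/2500000" "4813051/10000000" "3472453/10000" "8329243/10000000" "2698/625" "3313847/5000000" "268597/10000" "2616909/2500000"];
      simp add: cell_simps)

text \<open>One numerical bound at \<open>t0\<close> serves a whole interval: the bound persists for
  larger \<open>t\<close>, while the target increases and is largest at \<open>t1\<close>.\<close>

lemma good_step:
  assumes "bayes_lb t0 v" "0 < t0" "t0 \<le> t" "t \<le> t1" "4/5 * t1 / (1 + t1) \<le> v"
  shows "good t"
proof (rule bayes_lb_mono[OF assms(1-3)])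
  have "t / (1 + t) \<le> t1 / (1 + t1)" using assms by (simp add: field_simps)
  then have "4/5 * (t / (1 + t)) \<le> 4/5 * (t1 / (1 + t1))" by (rule mult_left_mono) simp
  then show "4/5 * t / (1 + t) \<le> v" using assms(5) by (simp only: times_divide_eq_right)
qed

lemma good_small:
  assumes "0 < t" "t \<le> 7/5"
  shows "good t"
proof -
  \<comment> \<open>Convexity puts the exponential below its chord on \<open>{0..14/15}\<close>,
    with 51/20 bounding the right endpoint value. The constant 1.0825 below is 5/4 times 0.866, a
    lower bound of \<open>sqrt 3 / 2\<close>.\<close>
  have "exp (2 * t / 3) \<le> 1 + (31/20 / (14/15)) * (2 * t / 3)"
  proof -
    define l where "l = t / (7/5)"
    have l: "0 \<le> l" "l \<le> 1" using assms by (auto simp: l_def)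
    have "exp ((1 - l) *\<^sub>R 0 + l *\<^sub>R (14/15)) \<le> (1 - l) * exp 0 + l * exp (14/15::real)"
      by (rule convex_onD[OF exp_convex]) (use l in auto)
    moreover have "exp (14/15) \<le> (1 + 31/20::real)"
      by (rule exp_le_num) (simp_all add: exp8_def power_divide)
    then have "l * exp (14/15) \<le> l * (1 + 31/20)" using l by (intro mult_left_mono)
    moreover have "l * (14/15) = 2 * t / 3" by (simp add: l_def)
    ultimately show ?thesis by (simp add: l_def field_simps)
  qed
  also have "\<dots> \<le> 1.0825 * (1 + t)" using assms by (simp add: field_simps)
  finally have e: "exp (2 * t / 3) \<le> 1.0825 * (1 + t)" .
  have s3: "1.732 \<le> sqrt 3" by (rule real_le_rsqrt) (simp add: power_divide)
  have "4/5 * exp (2 * t / 3) \<le> sqrt 3 / 2 * (1 + t)"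
  proof -
    have "4/5 * exp (2 * t / 3) \<le> 0.866 * (1 + t)" using e by simp
    also have "\<dots> \<le> sqrt 3 / 2 * (1 + t)" using s3 assms by (intro mult_right_mono) auto
    finally show ?thesis .
  qed
  then have "4/5 / (1 + t) \<le> sqrt 3 / 2 * exp (- (2 * t / 3))"
    using assms by (simp add: exp_minus field_simps)
  from mult_left_mono[OF this, of t] have "4/5 * t / (1 + t) \<le> t * (sqrt 3 / 2) * exp (- (2 * t / 3))"
    using assms by (simp add: mult_ac)
  then show ?thesis by (intro bayes_lb_mono[OF two_point_bound[of t]]) (use assms in auto)
qed

text \<open>Bridges the gap between the chord estimate, which stops at 7/5, and the closed form,
  which starts at 147/100, by freezing the two-point prior at 7/5.\<close>

lemma good_two_point:
  assumes "7/5 \<le> t" "t \<le> 147/100"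
  shows "good t"
proof (rule good_step[OF two_point_bound, of "7/5" t "147/100"])
  have "0.393 \<le> exp (- (14/15)::real)"
    by (rule exp_ge_num) (simp_all add: exp8_def power_divide)
  moreover have "1.732 \<le> sqrt 3" by (rule real_le_rsqrt) (simp add: power_divide)
  ultimately have "1.732 * 0.393 \<le> sqrt 3 * exp (- (14/15)::real)" by (intro mult_mono) auto
  then show "4/5 * (147/100) / (1 + 147/100) \<le> 7/5 * (sqrt 3 / 2) * exp (- (2 * (7/5) / 3))" by simp
qed (use assms in auto)

lemma exp_chord:
  fixes a b x A B :: real
  assumes ab: "a < b" and x: "a \<le> x" "x \<le> b" and A: "exp a \<le> A" and B: "exp b \<le> B"
  shows "exp x * (b - a) \<le> A * (b - x) + B * (x - a)"
proof -
  define l where "l = (x - a) / (b - a)"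
  have l: "0 \<le> l" "l \<le> 1" using ab x by (auto simp: l_def)
  have lb: "l * (b - a) = x - a" using ab by (simp add: l_def)
  then have l1: "(1 - l) * (b - a) = b - x" by (simp add: left_diff_distrib)
  have xl: "(1 - l) *\<^sub>R a + l *\<^sub>R b = x" using lb by (simp add: algebra_simps)
  have "exp x \<le> (1 - l) * exp a + l * exp b"
    using convex_onD[OF exp_convex, of l a b] l unfolding xl by simp
  also have "\<dots> \<le> (1 - l) * A + l * B" using A B l by (intro add_mono mult_left_mono) auto
  finally have "exp x * (b - a) \<le> ((1 - l) * A + l * B) * (b - a)" using ab by (intro mult_right_mono) auto
  also have "\<dots> = A * ((1 - l) * (b - a)) + B * (l * (b - a))" by (simp add: algebra_simps)
  finally show ?thesis unfolding lb l1 .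
qed

text \<open>For \<open>a = b = 0\<close> the tangent term disappears and the bound is
  \<open>t / (exp (t / 2) + 1)\<close>. What remains is
  \<open>4 * exp (t / 2) \<le> 1 + 5 * t\<close>; by convexity the endpoints suffice, and the bounds
  20875/10000 and 29625/10000 are the values of the right-hand side over 4 there.\<close>

lemma good_closed_form:
  assumes "147/100 \<le> t" "t \<le> 217/100"
  shows "good t"
proof -
  have A: "exp (147/200) \<le> (20875/10000::real)" by (rule exp_le_num) (simp_all add: exp8_def power_divide)
  have B: "exp (217/200) \<le> (29625/10000::real)" by (rule exp_le_num) (simp_all add: exp8_def power_divide)
  have "exp (t / 2) * (217/200 - 147/200) \<le> 20875/10000 * (217/200 - t / 2) + 29625/10000 * (t / 2 - 147/200)"
    using assms by (intro exp_chord A B) auto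
  then have e: "4 * exp (t / 2) \<le> 1 + 5 * t" by (simp add: field_simps)
  have t: "0 < t" using assms by linarith
  have "bayes_lb t (t / (exp (t / 2) + 1))"
    using five_point_bound[OF t order_refl order_refl order_refl, of 0] by simp
  moreover have "4/5 * t / (1 + t) \<le> t / (exp (t / 2) + 1)"
  proof -
    have "exp (t / 2) + 1 > 0" by (rule add_pos_pos) auto
    moreover have "exp (t / 2) + 1 \<le> (1 + t) * (5/4)" using e by (simp add: field_simps)
    ultimately have "inverse ((1 + t) * (5/4)) \<le> inverse (exp (t / 2) + 1)" by (intro le_imp_inverse_le)
    then have "t * inverse ((1 + t) * (5/4)) \<le> t * inverse (exp (t / 2) + 1)" using t by (intro mult_left_mono) auto
    moreover have "t * inverse (s * (5/4)) = 4/5 * t / s" if "s > 0" for s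
      using that by (simp add: field_simps)
    then have "t * inverse ((1 + t) * (5/4)) = 4/5 * t / (1 + t)" using t by (metis add_pos_pos zero_less_one)
    ultimately show ?thesis by (simp only: divide_inverse)
  qed
  ultimately show ?thesis by (rule bayes_lb_mono[OF _ t order_refl])
qed

text \<open>The profile \<open>1, c, 1\<close> on three grid points of spacing
  \<open>sqrt d\<close>; the second hypothesis on \<open>v\<close> is the required inequality after
  clearing the denominator and enclosing \<open>exp (- d / 2)\<close> and
  \<open>exp (- 2 * d)\<close>. The four-point version uses \<open>1, c, c, 1\<close>.\<close>

lemma square_prior_three:
  fixes c d y1 y1' y2 y2' v :: real
  assumes "c > 0" "d > 0" and y: "y1 \<le> exp (- (d / 2))" "exp (- (d / 2)) \<le> y1'" "y2 \<le> exp (- (2 * d))" "exp (- (2 * d)) \<le> y2'"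
    and v: "0 \<le> v" "v * (2 + c\<^sup>2 + 4 * c * y1' + 2 * y2') \<le> d * (4 * c * y1 + 8 * y2)"
  shows "bayes_lb (4 * d) v"
proof -
  define f where "f k = (if k = 1 then c else 1)" for k :: nat
  define e1 where "e1 = exp (- (d / 2))"
  define e2 where "e2 = exp (- (2 * d))"
  have K: "{..<3} = {0, 1, 2::nat}" by auto
  have "bayes_lb ((real 3 - 1)\<^sup>2 * d) (d * (\<Sum>(k, l)\<in>{..<3}\<times>{..<3}. (real k - real l)\<^sup>2 * (case (k, l) of (k, l) \<Rightarrow> f k * f l * exp (- (d / 2 * (real k - real l)\<^sup>2))))
      / (\<Sum>x\<in>{..<3}\<times>{..<3}. case x of (k, l) \<Rightarrow> f k * f l * exp (- (d / 2 * (real k - real l)\<^sup>2))))"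
    by (rule square_prior_bound) (use assms in \<open>auto simp: f_def\<close>)
  also have "(\<Sum>(k, l)\<in>{..<3}\<times>{..<3}. (real k - real l)\<^sup>2 * (case (k, l) of (k, l) \<Rightarrow> f k * f l * exp (- (d / 2 * (real k - real l)\<^sup>2))))
     = 4 * c * e1 + 8 * e2"
    unfolding sum.cartesian_product[symmetric] prod.case K by (simp add: f_def e1_def e2_def)
  also have "(\<Sum>x\<in>{..<3}\<times>{..<3}. case x of (k, l) \<Rightarrow> f k * f l * exp (- (d / 2 * (real k - real l)\<^sup>2)))
     = 2 + c\<^sup>2 + 4 * c * e1 + 2 * e2"
    unfolding sum.cartesian_product[symmetric] K by (simp add: f_def e1_def e2_def power2_eq_square)
  finally have b: "bayes_lb (4 * d) (d * (4 * c * e1 + 8 * e2) / (2 + c\<^sup>2 + 4 * c * e1 + 2 * e2))" by simp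
  have pos: "2 + c\<^sup>2 + 4 * c * e1 + 2 * e2 > 0" using assms by (simp add: e1_def e2_def add_pos_pos)
  have "v * (2 + c\<^sup>2 + 4 * c * e1 + 2 * e2) \<le> v * (2 + c\<^sup>2 + 4 * c * y1' + 2 * y2')"
    using assms by (intro mult_left_mono add_mono) (auto simp: e1_def e2_def)
  also have "\<dots> \<le> d * (4 * c * y1 + 8 * y2)" by (rule v)
  also have "\<dots> \<le> d * (4 * c * e1 + 8 * e2)"
    using assms by (intro mult_left_mono add_mono) (auto simp: e1_def e2_def)
  finally have "v \<le> d * (4 * c * e1 + 8 * e2) / (2 + c\<^sup>2 + 4 * c * e1 + 2 * e2)" using pos by (simp add: field_simps)
  then show ?thesis using assms by (intro bayes_lb_mono[OF b]) auto
qed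

lemma square_prior_four:
  fixes c d y1 y1' y2 y2' y3 y3' v :: real
  assumes "c > 0" "d > 0" and y: "y1 \<le> exp (- (d / 2))" "exp (- (d / 2)) \<le> y1'" "y2 \<le> exp (- (2 * d))" "exp (- (2 * d)) \<le> y2'"
    "y3 \<le> exp (- (9 * d / 2))" "exp (- (9 * d / 2)) \<le> y3'"
    and v: "0 \<le> v" "v * (2 + 2 * c\<^sup>2 + (4 * c + 2 * c\<^sup>2) * y1' + 4 * c * y2' + 2 * y3')
      \<le> d * ((4 * c + 2 * c\<^sup>2) * y1 + 16 * c * y2 + 18 * y3)"
  shows "bayes_lb (9 * d) v"
proof -
  define f where "f k = (if k = 1 \<or> k = 2 then c else 1)" for k :: nat
  define e1 where "e1 = exp (- (d / 2))"
  define e2 where "e2 = exp (- (2 * d))"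
  define e3 where "e3 = exp (- (9 * d / 2))"
  have K: "{..<4} = {0, 1, 2, 3::nat}" by auto
  have "bayes_lb ((real 4 - 1)\<^sup>2 * d) (d * (\<Sum>(k, l)\<in>{..<4}\<times>{..<4}. (real k - real l)\<^sup>2 * (case (k, l) of (k, l) \<Rightarrow> f k * f l * exp (- (d / 2 * (real k - real l)\<^sup>2))))
      / (\<Sum>x\<in>{..<4}\<times>{..<4}. case x of (k, l) \<Rightarrow> f k * f l * exp (- (d / 2 * (real k - real l)\<^sup>2))))"
    by (rule square_prior_bound) (use assms in \<open>auto simp: f_def\<close>)
  also have "(\<Sum>(k, l)\<in>{..<4}\<times>{..<4}. (real k - real l)\<^sup>2 * (case (k, l) of (k, l) \<Rightarrow> f k * f l * exp (- (d / 2 * (real k - real l)\<^sup>2))))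
     = (4 * c + 2 * c\<^sup>2) * e1 + 16 * c * e2 + 18 * e3"
    unfolding sum.cartesian_product[symmetric] prod.case K
    by (simp add: f_def e1_def e2_def e3_def power2_eq_square[of c] algebra_simps)
  also have "(\<Sum>x\<in>{..<4}\<times>{..<4}. case x of (k, l) \<Rightarrow> f k * f l * exp (- (d / 2 * (real k - real l)\<^sup>2)))
     = 2 + 2 * c\<^sup>2 + (4 * c + 2 * c\<^sup>2) * e1 + 4 * c * e2 + 2 * e3"
    unfolding sum.cartesian_product[symmetric] K
    by (simp add: f_def e1_def e2_def e3_def power2_eq_square[of c] algebra_simps)
  finally have b: "bayes_lb (9 * d) (d * ((4 * c + 2 * c\<^sup>2) * e1 + 16 * c * e2 + 18 * e3)
      / (2 + 2 * c\<^sup>2 + (4 * c + 2 * c\<^sup>2) * e1 + 4 * c * e2 + 2 * e3))" by simp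
  have pos: "2 + 2 * c\<^sup>2 + (4 * c + 2 * c\<^sup>2) * e1 + 4 * c * e2 + 2 * e3 > 0"
    using assms by (simp add: e1_def e2_def e3_def add_pos_pos)
  have "v * (2 + 2 * c\<^sup>2 + (4 * c + 2 * c\<^sup>2) * e1 + 4 * c * e2 + 2 * e3)
      \<le> v * (2 + 2 * c\<^sup>2 + (4 * c + 2 * c\<^sup>2) * y1' + 4 * c * y2' + 2 * y3')"
    using assms by (intro mult_left_mono add_mono) (auto simp: e1_def e2_def e3_def)
  also have "\<dots> \<le> d * ((4 * c + 2 * c\<^sup>2) * y1 + 16 * c * y2 + 18 * y3)" by (rule v)
  also have "\<dots> \<le> d * ((4 * c + 2 * c\<^sup>2) * e1 + 16 * c * e2 + 18 * e3)"
    using assms by (intro mult_left_mono add_mono) (auto simp: e1_def e2_def e3_def)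
  finally have "v \<le> d * ((4 * c + 2 * c\<^sup>2) * e1 + 16 * c * e2 + 18 * e3)
      / (2 + 2 * c\<^sup>2 + (4 * c + 2 * c\<^sup>2) * e1 + 4 * c * e2 + 2 * e3)" using pos by (simp add: field_simps)
  then show ?thesis using assms by (intro bayes_lb_mono[OF b]) auto
qed

text \<open>Values at \<open>d / 2\<close>, \<open>2 * d\<close> and, for the last two spacings
  only, \<open>9 * d / 2\<close>, where \<open>d\<close> is 51/25, 23/20 and 17/10.\<close>

lemma exp_bounds_num:
  "3605/10000 \<le> exp (- (51/50::real))" "exp (- (51/50::real)) \<le> 3607/10000"
  "1690/100000 \<le> exp (- (102/25::real))" "exp (- (102/25::real)) \<le> 1692/100000"
  "5626/10000 \<le> exp (- (23/40::real))" "exp (- (23/40::real)) \<le> 5628/10000"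
  "1002/10000 \<le> exp (- (23/10::real))" "exp (- (23/10::real)) \<le> 1003/10000"
  "565/100000 \<le> exp (- (207/40::real))" "exp (- (207/40::real)) \<le> 566/100000"
  "4273/10000 \<le> exp (- (17/20::real))" "exp (- (17/20::real)) \<le> 4275/10000"
  "333/10000 \<le> exp (- (17/5::real))" "exp (- (17/5::real)) \<le> 334/10000"
  "47/100000 \<le> exp (- (153/20::real))" "exp (- (153/20::real)) \<le> 48/100000"
  by ((rule exp_ge_num_rounded[where ?r0.0 = "88029/100000"]; simp add: exp8_def power_divide fact_numeral),
     (rule exp_le_num_rounded[where ?r0.0 = "56799/50000"]; simp add: exp8_def power_divide fact_numeral),
     (rule exp_ge_num_rounded[where ?r0.0 = "60049/100000"]; simp add: exp8_def power_divide fact_numeral),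
     (rule exp_le_num_rounded[where ?r0.0 = "166529/100000"]; simp add: exp8_def power_divide fact_numeral),
     (rule exp_ge_num_rounded[where ?r0.0 = "11633/12500"]; simp add: exp8_def power_divide fact_numeral),
     (rule exp_le_num_rounded[where ?r0.0 = "26863/25000"]; simp add: exp8_def power_divide fact_numeral),
     (rule exp_ge_num_rounded[where ?r0.0 = "75013/100000"]; simp add: exp8_def power_divide fact_numeral),
     (rule exp_le_num_rounded[where ?r0.0 = "133309/100000"]; simp add: exp8_def power_divide fact_numeral),
     (rule exp_ge_num_rounded[where ?r0.0 = "52367/100000"]; simp add: exp8_def power_divide fact_numeral),
     (rule exp_le_num_rounded[where ?r0.0 = "47739/25000"]; simp add: exp8_def power_divide fact_numeral),
     (rule exp_ge_num_rounded[where ?r0.0 = "89919/100000"]; simp add: exp8_def power_divide fact_numeral),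
     (rule exp_le_num_rounded[where ?r0.0 = "111209/100000"]; simp add: exp8_def power_divide fact_numeral),
     (rule exp_ge_num_rounded[where ?r0.0 = "2043/3125"]; simp add: exp8_def power_divide fact_numeral),
     (rule exp_le_num_rounded[where ?r0.0 = "152959/100000"]; simp add: exp8_def power_divide fact_numeral),
     (rule exp_ge_num_rounded[where ?r0.0 = "38431/100000"]; simp add: exp8_def power_divide fact_numeral),
     (rule exp_le_num_rounded[where ?r0.0 = "26019/10000"]; simp add: exp8_def power_divide fact_numeral))

text \<open>Three anchors are enough: the bound at 8.16 reaches to 10.35, the one at 10.35 to 15.3,
  and at 15.3 the value 4/5 is attained, which exceeds every target.\<close>

lemma good_large:
  assumes "816/100 \<le> t"
  shows "good t"
proof -
  have p1: "bayes_lb (4 * (51/25)) (731/1000)"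
    by (rule square_prior_three[where c = "13/10" and ?y1.0 = "3605/10000" and y1' = "3607/10000" and ?y2.0 = "1690/100000"
        and y2' = "1692/100000"])
       (use exp_bounds_num in \<open>simp_all add: power2_eq_square\<close>)
  have p2: "bayes_lb (9 * (23/20)) (752/1000)"
    by (rule square_prior_four[where c = "6/5" and ?y1.0 = "5626/10000" and y1' = "5628/10000" and ?y2.0 = "1002/10000"
        and y2' = "1003/10000" and ?y3.0 = "565/100000" and y3' = "566/100000"])
       (use exp_bounds_num in \<open>simp_all add: power2_eq_square\<close>)
  have p3: "bayes_lb (9 * (17/10)) (4/5)"
    by (rule square_prior_four[where c = "7/5" and ?y1.0 = "4273/10000" and y1' = "4275/10000" and ?y2.0 = "333/10000"
        and y2' = "334/10000" and ?y3.0 = "47/100000" and y3' = "48/100000"])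
       (use exp_bounds_num in \<open>simp_all add: power2_eq_square\<close>)
  consider "t \<le> 1035/100" | "1035/100 \<le> t" "t \<le> 153/10" | "153/10 \<le> t" by linarith
  then show ?thesis
  proof cases
    case 1
    then show ?thesis by (intro good_step[OF p1, of t "1035/100"]) (use assms in auto)
  next
    case 2
    then show ?thesis by (intro good_step[OF p2, of t "153/10"]) auto
  next
    case 3
    have "4/5 * t / (1 + t) \<le> 4/5" using 3 by (simp add: field_simps)
    then show ?thesis by (intro bayes_lb_mono[OF p3]) (use 3 in auto)
  qed
qed

theorem good_all:
  assumes "0 < t"
  shows "good t"
proof -
  have c: "good t" if "41/5 \<le> t" using that by (intro good_large) simp
  have c: "good t" if "37/5 \<le> t" using linear[of t "41/5"] that cell_14[of t] c by blast
  have c: "good t" if "33/5 \<le> t" using linear[of t "37/5"] that cell_13[of t] c by blast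
  have c: "good t" if "293/50 \<le> t" using linear[of t "33/5"] that cell_12[of t] c by blast
  have c: "good t" if "131/25 \<le> t" using linear[of t "293/50"] that cell_11[of t] c by blast
  have c: "good t" if "119/25 \<le> t" using linear[of t "131/25"] that cell_10[of t] c by blast
  have c: "good t" if "219/50 \<le> t" using linear[of t "119/25"] that cell_9[of t] c by blast
  have c: "good t" if "81/20 \<le> t" using linear[of t "219/50"] that cell_8[of t] c by blast
  have c: "good t" if "369/100 \<le> t" using linear[of t "81/20"] that cell_7[of t] c by blast
  have c: "good t" if "333/100 \<le> t" using linear[of t "369/100"] that cell_6[of t] c by blast
  have c: "good t" if "301/100 \<le> t" using linear[of t "333/100"] that cell_5[of t] c by blast
  have c: "good t" if "137/50 \<le> t" using linear[of t "301/100"] that cell_4[of t] c by blast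
  have c: "good t" if "5/2 \<le> t" using linear[of t "137/50"] that cell_3[of t] c by blast
  have c: "good t" if "233/100 \<le> t" using linear[of t "5/2"] that cell_2[of t] c by blast
  have c: "good t" if "54/25 \<le> t" using linear[of t "233/100"] that cell_1[of t] c by blast
  have c: "good t" if "147/100 \<le> t"
    using linear[of t "54/25"] that good_closed_form[of t] c by fastforce
  have c: "good t" if "7/5 \<le> t" using linear[of t "147/100"] that good_two_point[of t] c by blast
  show ?thesis using linear[of t "7/5"] assms good_small[of t] c by blast
qed

section \<open>Quadratic forms and matrix square roots\<close>

definition qf :: "nat \<Rightarrow> (nat \<Rightarrow> nat \<Rightarrow> real) \<Rightarrow> (nat \<Rightarrow> real) \<Rightarrow> real" where
  "qf n A x = ip n x (mv n A x)"

definition eigenbasis :: "nat \<Rightarrow> (nat \<Rightarrow> nat \<Rightarrow> real) \<Rightarrow> (nat \<Rightarrow> nat \<Rightarrow> real) \<Rightarrow> (nat \<Rightarrow> real) \<Rightarrow> bool" where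
  "eigenbasis n A e la \<longleftrightarrow> orthonormal n n e \<and> (\<forall>k<n. \<forall>i<n. mv n A (e k) i = la k * e k i)"

lemma eigenbasis_exists:
  assumes "msym n A"
  obtains e la where "eigenbasis n A e la"
proof -
  have c: "\<forall>i<n. \<forall>j<n. mmul n A A i j = mmul n A A i j" by simp
  show ?thesis
  proof (rule simultaneous_spectral[OF assms assms c])
    fix e la mu
    assume "orthonormal n n e" "\<And>k i. k < n \<Longrightarrow> i < n \<Longrightarrow> mv n A (e k) i = la k * e k i"
    then have "eigenbasis n A e la" by (simp add: eigenbasis_def)
    then show ?thesis by (rule that)
  qed
qed

lemma orthonormal_ip: "orthonormal n n e \<Longrightarrow> k < n \<Longrightarrow> l < n \<Longrightarrow> ip n (e k) (e l) = (if k = l then 1 else 0)"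
  by (simp add: orthonormal_def)

lemma orthonormal_expand:
  assumes e: "orthonormal n n e" and i: "i < n"
  shows "x i = (\<Sum>k<n. ip n x (e k) * e k i)"
proof -
  have "(\<Sum>k<n. ip n x (e k) * e k i) = (\<Sum>k<n. \<Sum>j<n. x j * (e k j * e k i))"
    by (simp add: ip_def sum_distrib_right mult.assoc)
  also have "\<dots> = (\<Sum>j<n. x j * (\<Sum>k<n. e k j * e k i))"
    by (subst sum.swap) (simp add: sum_distrib_left)
  also have "\<dots> = (\<Sum>j<n. x j * (if j = i then 1 else 0))"
    using orthonormal_complete[OF e] i by (intro sum.cong) auto
  also have "\<dots> = x i" using ip_unit[OF i, of x] by (simp add: ip_def)
  finally show ?thesis by simp
qed

lemma parseval:
  assumes e: "orthonormal n n e"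
  shows "ip n x y = (\<Sum>k<n. ip n x (e k) * ip n y (e k))"
proof -
  have "ip n x y = ip n (\<lambda>i. \<Sum>k<n. ip n x (e k) * e k i) y"
    by (rule ip_cong) (use orthonormal_expand[OF e] in auto)
  also have "\<dots> = (\<Sum>k<n. ip n x (e k) * ip n (e k) y)" by (simp add: ip_sum_left ip_scale_left)
  finally show ?thesis by (simp add: ip_commute[of n _ y])
qed

lemma parseval_sqnorm: "orthonormal n n e \<Longrightarrow> sqnorm n x = (\<Sum>k<n. (ip n x (e k))\<^sup>2)"
  unfolding sqnorm_ip by (subst parseval) (simp_all add: power2_eq_square)

lemma ip_lincomb:
  assumes e: "orthonormal n n e" and k: "k < n"
  shows "ip n (\<lambda>i. \<Sum>l<n. c l * e l i) (e k) = c k"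
proof -
  have "ip n (\<lambda>i. \<Sum>l<n. c l * e l i) (e k) = (\<Sum>l<n. if l = k then c l else 0)"
    unfolding ip_sum_left ip_scale_left using k by (intro sum.cong) (auto simp: orthonormal_ip[OF e])
  then show ?thesis using k by simp
qed

lemma mv_eigen_ip:
  assumes "msym n A" "eigenbasis n A e la" "k < n"
  shows "ip n (mv n A x) (e k) = la k * ip n x (e k)"
proof -
  have "ip n (mv n A x) (e k) = ip n x (mv n A (e k))" by (rule mv_sym_adjoint[OF assms(1)])
  also have "\<dots> = ip n x (\<lambda>i. la k * e k i)" by (rule ip_cong) (use assms in \<open>auto simp: eigenbasis_def\<close>)
  finally show ?thesis by (simp add: ip_scale_right)
qed

lemma qf_eigen:
  assumes A: "msym n A" "eigenbasis n A e la"
  shows "qf n A x = (\<Sum>k<n. la k * (ip n x (e k))\<^sup>2)"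
proof -
  have "qf n A x = (\<Sum>k<n. ip n x (e k) * ip n (mv n A x) (e k))"
    unfolding qf_def using A(2) by (intro parseval) (simp add: eigenbasis_def)
  also have "\<dots> = (\<Sum>k<n. la k * (ip n x (e k))\<^sup>2)"
    by (intro sum.cong refl) (simp add: mv_eigen_ip[OF A] power2_eq_square)
  finally show ?thesis .
qed

lemma eigen_entry:
  assumes "eigenbasis n A e la" "i < n" "j < n"
  shows "A i j = (\<Sum>k<n. la k * (e k i * e k j))"
proof -
  have "(\<Sum>k<n. la k * (e k i * e k j)) = (\<Sum>k<n. mv n A (e k) i * e k j)"
    using assms by (intro sum.cong) (auto simp: eigenbasis_def)
  also have "\<dots> = (\<Sum>l<n. A i l * (\<Sum>k<n. e k l * e k j))"
    unfolding mv_def sum_distrib_left sum_distrib_right by (subst sum.swap) (simp add: mult.assoc)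
  also have "\<dots> = (\<Sum>l<n. A i l * (if l = j then 1 else 0))"
    using orthonormal_complete[of n e] assms by (intro sum.cong) (auto simp: eigenbasis_def)
  also have "\<dots> = A i j" using ip_unit[OF assms(3), of "A i"] by (simp add: ip_def)
  finally show ?thesis by simp
qed

lemma mpsd_qf: "mpsd n A \<Longrightarrow> 0 \<le> qf n A x"
  unfolding mpsd_def loewner_le_def qf_def by (simp add: sum_sum_ip[symmetric])

lemma mpsdI: "msym n A \<Longrightarrow> (\<And>x. 0 \<le> qf n A x) \<Longrightarrow> mpsd n A"
  unfolding mpsd_def loewner_le_def qf_def by (simp add: sum_sum_ip[symmetric])

lemma mpsd_eigen_nonneg:
  assumes "mpsd n A" "eigenbasis n A e la" "k < n"
  shows "0 \<le> la k"
proof -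
  have "qf n A (e k) = ip n (e k) (\<lambda>i. la k * e k i)"
    unfolding qf_def by (rule ip_cong) (use assms in \<open>auto simp: eigenbasis_def\<close>)
  also have "\<dots> = la k" using assms by (simp add: ip_scale_right eigenbasis_def orthonormal_def)
  finally show ?thesis using mpsd_qf[OF assms(1), of "e k"] by simp
qed

text \<open>For \<open>D = S - T\<close> one has \<open>S D + D T = 0\<close>. On an eigenvector of
  \<open>D\<close> with eigenvalue \<open>mu\<close> this says that \<open>mu\<close> times the sum
  of the two quadratic forms vanishes; if \<open>mu\<close> were nonzero, both forms would vanish
  there, hence so would \<open>mu\<close>, their difference.\<close>

lemma psd_sqrt_unique:
  assumes S: "mpsd n S" "\<forall>i<n. \<forall>j<n. mmul n S S i j = A i j"
    and T: "mpsd n T" "\<forall>i<n. \<forall>j<n. mmul n T T i j = A i j"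
    and ij: "i < n" "j < n"
  shows "S i j = T i j"
proof -
  define D where "D i j = S i j - T i j" for i j
  have sym: "msym n S" "msym n T" "msym n D" using S T by (auto simp: mpsd_def msym_def D_def)
  obtain e mu where e: "eigenbasis n D e mu" using eigenbasis_exists[OF sym(3)] .
  have Dv: "mv n D x = (\<lambda>i. mv n S x i - mv n T x i)" for x
    by (simp add: mv_def D_def algebra_simps sum_subtractf)
  have "mu k = 0" if k: "k < n" for k
  proof (rule ccontr)
    assume nz: "mu k \<noteq> 0"
    have De: "ip n x (mv n D (e k)) = mu k * ip n x (e k)" for x
      using mv_eigen_ip[OF sym(3) e k, of x] mv_sym_adjoint[OF sym(3), of x "e k"] by simp
    have SS: "ip n (e k) (mv n S (mv n S (e k))) = ip n (e k) (mv n T (mv n T (e k)))"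
    proof (rule ip_cong[OF refl])
      fix i assume "i < n"
      then show "mv n S (mv n S (e k)) i = mv n T (mv n T (e k)) i"
        unfolding mv_mmul[symmetric] using S T by (intro mv_cong_mat) auto
    qed
    have "ip n (e k) (mv n S (mv n D (e k))) + ip n (mv n D (e k)) (mv n T (e k)) = 0"
    proof -
      have "ip n (e k) (mv n S (mv n D (e k))) = ip n (e k) (mv n S (mv n S (e k))) - ip n (e k) (mv n S (mv n T (e k)))"
        unfolding Dv mv_diff ip_diff_right ..
      moreover have "ip n (mv n D (e k)) (mv n T (e k)) = ip n (mv n S (e k)) (mv n T (e k)) - ip n (mv n T (e k)) (mv n T (e k))"
        unfolding Dv ip_diff_left ..
      moreover have "ip n (mv n S (e k)) (mv n T (e k)) = ip n (e k) (mv n S (mv n T (e k)))"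
        by (rule mv_sym_adjoint[OF sym(1)])
      moreover have "ip n (mv n T (e k)) (mv n T (e k)) = ip n (e k) (mv n T (mv n T (e k)))"
        by (rule mv_sym_adjoint[OF sym(2)])
      ultimately show ?thesis using SS by simp
    qed
    moreover have "ip n (e k) (mv n S (mv n D (e k))) = mu k * qf n S (e k)"
      using De[of "mv n S (e k)"] mv_sym_adjoint[OF sym(1), of "e k" "mv n D (e k)"]
        mv_sym_adjoint[OF sym(1), of "e k" "e k"] by (simp add: qf_def)
    moreover have "ip n (mv n D (e k)) (mv n T (e k)) = mu k * qf n T (e k)"
      using De[of "mv n T (e k)"] ip_commute[of n "mv n D (e k)" "mv n T (e k)"]
        ip_commute[of n "mv n T (e k)" "e k"] by (simp add: qf_def)
    ultimately have "mu k * (qf n S (e k) + qf n T (e k)) = 0" by (simp add: algebra_simps)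
    then have "qf n S (e k) = 0" "qf n T (e k) = 0"
      using nz mpsd_qf[OF S(1), of "e k"] mpsd_qf[OF T(1), of "e k"] by auto
    then have "ip n (e k) (mv n D (e k)) = 0" by (simp add: Dv ip_diff_right qf_def)
    then show False using De[of "e k"] e k nz by (simp add: eigenbasis_def orthonormal_def)
  qed
  then have "D i j = 0" using eigen_entry[OF e ij] by simp
  then show ?thesis by (simp add: D_def)
qed

text \<open>\<open>msqrt\<close> is a definite description. The spectral root supplies existence,
  the uniqueness lemma together with the zero convention outside the block supplies uniqueness, and
  the explicit form allows computation in the eigenbasis.\<close>

lemma psd_sqrt_spectral:
  assumes A: "mpsd n A" and e: "eigenbasis n A e la"
  defines "S \<equiv> \<lambda>i j. if i < n \<and> j < n then (\<Sum>k<n. sqrt (la k) * (e k i * e k j)) else 0"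
  shows "msqrt n A = S" "mpsd n S" "\<And>i j. i < n \<Longrightarrow> j < n \<Longrightarrow> mmul n S S i j = A i j"
proof -
  have on: "orthonormal n n e" using e by (simp add: eigenbasis_def)
  have la: "0 \<le> la k" if "k < n" for k using mpsd_eigen_nonneg[OF A e that] .
  have Sx: "mv n S x i = (\<Sum>k<n. sqrt (la k) * ip n x (e k) * e k i)" if "i < n" for x i
  proof -
    have "mv n S x i = (\<Sum>j<n. \<Sum>k<n. sqrt (la k) * (e k i * e k j) * x j)"
      unfolding mv_def S_def using that by (simp add: sum_distrib_right)
    also have "\<dots> = (\<Sum>k<n. \<Sum>j<n. sqrt (la k) * (e k i * e k j) * x j)" by (rule sum.swap)
    also have "\<dots> = (\<Sum>k<n. sqrt (la k) * ip n x (e k) * e k i)"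
      unfolding ip_def sum_distrib_left sum_distrib_right by (simp add: mult_ac)
    finally show ?thesis .
  qed
  have symS: "msym n S" unfolding msym_def S_def by (simp add: mult_ac)
  have eS: "eigenbasis n S e (\<lambda>k. sqrt (la k))"
    unfolding eigenbasis_def
  proof (intro conjI allI impI on)
    fix k i assume k: "k < n" and i: "i < n"
    have "mv n S (e k) i = (\<Sum>l<n. if l = k then sqrt (la l) * e l i else 0)"
      unfolding Sx[OF i] using k by (intro sum.cong) (auto simp: orthonormal_ip[OF on])
    then show "mv n S (e k) i = sqrt (la k) * e k i" using k by simp
  qed
  show psd: "mpsd n S"
    by (rule mpsdI[OF symS]) (auto simp: qf_eigen[OF symS eS] la intro!: sum_nonneg mult_nonneg_nonneg)
  show sq: "mmul n S S i j = A i j" if "i < n" "j < n" for i j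
  proof -
    have "mmul n S S i j = mv n S (\<lambda>l. S l j) i" by (simp add: mmul_def mv_def)
    also have "\<dots> = (\<Sum>k<n. sqrt (la k) * ip n (\<lambda>l. S l j) (e k) * e k i)" by (rule Sx[OF that(1)])
    also have "\<dots> = (\<Sum>k<n. la k * (e k i * e k j))"
    proof (intro sum.cong refl)
      fix k assume k: "k \<in> {..<n}"
      have "ip n (\<lambda>l. S l j) (e k) = ip n (\<lambda>l. \<Sum>m<n. (sqrt (la m) * e m j) * e m l) (e k)"
        by (rule ip_cong) (use that in \<open>auto simp: S_def mult_ac\<close>)
      also have "\<dots> = sqrt (la k) * e k j" using k by (intro ip_lincomb[OF on]) auto
      finally have "sqrt (la k) * ip n (\<lambda>l. S l j) (e k) * e k i = (sqrt (la k) * sqrt (la k)) * (e k i * e k j)"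
        by (simp add: mult_ac)
      then show "sqrt (la k) * ip n (\<lambda>l. S l j) (e k) * e k i = la k * (e k i * e k j)" using la k by simp
    qed
    also have "\<dots> = A i j" by (rule eigen_entry[OF e that, symmetric])
    finally show ?thesis .
  qed
  show "msqrt n A = S"
    unfolding msqrt_def
  proof (rule the_equality)
    show "mpsd n S \<and> (\<forall>i<n. \<forall>j<n. mmul n S S i j = A i j) \<and> (\<forall>i j. \<not> (i < n \<and> j < n) \<longrightarrow> S i j = 0)"
      using psd sq by (auto simp: S_def)
    fix T assume T: "mpsd n T \<and> (\<forall>i<n. \<forall>j<n. mmul n T T i j = A i j) \<and> (\<forall>i j. \<not> (i < n \<and> j < n) \<longrightarrow> T i j = 0)"
    show "T = S"
    proof (intro ext)
      fix i j
      show "T i j = S i j"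
      proof (cases "i < n \<and> j < n")
        case True
        then show ?thesis using psd_sqrt_unique[of n T A S i j] T psd sq by auto
      next
        case False then show ?thesis using T by (auto simp: S_def)
      qed
    qed
  qed
qed

text \<open>Removes the square root from the loss: all risk estimates can work with the quadratic
  form of \<open>A\<close> alone.\<close>

lemma sqnorm_msqrt:
  assumes A: "mpsd n A"
  shows "sqnorm n (mv n (msqrt n A) x) = qf n A x"
proof -
  have "msym n A" using A by (simp add: mpsd_def)
  then obtain e la where e: "eigenbasis n A e la" using eigenbasis_exists by blast
  define S where "S = msqrt n A"
  have S: "mpsd n S" "\<And>i j. i < n \<Longrightarrow> j < n \<Longrightarrow> mmul n S S i j = A i j"
    using psd_sqrt_spectral[OF A e] unfolding S_def by auto
  have "sqnorm n (mv n S x) = ip n x (mv n S (mv n S x))"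
    unfolding sqnorm_ip using S by (intro mv_sym_adjoint) (simp add: mpsd_def)
  also have "\<dots> = qf n A x"
    unfolding qf_def mv_mmul[symmetric] using S by (intro ip_cong refl mv_cong_mat) auto
  finally show ?thesis by (simp add: S_def)
qed

lemma is_inv_unique:
  assumes "is_inv n A B" "is_inv n A B'" "i < n" "j < n"
  shows "B i j = B' i j"
proof -
  have "B i j = (\<Sum>l<n. B i l * mmul n A B' l j)"
  proof -
    have "(\<Sum>l<n. B i l * mmul n A B' l j) = (\<Sum>l<n. B i l * (if l = j then 1 else 0))"
      using assms by (intro sum.cong) (auto simp: is_inv_def idm_def)
    then show ?thesis using ip_unit[OF assms(4), of "B i"] by (simp add: ip_def)
  qed
  also have "\<dots> = (\<Sum>m<n. mmul n B A i m * B' m j)"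
    unfolding mmul_def sum_distrib_left sum_distrib_right by (subst sum.swap) (simp add: mult_ac)
  also have "\<dots> = (\<Sum>m<n. (if m = i then 1 else 0) * B' m j)"
    using assms by (intro sum.cong) (auto simp: is_inv_def idm_def)
  also have "\<dots> = B' i j" using ip_unit[OF assms(3), of "\<lambda>m. B' m j"] by (simp add: ip_def mult.commute)
  finally show ?thesis .
qed

lemma minv_is_inv:
  assumes "minvertible n A"
  shows "is_inv n A (minv n A)"
proof -
  obtain B where B: "is_inv n A B" using assms by (auto simp: minvertible_def)
  define B0 where "B0 i j = (if i < n \<and> j < n then B i j else 0)" for i j
  have B0: "is_inv n A B0"
  proof -
    have "mmul n A B0 i j = mmul n A B i j" "mmul n B0 A i j = mmul n B A i j" if "i < n" "j < n" for i j
      using that by (auto simp: mmul_def B0_def intro!: sum.cong)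
    then show ?thesis using B by (auto simp: is_inv_def)
  qed
  have "is_inv n A (minv n A) \<and> (\<forall>i j. \<not> (i < n \<and> j < n) \<longrightarrow> minv n A i j = 0)"
    unfolding minv_def
  proof (rule theI[of _ B0])
    show "is_inv n A B0 \<and> (\<forall>i j. \<not> (i < n \<and> j < n) \<longrightarrow> B0 i j = 0)" using B0 by (auto simp: B0_def)
    fix C assume C: "is_inv n A C \<and> (\<forall>i j. \<not> (i < n \<and> j < n) \<longrightarrow> C i j = 0)"
    show "C = B0"
    proof (intro ext)
      fix i j show "C i j = B0 i j"
        using is_inv_unique[of n A C B0 i j] C B0 by (cases "i < n \<and> j < n") (auto simp: B0_def)
    qed
  qed
  then show ?thesis by simp
qed

section \<open>Covariance concentration\<close>

declare measurable_gauss_coord [measurable del]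

section \<open>Squares of subgaussian variables\<close>

lemma std_gauss_exp_nn:
  assumes "\<theta> > -1/2"
  shows "(\<integral>\<^sup>+u. ennreal (exp (\<mu> * u - \<theta> * u\<^sup>2)) \<partial>std_gauss) = ennreal (exp (\<mu>\<^sup>2 / (2 * (1 + 2 * \<theta>))) / sqrt (1 + 2 * \<theta>))"
  unfolding std_gauss_exp(2)[OF assms, symmetric]
  by (rule nn_integral_eq_integral[OF std_gauss_exp(1)[OF assms]]) auto

locale subgaussian_variable = prob_space M for M :: "'a measure" +
  fixes Z :: "'a \<Rightarrow> real" and \<rho> :: real
  assumes Z [measurable]: "Z \<in> borel_measurable M" and \<rho>: "\<rho> > 0"
    and mgf: "\<And>s. (\<integral>\<^sup>+x. ennreal (exp (s * Z x)) \<partial>M) \<le> ennreal (exp (s\<^sup>2 * \<rho>\<^sup>2 / 2))"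
begin

text \<open>Averaging the moment generating function over a standard normal argument \<open>s\<close> turns it into
  the exponential moment of the square.\<close>

lemma exp_square_nn: "(\<integral>\<^sup>+x. ennreal (exp ((Z x)\<^sup>2 / (4 * \<rho>\<^sup>2))) \<partial>M) \<le> ennreal (sqrt 2)"
proof -
  interpret N: prob_space std_gauss by (rule prob_space_std_gauss)
  interpret pair_prob_space M std_gauss ..
  have e: "ennreal (exp ((Z x)\<^sup>2 / (4 * \<rho>\<^sup>2))) = (\<integral>\<^sup>+u. ennreal (exp (u / (sqrt 2 * \<rho>) * Z x)) \<partial>std_gauss)" for x
  proof -
    have "(\<integral>\<^sup>+u. ennreal (exp (Z x / (sqrt 2 * \<rho>) * u - 0 * u\<^sup>2)) \<partial>std_gauss)
      = ennreal (exp ((Z x / (sqrt 2 * \<rho>))\<^sup>2 / 2))"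
      using std_gauss_exp_nn[of 0 "Z x / (sqrt 2 * \<rho>)"] by simp
    then show ?thesis by (simp add: power_divide power_mult_distrib mult_ac)
  qed
  have "(\<integral>\<^sup>+x. ennreal (exp ((Z x)\<^sup>2 / (4 * \<rho>\<^sup>2))) \<partial>M)
      = (\<integral>\<^sup>+x. \<integral>\<^sup>+u. ennreal (exp (u / (sqrt 2 * \<rho>) * Z x)) \<partial>std_gauss \<partial>M)" unfolding e ..
  also have "\<dots> = (\<integral>\<^sup>+u. \<integral>\<^sup>+x. ennreal (exp (u / (sqrt 2 * \<rho>) * Z x)) \<partial>M \<partial>std_gauss)"
    by (rule Fubini'[symmetric]) measurable
  also have "\<dots> \<le> (\<integral>\<^sup>+u. ennreal (exp ((u / (sqrt 2 * \<rho>))\<^sup>2 * \<rho>\<^sup>2 / 2)) \<partial>std_gauss)"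
    by (intro nn_integral_mono mgf)
  also have "\<dots> = (\<integral>\<^sup>+u. ennreal (exp (0 * u - (-1/4) * u\<^sup>2)) \<partial>std_gauss)"
    using \<rho> by (intro nn_integral_cong) (simp add: power_divide power_mult_distrib)
  also have "\<dots> = ennreal (sqrt 2)"
    by (subst std_gauss_exp_nn) (auto simp: real_sqrt_divide)
  finally show ?thesis .
qed

lemma exp_square: "integrable M (\<lambda>x. exp ((Z x)\<^sup>2 / (4 * \<rho>\<^sup>2)))"
    "(\<integral>x. exp ((Z x)\<^sup>2 / (4 * \<rho>\<^sup>2)) \<partial>M) \<le> sqrt 2"
proof -
  show i: "integrable M (\<lambda>x. exp ((Z x)\<^sup>2 / (4 * \<rho>\<^sup>2)))"
    using exp_square_nn by (intro integrableI_nonneg) (auto simp: top.not_eq_extremum intro: le_less_trans)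
  have "ennreal (\<integral>x. exp ((Z x)\<^sup>2 / (4 * \<rho>\<^sup>2)) \<partial>M) \<le> ennreal (sqrt 2)"
    using exp_square_nn nn_integral_eq_integral[OF i] by simp
  then show "(\<integral>x. exp ((Z x)\<^sup>2 / (4 * \<rho>\<^sup>2)) \<partial>M) \<le> sqrt 2" by (simp add: ennreal_le_iff)
qed

lemma square_bound: "(Z x)\<^sup>2 \<le> 4 * \<rho>\<^sup>2 * (exp ((Z x)\<^sup>2 / (4 * \<rho>\<^sup>2)) - 1)"
proof -
  have "(Z x)\<^sup>2 / (4 * \<rho>\<^sup>2) \<le> exp ((Z x)\<^sup>2 / (4 * \<rho>\<^sup>2)) - 1"
    using exp_ge_add_one_self[of "(Z x)\<^sup>2 / (4 * \<rho>\<^sup>2)"] by linarith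
  then show ?thesis using \<rho> by (simp add: field_simps)
qed

lemma square_integrable: "integrable M (\<lambda>x. (Z x)\<^sup>2)"
proof (rule Bochner_Integration.integrable_bound)
  show "integrable M (\<lambda>x. 4 * \<rho>\<^sup>2 * (exp ((Z x)\<^sup>2 / (4 * \<rho>\<^sup>2)) - 1))" using exp_square(1) by auto
  show "AE x in M. norm ((Z x)\<^sup>2) \<le> norm (4 * \<rho>\<^sup>2 * (exp ((Z x)\<^sup>2 / (4 * \<rho>\<^sup>2)) - 1))"
    using square_bound by (auto intro!: AE_I2 order_trans[OF _ abs_ge_self])
qed measurable

lemma second_moment_le: "(\<integral>x. (Z x)\<^sup>2 \<partial>M) \<le> 2 * \<rho>\<^sup>2"
proof -
  have "(\<integral>x. (Z x)\<^sup>2 \<partial>M) \<le> (\<integral>x. 4 * \<rho>\<^sup>2 * (exp ((Z x)\<^sup>2 / (4 * \<rho>\<^sup>2)) - 1) \<partial>M)"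
    using exp_square(1) by (intro integral_mono square_integrable square_bound) auto
  also have "\<dots> = 4 * \<rho>\<^sup>2 * ((\<integral>x. exp ((Z x)\<^sup>2 / (4 * \<rho>\<^sup>2)) \<partial>M) - 1)"
    using exp_square(1) by (simp add: prob_space)
  also have "\<dots> \<le> 4 * \<rho>\<^sup>2 * (1/2)"
  proof (intro mult_left_mono)
    have "sqrt 2 \<le> 3/2" by (rule real_le_lsqrt) (simp_all add: power_divide)
    then show "(\<integral>x. exp ((Z x)\<^sup>2 / (4 * \<rho>\<^sup>2)) \<partial>M) - 1 \<le> 1/2" using exp_square(2) by linarith
  qed auto
  finally show ?thesis by simp
qed

lemma exp_le_quadratic: "exp (x::real) \<le> 1 + x + x\<^sup>2 / 2 * exp \<bar>x\<bar>"
proof -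
  obtain t where t: "\<bar>t\<bar> \<le> \<bar>x\<bar>" and e: "exp x = (\<Sum>m<2. x ^ m / fact m) + exp t / fact 2 * x ^ 2"
    using Maclaurin_exp_le[of x 2] by blast
  have "exp t \<le> exp \<bar>x\<bar>" using t by simp
  then have "exp t / fact 2 * x ^ 2 \<le> exp \<bar>x\<bar> / fact 2 * x ^ 2" by (intro mult_right_mono divide_right_mono) auto
  then have "exp t / fact 2 * x ^ 2 \<le> x\<^sup>2 / 2 * exp \<bar>x\<bar>" by (simp add: mult.commute)
  then show ?thesis unfolding e by (simp add: eval_nat_numeral)
qed

text \<open>Second-order Taylor expansion: the linear term is centred and drops out. The range of
  \<open>l\<close> is half of the exponent \<open>1 / (4 * \<rho>\<^sup>2)\<close> whose moment is
  controlled; the other half absorbs the quadratic factor of the remainder. Finally 200 exceeds 128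
  times 3/2.\<close>

lemma subexponential_square:
  assumes l: "\<bar>l\<bar> \<le> 1 / (8 * \<rho>\<^sup>2)"
  shows "(\<integral>\<^sup>+x. ennreal (exp (l * ((Z x)\<^sup>2 - (\<integral>x. (Z x)\<^sup>2 \<partial>M)))) \<partial>M) \<le> ennreal (exp (200 * l\<^sup>2 * \<rho> ^ 4))"
proof -
  define m where "m = (\<integral>x. (Z x)\<^sup>2 \<partial>M)"
  define g where "g x = exp ((Z x)\<^sup>2 / (4 * \<rho>\<^sup>2))" for x
  have m: "0 \<le> m" "m \<le> 2 * \<rho>\<^sup>2" using second_moment_le by (auto simp: m_def)
  have \<rho>2: "\<rho>\<^sup>2 > 0" using \<rho> by simp
  have pw: "exp (l * ((Z x)\<^sup>2 - m)) \<le> 1 + l * ((Z x)\<^sup>2 - m) + 128 * l\<^sup>2 * \<rho> ^ 4 * g x" for x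
  proof -
    \<comment> \<open>A common scale: \<open>8 * \<rho>\<^sup>2 * u\<close> dominates the deviation
      of the square from its mean, and \<open>exp u * exp u\<close> is \<open>g\<close> up to a
      constant. One factor pays for \<open>u\<^sup>2 / 2\<close>, the other for the exponential in
      the remainder.\<close>
    define u where "u = ((Z x)\<^sup>2 + m) / (8 * \<rho>\<^sup>2)"
    have u: "0 \<le> u" using m \<rho>2 by (simp add: u_def)
    have d: "\<bar>(Z x)\<^sup>2 - m\<bar> \<le> 8 * \<rho>\<^sup>2 * u" using m \<rho>2 by (simp add: u_def abs_le_iff)
    have "\<bar>l * ((Z x)\<^sup>2 - m)\<bar> \<le> 1 / (8 * \<rho>\<^sup>2) * (8 * \<rho>\<^sup>2 * u)"
      unfolding abs_mult using l d by (intro mult_mono) auto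
    then have x: "\<bar>l * ((Z x)\<^sup>2 - m)\<bar> \<le> u" using \<rho>2 by simp
    have "(l * ((Z x)\<^sup>2 - m))\<^sup>2 / 2 * exp \<bar>l * ((Z x)\<^sup>2 - m)\<bar> \<le> (l\<^sup>2 * (8 * \<rho>\<^sup>2 * u)\<^sup>2) / 2 * exp u"
    proof (intro mult_mono divide_right_mono)
      have "((Z x)\<^sup>2 - m)\<^sup>2 \<le> (8 * \<rho>\<^sup>2 * u)\<^sup>2" using d by (metis abs_ge_zero power2_abs power_mono)
      then show "(l * ((Z x)\<^sup>2 - m))\<^sup>2 \<le> l\<^sup>2 * (8 * \<rho>\<^sup>2 * u)\<^sup>2" by (simp add: power_mult_distrib mult_left_mono)
    qed (use x in auto)
    also have "\<dots> = 64 * l\<^sup>2 * \<rho> ^ 4 * (u\<^sup>2 / 2 * exp u)"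
      by (simp add: power_mult_distrib power4_eq_xxxx power2_eq_square)
    also have "\<dots> \<le> 64 * l\<^sup>2 * \<rho> ^ 4 * (exp u * exp u)"
    proof (intro mult_left_mono mult_right_mono)
      show "u\<^sup>2 / 2 \<le> exp u" using exp_lower_Taylor_quadratic[OF u] u by linarith
    qed auto
    also have "exp u * exp u = exp (m / (4 * \<rho>\<^sup>2)) * g x"
    proof -
      have "u + u = (m + (Z x)\<^sup>2) / (4 * \<rho>\<^sup>2)" unfolding u_def by (simp add: field_simps)
      also have "\<dots> = m / (4 * \<rho>\<^sup>2) + (Z x)\<^sup>2 / (4 * \<rho>\<^sup>2)" by (rule add_divide_distrib)
      finally show ?thesis unfolding g_def exp_add[symmetric] by simp
    qed
    also have "\<dots> \<le> 2 * g x"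
    proof (intro mult_right_mono)
      have "m / (4 * \<rho>\<^sup>2) \<le> 1/2" using m \<rho>2 by (simp add: field_simps)
      then have "exp (m / (4 * \<rho>\<^sup>2)) \<le> exp (1/2)" by simp
      also have "exp (1/2::real) \<le> 2" using exp_half_le2 by simp
      finally show "exp (m / (4 * \<rho>\<^sup>2)) \<le> 2" .
    qed (simp add: g_def)
    finally have "(l * ((Z x)\<^sup>2 - m))\<^sup>2 / 2 * exp \<bar>l * ((Z x)\<^sup>2 - m)\<bar> \<le> 128 * l\<^sup>2 * \<rho> ^ 4 * g x"
      by (simp add: mult_left_mono)
    then show ?thesis using exp_le_quadratic[of "l * ((Z x)\<^sup>2 - m)"] by linarith
  qed
  have gi: "integrable M g" unfolding g_def by (rule exp_square(1))
  have ri: "integrable M (\<lambda>x. 1 + l * ((Z x)\<^sup>2 - m) + 128 * l\<^sup>2 * \<rho> ^ 4 * g x)"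
    using gi square_integrable by auto
  have "(\<integral>\<^sup>+x. ennreal (exp (l * ((Z x)\<^sup>2 - m))) \<partial>M) \<le> (\<integral>\<^sup>+x. ennreal (1 + l * ((Z x)\<^sup>2 - m) + 128 * l\<^sup>2 * \<rho> ^ 4 * g x) \<partial>M)"
    by (intro nn_integral_mono ennreal_leI pw)
  also have "\<dots> = ennreal (\<integral>x. 1 + l * ((Z x)\<^sup>2 - m) + 128 * l\<^sup>2 * \<rho> ^ 4 * g x \<partial>M)"
    by (rule nn_integral_eq_integral[OF ri]) (auto intro!: AE_I2 order_trans[OF exp_ge_zero pw])
  also have "(\<integral>x. 1 + l * ((Z x)\<^sup>2 - m) + 128 * l\<^sup>2 * \<rho> ^ 4 * g x \<partial>M) = 1 + 128 * l\<^sup>2 * \<rho> ^ 4 * (\<integral>x. g x \<partial>M)"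
    using gi square_integrable by (simp add: prob_space m_def[symmetric])
  also have "\<dots> \<le> 1 + 128 * l\<^sup>2 * \<rho> ^ 4 * (3/2)"
  proof -
    have "sqrt 2 \<le> 3/2" by (rule real_le_lsqrt) (simp_all add: power_divide)
    then have "(\<integral>x. g x \<partial>M) \<le> 3/2" using exp_square(2) unfolding g_def by linarith
    then show ?thesis by (intro add_left_mono mult_left_mono) auto
  qed
  also have "\<dots> \<le> 1 + 200 * l\<^sup>2 * \<rho> ^ 4" by simp
  also have "\<dots> \<le> exp (200 * l\<^sup>2 * \<rho> ^ 4)" by (rule exp_ge_add_one_self)
  finally show ?thesis unfolding m_def by (simp add: ennreal_leI)
qed

text \<open>Exponential Markov inequality, with the product measure splitting the expectation over
  the samples. As \<open>l\<close> may have either sign, both tails are covered.\<close>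

lemma chernoff_one_sided:
  assumes l: "\<bar>l\<bar> \<le> 1 / (8 * \<rho>\<^sup>2)" and t: "0 < t"
  shows "emeasure (PiM {..<n} (\<lambda>_. M)) {X \<in> space (PiM {..<n} (\<lambda>_::nat. M)).
      t \<le> l * (\<Sum>k<n. (Z (X k))\<^sup>2 - (\<integral>x. (Z x)\<^sup>2 \<partial>M))} \<le> ennreal (exp (200 * real n * l\<^sup>2 * \<rho> ^ 4 - t))"
proof -
  define m where "m = (\<integral>x. (Z x)\<^sup>2 \<partial>M)"
  define P where "P = PiM {..<n} (\<lambda>_::nat. M)"
  interpret product_prob_space "\<lambda>_::nat. M" "{..<n}" by (rule product_prob_spaceI) (rule prob_space_axioms)
  have Zm [measurable]: "(\<lambda>X. Z (X k)) \<in> borel_measurable P" if "k < n" for k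
    unfolding P_def using measurable_compose[OF measurable_component_singleton[of k "{..<n}" "\<lambda>_. M"] Z] that by simp
  have "emeasure P {X \<in> space P. t \<le> l * (\<Sum>k<n. (Z (X k))\<^sup>2 - m)}
      \<le> ennreal (exp (- t)) * (\<integral>\<^sup>+X. ennreal (exp (l * (\<Sum>k<n. (Z (X k))\<^sup>2 - m))) \<partial>P)"
  proof -
    have "emeasure P {X \<in> space P. t \<le> l * (\<Sum>k<n. (Z (X k))\<^sup>2 - m)}
       = (\<integral>\<^sup>+X. indicator {X \<in> space P. t \<le> l * (\<Sum>k<n. (Z (X k))\<^sup>2 - m)} X \<partial>P)"
      by (rule nn_integral_indicator[symmetric]) measurable
    also have "\<dots> \<le> (\<integral>\<^sup>+X. ennreal (exp (- t)) * ennreal (exp (l * (\<Sum>k<n. (Z (X k))\<^sup>2 - m))) \<partial>P)"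
    proof (rule nn_integral_mono)
      fix X
      show "indicator {X \<in> space P. t \<le> l * (\<Sum>k<n. (Z (X k))\<^sup>2 - m)} X
          \<le> ennreal (exp (- t)) * ennreal (exp (l * (\<Sum>k<n. (Z (X k))\<^sup>2 - m)))"
      proof (cases "t \<le> l * (\<Sum>k<n. (Z (X k))\<^sup>2 - m)")
        case True
        then have "1 \<le> exp (- t) * exp (l * (\<Sum>k<n. (Z (X k))\<^sup>2 - m))" by (simp add: exp_add[symmetric])
        then have "1 \<le> ennreal (exp (- t) * exp (l * (\<Sum>k<n. (Z (X k))\<^sup>2 - m)))" by (metis ennreal_1 ennreal_leI)
        then show ?thesis by (auto simp: ennreal_mult indicator_def)
      qed auto
    qed
    also have "\<dots> = ennreal (exp (- t)) * (\<integral>\<^sup>+X. ennreal (exp (l * (\<Sum>k<n. (Z (X k))\<^sup>2 - m))) \<partial>P)"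
      by (rule nn_integral_cmult) measurable
    finally show ?thesis .
  qed
  also have "(\<integral>\<^sup>+X. ennreal (exp (l * (\<Sum>k<n. (Z (X k))\<^sup>2 - m))) \<partial>P)
      = (\<integral>\<^sup>+X. (\<Prod>k<n. ennreal (exp (l * ((Z (X k))\<^sup>2 - m)))) \<partial>P)"
    by (intro nn_integral_cong) (simp add: prod_ennreal exp_sum[symmetric] sum_distrib_left)
  also have "\<dots> = (\<Prod>k<n. \<integral>\<^sup>+x. ennreal (exp (l * ((Z x)\<^sup>2 - m))) \<partial>M)"
    unfolding P_def by (rule product_nn_integral_prod) auto
  also have "\<dots> \<le> (\<Prod>k<n. ennreal (exp (200 * l\<^sup>2 * \<rho> ^ 4)))"
    unfolding m_def by (intro prod_mono_ennreal subexponential_square l)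
  also have "\<dots> = ennreal (exp (200 * real n * l\<^sup>2 * \<rho> ^ 4))"
    by (simp add: ennreal_power exp_of_nat_mult[symmetric] mult_ac)
  finally have "emeasure P {X \<in> space P. t \<le> l * (\<Sum>k<n. (Z (X k))\<^sup>2 - m)}
      \<le> ennreal (exp (- t)) * ennreal (exp (200 * real n * l\<^sup>2 * \<rho> ^ 4))" by (simp add: mult_left_mono)
  also have "\<dots> = ennreal (exp (200 * real n * l\<^sup>2 * \<rho> ^ 4 - t))"
    by (simp add: ennreal_mult[symmetric] exp_add[symmetric])
  finally show ?thesis unfolding P_def m_def .
qed

lemma chernoff_square:
  assumes t: "0 < t" "t \<le> 50 * \<rho>\<^sup>2" and n: "n > 0"
  shows "emeasure (PiM {..<n} (\<lambda>_. M)) {X \<in> space (PiM {..<n} (\<lambda>_::nat. M)).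
      real n * t \<le> \<bar>\<Sum>k<n. (Z (X k))\<^sup>2 - (\<integral>x. (Z x)\<^sup>2 \<partial>M)\<bar>} \<le> ennreal (2 * exp (- (real n * t\<^sup>2 / (800 * \<rho> ^ 4))))"
proof -
  define m where "m = (\<integral>x. (Z x)\<^sup>2 \<partial>M)"
  define P where "P = PiM {..<n} (\<lambda>_::nat. M)"
  \<comment> \<open>Minimises \<open>200 * l\<^sup>2 * \<rho> ^ 4 - l * t\<close>. The hypothesis
    that \<open>t\<close> is at most \<open>50 * \<rho>\<^sup>2\<close> is what keeps this
    \<open>l\<close> in the admissible range.\<close>
  define l where "l = t / (400 * \<rho> ^ 4)"
  have l: "l > 0" using t \<rho> by (simp add: l_def)
  have l8: "\<bar>l\<bar> \<le> 1 / (8 * \<rho>\<^sup>2)" "\<bar>- l\<bar> \<le> 1 / (8 * \<rho>\<^sup>2)"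
    using t \<rho> l by (simp_all add: l_def field_simps power4_eq_xxxx power2_eq_square)
  have nt: "real n * t > 0" using t n by simp
  have [measurable]: "(\<lambda>X. Z (X k)) \<in> borel_measurable P" if "k < n" for k
    unfolding P_def using measurable_compose[OF measurable_component_singleton[of k "{..<n}" "\<lambda>_. M"] Z] that by simp
  let ?S = "\<lambda>X. (\<Sum>k<n. (Z (X k))\<^sup>2 - m)"
  have ex: "200 * real n * l\<^sup>2 * \<rho> ^ 4 - l * (real n * t) = - (real n * t\<^sup>2 / (800 * \<rho> ^ 4))"
    using \<rho> by (simp add: l_def field_simps power2_eq_square)
  have "{X \<in> space P. real n * t \<le> \<bar>?S X\<bar>}
     \<subseteq> {X \<in> space P. l * (real n * t) \<le> l * ?S X} \<union> {X \<in> space P. l * (real n * t) \<le> (- l) * ?S X}"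
  proof
    fix X assume X: "X \<in> {X \<in> space P. real n * t \<le> \<bar>?S X\<bar>}"
    then have "real n * t \<le> ?S X \<or> real n * t \<le> - ?S X" by (auto simp: abs_real_def split: if_splits)
    then have "l * (real n * t) \<le> l * ?S X \<or> l * (real n * t) \<le> l * (- ?S X)"
      using mult_left_mono[of "real n * t" "?S X" l] mult_left_mono[of "real n * t" "- ?S X" l] l by linarith
    then show "X \<in> {X \<in> space P. l * (real n * t) \<le> l * ?S X} \<union> {X \<in> space P. l * (real n * t) \<le> (- l) * ?S X}"
      using X by auto
  qed
  then have "emeasure P {X \<in> space P. real n * t \<le> \<bar>?S X\<bar>}
      \<le> emeasure P ({X \<in> space P. l * (real n * t) \<le> l * ?S X} \<union> {X \<in> space P. l * (real n * t) \<le> (- l) * ?S X})"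
    by (rule emeasure_mono) measurable
  also have "\<dots> \<le> emeasure P {X \<in> space P. l * (real n * t) \<le> l * ?S X} + emeasure P {X \<in> space P. l * (real n * t) \<le> (- l) * ?S X}"
    by (rule emeasure_subadditive) measurable
  also have "\<dots> \<le> ennreal (exp (200 * real n * l\<^sup>2 * \<rho> ^ 4 - l * (real n * t))) + ennreal (exp (200 * real n * (- l)\<^sup>2 * \<rho> ^ 4 - l * (real n * t)))"
    unfolding P_def m_def using l nt by (intro add_mono chernoff_one_sided l8) auto
  also have "\<dots> = ennreal (2 * exp (- (real n * t\<^sup>2 / (800 * \<rho> ^ 4))))"
    by (simp add: ex ennreal_plus[symmetric] del: ennreal_plus)
  finally show ?thesis unfolding P_def m_def .
qed

end

section \<open>A lattice net in the unit ball\<close>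

definition lattice_net :: "nat \<Rightarrow> (nat \<Rightarrow> int) set" where
  "lattice_net d = {z \<in> Pi\<^sub>E {..<d} (\<lambda>_. {- int (16 * d)..int (16 * d)}). (\<Sum>i<d. (z i)\<^sup>2) \<le> 16 * int d}"

text \<open>The net consists of integer points in the ball of radius \<open>4 * sqrt d\<close>.
  Scaling brings them into the unit ball, and an error of at most one lattice unit in each
  coordinate becomes a Euclidean distance of at most 1/4.\<close>

definition net_point :: "nat \<Rightarrow> (nat \<Rightarrow> int) \<Rightarrow> (nat \<Rightarrow> real)" where
  "net_point d z = (\<lambda>i. real_of_int (z i) / (4 * sqrt (real d)))"

lemma finite_lattice_net: "finite (lattice_net d)"
proof -
  have "finite (Pi\<^sub>E {..<d} (\<lambda>_. {- int (16 * d)..int (16 * d)}))" by (intro finite_PiE) auto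
  then show ?thesis unfolding lattice_net_def by (rule finite_subset[rotated]) auto
qed

text \<open>Since \<open>exp (- k\<^sup>2) \<le> (1/2) ^ k\<close>, a two-sided geometric series
  dominates; the right-hand side is its exact partial sum.\<close>

lemma sum_exp_neg_square: "(\<Sum>z\<in>{- int N..int N}. exp (- real_of_int (z\<^sup>2))) \<le> 3 - 2 * (1/2) ^ N"
proof (induction N)
  case (Suc N)
  define A where "A = {- int N..int N}"
  have eq: "{- int (Suc N)..int (Suc N)} = insert (int (Suc N)) (insert (- int (Suc N)) A)" by (auto simp: A_def)
  have n: "int (Suc N) \<notin> insert (- int (Suc N)) A" "- int (Suc N) \<notin> A" "finite A" "finite (insert (- int (Suc N)) A)"
    by (auto simp: A_def)
  have e: "exp (- real_of_int ((int (Suc N))\<^sup>2)) = exp (- ((real (Suc N))\<^sup>2))"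
     "exp (- real_of_int ((- int (Suc N))\<^sup>2)) = exp (- ((real (Suc N))\<^sup>2))"
    by (simp_all del: of_nat_Suc)
  have "(\<Sum>z\<in>{- int (Suc N)..int (Suc N)}. exp (- real_of_int (z\<^sup>2)))
      = 2 * exp (- ((real (Suc N))\<^sup>2)) + (\<Sum>z\<in>A. exp (- real_of_int (z\<^sup>2)))"
    unfolding eq by (simp only: sum.insert[OF n(4,1)] sum.insert[OF n(3,2)] e)
  also have "exp (- ((real (Suc N))\<^sup>2)) \<le> (1/2) ^ Suc N"
  proof -
    have sq: "real (Suc N) * 1 \<le> (real (Suc N))\<^sup>2"
      unfolding power2_eq_square by (rule mult_left_mono) auto
    have "(2::real) ^ Suc N \<le> exp 1 ^ Suc N"
    proof (rule power_mono)
      show "(2::real) \<le> exp 1" using exp_ge_add_one_self[of 1] by simp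
    qed simp
    also have "\<dots> = exp (real (Suc N) * 1)" by (rule exp_of_nat_mult[symmetric])
    also have "\<dots> \<le> exp ((real (Suc N))\<^sup>2)" using sq by (simp only: exp_le_cancel_iff)
    finally have "inverse (exp ((real (Suc N))\<^sup>2)) \<le> inverse (2 ^ Suc N)" by (intro le_imp_inverse_le) auto
    then show ?thesis by (simp only: exp_minus power_one_over inverse_eq_divide)
  qed
  finally show ?case using Suc.IH unfolding A_def by simp
qed simp

text \<open>The number of lattice points in a ball is bounded by comparison with a discrete Gaussian.\<close>

lemma card_lattice_net: "real (card (lattice_net d)) \<le> exp (18 * real d)"
proof -
  let ?B = "Pi\<^sub>E {..<d} (\<lambda>_. {- int (16 * d)..int (16 * d)})"
  have "real (card (lattice_net d)) = (\<Sum>z\<in>lattice_net d. 1)" by simp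
  \<comment> \<open>The square sum of a net point is at most \<open>16 * d\<close>, so
    \<open>exp (16 * d)\<close> compensates its Gaussian weight. The full sum over the box then
    factorises, each factor being at most 3 and hence at most \<open>exp 2\<close>; together this
    gives the exponent \<open>18 * d\<close>.\<close>
  also have "\<dots> \<le> (\<Sum>z\<in>lattice_net d. exp (16 * real d) * (\<Prod>i<d. exp (- real_of_int ((z i)\<^sup>2))))"
  proof (rule sum_mono)
    fix z assume "z \<in> lattice_net d"
    then have "(\<Sum>i<d. (z i)\<^sup>2) \<le> 16 * int d" by (simp add: lattice_net_def)
    then have "real_of_int (\<Sum>i<d. (z i)\<^sup>2) \<le> 16 * real d" by linarith
    then have "0 \<le> 16 * real d + (\<Sum>i<d. - real_of_int ((z i)\<^sup>2))" by (simp add: sum_negf)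
    then have "1 \<le> exp (16 * real d + (\<Sum>i<d. - real_of_int ((z i)\<^sup>2)))" by (simp only: one_le_exp_iff)
    then show "1 \<le> exp (16 * real d) * (\<Prod>i<d. exp (- real_of_int ((z i)\<^sup>2)))"
      by (simp only: exp_add exp_sum[OF finite_lessThan])
  qed
  also have "\<dots> \<le> (\<Sum>z\<in>?B. exp (16 * real d) * (\<Prod>i<d. exp (- real_of_int ((z i)\<^sup>2))))"
  proof (rule sum_mono2)
    show "finite ?B" by (intro finite_PiE) auto
    show "lattice_net d \<subseteq> ?B" unfolding lattice_net_def by blast
  qed (intro mult_nonneg_nonneg prod_nonneg exp_ge_zero)
  also have "\<dots> = exp (16 * real d) * (\<Prod>i<d. \<Sum>z\<in>{- int (16 * d)..int (16 * d)}. exp (- real_of_int (z\<^sup>2)))"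
  proof -
    have "(\<Prod>i<d. \<Sum>z\<in>{- int (16 * d)..int (16 * d)}. exp (- real_of_int (z\<^sup>2)))
      = (\<Sum>z\<in>?B. \<Prod>i<d. exp (- real_of_int ((z i)\<^sup>2)))"
      by (rule prod_sum_PiE) auto
    then show ?thesis by (simp only: sum_distrib_left)
  qed
  also have "\<dots> \<le> exp (16 * real d) * (\<Prod>i<d. exp 2)"
  proof (intro mult_left_mono prod_mono conjI)
    fix i
    have "(\<Sum>z\<in>{- int (16 * d)..int (16 * d)}. exp (- real_of_int (z\<^sup>2))) \<le> 3"
    proof -
      have "3 - 2 * (1/2::real) ^ (16 * d) \<le> 3" by (simp only: diff_le_eq le_add_same_cancel1 mult_nonneg_nonneg zero_le_power zero_le_numeral zero_le_divide_1_iff)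
      with sum_exp_neg_square[of "16 * d"] show ?thesis by (rule order_trans)
    qed
    also have "\<dots> \<le> exp (2::real)" using exp_ge_add_one_self[of 2] by simp
    finally show "(\<Sum>z\<in>{- int (16 * d)..int (16 * d)}. exp (- real_of_int (z\<^sup>2))) \<le> exp 2" .
  qed (auto intro: sum_nonneg)
  also have "\<dots> = exp (18 * real d)"
  proof -
    have "(\<Prod>i<d. exp (2::real)) = exp 2 ^ d" by simp
    also have "\<dots> = exp (real d * 2)" by (rule exp_of_nat_mult[symmetric])
    finally have "(\<Prod>i<d. exp (2::real)) = exp (real d * 2)" .
    moreover have "16 * real d + real d * 2 = 18 * real d" by simp
    ultimately show ?thesis by (simp only: exp_add[symmetric])
  qed
  finally show ?thesis .
qed

lemma net_point_sqnorm:
  assumes "z \<in> lattice_net d"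
  shows "sqnorm d (net_point d z) \<le> 1"
proof (cases "d = 0")
  case False
  have "(\<Sum>i<d. (z i)\<^sup>2) \<le> 16 * int d" using assms by (simp add: lattice_net_def)
  then have "real_of_int (\<Sum>i<d. (z i)\<^sup>2) \<le> 16 * real d" by linarith
  then have "(\<Sum>i<d. (real_of_int (z i))\<^sup>2) \<le> 16 * real d" by simp
  moreover have "sqnorm d (net_point d z) = (\<Sum>i<d. (real_of_int (z i))\<^sup>2) / (16 * real d)"
    by (simp add: sqnorm_def net_point_def power_divide power_mult_distrib sum_divide_distrib)
  ultimately show ?thesis using False by simp
qed (simp add: sqnorm_def)

lemma net_covers:
  assumes d: "d > 0" and c: "sqnorm d c = 1"
  obtains z where "z \<in> lattice_net d" "sqnorm d (\<lambda>i. c i - net_point d z i) \<le> 1/16"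
proof -
  define L where "L = 4 * sqrt (real d)"
  have L: "L > 0" "L\<^sup>2 = 16 * real d" using d by (auto simp: L_def power_mult_distrib)
  \<comment> \<open>Rounding towards zero rather than to the nearest integer never increases
    absolute values, so the rounded point stays in the ball.\<close>
  define r :: "real \<Rightarrow> int" where "r x = (if x \<ge> 0 then \<lfloor>x\<rfloor> else - \<lfloor>- x\<rfloor>)" for x
  have r1: "\<bar>real_of_int (r x)\<bar> \<le> \<bar>x\<bar>" and r2: "\<bar>x - real_of_int (r x)\<bar> \<le> 1" for x
  proof -
    have fl: "real_of_int \<lfloor>y\<rfloor> \<le> y" "y \<le> real_of_int \<lfloor>y\<rfloor> + 1" for y :: real by linarith+
    have "\<bar>real_of_int (r x)\<bar> \<le> \<bar>x\<bar> \<and> \<bar>x - real_of_int (r x)\<bar> \<le> 1"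
    proof (cases "0 \<le> x")
      case True
      then have "0 \<le> real_of_int \<lfloor>x\<rfloor>" "r x = \<lfloor>x\<rfloor>" by (simp_all add: r_def)
      then have "\<bar>real_of_int (r x)\<bar> = real_of_int \<lfloor>x\<rfloor>" "\<bar>x\<bar> = x" "\<bar>x - real_of_int (r x)\<bar> = x - real_of_int \<lfloor>x\<rfloor>"
        using True fl[of x] by auto
      with fl[of x] show ?thesis by linarith
    next
      case False
      then have "0 \<le> real_of_int \<lfloor>- x\<rfloor>" "real_of_int (r x) = - real_of_int \<lfloor>- x\<rfloor>" by (simp_all add: r_def)
      with False fl[of "- x"] show ?thesis by (smt (verit))
    qed
    then show "\<bar>real_of_int (r x)\<bar> \<le> \<bar>x\<bar>" "\<bar>x - real_of_int (r x)\<bar> \<le> 1" by auto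
  qed
  define z where "z = restrict (\<lambda>i. r (L * c i)) {..<d}"
  have sq: "(real_of_int (z i))\<^sup>2 \<le> L\<^sup>2 * (c i)\<^sup>2" if "i < d" for i
  proof -
    have "(real_of_int (z i))\<^sup>2 \<le> (L * c i)\<^sup>2" using r1[of "L * c i"] that by (simp add: z_def abs_le_square_iff)
    then show ?thesis by (simp add: power_mult_distrib)
  qed
  have sum: "(\<Sum>i<d. (real_of_int (z i))\<^sup>2) \<le> 16 * real d"
  proof -
    have "(\<Sum>i<d. (real_of_int (z i))\<^sup>2) \<le> (\<Sum>i<d. L\<^sup>2 * (c i)\<^sup>2)" by (intro sum_mono sq) auto
    also have "\<dots> = L\<^sup>2" using c by (simp add: sum_distrib_left[symmetric] sqnorm_def)
    finally show ?thesis using L by simp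
  qed
  then have "real_of_int (\<Sum>i<d. (z i)\<^sup>2) \<le> real_of_int (16 * int d)" by simp
  then have sumi: "(\<Sum>i<d. (z i)\<^sup>2) \<le> 16 * int d" by (simp only: of_int_le_iff)
  have "z \<in> lattice_net d"
    unfolding lattice_net_def
  proof (intro CollectI conjI sumi)
    show "z \<in> Pi\<^sub>E {..<d} (\<lambda>_. {- int (16 * d)..int (16 * d)})"
    proof (rule PiE_I)
      fix i assume i: "i \<in> {..<d}"
      have "\<bar>z i\<bar> \<le> (z i)\<^sup>2"
      proof (cases "z i = 0")
        case False
        then have "\<bar>z i\<bar> * 1 \<le> \<bar>z i\<bar> * \<bar>z i\<bar>" by (intro mult_left_mono) auto
        then show ?thesis by (simp add: power2_eq_square)
      qed simp
      also have "(z i)\<^sup>2 \<le> (\<Sum>i<d. (z i)\<^sup>2)" using i by (intro member_le_sum) auto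
      finally show "z i \<in> {- int (16 * d)..int (16 * d)}" using sumi by (auto simp: abs_le_iff)
    qed (simp add: z_def)
  qed
  moreover have "sqnorm d (\<lambda>i. c i - net_point d z i) \<le> 1/16"
  proof -
    have "sqnorm d (\<lambda>i. c i - net_point d z i) \<le> (\<Sum>i<d. 1 / L\<^sup>2)"
      unfolding sqnorm_def
    proof (rule sum_mono)
      fix i assume "i \<in> {..<d}"
      then have "c i - net_point d z i = (L * c i - real_of_int (r (L * c i))) / L"
        using L by (simp add: net_point_def z_def L_def[symmetric] diff_divide_distrib)
      then have "(c i - net_point d z i)\<^sup>2 = (L * c i - real_of_int (r (L * c i)))\<^sup>2 / L\<^sup>2" by (simp add: power_divide)
      also have "\<dots> \<le> 1 / L\<^sup>2" using r2[of "L * c i"] by (intro divide_right_mono) (auto simp: abs_square_le_1)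
      finally show "(c i - net_point d z i)\<^sup>2 \<le> 1 / L\<^sup>2" .
    qed
    also have "\<dots> = 1/16" using L d by simp
    finally show ?thesis .
  qed
  ultimately show ?thesis by (rule that)
qed

text \<open>Take a unit eigenvector for the largest absolute eigenvalue \<open>S\<close> and a net
  point at distance at most 1/4. The two values of the form differ by at most
  \<open>S * (1/4) * 2\<close>, half of \<open>S\<close>, so \<open>S\<close> is at most
  \<open>t\<close> plus half of \<open>S\<close>.\<close>

lemma quadratic_form_net:
  assumes d: "d > 0" and G: "msym d G" and net: "\<And>z. z \<in> lattice_net d \<Longrightarrow> \<bar>qf d G (net_point d z)\<bar> \<le> t"
  shows "\<bar>qf d G x\<bar> \<le> 2 * t * sqnorm d x"
proof -
  obtain e la where e: "eigenbasis d G e la" using eigenbasis_exists[OF G] .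
  have on: "orthonormal d d e" using e by (simp add: eigenbasis_def)
  define S where "S = Max ((\<lambda>k. \<bar>la k\<bar>) ` {..<d})"
  have ne: "(\<lambda>k. \<bar>la k\<bar>) ` {..<d} \<noteq> {}" using d by auto
  have S: "\<bar>la k\<bar> \<le> S" if "k < d" for k unfolding S_def using that by (intro Max_ge) auto
  obtain k0 where k0: "k0 < d" "\<bar>la k0\<bar> = S" using Max_in[OF _ ne] unfolding S_def by auto
  have S0: "S \<ge> 0" using k0 by auto
  have bil: "\<bar>ip d x (mv d G y)\<bar> \<le> S * sqrt (sqnorm d x) * sqrt (sqnorm d y)" for x y
  proof -
    have "sqnorm d (mv d G y) = (\<Sum>k<d. (la k)\<^sup>2 * (ip d y (e k))\<^sup>2)"
      unfolding parseval_sqnorm[OF on] by (intro sum.cong) (auto simp: mv_eigen_ip[OF G e] power_mult_distrib)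
    also have "\<dots> \<le> (\<Sum>k<d. S\<^sup>2 * (ip d y (e k))\<^sup>2)"
      using S by (intro sum_mono mult_right_mono) (auto simp: abs_le_square_iff[symmetric] S0)
    also have "\<dots> = S\<^sup>2 * sqnorm d y" by (simp add: parseval_sqnorm[OF on] sum_distrib_left)
    finally have 1: "sqnorm d (mv d G y) \<le> S\<^sup>2 * sqnorm d y" .
    have "(ip d x (mv d G y))\<^sup>2 \<le> sqnorm d x * (S\<^sup>2 * sqnorm d y)"
      using ip_cauchy_schwarz[of d x "mv d G y"] mult_left_mono[OF 1, of "sqnorm d x"] by simp
    then have "sqrt ((ip d x (mv d G y))\<^sup>2) \<le> sqrt (sqnorm d x * (S\<^sup>2 * sqnorm d y))" by (rule real_sqrt_le_mono)
    then show ?thesis using S0 by (simp add: real_sqrt_mult mult_ac)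
  qed
  have ek: "sqnorm d (e k0) = 1" using k0 on by (simp add: sqnorm_ip orthonormal_def)
  have qk: "\<bar>qf d G (e k0)\<bar> = S"
  proof -
    have "qf d G (e k0) = ip d (e k0) (\<lambda>i. la k0 * e k0 i)"
      unfolding qf_def using e k0 by (intro ip_cong) (auto simp: eigenbasis_def)
    then show ?thesis using k0 ek by (simp add: ip_scale_right sqnorm_ip)
  qed
  obtain z where z: "z \<in> lattice_net d" "sqnorm d (\<lambda>i. e k0 i - net_point d z i) \<le> 1/16"
    using net_covers[OF d ek] .
  define v where "v = net_point d z"
  have v1: "sqnorm d v \<le> 1" unfolding v_def by (rule net_point_sqnorm[OF z(1)])
  have diff: "qf d G (e k0) - qf d G v = ip d (\<lambda>i. e k0 i - v i) (mv d G (\<lambda>i. e k0 i + v i))"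
    unfolding qf_def mv_add ip_add_right ip_diff_left
    using mv_sym_adjoint[OF G, of v "e k0"] ip_commute[of d "mv d G v" "e k0"] by simp
  have s4: "sqnorm d (\<lambda>i. e k0 i + v i) \<le> 4"
  proof -
    have "sqnorm d (\<lambda>i. e k0 i + v i) \<le> (\<Sum>i<d. 2 * (e k0 i)\<^sup>2 + 2 * (v i)\<^sup>2)"
      unfolding sqnorm_def
    proof (rule sum_mono)
      fix i
      show "(e k0 i + v i)\<^sup>2 \<le> 2 * (e k0 i)\<^sup>2 + 2 * (v i)\<^sup>2"
        using sum_squares_bound[of "e k0 i" "v i"] by (simp add: power2_sum)
    qed
    also have "\<dots> = 2 * sqnorm d (e k0) + 2 * sqnorm d v" by (simp add: sqnorm_def sum.distrib sum_distrib_left)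
    finally show ?thesis using ek v1 by simp
  qed
  have "\<bar>qf d G (e k0) - qf d G v\<bar> \<le> S * (1/4) * 2"
  proof -
    have "sqrt (sqnorm d (\<lambda>i. e k0 i - v i)) \<le> 1/4"
      using z(2) by (intro real_le_lsqrt) (auto simp: v_def power_divide)
    moreover have "sqrt (sqnorm d (\<lambda>i. e k0 i + v i)) \<le> 2" using s4 by (intro real_le_lsqrt) auto
    ultimately have "S * sqrt (sqnorm d (\<lambda>i. e k0 i - v i)) * sqrt (sqnorm d (\<lambda>i. e k0 i + v i)) \<le> S * (1/4) * 2"
      using S0 by (intro mult_mono mult_left_mono) auto
    then show ?thesis unfolding diff using bil[of "\<lambda>i. e k0 i - v i" "\<lambda>i. e k0 i + v i"] by linarith
  qed
  then have "S \<le> 2 * t" using net[OF z(1)] qk unfolding v_def by linarith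
  moreover have "\<bar>qf d G x\<bar> \<le> S * sqnorm d x"
    using bil[of x x] by (simp add: qf_def mult.assoc)
  ultimately show ?thesis by (meson mult_right_mono order_trans sqnorm_nonneg)
qed

section \<open>Second moments and whitening\<close>

lemma second_moment_sym: "msym d (second_moment P)"
  by (simp add: msym_def second_moment_def mult.commute)

lemma mean_zero_l2_measurable:
  assumes "mean_zero_l2 d P" "i < d"
  shows "(\<lambda>x. x i) \<in> borel_measurable P"
  using assms unfolding mean_zero_l2_def by (auto dest: borel_measurable_integrable)

lemma second_moment_bilinear:
  assumes P: "mean_zero_l2 d P"
  shows "integrable P (\<lambda>x. ip d u x * ip d v x)"
    and "(\<integral>x. ip d u x * ip d v x \<partial>P) = ip d u (mv d (second_moment P) v)"
proof -
  have e: "ip d u x * ip d v x = (\<Sum>i<d. \<Sum>j<d. (u i * v j) * (x i * x j))" for x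
    unfolding ip_def sum_product by (intro sum.cong refl) (simp add: mult_ac)
  have i: "integrable P (\<lambda>x. x i * x j)" if "i < d" "j < d" for i j
    using P that by (simp add: mean_zero_l2_def)
  show "integrable P (\<lambda>x. ip d u x * ip d v x)"
    unfolding e by (intro Bochner_Integration.integrable_sum integrable_mult_right i) auto
  have "(\<integral>x. ip d u x * ip d v x \<partial>P) = (\<Sum>i<d. \<Sum>j<d. (u i * v j) * (\<integral>x. x i * x j \<partial>P))"
    unfolding e
    by (intro has_bochner_integral_integral_eq has_bochner_integral_sum has_bochner_integral_mult_right
        has_bochner_integral_integrable i) auto
  also have "\<dots> = ip d u (mv d (second_moment P) v)"
    unfolding ip_def mv_def second_moment_def sum_distrib_left by (intro sum.cong refl) (simp add: mult_ac)
  finally show "(\<integral>x. ip d u x * ip d v x \<partial>P) = ip d u (mv d (second_moment P) v)" .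
qed

lemma second_moment_psd:
  assumes "mean_zero_l2 d P"
  shows "mpsd d (second_moment P)"
proof (rule mpsdI[OF second_moment_sym])
  fix x
  have "0 \<le> (\<integral>y. ip d x y * ip d x y \<partial>P)" by simp
  then show "0 \<le> qf d (second_moment P) x" unfolding second_moment_bilinear(2)[OF assms] qf_def .
qed

text \<open>Eigencoordinates divided by the standard deviations, with zero in the directions of the
  kernel. It is a function of \<open>x\<close> itself, whereas the whitened vector in
  \<open>subgaussian\<close> is only known to exist.\<close>

definition whiten :: "nat \<Rightarrow> (nat \<Rightarrow> nat \<Rightarrow> real) \<Rightarrow> (nat \<Rightarrow> real) \<Rightarrow> (nat \<Rightarrow> real) \<Rightarrow> (nat \<Rightarrow> real)" where
  "whiten d e la x = (\<lambda>k. if la k > 0 then ip d (e k) x / sqrt (la k) else 0)"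

lemma whiten_linear:
  "(\<Sum>k<d. c k * whiten d e la x k) = ip d (\<lambda>i. \<Sum>k<d. (if la k > 0 then c k / sqrt (la k) else 0) * e k i) x"
  unfolding ip_sum_left ip_scale_left whiten_def by (intro sum.cong) auto

lemma whiten_variance:
  assumes P: "mean_zero_l2 d P" and e: "eigenbasis d (second_moment P) e la"
  shows "(\<integral>x. (\<Sum>k<d. c k * whiten d e la x k)\<^sup>2 \<partial>P) = (\<Sum>k<d. if la k > 0 then (c k)\<^sup>2 else 0)"
proof -
  define w where "w = (\<lambda>i. \<Sum>k<d. (if la k > 0 then c k / sqrt (la k) else 0) * e k i)"
  have on: "orthonormal d d e" using e by (simp add: eigenbasis_def)
  have "(\<integral>x. (\<Sum>k<d. c k * whiten d e la x k)\<^sup>2 \<partial>P) = qf d (second_moment P) w"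
    unfolding whiten_linear w_def[symmetric] power2_eq_square second_moment_bilinear(2)[OF P] qf_def ..
  also have "\<dots> = (\<Sum>k<d. la k * (ip d w (e k))\<^sup>2)" by (rule qf_eigen[OF second_moment_sym e])
  also have "\<dots> = (\<Sum>k<d. if la k > 0 then (c k)\<^sup>2 else 0)"
  proof (intro sum.cong refl)
    fix k assume k: "k \<in> {..<d}"
    have "ip d w (e k) = (if la k > 0 then c k / sqrt (la k) else 0)"
      unfolding w_def using k by (intro ip_lincomb[OF on]) auto
    moreover have "0 \<le> la k" using mpsd_eigen_nonneg[OF second_moment_psd[OF P] e] k by simp
    ultimately show "la k * (ip d w (e k))\<^sup>2 = (if la k > 0 then (c k)\<^sup>2 else 0)"
      by (simp add: power_divide)
  qed
  finally show ?thesis .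
qed

text \<open>The vector \<open>xb\<close> of the definition is arbitrary in the kernel directions and
  need not be centred. Along positive eigendirections its coordinates agree almost everywhere with
  \<open>whiten\<close>, so the combination equals \<open>ip d w (xb x)\<close> with a
  \<open>w\<close> no longer than \<open>c\<close>; its mean vanishes because the mean of
  \<open>P\<close> does, and the centring in the definition has no effect on it.\<close>

lemma whiten_mgf:
  assumes P: "mean_zero_l2 d P" and e: "eigenbasis d (second_moment P) e la" and sub: "subgaussian d \<rho> P"
  shows "(\<integral>\<^sup>+x. ennreal (exp (s * (\<Sum>k<d. c k * whiten d e la x k))) \<partial>P) \<le> ennreal (exp (s\<^sup>2 * \<rho>\<^sup>2 * sqnorm d c / 2))"
proof -
  interpret prob_space P using P by (simp add: mean_zero_l2_def)
  have on: "orthonormal d d e" using e by (simp add: eigenbasis_def)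
  obtain xb where xi: "\<And>i. i < d \<Longrightarrow> integrable P (\<lambda>x. xb x i)"
    and xa: "AE x in P. \<forall>i<d. x i = mv d (msqrt d (second_moment P)) (xb x) i"
    and xs: "\<And>v s. sqnorm d v = 1 \<Longrightarrow> (\<integral>\<^sup>+x. ennreal (exp (s * (\<Sum>i<d. v i * (xb x i - (\<integral>y. xb y i \<partial>P))))) \<partial>P)
             \<le> ennreal (exp (s\<^sup>2 * \<rho>\<^sup>2 / 2))"
    using sub unfolding subgaussian_def by blast
  have psd: "mpsd d (second_moment P)" by (rule second_moment_psd[OF P])
  define b where "b k = (if la k > 0 then c k else 0)" for k
  define w where "w = (\<lambda>i. \<Sum>k<d. b k * e k i)"
  define Y where "Y x = (\<Sum>k<d. c k * whiten d e la x k)" for x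
  have Yeq: "Y x = (\<Sum>k<d. (if la k > 0 then c k / sqrt (la k) else 0) * ip d (e k) x)" for x
    unfolding Y_def whiten_def by (intro sum.cong) auto
  have wn: "sqnorm d w = (\<Sum>k<d. (b k)\<^sup>2)"
    unfolding parseval_sqnorm[OF on] w_def by (intro sum.cong) (auto simp: ip_lincomb[OF on])
  have wle: "sqnorm d w \<le> sqnorm d c"
    unfolding wn sqnorm_def[of d c] by (intro sum_mono) (auto simp: b_def)
  define S where "S = msqrt d (second_moment P)"
  have eS: "ip d (e k) (mv d S x) = sqrt (la k) * ip d (e k) x" if k: "k < d" for k x
  proof -
    have symS: "msym d S" using psd_sqrt_spectral(1,2)[OF psd e] by (simp add: S_def mpsd_def)
    have "mv d S (e k) i = sqrt (la k) * e k i" if "i < d" for i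
    proof -
      have "mv d S (e k) i = (\<Sum>j<d. (\<Sum>l<d. sqrt (la l) * (e l i * e l j)) * e k j)"
        unfolding S_def psd_sqrt_spectral(1)[OF psd e] mv_def using that by (intro sum.cong) auto
      also have "\<dots> = (\<Sum>l<d. sqrt (la l) * e l i * ip d (e l) (e k))"
        unfolding ip_def sum_distrib_left sum_distrib_right by (subst sum.swap) (simp add: mult_ac)
      also have "\<dots> = (\<Sum>l<d. if l = k then sqrt (la l) * e l i else 0)"
        using k by (intro sum.cong) (auto simp: orthonormal_ip[OF on])
      finally show ?thesis using k by simp
    qed
    then have "ip d (mv d S (e k)) x = ip d (\<lambda>i. sqrt (la k) * e k i) x" by (intro ip_cong) auto
    then show ?thesis using mv_sym_adjoint[OF symS, of "e k" x] by (simp add: ip_scale_left)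
  qed
  have Yx: "AE x in P. Y x = ip d w (xb x)"
    using xa
  proof eventually_elim
    case (elim x)
    have "Y x = (\<Sum>k<d. b k * ip d (e k) (xb x))"
      unfolding Yeq
    proof (intro sum.cong refl)
      fix k assume k: "k \<in> {..<d}"
      have "ip d (e k) x = ip d (e k) (mv d S (xb x))" using elim by (intro ip_cong) (auto simp: S_def)
      then show "(if la k > 0 then c k / sqrt (la k) else 0) * ip d (e k) x = b k * ip d (e k) (xb x)"
        using k by (auto simp: eS b_def)
    qed
    also have "\<dots> = ip d w (xb x)" unfolding w_def ip_sum_left ip_scale_left ..
    finally show ?case .
  qed
  have mi: "integrable P (\<lambda>x. ip d (e k) x)" "(\<integral>x. ip d (e k) x \<partial>P) = 0" for k
    using P unfolding mean_zero_l2_def ip_def by auto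
  have Ei: "integrable P (\<lambda>x. ip d w (xb x))" unfolding ip_def using xi by auto
  have "(\<integral>x. ip d w (xb x) \<partial>P) = (\<integral>x. Y x \<partial>P)"
  proof (rule integral_cong_AE)
    show "Y \<in> borel_measurable P" unfolding Yeq using mi by (auto intro!: borel_measurable_sum borel_measurable_times dest: borel_measurable_integrable)
  qed (use Yx Ei in auto)
  also have "\<dots> = 0" unfolding Yeq using mi by (subst Bochner_Integration.integral_sum) auto
  finally have E0: "(\<Sum>i<d. w i * (\<integral>y. xb y i \<partial>P)) = 0" unfolding ip_def using xi by (subst (asm) Bochner_Integration.integral_sum) auto
  have Yc: "AE x in P. Y x = (\<Sum>i<d. w i * (xb x i - (\<integral>y. xb y i \<partial>P)))"
    using Yx
  proof eventually_elim
    case (elim x)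
    then show ?case using E0 by (simp add: ip_def right_diff_distrib sum_subtractf)
  qed
  have "(\<integral>\<^sup>+x. ennreal (exp (s * Y x)) \<partial>P) \<le> ennreal (exp (s\<^sup>2 * \<rho>\<^sup>2 * sqnorm d w / 2))"
  proof (cases "sqnorm d w = 0")
    case True
    then have "w i = 0" if "i < d" for i using that by (simp add: sqnorm_eq_0_iff)
    then have "AE x in P. ennreal (exp (s * Y x)) = 1" using Yx by (simp add: ip_def)
    then have "(\<integral>\<^sup>+x. ennreal (exp (s * Y x)) \<partial>P) = (\<integral>\<^sup>+x. 1 \<partial>P)" by (rule nn_integral_cong_AE)
    then show ?thesis using True by (simp add: emeasure_space_1)
  next
    case False
    define r where "r = sqrt (sqnorm d w)"
    have r: "r > 0" "r\<^sup>2 = sqnorm d w" using False sqnorm_nonneg[of d w] by (auto simp: r_def order.strict_iff_order)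
    define v where "v i = 1 / r * w i" for i
    have "sqnorm d v = 1" unfolding v_def sqnorm_scale using r False by (simp add: power_divide)
    from xs[OF this, of "s * r"]
    have *: "(\<integral>\<^sup>+x. ennreal (exp (s * r * (\<Sum>i<d. v i * (xb x i - (\<integral>y. xb y i \<partial>P))))) \<partial>P)
             \<le> ennreal (exp ((s * r)\<^sup>2 * \<rho>\<^sup>2 / 2))" .
    have vw: "s * r * (\<Sum>i<d. v i * (xb x i - (\<integral>y. xb y i \<partial>P))) = s * (\<Sum>i<d. w i * (xb x i - (\<integral>y. xb y i \<partial>P)))" for x
    proof -
      have "(\<Sum>i<d. w i * (xb x i - (\<integral>y. xb y i \<partial>P))) = r * (\<Sum>i<d. v i * (xb x i - (\<integral>y. xb y i \<partial>P)))"
        unfolding sum_distrib_left v_def using r by (intro sum.cong) auto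
      then show ?thesis by simp
    qed
    have "(\<integral>\<^sup>+x. ennreal (exp (s * Y x)) \<partial>P) = (\<integral>\<^sup>+x. ennreal (exp (s * r * (\<Sum>i<d. v i * (xb x i - (\<integral>y. xb y i \<partial>P))))) \<partial>P)"
      unfolding vw by (rule nn_integral_cong_AE) (use Yc in auto)
    also note *
    also have "(s * r)\<^sup>2 * \<rho>\<^sup>2 / 2 = s\<^sup>2 * \<rho>\<^sup>2 * sqnorm d w / 2" using r by (simp add: power_mult_distrib mult_ac)
    finally show ?thesis .
  qed
  also have "\<dots> \<le> ennreal (exp (s\<^sup>2 * \<rho>\<^sup>2 * sqnorm d c / 2))"
    using wle by (intro ennreal_leI) (simp add: mult_left_mono divide_right_mono)
  finally show ?thesis unfolding Y_def .
qed

section \<open>Concentration of the empirical covariance\<close>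

lemma emp_cov_qf: "qf d (emp_cov n X) u = (\<Sum>k<n. (ip d u (X k))\<^sup>2) / real n"
proof -
  have "qf d (emp_cov n X) u = (\<Sum>i<d. \<Sum>j<d. \<Sum>k<n. (u i * X k i) * (u j * X k j) / real n)"
    unfolding qf_def ip_def mv_def emp_cov_def sum_distrib_left
    by (intro sum.cong refl) (simp add: sum_divide_distrib sum_distrib_left sum_distrib_right mult_ac)
  also have "\<dots> = (\<Sum>k<n. \<Sum>i<d. \<Sum>j<d. (u i * X k i) * (u j * X k j) / real n)"
    by (subst sum.swap[of _ "{..<d}" "{..<n}"], subst sum.swap[of _ "{..<d}" "{..<n}"]) (rule refl)
  also have "\<dots> = (\<Sum>k<n. (ip d u (X k))\<^sup>2) / real n"
    unfolding ip_def power2_eq_square sum_product sum_divide_distrib ..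
  finally show ?thesis .
qed

text \<open>A bound relative to the form of the second-moment matrix is an absolute bound in
  whitened coordinates, where the net applies. There the target is the projection onto the positive
  eigendirections, and the kernel directions are removed by a null set.\<close>

theorem covariance_concentration:
  fixes \<rho> \<delta> :: real
  assumes d: "d > 0" and n: "n > 0" and P: "mean_zero_l2 d P" and sub: "subgaussian d \<rho> P" and \<rho>: "\<rho> > 0"
    and \<delta>: "0 < \<delta>" "\<delta> < 1" and large: "300000 * \<rho> ^ 4 * (real d + ln (1 / \<delta>)) \<le> real n"
  defines "\<epsilon> \<equiv> sqrt (\<rho> ^ 4 * (real d + ln (1 / \<delta>)) / real n)"
  shows "\<exists>E \<in> sets (PiM {..<n} (\<lambda>_. P)). 1 - \<delta> \<le> measure (PiM {..<n} (\<lambda>_. P)) E \<and>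
    (\<forall>X\<in>E. \<forall>u. \<bar>qf d (emp_cov n X) u - qf d (second_moment P) u\<bar> \<le> 260 * \<epsilon> * qf d (second_moment P) u)"
proof -
  interpret P: prob_space P using P by (simp add: mean_zero_l2_def)
  define PU where "PU = PiM {..<n} (\<lambda>_. P)"
  interpret PU: prob_space PU unfolding PU_def by (intro prob_space_PiM P.prob_space_axioms)
  define Sig where "Sig = second_moment P"
  have psd: "mpsd d Sig" unfolding Sig_def by (rule second_moment_psd[OF P])
  obtain e la where e: "eigenbasis d Sig e la"
    using eigenbasis_exists[of d Sig] psd by (auto simp: mpsd_def)
  have on: "orthonormal d d e" using e by (simp add: eigenbasis_def)
  have la: "0 \<le> la k" if "k < d" for k using mpsd_eigen_nonneg[OF psd e that] .
  define L where "L = real d + ln (1 / \<delta>)"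
  have lnpos: "0 < ln (1 / \<delta>)" using \<delta> by simp
  have L: "L > 0" "real d \<le> L" using lnpos d by (auto simp: L_def)
  have eps: "\<epsilon> > 0" "\<epsilon>\<^sup>2 = \<rho> ^ 4 * L / real n"
    unfolding \<epsilon>_def L_def[symmetric] using L \<rho> n by auto
  define t where "t = 130 * \<epsilon>"
  have t: "t > 0" using eps by (simp add: t_def)
  define y where "y = whiten d e la"
  define Z where "Z z x = (\<Sum>k<d. net_point d z k * y x k)" for z x
  define V where "V z = (\<integral>x. (Z z x)\<^sup>2 \<partial>P)" for z
  have Vz: "V z = (\<Sum>k<d. if la k > 0 then (net_point d z k)\<^sup>2 else 0)" for z
    unfolding V_def Z_def y_def by (rule whiten_variance[OF P e[unfolded Sig_def]])
  have ipm [measurable]: "(\<lambda>x. ip d u x) \<in> borel_measurable P" for u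
    unfolding ip_def using mean_zero_l2_measurable[OF P] by measurable
  have ym: "(\<lambda>x. y x k) \<in> borel_measurable P" for k
    unfolding y_def whiten_def by (cases "la k > 0") auto
  have Zm [measurable]: "Z z \<in> borel_measurable P" for z unfolding Z_def using ym by measurable
  have sgv: "subgaussian_variable P (\<lambda>x. \<Sum>k<d. c k * y x k) \<rho>" if c: "sqnorm d c \<le> 1" for c
  proof (unfold_locales)
    show "(\<lambda>x. \<Sum>k<d. c k * y x k) \<in> borel_measurable P" using ym by measurable
    show "\<rho> > 0" by fact
    fix s
    have "(\<integral>\<^sup>+x. ennreal (exp (s * (\<Sum>k<d. c k * y x k))) \<partial>P) \<le> ennreal (exp (s\<^sup>2 * \<rho>\<^sup>2 * sqnorm d c / 2))"
      unfolding y_def by (rule whiten_mgf[OF P e[unfolded Sig_def] sub])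
    also have "\<dots> \<le> ennreal (exp (s\<^sup>2 * \<rho>\<^sup>2 / 2))"
    proof (intro ennreal_leI)
      have "s\<^sup>2 * \<rho>\<^sup>2 * sqnorm d c \<le> s\<^sup>2 * \<rho>\<^sup>2 * 1" using c by (intro mult_left_mono) auto
      then show "exp (s\<^sup>2 * \<rho>\<^sup>2 * sqnorm d c / 2) \<le> exp (s\<^sup>2 * \<rho>\<^sup>2 / 2)" by simp
    qed
    finally show "(\<integral>\<^sup>+x. ennreal (exp (s * (\<Sum>k<d. c k * y x k))) \<partial>P) \<le> ennreal (exp (s\<^sup>2 * \<rho>\<^sup>2 / 2))" .
  qed
  define S where "S z X = (\<Sum>k<n. (Z z (X k))\<^sup>2 - V z)" for z X
  have cm: "(\<lambda>X. f (X k)) \<in> borel_measurable PU" if "k < n" "f \<in> borel_measurable P" for f :: "_ \<Rightarrow> real" and k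
    unfolding PU_def using measurable_compose[OF measurable_component_singleton[of k "{..<n}" "\<lambda>_. P"] that(2)] that(1) by simp
  have Sm [measurable]: "S z \<in> borel_measurable PU" for z
    unfolding S_def by (intro borel_measurable_sum borel_measurable_diff borel_measurable_power borel_measurable_const cm Zm) auto
  define Bad where "Bad z = {X \<in> space PU. real n * t \<le> \<bar>S z X\<bar>}" for z
  have Bm [measurable]: "Bad z \<in> sets PU" for z unfolding Bad_def by measurable
  have badp: "emeasure PU (Bad z) \<le> ennreal (2 * exp (- (21 * L)))" if z: "z \<in> lattice_net d" for z
  proof (cases "\<exists>k<d. la k > 0")
    case False
    then have "Z z x = 0" "V z = 0" for x by (auto simp: Vz Z_def y_def whiten_def intro!: sum.neutral)
    then have "S z X = 0" for X by (simp add: S_def)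
    moreover have "real n * t > 0" using n t by simp
    ultimately have "Bad z = {}" unfolding Bad_def by auto
    then show ?thesis by simp
  next
    case True
    then obtain k where k: "k < d" "la k > 0" by auto
    \<comment> \<open>A whitened coordinate has variance one, so \<open>\<rho>\<close> cannot be
      small. This brings the deviation \<open>t\<close> into the range allowed by the Chernoff
      bound.\<close>
    have "1 \<le> 2 * \<rho>\<^sup>2"
    proof -
      define c where "c = (\<lambda>i. if i = k then 1 else 0 :: real)"
      have c1: "sqnorm d c = 1" using ip_unit[OF k(1), of c] by (simp add: c_def sqnorm_ip)
      interpret sv: subgaussian_variable P "\<lambda>x. \<Sum>k<d. c k * y x k" \<rho> using c1 by (intro sgv) simp
      have "(\<integral>x. (\<Sum>k<d. c k * y x k)\<^sup>2 \<partial>P) = (\<Sum>i<d. if la i > 0 then (c i)\<^sup>2 else 0)"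
        unfolding y_def by (rule whiten_variance[OF P e[unfolded Sig_def]])
      also have "\<dots> = (\<Sum>i<d. (c i)\<^sup>2)" using k by (intro sum.cong) (auto simp: c_def)
      also have "\<dots> = 1" using c1 by (simp add: sqnorm_def)
      finally show ?thesis using sv.second_moment_le by simp
    qed
    have "\<epsilon>\<^sup>2 \<le> (1/10)\<^sup>2"
    proof -
      have "\<rho> ^ 4 * L * 300000 \<le> real n" using large by (simp add: L_def mult_ac)
      then have "\<rho> ^ 4 * L / real n \<le> 1 / 300000" using n by (simp add: field_simps)
      also have "1 / 300000 \<le> (1/10::real)\<^sup>2" by (simp add: power_divide)
      finally show ?thesis unfolding eps(2) .
    qed
    then have "\<epsilon> \<le> 1/10" by (rule power2_le_imp_le) simp
    then have t50: "t \<le> 50 * \<rho>\<^sup>2" using \<open>1 \<le> 2 * \<rho>\<^sup>2\<close> unfolding t_def by linarith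
    interpret sv: subgaussian_variable P "Z z" \<rho> unfolding Z_def by (rule sgv[OF net_point_sqnorm[OF z]])
    \<comment> \<open>The factor 130 in \<open>t\<close> is chosen to make 16900/800 exceed 21. The
      union bound spends 18 of these on the size of the net; the rest covers the factor 2 and the
      confidence level.\<close>
    have "real n * t\<^sup>2 / (800 * \<rho> ^ 4) = 16900 / 800 * L"
      using n \<rho> by (simp add: t_def power_mult_distrib eps(2))
    then have "21 * L \<le> real n * t\<^sup>2 / (800 * \<rho> ^ 4)" using L by simp
    then have "2 * exp (- (real n * t\<^sup>2 / (800 * \<rho> ^ 4))) \<le> 2 * exp (- (21 * L))" by simp
    then show ?thesis
      using sv.chernoff_square[OF t t50 n] unfolding Bad_def S_def V_def PU_def
      by (meson ennreal_leI order_trans)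
  qed
  define B where "B = (\<Union>z\<in>lattice_net d. Bad z)"
  have Bsets [measurable]: "B \<in> sets PU" unfolding B_def by (intro sets.finite_UN finite_lattice_net Bm)
  have "emeasure PU B \<le> (\<Sum>z\<in>lattice_net d. emeasure PU (Bad z))"
    unfolding B_def by (rule emeasure_subadditive_finite) (use finite_lattice_net in auto)
  also have "\<dots> \<le> (\<Sum>z\<in>lattice_net d. ennreal (2 * exp (- (21 * L))))" by (intro sum_mono badp)
  also have "\<dots> = ennreal (real (card (lattice_net d)) * (2 * exp (- (21 * L))))"
    by (simp add: ennreal_mult ennreal_of_nat_eq_real_of_nat)
  also have "\<dots> \<le> ennreal \<delta>"
  proof (intro ennreal_leI)
    have "real (card (lattice_net d)) * (2 * exp (- (21 * L))) \<le> exp (18 * real d) * (exp 1 * exp (- (21 * L)))"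
      using exp_ge_add_one_self[of 1] by (intro mult_mono card_lattice_net) auto
    also have "\<dots> = exp (18 * real d + (1 - 21 * L))" by (simp only: exp_add[symmetric] add_uminus_conv_diff)
    also have "\<dots> \<le> exp (- ln (1 / \<delta>))"
    proof -
      have "18 * real d + (1 - 21 * L) \<le> - ln (1 / \<delta>)" using d lnpos by (simp add: L_def)
      then show ?thesis by simp
    qed
    also have "\<dots> = \<delta>" using \<delta> by (simp add: ln_div)
    finally show "real (card (lattice_net d)) * (2 * exp (- (21 * L))) \<le> \<delta>" .
  qed
  finally have Bp: "measure PU B \<le> \<delta>" using \<delta> by (simp add: PU.emeasure_eq_measure)
  \<comment> \<open>A direction with eigenvalue zero has second moment zero, so almost surely no
    sample has a component in it. Exact vanishing is needed: a relative bound allows no error at all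
    on the kernel.\<close>
  define nullset where "nullset X \<longleftrightarrow> (\<forall>k<n. \<forall>l<d. la l = 0 \<longrightarrow> ip d (e l) (X k) = 0)" for X
  have nullAE: "AE X in PU. nullset X"
  proof -
    have "AE x in P. ip d (e l) x = 0" if l: "l < d" "la l = 0" for l
    proof -
      have "(\<integral>x. ip d (e l) x * ip d (e l) x \<partial>P) = qf d Sig (e l)"
        unfolding second_moment_bilinear(2)[OF P] Sig_def qf_def ..
      also have "\<dots> = ip d (e l) (\<lambda>i. la l * e l i)"
        unfolding qf_def using e l by (intro ip_cong) (auto simp: eigenbasis_def)
      also have "\<dots> = 0" using l by (simp add: ip_def)
      finally have "AE x in P. ip d (e l) x * ip d (e l) x = 0"
        using integral_nonneg_eq_0_iff_AE[OF second_moment_bilinear(1)[OF P, of "e l" "e l"]] by simp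
      then show ?thesis by simp
    qed
    then have "AE X in PU. ip d (e l) (X k) = 0" if "k < n" "l < d" "la l = 0" for k l
      unfolding PU_def using that P.prob_space_axioms by (intro AE_PiM_component) auto
    then show ?thesis unfolding nullset_def by (auto simp: AE_all_countable)
  qed
  have nullm: "{X \<in> space PU. nullset X} \<in> sets PU"
  proof -
    have "{X \<in> space PU. nullset X} = {X \<in> space PU. \<forall>k\<in>{..<n}. \<forall>l\<in>{..<d}. la l = 0 \<longrightarrow> ip d (e l) (X k) = 0}"
      by (auto simp: nullset_def)
    also have "\<dots> \<in> sets PU"
    proof (intro sets.sets_Collect_finite_All sets.sets_Collect_imp)
      fix k l assume "k \<in> {..<n}" "l \<in> {..<d}"
      have "(\<lambda>X. ip d (e l) (X k)) \<in> borel_measurable PU" using \<open>k \<in> {..<n}\<close> by (intro cm ipm) auto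
      then show "{X \<in> space PU. ip d (e l) (X k) = 0} \<in> sets PU" by measurable
    qed auto
    finally show ?thesis .
  qed
  define E where "E = {X \<in> space PU. nullset X} - B"
  have Es: "E \<in> sets PU" unfolding E_def using nullm by auto
  have "measure PU (space PU - B) \<le> measure PU E"
    using nullAE Es by (intro PU.finite_measure_mono_AE) (auto simp: E_def)
  moreover have "measure PU (space PU - B) = 1 - measure PU B" by (rule PU.prob_compl[OF Bsets])
  ultimately have Ep: "1 - \<delta> \<le> measure PU E" using Bp by linarith
  have "\<bar>qf d (emp_cov n X) u - qf d Sig u\<bar> \<le> 260 * \<epsilon> * qf d Sig u" if X: "X \<in> E" for X u
  proof -
    \<comment> \<open>The whitened empirical covariance minus the projection onto the positive
      eigendirections.\<close>
    define G where "G i j = (\<Sum>k<n. y (X k) i * y (X k) j) / real n - (if i = j \<and> la i > 0 then 1 else 0)" for i j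
    have Gsym: "msym d G" by (auto simp: msym_def G_def mult.commute)
    have qG: "qf d G c = (\<Sum>k<n. (\<Sum>i<d. c i * y (X k) i)\<^sup>2) / real n - (\<Sum>i<d. if la i > 0 then (c i)\<^sup>2 else 0)" for c
    proof -
      have "qf d G c = qf d (emp_cov n (\<lambda>k. y (X k))) c - (\<Sum>i<d. \<Sum>j<d. if i = j then (if la i > 0 then (c i)\<^sup>2 else 0) else 0)"
        unfolding qf_def ip_def mv_def emp_cov_def G_def sum_distrib_left sum_subtractf[symmetric]
        by (intro sum.cong refl) (auto simp: algebra_simps power2_eq_square)
      then show ?thesis by (simp add: emp_cov_qf ip_def)
    qed
    have "\<bar>qf d G (net_point d z)\<bar> \<le> t" if z: "z \<in> lattice_net d" for z
    proof -
      have "X \<notin> Bad z" "X \<in> space PU" using X z by (auto simp: E_def B_def)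
      then have "\<bar>S z X\<bar> \<le> real n * t" by (simp add: Bad_def)
      then have "\<bar>S z X\<bar> / real n \<le> real n * t / real n" by (rule divide_right_mono) simp
      moreover have "qf d G (net_point d z) = S z X / real n"
        unfolding qG Vz[symmetric] S_def Z_def using n by (simp add: sum_subtractf diff_divide_distrib)
      ultimately show ?thesis using n by (simp add: abs_divide)
    qed
    from quadratic_form_net[OF d Gsym this] have all: "\<bar>qf d G c\<bar> \<le> 2 * t * sqnorm d c" for c by blast
    \<comment> \<open>With these coefficients the Euclidean square norm is the target form at
      \<open>u\<close>, and pairing with a whitened sample gives back
      \<open>ip d u (X k)\<close>.\<close>
    define c where "c l = sqrt (la l) * ip d u (e l)" for l
    have cn: "sqnorm d c = qf d Sig u"
      unfolding qf_eigen[OF psd[unfolded mpsd_def, THEN conjunct1] e] sqnorm_def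
      by (intro sum.cong) (auto simp: c_def power_mult_distrib la)
    have cI: "(\<Sum>i<d. if la i > 0 then (c i)\<^sup>2 else 0) = sqnorm d c"
      unfolding sqnorm_def using la by (intro sum.cong) (auto simp: c_def order.strict_iff_order)
    have "(\<Sum>i<d. c i * y (X k) i) = ip d u (X k)" if k: "k < n" for k
    proof -
      have "(\<Sum>i<d. c i * y (X k) i) = (\<Sum>i<d. ip d u (e i) * ip d (X k) (e i))"
      proof (intro sum.cong refl)
        fix i assume i: "i \<in> {..<d}"
        show "c i * y (X k) i = ip d u (e i) * ip d (X k) (e i)"
        proof (cases "la i > 0")
          case True
          then show ?thesis by (simp add: c_def y_def whiten_def ip_commute[of d "X k" "e i"])
        next
          case False
          then have "la i = 0" using la[of i] i by simp
          then have "ip d (e i) (X k) = 0" using X k i by (auto simp: E_def nullset_def)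
          then show ?thesis using \<open>la i = 0\<close> by (simp add: c_def ip_commute[of d "X k" "e i"])
        qed
      qed
      also have "\<dots> = ip d u (X k)" by (rule parseval[OF on, symmetric])
      finally show ?thesis .
    qed
    then have "qf d G c = qf d (emp_cov n X) u - qf d Sig u" unfolding qG emp_cov_qf cI cn by simp
    then show ?thesis using all[of c] unfolding cn t_def by simp
  qed
  then show ?thesis using Es Ep unfolding PU_def Sig_def by blast
qed

section \<open>Linear estimators\<close>

text \<open>The trace of the transpose of \<open>A\<close> times \<open>T\<close> times
  \<open>A\<close>, written by columns so that inequalities between quadratic forms can be applied
  to each summand.\<close>

definition variance_sum :: "nat \<Rightarrow> nat \<Rightarrow> (nat \<Rightarrow> nat \<Rightarrow> real) \<Rightarrow> (nat \<Rightarrow> nat \<Rightarrow> real) \<Rightarrow> real" where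
  "variance_sum d n T A = (\<Sum>k<n. qf d T (\<lambda>i. A i k))"

lemma qf_scale: "qf n T (\<lambda>i. c * x i) = c\<^sup>2 * qf n T x"
  unfolding qf_def mv_scale ip_scale_left ip_scale_right by (simp add: power2_eq_square)

lemma qf_cong: "(\<And>i. i < n \<Longrightarrow> x i = y i) \<Longrightarrow> qf n T x = qf n T y"
  unfolding qf_def by (intro ip_cong) (auto simp: mv_cong[of n x y])

lemma linear_risk:
  assumes \<sigma>: "\<sigma> > 0" and T: "mpsd d T"
  shows "(\<integral>\<^sup>+z. ennreal (sqnorm d (mv d (msqrt d T)
                 (\<lambda>i. mv n A (restrict (\<lambda>k. mv d X \<beta> k + z k) {..<n}) i - \<beta> i))) \<partial>gauss_noise n \<sigma>)
    = ennreal (qf d T (\<lambda>i. mv n A (mv d X \<beta>) i - \<beta> i) + \<sigma>\<^sup>2 * variance_sum d n T A)"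
proof -
  define S where "S = msqrt d T"
  define M where "M = mv d S (\<lambda>i. mv n A (mv d X \<beta>) i - \<beta> i)"
  define B where "B k = mv d S (\<lambda>i. A i k)" for k
  have eq: "mv d S (\<lambda>i. mv n A (restrict (\<lambda>k. mv d X \<beta> k + z k) {..<n}) i - \<beta> i) j = M j + (\<Sum>k<n. B k j * z k)" for z j
  proof -
    have "mv n A (restrict (\<lambda>k. mv d X \<beta> k + z k) {..<n}) = mv n A (\<lambda>k. mv d X \<beta> k + z k)"
      by (rule mv_cong) simp
    also have "\<dots> = (\<lambda>i. mv n A (mv d X \<beta>) i + mv n A z i)" by (rule mv_add)
    finally have A: "mv n A (restrict (\<lambda>k. mv d X \<beta> k + z k) {..<n}) = (\<lambda>i. mv n A (mv d X \<beta>) i + mv n A z i)" .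
    have "mv d S (\<lambda>i. mv n A (restrict (\<lambda>k. mv d X \<beta> k + z k) {..<n}) i - \<beta> i)
        = mv d S (\<lambda>i. (mv n A (mv d X \<beta>) i - \<beta> i) + mv n A z i)"
      unfolding A by (rule arg_cong[where f = "mv d S"]) (simp add: fun_eq_iff)
    also have "\<dots> = (\<lambda>j. M j + mv d S (mv n A z) j)" unfolding mv_add M_def ..
    also have "mv d S (mv n A z) = (\<lambda>j. \<Sum>k<n. B k j * z k)"
      unfolding mv_mmul[symmetric] B_def by (simp add: mv_def mmul_def)
    finally show ?thesis by (simp only:)
  qed
  have [measurable]: "(\<lambda>z. z k) \<in> borel_measurable (gauss_noise n \<sigma>)" if "k < n" for k
    using that by (rule measurable_gauss_coord)
  have "(\<integral>\<^sup>+z. ennreal (sqnorm d (mv d S (\<lambda>i. mv n A (restrict (\<lambda>k. mv d X \<beta> k + z k) {..<n}) i - \<beta> i))) \<partial>gauss_noise n \<sigma>)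
     = (\<integral>\<^sup>+z. (\<Sum>j<d. ennreal ((M j + (\<Sum>k<n. B k j * z k))\<^sup>2)) \<partial>gauss_noise n \<sigma>)"
    unfolding sqnorm_def eq by (intro nn_integral_cong sum_ennreal[symmetric]) auto
  also have "\<dots> = (\<Sum>j<d. \<integral>\<^sup>+z. ennreal ((M j + (\<Sum>k<n. B k j * z k))\<^sup>2) \<partial>gauss_noise n \<sigma>)"
    by (rule nn_integral_sum) measurable
  also have "\<dots> = (\<Sum>j<d. ennreal ((M j)\<^sup>2 + \<sigma>\<^sup>2 * (\<Sum>k<n. (B k j)\<^sup>2)))"
    by (simp only: gauss_affine_second_moment[OF \<sigma>])
  also have "\<dots> = ennreal (\<Sum>j<d. (M j)\<^sup>2 + \<sigma>\<^sup>2 * (\<Sum>k<n. (B k j)\<^sup>2))"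
    by (rule sum_ennreal) (auto intro!: add_nonneg_nonneg mult_nonneg_nonneg sum_nonneg)
  also have "(\<Sum>j<d. (M j)\<^sup>2 + \<sigma>\<^sup>2 * (\<Sum>k<n. (B k j)\<^sup>2)) = sqnorm d M + \<sigma>\<^sup>2 * (\<Sum>k<n. sqnorm d (B k))"
    unfolding sqnorm_def sum.distrib sum_distrib_left[symmetric] by (subst sum.swap) (rule refl)
  also have "\<dots> = qf d T (\<lambda>i. mv n A (mv d X \<beta>) i - \<beta> i) + \<sigma>\<^sup>2 * variance_sum d n T A"
    unfolding M_def B_def S_def sqnorm_msqrt[OF T] variance_sum_def ..
  finally show ?thesis unfolding S_def .
qed

lemma worst_risk_linear_le:
  assumes \<sigma>: "\<sigma> > 0" and T: "mpsd d T" and r: "r > 0" and \<tau>: "0 \<le> \<tau>"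
    and bias: "\<And>x. qf d T (\<lambda>i. mv n A (mv d X x) i - x i) \<le> \<tau> * sqnorm d x"
  shows "worst_risk d n X \<sigma> r T (mv n A) \<le> ennreal (r\<^sup>2 * \<tau> + \<sigma>\<^sup>2 * variance_sum d n T A)"
  unfolding worst_risk_def linear_risk[OF \<sigma> T]
proof (intro SUP_least ennreal_leI add_right_mono)
  fix \<beta> assume "\<beta> \<in> {\<beta>. sqrt (sqnorm d \<beta>) \<le> r}"
  then have "sqnorm d \<beta> \<le> r\<^sup>2" using r by (simp add: real_sqrt_le_iff' sqrt_le_D)
  then have "\<tau> * sqnorm d \<beta> \<le> \<tau> * r\<^sup>2" using \<tau> by (intro mult_left_mono)
  then show "qf d T (\<lambda>i. mv n A (mv d X \<beta>) i - \<beta> i) \<le> r\<^sup>2 * \<tau>" using bias[of \<beta>] by (simp add: mult.commute)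
qed

text \<open>The bias is homogeneous of degree two, so a bound on the ball of radius \<open>r\<close>
  extends to all \<open>x\<close> by scaling; the parameter zero isolates the variance. Together
  with the upper bound this expresses the worst risk through a bias constant and a variance.\<close>

lemma worst_risk_linear_ge:
  assumes \<sigma>: "\<sigma> > 0" and T: "mpsd d T" and r: "r > 0" and W: "0 \<le> W"
    and wr: "worst_risk d n X \<sigma> r T (mv n A) \<le> ennreal W"
  shows "qf d T (\<lambda>i. mv n A (mv d X x) i - x i) \<le> (W - \<sigma>\<^sup>2 * variance_sum d n T A) / r\<^sup>2 * sqnorm d x"
    and "\<sigma>\<^sup>2 * variance_sum d n T A \<le> W"
proof -
  have le: "qf d T (\<lambda>i. mv n A (mv d X \<beta>) i - \<beta> i) + \<sigma>\<^sup>2 * variance_sum d n T A \<le> W"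
    if "sqrt (sqnorm d \<beta>) \<le> r" for \<beta>
  proof -
    have "ennreal (qf d T (\<lambda>i. mv n A (mv d X \<beta>) i - \<beta> i) + \<sigma>\<^sup>2 * variance_sum d n T A) \<le> worst_risk d n X \<sigma> r T (mv n A)"
      unfolding worst_risk_def linear_risk[OF \<sigma> T] using that by (intro SUP_upper) simp
    also note wr
    finally show ?thesis using W by (simp add: ennreal_le_iff)
  qed
  show "\<sigma>\<^sup>2 * variance_sum d n T A \<le> W"
    using le[of "\<lambda>_. 0"] r by (simp add: sqnorm_def qf_def mv_def ip_def)
  show "qf d T (\<lambda>i. mv n A (mv d X x) i - x i) \<le> (W - \<sigma>\<^sup>2 * variance_sum d n T A) / r\<^sup>2 * sqnorm d x"
  proof (cases "sqnorm d x = 0")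
    case True
    then have x: "x i = 0" if "i < d" for i using that by (simp add: sqnorm_eq_0_iff)
    then have "mv d X x = mv d X (\<lambda>_. 0)" by (rule mv_cong)
    then have "qf d T (\<lambda>i. mv n A (mv d X x) i - x i) = qf d T (\<lambda>i. 0)"
      by (intro qf_cong) (simp add: x mv_def)
    then show ?thesis using True by (simp add: qf_def ip_def)
  next
    case False
    then have p: "sqnorm d x > 0" by (simp add: order.strict_iff_order)
    define c where "c = r / sqrt (sqnorm d x)"
    have c: "c > 0" "c\<^sup>2 = r\<^sup>2 / sqnorm d x" using p r by (auto simp: c_def power_divide)
    have "sqrt (sqnorm d (\<lambda>i. c * x i)) \<le> r" using c p r by (simp add: sqnorm_scale)
    from le[OF this] have "qf d T (\<lambda>i. c * (mv n A (mv d X x) i - x i)) \<le> W - \<sigma>\<^sup>2 * variance_sum d n T A"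
      by (simp add: mv_scale right_diff_distrib)
    then have "r\<^sup>2 / sqnorm d x * qf d T (\<lambda>i. mv n A (mv d X x) i - x i) \<le> W - \<sigma>\<^sup>2 * variance_sum d n T A"
      unfolding qf_scale c(2) .
    then show ?thesis using p r by (simp add: field_simps)
  qed
qed

section \<open>The semidefinite program as a bias and variance tradeoff\<close>

lemma sdp_feasible_qf:
  "sdp_feasible d U C \<tau> \<longleftrightarrow> (\<forall>x. qf d U (\<lambda>i. mv d C x i - x i) \<le> \<tau> * sqnorm d x)"
proof -
  define D where "D i j = C i j - idm i j" for i j
  have Dx: "mv d D x i = mv d C x i - x i" if "i < d" for x i
  proof -
    have "mv d idm x i = x i" using ip_unit[OF that, of x] by (simp add: mv_def idm_def ip_def mult.commute eq_commute)
    then show ?thesis by (simp add: mv_def D_def left_diff_distrib sum_subtractf)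
  qed
  have "(\<Sum>i<d. \<Sum>j<d. x i * (\<tau> * idm i j - mmul d (mmul d (mtr D) U) D i j) * x j)
    = \<tau> * sqnorm d x - qf d U (\<lambda>i. mv d C x i - x i)" for x
  proof -
    have "(\<Sum>i<d. \<Sum>j<d. x i * (\<tau> * idm i j - mmul d (mmul d (mtr D) U) D i j) * x j)
      = (\<Sum>i<d. \<Sum>j<d. x i * (\<tau> * idm i j) * x j) - (\<Sum>i<d. \<Sum>j<d. x i * mmul d (mmul d (mtr D) U) D i j * x j)"
      by (simp add: algebra_simps sum_subtractf)
    also have "(\<Sum>i<d. \<Sum>j<d. x i * (\<tau> * idm i j) * x j) = \<tau> * sqnorm d x"
    proof -
      have "(\<Sum>j<d. x i * (\<tau> * idm i j) * x j) = \<tau> * (x i)\<^sup>2" if "i < d" for i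
      proof -
        have "(\<Sum>j<d. x i * (\<tau> * idm i j) * x j) = (\<Sum>j<d. if j = i then \<tau> * (x i)\<^sup>2 else 0)"
          by (intro sum.cong) (auto simp: idm_def power2_eq_square)
        then show ?thesis using that by simp
      qed
      then show ?thesis by (simp add: sqnorm_def sum_distrib_left)
    qed
    also have "(\<Sum>i<d. \<Sum>j<d. x i * mmul d (mmul d (mtr D) U) D i j * x j) = ip d x (mv d (mtr D) (mv d U (mv d D x)))"
      unfolding sum_sum_ip mv_mmul ..
    also have "\<dots> = ip d (mv d D x) (mv d U (mv d D x))" by (rule mv_adjoint[symmetric])
    also have "\<dots> = qf d U (\<lambda>i. mv d C x i - x i)" unfolding qf_def[symmetric] by (rule qf_cong) (rule Dx)
    finally show ?thesis .
  qed
  then show ?thesis unfolding sdp_feasible_def Let_def loewner_le_def D_def[symmetric] by simp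
qed

definition est_matrix :: "nat \<Rightarrow> nat \<Rightarrow> (nat \<Rightarrow> nat \<Rightarrow> real) \<Rightarrow> (nat \<Rightarrow> nat \<Rightarrow> real) \<Rightarrow> (nat \<Rightarrow> nat \<Rightarrow> real)" where
  "est_matrix d n X C = (\<lambda>i j. mmul d (mmul d C (minv d (emp_cov n X))) (mtr X) i j / real n)"

lemma sdp_estimator_matrix: "sdp_estimator d n X C = mv n (est_matrix d n X C)"
  by (simp add: sdp_estimator_def est_matrix_def fun_eq_iff)

lemma emp_cov_sym: "msym d (emp_cov n X)"
  by (simp add: msym_def emp_cov_def mult.commute)

lemma emp_cov_mv:
  assumes "n > 0"
  shows "mv n (mtr X) (mv d X x) j = real n * mv d (emp_cov n X) x j"
proof -
  have "real n * mv d (emp_cov n X) x j = (\<Sum>a<d. (\<Sum>k<n. X k j * X k a) * x a)"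
    unfolding mv_def sum_distrib_left emp_cov_def by (rule sum.cong) (use assms in auto)
  also have "\<dots> = (\<Sum>a<d. \<Sum>k<n. X k j * (X k a * x a))" by (simp only: sum_distrib_right mult.assoc)
  also have "\<dots> = (\<Sum>k<n. \<Sum>a<d. X k j * (X k a * x a))" by (rule sum.swap)
  also have "\<dots> = mv n (mtr X) (mv d X x) j" by (simp only: mv_def mtr_def sum_distrib_left)
  finally show ?thesis ..
qed

lemma minv_mv:
  assumes "is_inv d A M" "i < d"
  shows "mv d A (mv d M x) i = x i" "mv d M (mv d A x) i = x i"
proof -
  have id: "mv d idm x i = x i" using ip_unit[OF assms(2), of x] by (simp add: mv_def idm_def ip_def mult.commute eq_commute)
  show "mv d A (mv d M x) i = x i" "mv d M (mv d A x) i = x i"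
    unfolding mv_mmul[symmetric] id[symmetric] using assms by (auto intro!: mv_cong_mat simp: is_inv_def)
qed

lemma est_matrix_mv: "mv n (est_matrix d n X C) y i = mv d C (mv d (minv d (emp_cov n X)) (mv n (mtr X) y)) i / real n"
proof -
  have "mv n (est_matrix d n X C) y i = mv n (mmul d (mmul d C (minv d (emp_cov n X))) (mtr X)) y i / real n"
    by (simp add: mv_def est_matrix_def sum_divide_distrib)
  then show ?thesis unfolding mv_mmul .
qed

text \<open>The least-squares factor inverts the design, so on noiseless data the estimator acts as
  \<open>C\<close>. Its bias operator is \<open>C - I\<close>, exactly as in the constraint of the
  program.\<close>

lemma est_matrix_design:
  assumes inv: "minvertible d (emp_cov n X)" and n: "n > 0"
  shows "mv n (est_matrix d n X C) (mv d X x) i = mv d C x i"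
proof -
  have "mv d C (mv d (minv d (emp_cov n X)) (mv n (mtr X) (mv d X x))) i = mv d C (\<lambda>j. real n * x j) i"
  proof (rule fun_cong[OF mv_cong])
    fix j assume j: "j < d"
    have "mv n (mtr X) (mv d X x) = (\<lambda>j. real n * mv d (emp_cov n X) x j)" using emp_cov_mv[OF n] by auto
    then show "mv d (minv d (emp_cov n X)) (mv n (mtr X) (mv d X x)) j = real n * x j"
      using minv_mv(2)[OF minv_is_inv[OF inv] j] by (simp add: mv_scale)
  qed
  then show ?thesis unfolding est_matrix_mv using n by (simp add: mv_scale)
qed

lemma minv_sym:
  assumes inv: "minvertible d A" and A: "msym d A"
  shows "msym d (minv d A)"
proof -
  have M: "is_inv d A (minv d A)" by (rule minv_is_inv[OF inv])
  have t1: "mmul d A (mtr (minv d A)) i j = mmul d (minv d A) A j i"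
    and t2: "mmul d (mtr (minv d A)) A i j = mmul d A (minv d A) j i" if ij: "i < d" "j < d" for i j
  proof -
    have s: "A p q = A q p" if "p < d" "q < d" for p q using A that by (simp add: msym_def)
    show "mmul d A (mtr (minv d A)) i j = mmul d (minv d A) A j i"
      unfolding mmul_def mtr_def
    proof (rule sum.cong[OF refl])
      fix l assume "l \<in> {..<d}"
      then show "A i l * minv d A j l = minv d A j l * A l i" using s[of i l] ij by simp
    qed
    show "mmul d (mtr (minv d A)) A i j = mmul d A (minv d A) j i"
      unfolding mmul_def mtr_def
    proof (rule sum.cong[OF refl])
      fix l assume "l \<in> {..<d}"
      then show "minv d A l i * A l j = A j l * minv d A l i" using s[of j l] ij by simp
    qed
  qed
  have Mij: "mmul d A (minv d A) i j = idm i j" "mmul d (minv d A) A i j = idm i j" if "i < d" "j < d" for i j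
    using M that unfolding is_inv_def by blast+
  have idms: "idm j i = idm i j" for i j by (auto simp: idm_def)
  have M': "is_inv d A (mtr (minv d A))"
    unfolding is_inv_def
  proof (intro allI impI conjI)
    fix i j assume ij: "i < d" "j < d"
    show "mmul d A (mtr (minv d A)) i j = idm i j" unfolding t1[OF ij] Mij(2)[OF ij(2,1)] by (rule idms)
    show "mmul d (mtr (minv d A)) A i j = idm i j" unfolding t2[OF ij] Mij(1)[OF ij(2,1)] by (rule idms)
  qed
  show ?thesis
    unfolding msym_def
  proof (intro allI impI)
    fix i j assume ij: "i < d" "j < d"
    show "minv d A i j = minv d A j i" using is_inv_unique[OF M M' ij] by (simp add: mtr_def)
  qed
qed

lemma variance_sum_trace: "variance_sum d n U A = (\<Sum>i<d. \<Sum>j<d. U i j * (\<Sum>k<n. A i k * A j k))"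
proof -
  have "variance_sum d n U A = (\<Sum>k<n. \<Sum>i<d. \<Sum>j<d. U i j * (A i k * A j k))"
    unfolding variance_sum_def qf_def sum_sum_ip[symmetric] by (simp add: mult_ac)
  also have "\<dots> = (\<Sum>i<d. \<Sum>j<d. \<Sum>k<n. U i j * (A i k * A j k))"
    by (subst sum.swap, rule sum.cong[OF refl], rule sum.swap)
  finally show ?thesis by (simp only: sum_distrib_left)
qed

text \<open>For the estimator matrix \<open>A\<close>, the product of \<open>A\<close> and its
  transpose is \<open>C M\<close> times the transpose of \<open>C\<close>, divided by
  \<open>n\<close>, where \<open>M\<close> is the inverse covariance. The trace term is therefore
  the noise variance measured in \<open>U\<close>.\<close>

lemma sdp_obj_variance:
  assumes inv: "minvertible d (emp_cov n X)" and n: "n > 0" and U: "msym d U"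
  shows "sdp_obj d n \<sigma> r (emp_cov n X) U C \<tau> = r\<^sup>2 * \<tau> + \<sigma>\<^sup>2 * variance_sum d n U (est_matrix d n X C)"
proof -
  define M where "M = minv d (emp_cov n X)"
  define A where "A = est_matrix d n X C"
  have Msym: "M i j = M j i" if "i < d" "j < d" for i j
    using minv_sym[OF inv emp_cov_sym] that by (simp add: M_def msym_def)
  have AA: "(\<Sum>k<n. A i k * A j k) = mmul d (mmul d C M) (mtr C) i j / real n" if "i < d" "j < d" for i j
  proof -
    have "(\<Sum>k<n. A i k * A j k) = mv n A (\<lambda>k. A j k) i" by (simp add: mv_def)
    also have "\<dots> = mv n A (mv d X (\<lambda>l. mmul d C M j l / real n)) i"
      by (rule fun_cong[OF mv_cong]) (simp add: A_def est_matrix_def M_def[symmetric] mmul_def[of d "mmul d C M"] mv_def mtr_def sum_divide_distrib mult.commute)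
    also have "\<dots> = mv d C (\<lambda>l. mmul d C M j l / real n) i" unfolding A_def by (rule est_matrix_design[OF inv n])
    also have "\<dots> = mv d C (\<lambda>l. mmul d C M j l) i / real n" by (simp add: mv_def sum_divide_distrib)
    also have "mv d C (\<lambda>l. mmul d C M j l) i = mmul d (mmul d C M) (mtr C) i j"
    proof -
      have "mv d C (\<lambda>l. mmul d C M j l) i = (\<Sum>l<d. \<Sum>m<d. C i l * (C j m * M m l))" by (simp add: mv_def mmul_def sum_distrib_left)
      also have "\<dots> = (\<Sum>m<d. \<Sum>l<d. C i l * (C j m * M m l))" by (rule sum.swap)
      also have "\<dots> = (\<Sum>m<d. \<Sum>l<d. C i l * M l m * C j m)"
        using Msym by (intro sum.cong refl) (auto simp: mult_ac)
      also have "\<dots> = mmul d (mmul d C M) (mtr C) i j" by (simp add: mmul_def mtr_def sum_distrib_right)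
      finally show ?thesis .
    qed
    finally show ?thesis .
  qed
  have "variance_sum d n U A = (\<Sum>i<d. \<Sum>j<d. mmul d (mmul d C M) (mtr C) i j * U j i) / real n"
    unfolding variance_sum_trace sum_divide_distrib
    using AA U by (intro sum.cong refl) (auto simp: msym_def mult.commute)
  also have "\<dots> = mtrace d (mmul d (mmul d (mmul d C M) (mtr C)) U) / real n"
    unfolding mtrace_def mmul_def[of d "mmul d (mmul d C M) (mtr C)"] ..
  finally show ?thesis unfolding sdp_obj_def M_def[symmetric] A_def by simp
qed

text \<open>Replacing \<open>A\<close> by \<open>A\<close> times the projection onto the column space of the design can only decrease the variance.\<close>

lemma variance_projection:
  assumes inv: "minvertible d (emp_cov n X)" and n: "n > 0" and T: "mpsd d T"
  shows "variance_sum d n T (est_matrix d n X (mmul n A X)) \<le> variance_sum d n T A"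
proof -
  define M where "M = minv d (emp_cov n X)"
  have sym: "msym d T" using T by (simp add: mpsd_def)
  obtain e la where e: "eigenbasis d T e la" using eigenbasis_exists[OF sym] by blast
  have la: "0 \<le> la l" if "l < d" for l using mpsd_eigen_nonneg[OF T e that] .
  define a where "a B l k = ip d (\<lambda>i. B i k) (e l)" for B :: "nat \<Rightarrow> nat \<Rightarrow> real" and l k
  have vs: "variance_sum d n T B = (\<Sum>l<d. la l * sqnorm n (a B l))" for B
    unfolding variance_sum_def qf_eigen[OF sym e] sqnorm_def a_def sum_distrib_left by (rule sum.swap)
  have Msym: "msym d M" unfolding M_def by (rule minv_sym[OF inv emp_cov_sym])
  have "sqnorm n (a (est_matrix d n X (mmul n A X)) l) \<le> sqnorm n (a A l)" for l
  proof -
    define u where "u = a A l"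
    define w where "w = mv d M (mv n (mtr X) u)"
    define v where "v = (\<lambda>k. mv d X w k / real n)"
    have av: "a (est_matrix d n X (mmul n A X)) l k = v k" if k: "k < n" for k
    proof -
      have "a (est_matrix d n X (mmul n A X)) l k = (\<Sum>i<d. (\<Sum>m<d. mmul d (mmul n A X) M i m * X k m) * e l i) / real n"
        unfolding a_def est_matrix_def ip_def M_def[symmetric] mmul_def[of d "mmul d (mmul n A X) M"] mtr_def
        by (simp only: times_divide_eq_left sum_divide_distrib[symmetric])
      also have "(\<Sum>i<d. (\<Sum>m<d. mmul d (mmul n A X) M i m * X k m) * e l i) = mv d X w k"
      proof -
        have wm: "w m = (\<Sum>i<d. mmul d (mmul n A X) M i m * e l i)" if m: "m < d" for m
        proof -
          have "w m = (\<Sum>p<d. M m p * (\<Sum>q<n. X q p * (\<Sum>i<d. A i q * e l i)))"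
            by (simp add: w_def mv_def mtr_def u_def a_def ip_def)
          also have "\<dots> = (\<Sum>p<d. M m p * (\<Sum>i<d. (\<Sum>q<n. A i q * X q p) * e l i))"
          proof (rule sum.cong[OF refl], rule arg_cong[where f = "\<lambda>x. _ * x"])
            fix p
            show "(\<Sum>q<n. X q p * (\<Sum>i<d. A i q * e l i)) = (\<Sum>i<d. (\<Sum>q<n. A i q * X q p) * e l i)"
              unfolding sum_distrib_left sum_distrib_right by (subst sum.swap) (simp add: mult_ac)
          qed
          also have "\<dots> = (\<Sum>i<d. \<Sum>p<d. M m p * (mmul n A X i p * e l i))"
            unfolding mmul_def sum_distrib_left by (rule sum.swap)
          also have "\<dots> = (\<Sum>i<d. (\<Sum>p<d. mmul n A X i p * M p m) * e l i)"
            unfolding sum_distrib_right using Msym m by (intro sum.cong refl) (auto simp: msym_def mult_ac)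
          also have "\<dots> = (\<Sum>i<d. mmul d (mmul n A X) M i m * e l i)" by (simp add: mmul_def[of d "mmul n A X"])
          finally show ?thesis .
        qed
        have "mv d X w k = (\<Sum>m<d. X k m * (\<Sum>i<d. mmul d (mmul n A X) M i m * e l i))"
          unfolding mv_def using wm by (intro sum.cong) auto
        also have "\<dots> = (\<Sum>i<d. (\<Sum>m<d. mmul d (mmul n A X) M i m * X k m) * e l i)"
          unfolding sum_distrib_left sum_distrib_right by (subst sum.swap) (simp add: mult_ac)
        finally show ?thesis by simp
      qed
      finally show ?thesis by (simp add: v_def)
    qed
    \<comment> \<open>\<open>v\<close> is the orthogonal projection of the row \<open>u\<close> onto
      the column space of the design; the normal equations give the orthogonality.\<close>
    have vu: "ip n v u = ip n v v"
    proof -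
      have sc: "ip n v y = ip d w (mv n (mtr X) y) / real n" for y
      proof -
        have "ip n v y = ip n (mv d X w) y / real n" by (simp add: v_def ip_def sum_divide_distrib)
        then show ?thesis unfolding mv_adjoint .
      qed
      have "ip d w (mv n (mtr X) v) = ip d w (mv n (mtr X) u)"
      proof (rule ip_cong[OF refl])
        fix j assume j: "j < d"
        have "v = (\<lambda>k. (1 / real n) * mv d X w k)" by (simp add: v_def)
        then have "mv n (mtr X) v j = (1 / real n) * mv n (mtr X) (mv d X w) j" by (simp only: mv_scale)
        also have "\<dots> = mv d (emp_cov n X) w j" using n by (simp add: emp_cov_mv)
        also have "\<dots> = mv n (mtr X) u j" unfolding w_def M_def by (rule minv_mv(1)[OF minv_is_inv[OF inv] j])
        finally show "mv n (mtr X) v j = mv n (mtr X) u j" .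
      qed
      then show ?thesis unfolding sc by simp
    qed
    have "0 \<le> ip n (\<lambda>k. u k - v k) (\<lambda>k. u k - v k)" by simp
    also have "\<dots> = sqnorm n u - sqnorm n v"
      unfolding ip_diff_left ip_diff_right sqnorm_ip using vu ip_commute[of n u v] by simp
    finally have "sqnorm n v \<le> sqnorm n u" by simp
    moreover have "sqnorm n (a (est_matrix d n X (mmul n A X)) l) = sqnorm n v" using av by (rule sqnorm_cong)
    ultimately show ?thesis by (simp add: u_def)
  qed
  then show ?thesis unfolding vs using la by (intro sum_mono mult_left_mono) auto
qed

lemma le_mult_INF:
  fixes x :: ennreal
  assumes c: "0 < c" and le: "\<And>a. a \<in> S \<Longrightarrow> x \<le> ennreal c * f a"
  shows "x \<le> ennreal c * (INF a\<in>S. f a)"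
proof -
  have cancel: "ennreal (1 / c) * (ennreal c * y) = y" "ennreal c * (ennreal (1 / c) * y) = y" for y
    using c by (simp_all add: mult.assoc[symmetric] ennreal_mult[symmetric])
  have "ennreal (1 / c) * x \<le> (INF a\<in>S. f a)"
  proof (rule INF_greatest)
    fix a assume "a \<in> S"
    from mult_left_mono[OF le[OF this], of "ennreal (1 / c)"] show "ennreal (1 / c) * x \<le> f a"
      unfolding cancel by simp
  qed
  from mult_left_mono[OF this, of "ennreal c"] show ?thesis unfolding cancel by simp
qed

theorem sdp_linear_bound:
  fixes \<eta> :: real
  assumes d: "d > 0" and n: "n > 0" and \<sigma>: "\<sigma> > 0" and r: "r > 0" and inv: "minvertible d (emp_cov n X)"
    and T: "mpsd d T" and U: "msym d U" and eta: "0 \<le> \<eta>" "\<eta> \<le> 1/2"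
    and close: "\<And>u. \<bar>qf d U u - qf d T u\<bar> \<le> \<eta> * qf d T u"
    and opt: "sdp_optimal d n \<sigma> r (emp_cov n X) U C \<tau>"
  shows "worst_risk d n X \<sigma> r T (sdp_estimator d n X C) \<le> ennreal (1 + 4 * \<eta>) * linear_minimax d n X \<sigma> r T"
proof -
  have TU: "(1 - \<eta>) * qf d T u \<le> qf d U u" "qf d U u \<le> (1 + \<eta>) * qf d T u" for u
    using close[of u] by (auto simp: abs_le_iff algebra_simps)
  have vTU: "(1 - \<eta>) * variance_sum d n T A \<le> variance_sum d n U A" "variance_sum d n U A \<le> (1 + \<eta>) * variance_sum d n T A" for A :: "nat \<Rightarrow> nat \<Rightarrow> real"
    unfolding variance_sum_def sum_distrib_left by (intro sum_mono TU)+
  define A0 where "A0 = est_matrix d n X C"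
  have e1: "1 - \<eta> > 0" using eta by simp
  have feas: "qf d U (\<lambda>i. mv d C x i - x i) \<le> \<tau> * sqnorm d x" for x
    using opt unfolding sdp_optimal_def sdp_feasible_qf by blast
  have bias0: "qf d T (\<lambda>i. mv d C x i - x i) \<le> \<tau> / (1 - \<eta>) * sqnorm d x" for x
  proof -
    have "(1 - \<eta>) * qf d T (\<lambda>i. mv d C x i - x i) \<le> \<tau> * sqnorm d x" using TU(1) feas order_trans by blast
    then show ?thesis using e1 by (simp add: pos_le_divide_eq mult.commute)
  qed
  have \<tau>0: "0 \<le> \<tau>"
  proof -
    define x :: "nat \<Rightarrow> real" where "x = (\<lambda>i. if i = 0 then 1 else 0)"
    have x1: "sqnorm d x = 1" using ip_unit[OF d, of x] by (simp add: x_def sqnorm_ip)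
    have "0 \<le> \<tau> / (1 - \<eta>)" using order_trans[OF mpsd_qf[OF T] bias0[of x]] x1 by simp
    then show ?thesis using e1 by (simp add: zero_le_divide_iff)
  qed
  have "worst_risk d n X \<sigma> r T (sdp_estimator d n X C) \<le> ennreal (r\<^sup>2 * (\<tau> / (1 - \<eta>)) + \<sigma>\<^sup>2 * variance_sum d n T A0)"
    unfolding sdp_estimator_matrix A0_def[symmetric]
    by (rule worst_risk_linear_le[OF \<sigma> T r])
       (use \<tau>0 e1 bias0 in \<open>auto simp: A0_def est_matrix_design[OF inv n]\<close>)
  also have "\<dots> \<le> ennreal (1 + 4 * \<eta>) * linear_minimax d n X \<sigma> r T"
  proof -
    have "ennreal (r\<^sup>2 * (\<tau> / (1 - \<eta>)) + \<sigma>\<^sup>2 * variance_sum d n T A0) \<le> ennreal (1 + 4 * \<eta>) * worst_risk d n X \<sigma> r T (mv n A)" for A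
    proof (cases "worst_risk d n X \<sigma> r T (mv n A)")
      case top
      then show ?thesis using eta by (simp add: ennreal_mult_top)
    next
      case (real W)
      \<comment> \<open>Any linear competitor \<open>A\<close> yields the candidate
        \<open>C = A X\<close> with the same bias, and projecting its rows can only lower the
        variance; hence optimality over \<open>C\<close> suffices against all linear
        estimators.\<close>
      define A1 where "A1 = est_matrix d n X (mmul n A X)"
      define \<tau>T where "\<tau>T = (W - \<sigma>\<^sup>2 * variance_sum d n T A) / r\<^sup>2"
      have ge: "qf d T (\<lambda>i. mv n A (mv d X x) i - x i) \<le> \<tau>T * sqnorm d x" for x
        unfolding \<tau>T_def by (rule worst_risk_linear_ge(1)[OF \<sigma> T r]) (use real in auto)
      have "sdp_feasible d U (mmul n A X) ((1 + \<eta>) * \<tau>T)"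
        unfolding sdp_feasible_qf mv_mmul
      proof
        fix x
        have "qf d U (\<lambda>i. mv n A (mv d X x) i - x i) \<le> (1 + \<eta>) * qf d T (\<lambda>i. mv n A (mv d X x) i - x i)" by (rule TU(2))
        also have "\<dots> \<le> (1 + \<eta>) * (\<tau>T * sqnorm d x)" using ge eta by (intro mult_left_mono) auto
        finally show "qf d U (\<lambda>i. mv n A (mv d X x) i - x i) \<le> (1 + \<eta>) * \<tau>T * sqnorm d x" by (simp add: mult.assoc)
      qed
      then have "r\<^sup>2 * \<tau> + \<sigma>\<^sup>2 * variance_sum d n U A0 \<le> r\<^sup>2 * ((1 + \<eta>) * \<tau>T) + \<sigma>\<^sup>2 * variance_sum d n U A1"
        using opt unfolding sdp_optimal_def sdp_obj_variance[OF inv n U] A0_def A1_def by blast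
      also have "\<dots> \<le> (1 + \<eta>) * (r\<^sup>2 * \<tau>T + \<sigma>\<^sup>2 * variance_sum d n T A)"
      proof -
        have "variance_sum d n U A1 \<le> (1 + \<eta>) * variance_sum d n T A1" by (rule vTU(2))
        also have "\<dots> \<le> (1 + \<eta>) * variance_sum d n T A"
          unfolding A1_def using variance_projection[OF inv n T] eta by (intro mult_left_mono) auto
        finally have "\<sigma>\<^sup>2 * variance_sum d n U A1 \<le> \<sigma>\<^sup>2 * ((1 + \<eta>) * variance_sum d n T A)" by (intro mult_left_mono) auto
        then show ?thesis by (simp add: algebra_simps)
      qed
      also have "r\<^sup>2 * \<tau>T + \<sigma>\<^sup>2 * variance_sum d n T A = W" using r by (simp add: \<tau>T_def)
      finally have *: "r\<^sup>2 * \<tau> + \<sigma>\<^sup>2 * variance_sum d n U A0 \<le> (1 + \<eta>) * W" .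
      have "(1 - \<eta>) * (r\<^sup>2 * (\<tau> / (1 - \<eta>)) + \<sigma>\<^sup>2 * variance_sum d n T A0) = r\<^sup>2 * \<tau> + \<sigma>\<^sup>2 * ((1 - \<eta>) * variance_sum d n T A0)"
        using e1 by (simp add: distrib_left)
      also have "\<dots> \<le> r\<^sup>2 * \<tau> + \<sigma>\<^sup>2 * variance_sum d n U A0" by (intro add_left_mono mult_left_mono vTU) auto
      also note *
      \<comment> \<open>After expansion this is \<open>2 * \<eta>\<^sup>2 \<le> \<eta>\<close>, the
        place where \<open>\<eta> \<le> 1/2\<close> enters.\<close>
      also have "(1 + \<eta>) * W \<le> (1 - \<eta>) * ((1 + 4 * \<eta>) * W)"
      proof -
        have "2 * \<eta> * \<eta> \<le> \<eta>" using mult_right_mono[OF eta(2), of \<eta>] eta by simp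
        then have "1 + \<eta> \<le> (1 - \<eta>) * (1 + 4 * \<eta>)" by (simp add: algebra_simps)
        then have "(1 + \<eta>) * W \<le> (1 - \<eta>) * (1 + 4 * \<eta>) * W" using real by (intro mult_right_mono) auto
        then show ?thesis by (simp only: mult.assoc)
      qed
      finally have "r\<^sup>2 * (\<tau> / (1 - \<eta>)) + \<sigma>\<^sup>2 * variance_sum d n T A0 \<le> (1 + 4 * \<eta>) * W" using e1 by simp
      moreover have "ennreal (1 + 4 * \<eta>) * worst_risk d n X \<sigma> r T (mv n A) = ennreal ((1 + 4 * \<eta>) * W)"
        unfolding real(2) by (rule ennreal_mult[symmetric]) (use real eta in auto)
      ultimately show ?thesis by (simp only: ennreal_leI)
    qed
    then show ?thesis unfolding linear_minimax_def using eta by (intro le_mult_INF) auto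
  qed
  finally show ?thesis .
qed

section \<open>Lower bounds for arbitrary estimators\<close>

text \<open>The worst case dominates the average over a product prior. \<open>F m l\<close> is the
  loss in coordinate \<open>l\<close> at the prior point \<open>m\<close>; its one-dimensional bound
  holds for each fixed choice of the other coordinates, so averaging over them preserves it.\<close>

lemma product_prior:
  fixes L :: "nat \<Rightarrow> ennreal" and F :: "(nat \<Rightarrow> 'a) \<Rightarrow> nat \<Rightarrow> ennreal"
  assumes W1: "\<And>l. l < p \<Longrightarrow> (\<Sum>x\<in>S l. W l x) = 1"
    and le: "\<And>m l. l < p \<Longrightarrow> L l \<le> (\<Sum>x\<in>S l. W l x * F (m(l := x)) l)"
    and ub: "\<And>m. m \<in> PiE {..<p} S \<Longrightarrow> (\<Sum>l<p. F m l) \<le> V"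
  shows "(\<Sum>l<p. L l) \<le> V"
proof -
  define P where "P A m = (\<Prod>j\<in>A. W j (m j))" for A m
  \<comment> \<open>Sums over infinite sets are zero by convention, so total weight one forces
    finite supports.\<close>
  have fin: "finite (S l)" if "l < p" for l
    using W1[OF that] by (metis sum.infinite zero_neq_one)
  have P1: "(\<Sum>m\<in>PiE A S. P A m) = 1" if "A \<subseteq> {..<p}" for A
  proof -
    have "(\<Sum>m\<in>PiE A S. P A m) = (\<Prod>j\<in>A. \<Sum>x\<in>S j. W j x)"
      unfolding P_def using that fin by (intro prod_sum_PiE[symmetric]) (auto intro: finite_subset)
    also have "\<dots> = 1" using that W1 by (intro prod.neutral) auto
    finally show ?thesis .
  qed
  have coord: "L l \<le> (\<Sum>m\<in>PiE {..<p} S. P {..<p} m * F m l)" if l: "l < p" for l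
  proof -
    define A where "A = {..<p} - {l}"
    have ins: "{..<p} = insert l A" and lA: "l \<notin> A" and finA: "finite A" using l by (auto simp: A_def)
    have Pl: "P (insert l A) (g(l := y)) = W l y * P A g" for y g
      unfolding P_def using lA finA by (simp, intro arg_cong[where f = "\<lambda>x. _ * x"] prod.cong) auto
    have "(\<Sum>m\<in>PiE {..<p} S. P {..<p} m * F m l)
      = (\<Sum>(y, g)\<in>S l \<times> PiE A S. P (insert l A) (g(l := y)) * F (g(l := y)) l)"
      unfolding ins PiE_insert_eq
      by (subst sum.reindex[OF inj_combinator[OF lA]]) (simp add: case_prod_unfold)
    also have "\<dots> = (\<Sum>g\<in>PiE A S. \<Sum>y\<in>S l. W l y * P A g * F (g(l := y)) l)"
      unfolding Pl sum.cartesian_product[symmetric] by (rule sum.swap)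
    also have "\<dots> = (\<Sum>g\<in>PiE A S. P A g * (\<Sum>y\<in>S l. W l y * F (g(l := y)) l))"
      by (simp add: sum_distrib_left mult_ac)
    finally have eq: "(\<Sum>m\<in>PiE {..<p} S. P {..<p} m * F m l) = \<dots>" .
    have "L l = (\<Sum>g\<in>PiE A S. P A g) * L l" using P1[of A] by (simp add: A_def)
    also have "\<dots> \<le> (\<Sum>g\<in>PiE A S. P A g * (\<Sum>y\<in>S l. W l y * F (g(l := y)) l))"
      unfolding sum_distrib_right using le[OF l] by (intro sum_mono mult_left_mono) auto
    finally show ?thesis unfolding eq .
  qed
  have "(\<Sum>l<p. L l) \<le> (\<Sum>l<p. \<Sum>m\<in>PiE {..<p} S. P {..<p} m * F m l)"
    using coord by (intro sum_mono) auto
  also have "\<dots> = (\<Sum>m\<in>PiE {..<p} S. P {..<p} m * (\<Sum>l<p. F m l))"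
    unfolding sum_distrib_left by (rule sum.swap)
  also have "\<dots> \<le> (\<Sum>m\<in>PiE {..<p} S. P {..<p} m * V)"
    using ub by (intro sum_mono mult_left_mono) auto
  also have "\<dots> = V" using P1[of "{..<p}"] by (simp add: sum_distrib_right[symmetric])
  finally show ?thesis .
qed

text \<open>The signal-to-noise ratio of the segment is
  \<open>\<gamma> = b\<^sup>2 * s / \<sigma>\<^sup>2\<close>, and rescaling the one-dimensional
  bound by \<open>b\<^sup>2 / \<gamma>\<close> gives 4/5 of the linear risk on it. A degenerate
  segment is treated separately because the one-dimensional theorem needs a positive ratio.\<close>

lemma segment_prior:
  assumes \<sigma>: "\<sigma> > 0" and b: "b \<ge> 0" and s: "s > 0" and w: "(\<Sum>k<n. (w k)\<^sup>2) = s"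
  shows "\<exists>S W. finite S \<and> S \<subseteq> {-1..1::real} \<and> (\<Sum>m\<in>S. W m) = (1 :: ennreal) \<and>
    (\<forall>(g :: (nat \<Rightarrow> real) \<Rightarrow> real) \<in> borel_measurable (Rn n). \<forall>y0.
      ennreal (4 / 5 * b\<^sup>2 * \<sigma>\<^sup>2 / (\<sigma>\<^sup>2 + b\<^sup>2 * s)) \<le> (\<Sum>m\<in>S. W m *
        (\<integral>\<^sup>+z. ennreal ((g (restrict (\<lambda>k. y0 k + b * m * w k + z k) {..<n}) - b * m)\<^sup>2) \<partial>gauss_noise n \<sigma>)))"
proof (cases "b = 0")
  case True
  then show ?thesis by (intro exI[of _ "{0}"] exI[of _ "\<lambda>_. 1"]) simp
next
  case False
  then have b0: "b > 0" using b by simp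
  define \<gamma> where "\<gamma> = b\<^sup>2 * (\<Sum>k<n. (w k)\<^sup>2) / \<sigma>\<^sup>2"
  have \<gamma>: "\<gamma> > 0" using b0 s \<sigma> w by (simp add: \<gamma>_def)
  have w0: "(\<Sum>k<n. (w k)\<^sup>2) > 0" using w s by simp
  obtain S W where SW: "finite S" "S \<subseteq> {-1..1::real}" "\<And>m. m \<in> S \<Longrightarrow> 0 \<le> W m" "(\<Sum>m\<in>S. W m) = 1"
    "\<And>(g :: (nat \<Rightarrow> real) \<Rightarrow> real) y0. g \<in> borel_measurable (Rn n) \<Longrightarrow>
      ennreal (b\<^sup>2 / \<gamma> * (4/5 * \<gamma> / (1 + \<gamma>))) \<le> (\<Sum>m\<in>S. ennreal (W m) *
        (\<integral>\<^sup>+z. ennreal ((g (restrict (\<lambda>k. y0 k + b * m * w k + z k) {..<n}) - b * m)\<^sup>2) \<partial>gauss_noise n \<sigma>))"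
    by (rule bayes_segment[OF good_all[OF \<gamma>] \<sigma> b0 w0 \<gamma>_def]) (rule that)
  have "b\<^sup>2 / \<gamma> * (4/5 * \<gamma> / (1 + \<gamma>)) = b\<^sup>2 * (\<gamma> / \<gamma>) * (4/5) / (1 + \<gamma>)" by (simp add: mult_ac)
  also have "\<dots> = 4/5 * b\<^sup>2 / (1 + \<gamma>)" using \<gamma> by simp
  also have "\<dots> = 4/5 * b\<^sup>2 / ((\<sigma>\<^sup>2 + b\<^sup>2 * s) / \<sigma>\<^sup>2)" using \<sigma> w by (simp add: \<gamma>_def add_divide_distrib)
  finally have v: "b\<^sup>2 / \<gamma> * (4/5 * \<gamma> / (1 + \<gamma>)) = 4/5 * b\<^sup>2 * \<sigma>\<^sup>2 / (\<sigma>\<^sup>2 + b\<^sup>2 * s)"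
    by (simp only: divide_divide_eq_right)
  have "(\<Sum>m\<in>S. ennreal (W m)) = 1" using SW(3,4) by (simp add: sum_ennreal)
  then show ?thesis using SW(1,2,5) unfolding v by (intro exI[of _ S] exI[of _ "\<lambda>m. ennreal (W m)"]) blast
qed

text \<open>The prior is a product over the directions \<open>h l\<close> of scaled copies of the one-dimensional priors;
  the functionals \<open>\<phi> l\<close> are biorthogonal to the directions, so that each coordinate is estimated separately.\<close>

theorem product_minimax_bound:
  fixes est :: "(nat \<Rightarrow> real) \<Rightarrow> nat \<Rightarrow> real" and p :: nat
  assumes \<sigma>: "\<sigma> > 0" and T: "mpsd d T" and r: "r > 0"
    and est: "\<And>i. i < d \<Longrightarrow> (\<lambda>y. est y i) \<in> borel_measurable (Rn n)"
    and t: "\<And>l. l < p \<Longrightarrow> 0 \<le> t l" and b: "\<And>l. l < p \<Longrightarrow> 0 \<le> b l"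
    and s: "\<And>l. l < p \<Longrightarrow> sqnorm n (mv d X (h l)) = s l" "\<And>l. l < p \<Longrightarrow> s l > 0"
    and loss: "\<And>u. (\<Sum>l<p. t l * (ip d u (\<phi> l))\<^sup>2) \<le> qf d T u"
    and bi: "\<And>j l. j < p \<Longrightarrow> l < p \<Longrightarrow> ip d (h j) (\<phi> l) = (if j = l then 1 else 0)"
    and box: "\<And>\<theta>. (\<And>l. l < p \<Longrightarrow> \<bar>\<theta> l\<bar> \<le> b l) \<Longrightarrow> sqnorm d (\<lambda>i. \<Sum>l<p. \<theta> l * h l i) \<le> r\<^sup>2"
  shows "ennreal (\<Sum>l<p. t l * (4 / 5 * (b l)\<^sup>2 * \<sigma>\<^sup>2 / (\<sigma>\<^sup>2 + (b l)\<^sup>2 * s l))) \<le> worst_risk d n X \<sigma> r T est"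
proof -
  define w where "w l = mv d X (h l)" for l
  define L where "L l = 4 / 5 * (b l)\<^sup>2 * \<sigma>\<^sup>2 / (\<sigma>\<^sup>2 + (b l)\<^sup>2 * s l)" for l
  define Q where "Q l S W \<longleftrightarrow> finite S \<and> S \<subseteq> {-1..1::real} \<and> (\<Sum>m\<in>S. W m) = (1 :: ennreal) \<and>
    (\<forall>(g :: (nat \<Rightarrow> real) \<Rightarrow> real) \<in> borel_measurable (Rn n). \<forall>y0.
      ennreal (L l) \<le> (\<Sum>m\<in>S. W m *
        (\<integral>\<^sup>+z. ennreal ((g (restrict (\<lambda>k. y0 k + b l * m * w l k + z k) {..<n}) - b l * m)\<^sup>2) \<partial>gauss_noise n \<sigma>)))" for l :: nat and S W
  have "\<exists>S W. Q l S W" if "l < p" for l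
    unfolding Q_def L_def
    by (rule segment_prior[OF \<sigma> b[OF that] s(2)[OF that]]) (use s(1)[OF that] in \<open>simp add: w_def sqnorm_def\<close>)
  then obtain S W where SW: "\<And>l. l < p \<Longrightarrow> Q l (S l) (W l)" by metis
  define g where "g l y = ip d (est y) (\<phi> l)" for l y
  have gm [measurable]: "g l \<in> borel_measurable (Rn n)" for l
    unfolding g_def ip_def by (intro borel_measurable_sum borel_measurable_times est borel_measurable_const) auto
  define R where "R l c x = (\<integral>\<^sup>+z. ennreal ((g l (restrict (\<lambda>k. c k + z k) {..<n}) - x)\<^sup>2) \<partial>gauss_noise n \<sigma>)" for l c x
  define F where "F m l = ennreal (t l) * R l (\<lambda>k. \<Sum>j<p. b j * m j * w j k) (b l * m l)" for m l
  have L0: "0 \<le> L l" if "l < p" for l using s(2)[OF that] by (simp add: L_def)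
  have "(\<Sum>l<p. ennreal (t l * L l)) \<le> worst_risk d n X \<sigma> r T est"
  proof (rule product_prior[where S = S and W = W and F = F])
    show "(\<Sum>x\<in>S l. W l x) = 1" if "l < p" for l using SW[OF that] by (simp add: Q_def)
    show "ennreal (t l * L l) \<le> (\<Sum>x\<in>S l. W l x * F (m(l := x)) l)" if l: "l < p" for m l
    proof -
      \<comment> \<open>The remaining coordinates only shift the data by a vector independent of
        \<open>x\<close>, and the segment priors are uniform in such offsets.\<close>
      define y0 where "y0 k = (\<Sum>j\<in>{..<p} - {l}. b j * m j * w j k)" for k
      have "(\<Sum>j<p. b j * (m(l := x)) j * w j k) = y0 k + b l * x * w l k" for x k
      proof -
        have "(\<Sum>j<p. b j * (m(l := x)) j * w j k) = b l * x * w l k + (\<Sum>j\<in>{..<p} - {l}. b j * (m(l := x)) j * w j k)"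
          using l by (subst sum.remove[of _ l]) auto
        also have "(\<Sum>j\<in>{..<p} - {l}. b j * (m(l := x)) j * w j k) = y0 k"
          unfolding y0_def by (intro sum.cong) auto
        finally show ?thesis by simp
      qed
      then have F: "F (m(l := x)) l = ennreal (t l) * R l (\<lambda>k. y0 k + b l * x * w l k) (b l * x)" for x
        by (simp add: F_def)
      have "ennreal (L l) \<le> (\<Sum>x\<in>S l. W l x * R l (\<lambda>k. y0 k + b l * x * w l k) (b l * x))"
        using SW[OF l] gm unfolding Q_def R_def by blast
      then have "ennreal (t l) * ennreal (L l) \<le> ennreal (t l) * (\<Sum>x\<in>S l. W l x * R l (\<lambda>k. y0 k + b l * x * w l k) (b l * x))"
        by (rule mult_left_mono) simp
      then show ?thesis unfolding F using t[OF l] L0[OF l] by (simp add: ennreal_mult sum_distrib_left mult_ac)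
    qed
    show "(\<Sum>l<p. F m l) \<le> worst_risk d n X \<sigma> r T est" if m: "m \<in> PiE {..<p} S" for m
    proof -
      define \<beta> where "\<beta> = (\<lambda>i. \<Sum>l<p. (b l * m l) * h l i)"
      have "\<bar>b l * m l\<bar> \<le> b l" if "l < p" for l
      proof -
        have "m l \<in> {-1..1}" using m that SW[OF that] by (auto simp: Q_def PiE_def Pi_def)
        then have "\<bar>m l\<bar> \<le> 1" by auto
        from mult_left_mono[OF this b[OF that]] show ?thesis using b[OF that] by (simp add: abs_mult)
      qed
      then have "sqnorm d \<beta> \<le> r\<^sup>2" unfolding \<beta>_def by (rule box)
      then have \<beta>: "sqrt (sqnorm d \<beta>) \<le> r" using r real_sqrt_le_mono by fastforce
      have X\<beta>: "mv d X \<beta> = (\<lambda>k. \<Sum>j<p. b j * m j * w j k)"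
        unfolding \<beta>_def mv_sum w_def mv_scale ..
      have \<phi>\<beta>: "ip d \<beta> (\<phi> l) = b l * m l" if "l < p" for l
      proof -
        have "ip d \<beta> (\<phi> l) = (\<Sum>j<p. if j = l then b l * m l else 0)"
          unfolding \<beta>_def ip_sum_left ip_scale_left using that by (intro sum.cong) (auto simp: bi)
        then show ?thesis using that by simp
      qed
      have [measurable]: "(\<lambda>z. restrict (\<lambda>k. c k + z k) {..<n}) \<in> measurable (gauss_noise n \<sigma>) (Rn n)" for c
        unfolding measurable_cong_sets[OF sets_gauss_noise refl] Rn_def by (intro measurable_restrict) measurable
      have gr: "(\<lambda>z. ennreal ((g l (restrict (\<lambda>k. c k + z k) {..<n}) - x)\<^sup>2)) \<in> borel_measurable (gauss_noise n \<sigma>)" for l c x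
        by measurable
      have "(\<Sum>l<p. F m l) = (\<Sum>l<p. \<integral>\<^sup>+z. ennreal (t l) * ennreal ((g l (restrict (\<lambda>k. mv d X \<beta> k + z k) {..<n}) - b l * m l)\<^sup>2) \<partial>gauss_noise n \<sigma>)"
        unfolding F_def R_def X\<beta> by (intro sum.cong refl nn_integral_cmult[symmetric] gr)
      also have "\<dots> = (\<integral>\<^sup>+z. (\<Sum>l<p. ennreal (t l) * ennreal ((g l (restrict (\<lambda>k. mv d X \<beta> k + z k) {..<n}) - b l * m l)\<^sup>2)) \<partial>gauss_noise n \<sigma>)"
        by (intro nn_integral_sum[symmetric] borel_measurable_times_ennreal borel_measurable_const gr)
      also have "\<dots> \<le> (\<integral>\<^sup>+z. ennreal (sqnorm d (mv d (msqrt d T)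
                 (\<lambda>i. est (restrict (\<lambda>k. mv d X \<beta> k + z k) {..<n}) i - \<beta> i))) \<partial>gauss_noise n \<sigma>)"
      proof (rule nn_integral_mono)
        fix z
        define y where "y = restrict (\<lambda>k. mv d X \<beta> k + z k) {..<n}"
        have "(\<Sum>l<p. ennreal (t l) * ennreal ((g l y - b l * m l)\<^sup>2)) = (\<Sum>l<p. ennreal (t l * (ip d (\<lambda>i. est y i - \<beta> i) (\<phi> l))\<^sup>2))"
          using t by (intro sum.cong refl) (auto simp: ip_diff_left \<phi>\<beta> g_def ennreal_mult)
        also have "\<dots> = ennreal (\<Sum>l<p. t l * (ip d (\<lambda>i. est y i - \<beta> i) (\<phi> l))\<^sup>2)"
          using t by (intro sum_ennreal) auto
        also have "\<dots> \<le> ennreal (qf d T (\<lambda>i. est y i - \<beta> i))" by (intro ennreal_leI loss)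
        finally show "(\<Sum>l<p. ennreal (t l) * ennreal ((g l (restrict (\<lambda>k. mv d X \<beta> k + z k) {..<n}) - b l * m l)\<^sup>2))
          \<le> ennreal (sqnorm d (mv d (msqrt d T) (\<lambda>i. est (restrict (\<lambda>k. mv d X \<beta> k + z k) {..<n}) i - \<beta> i)))"
          unfolding sqnorm_msqrt[OF T] y_def .
      qed
      also have "\<dots> \<le> worst_risk d n X \<sigma> r T est"
        unfolding worst_risk_def using \<beta> by (intro SUP_upper) simp
      finally show ?thesis .
    qed
  qed
  also have "(\<Sum>l<p. ennreal (t l * L l)) = ennreal (\<Sum>l<p. t l * L l)"
    using t L0 by (intro sum_ennreal) auto
  finally show ?thesis unfolding L_def .
qed

lemma linear_minimax_le_minimax:
  assumes V: "\<And>est. (\<And>i. i < d \<Longrightarrow> (\<lambda>y. est y i :: real) \<in> borel_measurable (Rn n)) \<Longrightarrow> ennreal (4 / 5 * V) \<le> worst_risk d n X \<sigma> r T est"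
    and lin: "worst_risk d n X \<sigma> r T (mv n A) \<le> ennreal V"
  shows "linear_minimax d n X \<sigma> r T \<le> ennreal (5 / 4) * minimax d n X \<sigma> r T"
  unfolding minimax_def
proof (rule le_mult_INF)
  fix est :: "(nat \<Rightarrow> real) \<Rightarrow> nat \<Rightarrow> real" assume "est \<in> {est. \<forall>i<d. (\<lambda>y. est y i) \<in> borel_measurable (Rn n)}"
  then have "ennreal (4 / 5 * V) \<le> worst_risk d n X \<sigma> r T est" by (intro V) auto
  from mult_left_mono[OF this, of "ennreal (5/4)"]
  have "ennreal V \<le> ennreal (5 / 4) * worst_risk d n X \<sigma> r T est" by (simp add: ennreal_mult'[symmetric])
  moreover have "linear_minimax d n X \<sigma> r T \<le> worst_risk d n X \<sigma> r T (mv n A)"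
    unfolding linear_minimax_def by (rule INF_lower) simp
  ultimately show "linear_minimax d n X \<sigma> r T \<le> ennreal (5 / 4) * worst_risk d n X \<sigma> r T est"
    using lin by (meson order_trans)
qed simp

lemma emp_cov_eigen_pos:
  assumes inv: "minvertible d (emp_cov n X)" and e: "eigenbasis d (emp_cov n X) e s" and l: "l < d"
  shows "0 < s l"
proof -
  have "mpsd d (emp_cov n X)"
    by (rule mpsdI[OF emp_cov_sym]) (simp add: emp_cov_qf sum_nonneg)
  then have "0 \<le> s l" using e l by (rule mpsd_eigen_nonneg)
  moreover have "s l \<noteq> 0"
  proof
    assume 0: "s l = 0"
    have "e l i = 0" if i: "i < d" for i
    proof -
      have "mv d (minv d (emp_cov n X)) (mv d (emp_cov n X) (e l)) = mv d (minv d (emp_cov n X)) (\<lambda>_. 0)"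
        by (rule mv_cong) (use e l 0 in \<open>simp add: eigenbasis_def\<close>)
      then have "mv d (minv d (emp_cov n X)) (mv d (emp_cov n X) (e l)) i = 0" by (simp add: mv_def)
      then show ?thesis unfolding minv_mv(2)[OF minv_is_inv[OF inv] i] .
    qed
    then have "ip d (e l) (e l) = 0" by (simp add: ip_def)
    then show False using e l by (simp add: eigenbasis_def orthonormal_def)
  qed
  ultimately show ?thesis by simp
qed

section \<open>Spectral shrinkage estimators and water filling\<close>

lemma sqnorm_design:
  assumes n: "n > 0" and e: "eigenbasis d (emp_cov n X) e s"
  shows "sqnorm n (mv d X (\<lambda>i. \<Sum>l<d. c l * e l i)) = real n * (\<Sum>l<d. s l * (c l)\<^sup>2)"
proof -
  have on: "orthonormal d d e" using e by (simp add: eigenbasis_def)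
  have "sqnorm n (mv d X u) = real n * qf d (emp_cov n X) u" for u
    using n by (simp add: emp_cov_qf sqnorm_def mv_def ip_def mult.commute)
  moreover have "qf d (emp_cov n X) (\<lambda>i. \<Sum>l<d. c l * e l i) = (\<Sum>l<d. s l * (c l)\<^sup>2)"
    unfolding qf_eigen[OF emp_cov_sym e] by (intro sum.cong refl) (simp add: ip_lincomb[OF on])
  ultimately show ?thesis by simp
qed

lemma sqnorm_design_basis:
  assumes n: "n > 0" and e: "eigenbasis d (emp_cov n X) e s" and l: "l < d"
  shows "sqnorm n (mv d X (e l)) = real n * s l"
proof -
  have "(\<lambda>i. \<Sum>j<d. (if j = l then 1 else 0) * e j i) = e l"
    using l by (simp add: if_distrib[of "\<lambda>x. x * _"] cong: if_cong)
  then show ?thesis using sqnorm_design[OF n e, of "\<lambda>j. if j = l then 1 else 0"] l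
    by (simp add: if_distrib[of "\<lambda>x. x\<^sup>2"] if_distrib[of "\<lambda>x. _ * x"] cong: if_cong)
qed

text \<open>A linear estimator that is diagonal in the eigenbasis of the empirical covariance: on
  noiseless data it multiplies coordinate \<open>l\<close> by
  \<open>c l * (n * s l)\<close>.\<close>

definition shrink :: "nat \<Rightarrow> nat \<Rightarrow> (nat \<Rightarrow> nat \<Rightarrow> real) \<Rightarrow> (nat \<Rightarrow> nat \<Rightarrow> real) \<Rightarrow> (nat \<Rightarrow> real) \<Rightarrow> nat \<Rightarrow> nat \<Rightarrow> real" where
  "shrink d n X e c = (\<lambda>i k. \<Sum>l<d. (c l * mv d X (e l) k) * e l i)"

lemma shrink_column:
  assumes "orthonormal d d e" "l < d"
  shows "ip d (\<lambda>i. shrink d n X e c i k) (e l) = c l * mv d X (e l) k"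
  unfolding shrink_def by (rule ip_lincomb[OF assms])

lemma shrink_design:
  assumes n: "n > 0" and e: "eigenbasis d (emp_cov n X) e s" and l: "l < d"
  shows "ip d (mv n (shrink d n X e c) (mv d X x)) (e l) = c l * (real n * s l) * ip d x (e l)"
proof -
  have on: "orthonormal d d e" using e by (simp add: eigenbasis_def)
  have "mv n (shrink d n X e c) (mv d X x) = (\<lambda>i. \<Sum>j<d. (c j * ip n (mv d X x) (mv d X (e j))) * e j i)"
    unfolding mv_def[of n] shrink_def ip_def[of n] sum_distrib_left sum_distrib_right
    by (subst sum.swap) (simp add: mult_ac)
  then have "ip d (mv n (shrink d n X e c) (mv d X x)) (e l) = c l * ip n (mv d X x) (mv d X (e l))"
    by (simp add: ip_lincomb[OF on l])
  also have "ip n (mv d X x) (mv d X (e l)) = ip d x (mv n (mtr X) (mv d X (e l)))" by (rule mv_adjoint)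
  also have "\<dots> = ip d x (\<lambda>i. real n * s l * e l i)"
    by (rule ip_cong) (use e l n in \<open>auto simp: emp_cov_mv eigenbasis_def\<close>)
  finally show ?thesis by (simp add: ip_scale_right)
qed

text \<open>The filled volume is continuous in the level \<open>x\<close> and zero at level zero. At
  the level \<open>y\<close> coordinate \<open>k\<close> alone holds the volume \<open>R\<close>, so
  an intermediate value exists.\<close>

lemma water_level:
  fixes v a :: "nat \<Rightarrow> real" and R :: real
  assumes v: "\<And>l. l < d \<Longrightarrow> 0 < v l" and k: "k < d" "0 < a k" and R: "R > 0"
  obtains x where "x > 0" "(\<Sum>l<d. v l * max 0 (x * a l - 1)) = R"
proof -
  define f where "f x = (\<Sum>l<d. v l * max 0 (x * a l - 1))" for x
  define y where "y = (R / v k + 1) / a k"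
  have y: "y > 0" using v[OF k(1)] k R by (simp add: y_def add_pos_pos)
  have "R = v k * max 0 (y * a k - 1)" using v[OF k(1)] k R by (simp add: y_def)
  also have "\<dots> \<le> f y"
  proof -
    have "0 \<le> v l * max 0 z" if "l < d" for l z using v[OF that] by simp
    then show ?thesis unfolding f_def using k by (intro member_le_sum) auto
  qed
  finally have fy: "R \<le> f y" .
  have f0: "f 0 = 0" by (simp add: f_def)
  have "continuous_on {0..y} f" unfolding f_def by (intro continuous_intros)
  then obtain x where x: "0 \<le> x" "f x = R" using IVT'[of f 0 R y] fy f0 R y by auto
  then have "x \<noteq> 0" using f0 R by auto
  with x have "x > 0" by simp
  then show ?thesis using x that unfolding f_def by blast
qed

lemma variance_sum_zero: "variance_sum d n T (\<lambda>_ _. 0) = 0"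
  by (simp add: variance_sum_def qf_def mv_def ip_def)

lemma linear_minimax_degenerate:
  assumes \<sigma>: "\<sigma> > 0" and T: "mpsd d T" and r: "r > 0" and z: "\<And>u. qf d T u = 0"
  shows "linear_minimax d n X \<sigma> r T \<le> ennreal (5 / 4) * minimax d n X \<sigma> r T"
proof (rule linear_minimax_le_minimax[where V = 0])
  show "worst_risk d n X \<sigma> r T (mv n (\<lambda>_ _. 0)) \<le> ennreal 0"
    using worst_risk_linear_le[OF \<sigma> T r order_refl, of n "\<lambda>_ _. 0" X] by (simp add: z variance_sum_zero)
qed simp

text \<open>\<open>v l\<close> is the noise variance of the least-squares coordinate
  \<open>l\<close>, and \<open>m l\<close> becomes the signal-to-noise ratio of side
  \<open>l\<close> of a box with half-widths \<open>sqrt (v l * m l)\<close>. The level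
  \<open>x\<close> is tuned to make the squared half-widths sum to \<open>r\<^sup>2\<close>, which
  inscribes the box in the ball. The factors \<open>c l = m l / (m l + 1)\<close> are linear minimax
  on the sides, and the same estimator does no worse on the whole ball, so the box is a hardest one
  for linear estimators.\<close>

theorem linear_minimax_commuting:
  assumes n: "n > 0" and \<sigma>: "\<sigma> > 0" and T: "mpsd d T" and r: "r > 0" and inv: "minvertible d (emp_cov n X)"
    and comm: "\<forall>i<d. \<forall>j<d. mmul d T (emp_cov n X) i j = mmul d (emp_cov n X) T i j"
  shows "linear_minimax d n X \<sigma> r T \<le> ennreal (5 / 4) * minimax d n X \<sigma> r T"
proof -
  have symT: "msym d T" using T by (simp add: mpsd_def)
  obtain e t s where "orthonormal d d e"
    "\<And>k i. k < d \<Longrightarrow> i < d \<Longrightarrow> mv d T (e k) i = t k * e k i"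
    "\<And>k i. k < d \<Longrightarrow> i < d \<Longrightarrow> mv d (emp_cov n X) (e k) i = s k * e k i"
    by (rule simultaneous_spectral[OF symT emp_cov_sym comm]) (rule that)
  then have on: "orthonormal d d e" and eT: "eigenbasis d T e t" and eS: "eigenbasis d (emp_cov n X) e s"
    by (simp_all add: eigenbasis_def)
  have t0: "0 \<le> t l" if "l < d" for l by (rule mpsd_eigen_nonneg[OF T eT that])
  have s0: "0 < s l" if "l < d" for l by (rule emp_cov_eigen_pos[OF inv eS that])
  define v where "v l = \<sigma>\<^sup>2 / (real n * s l)" for l
  have v0: "0 < v l" if "l < d" for l using s0[OF that] n \<sigma> by (simp add: v_def)
  show ?thesis
  proof (cases "\<exists>k<d. t k \<noteq> 0")
    case False
    then have "qf d T u = 0" for u by (simp add: qf_eigen[OF symT eT])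
    then show ?thesis by (rule linear_minimax_degenerate[OF \<sigma> T r])
  next
    case True
    then obtain k where k: "k < d" "0 < sqrt (t k)" using t0 by fastforce
    have R: "r\<^sup>2 > 0" using r by simp
    obtain x where x: "x > 0" and wl: "(\<Sum>l<d. v l * max 0 (x * sqrt (t l) - 1)) = r\<^sup>2"
      by (rule water_level[where v = v and a = "\<lambda>l. sqrt (t l)", OF v0 k R]) (assumption | rule that)+
    define m where "m l = max 0 (x * sqrt (t l) - 1)" for l
    have m0: "0 \<le> m l" for l by (simp add: m_def)
    define c where "c l = m l / (m l + 1)" for l
    define A where "A = shrink d n X e (\<lambda>l. c l / (real n * s l))"
    define V where "V = (\<Sum>l<d. t l * (v l * c l))"
    have bias: "ip d (\<lambda>i. mv n A (mv d X u) i - u i) (e l) = (c l - 1) * ip d u (e l)" if "l < d" for u l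
      unfolding ip_diff_left A_def shrink_design[OF n eS that] using s0[OF that] n by (simp add: algebra_simps)
    \<comment> \<open>Equality holds on the filled coordinates, where
      \<open>m l + 1 = x * sqrt (t l)\<close>; on the others \<open>c l = 0\<close> and
      \<open>t l\<close> lies below the cap. Equalising the bias is what makes the box worst for
      this estimator.\<close>
    have tc: "t l * (c l - 1)\<^sup>2 \<le> 1 / x\<^sup>2" if "l < d" for l
    proof -
      have "x * sqrt (t l) \<le> m l + 1" by (simp add: m_def)
      then have "(x * sqrt (t l))\<^sup>2 \<le> (m l + 1)\<^sup>2" using x t0[OF that] by (intro power_mono) auto
      then have 1: "x\<^sup>2 * t l \<le> (m l + 1)\<^sup>2" using t0[OF that] by (simp add: power_mult_distrib)
      have m1: "m l + 1 > 0" using m0[of l] by simp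
      have "c l - 1 = - (1 / (m l + 1))" using m1 by (simp add: c_def field_simps)
      then have "t l * (c l - 1)\<^sup>2 = t l / (m l + 1)\<^sup>2" by (simp add: power_divide)
      also have "\<dots> \<le> 1 / x\<^sup>2" using 1 x m1 by (simp add: divide_le_eq mult.commute le_divide_eq)
      finally show ?thesis .
    qed
    have upper: "worst_risk d n X \<sigma> r T (mv n A) \<le> ennreal V"
    proof -
      have "worst_risk d n X \<sigma> r T (mv n A) \<le> ennreal (r\<^sup>2 * (1 / x\<^sup>2) + \<sigma>\<^sup>2 * variance_sum d n T A)"
      proof (rule worst_risk_linear_le[OF \<sigma> T r])
        fix u
        have "qf d T (\<lambda>i. mv n A (mv d X u) i - u i) = (\<Sum>l<d. t l * (c l - 1)\<^sup>2 * (ip d u (e l))\<^sup>2)"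
          unfolding qf_eigen[OF symT eT] by (intro sum.cong refl) (simp add: bias power_mult_distrib)
        also have "\<dots> \<le> (\<Sum>l<d. 1 / x\<^sup>2 * (ip d u (e l))\<^sup>2)" by (intro sum_mono mult_right_mono tc) auto
        also have "\<dots> = 1 / x\<^sup>2 * sqnorm d u" unfolding sum_distrib_left[symmetric] parseval_sqnorm[OF on] ..
        finally show "qf d T (\<lambda>i. mv n A (mv d X u) i - u i) \<le> 1 / x\<^sup>2 * sqnorm d u" .
      qed simp
      also have "variance_sum d n T A = (\<Sum>l<d. t l * ((c l / (real n * s l))\<^sup>2 * (real n * s l)))"
      proof -
        have "variance_sum d n T A = (\<Sum>k<n. \<Sum>l<d. t l * (c l / (real n * s l) * mv d X (e l) k)\<^sup>2)"
          unfolding variance_sum_def qf_eigen[OF symT eT] A_def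
        proof (rule sum.cong[OF refl], rule sum.cong[OF refl])
          fix k l assume "l \<in> {..<d}"
          then have l: "l < d" by simp
          show "t l * (ip d (\<lambda>i. shrink d n X e (\<lambda>l. c l / (real n * s l)) i k) (e l))\<^sup>2
            = t l * (c l / (real n * s l) * mv d X (e l) k)\<^sup>2"
            unfolding shrink_column[OF on l] ..
        qed
        also have "\<dots> = (\<Sum>l<d. \<Sum>k<n. t l * ((c l / (real n * s l))\<^sup>2 * (mv d X (e l) k)\<^sup>2))"
          unfolding power_mult_distrib by (rule sum.swap)
        also have "\<dots> = (\<Sum>l<d. t l * ((c l / (real n * s l))\<^sup>2 * sqnorm n (mv d X (e l))))"
          by (simp only: sqnorm_def sum_distrib_left)
        also have "\<dots> = (\<Sum>l<d. t l * ((c l / (real n * s l))\<^sup>2 * (real n * s l)))"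
          by (intro sum.cong refl) (simp add: sqnorm_design_basis[OF n eS])
        finally show ?thesis .
      qed
      also have "r\<^sup>2 * (1 / x\<^sup>2) + \<sigma>\<^sup>2 * (\<Sum>l<d. t l * ((c l / (real n * s l))\<^sup>2 * (real n * s l))) = V"
      proof -
        have "r\<^sup>2 * (1 / x\<^sup>2) = (\<Sum>l<d. v l * m l * (1 / x\<^sup>2))"
          unfolding wl[symmetric] m_def sum_distrib_right ..
        moreover have "\<sigma>\<^sup>2 * (\<Sum>l<d. t l * ((c l / (real n * s l))\<^sup>2 * (real n * s l))) = (\<Sum>l<d. v l * t l * (c l)\<^sup>2)"
        proof -
          have "\<sigma>\<^sup>2 * (t l * ((c l / (real n * s l))\<^sup>2 * (real n * s l))) = v l * t l * (c l)\<^sup>2" if "l < d" for l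
          proof -
            have "real n * s l \<noteq> 0" using n s0[OF that] by simp
            then have "(c l / (real n * s l))\<^sup>2 * (real n * s l) = (c l)\<^sup>2 / (real n * s l)"
              by (simp add: power2_eq_square)
            then show ?thesis by (simp add: v_def)
          qed
          then show ?thesis unfolding sum_distrib_left by (intro sum.cong) auto
        qed
        \<comment> \<open>The bias cap is distributed over the coordinates by the identity for the
          water level; coordinatewise, bias share plus variance is then the linear risk of that side
          of the box.\<close>
        moreover have "v l * m l * (1 / x\<^sup>2) + v l * t l * (c l)\<^sup>2 = t l * (v l * c l)" if "l < d" for l
        proof (cases "m l = 0")
          case True
          then show ?thesis by (simp add: c_def)
        next
          case False
          then have "m l + 1 = x * sqrt (t l)" by (simp add: m_def max_def split: if_splits)
          then have "(m l + 1)\<^sup>2 = x\<^sup>2 * t l" using t0[OF that] by (simp add: power_mult_distrib)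
          then have tl: "t l = (m l + 1)\<^sup>2 / x\<^sup>2" using x by simp
          have m1: "m l + 1 \<noteq> 0" using m0[of l] by simp
          have "t l * c l = (m l + 1) * m l / x\<^sup>2" "t l * (c l)\<^sup>2 = (m l)\<^sup>2 / x\<^sup>2"
            unfolding tl c_def power_divide using m1 by (simp_all add: power2_eq_square)
          then have "m l * (1 / x\<^sup>2) + t l * (c l)\<^sup>2 = t l * c l"
            by (simp add: add_divide_distrib[symmetric] power2_eq_square algebra_simps)
          then have "v l * (m l * (1 / x\<^sup>2) + t l * (c l)\<^sup>2) = v l * (t l * c l)" by simp
          then show ?thesis by (simp only: distrib_left mult_ac)
        qed
        ultimately show ?thesis unfolding V_def by (simp add: sum.distrib[symmetric])
      qed
      finally show ?thesis .
    qed
    have lower: "ennreal (4 / 5 * V) \<le> worst_risk d n X \<sigma> r T est"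
      if est: "\<And>i. i < d \<Longrightarrow> (\<lambda>y. est y i) \<in> borel_measurable (Rn n)" for est :: "(nat \<Rightarrow> real) \<Rightarrow> nat \<Rightarrow> real"
    proof -
      define b where "b l = sqrt (v l * m l)" for l
      have b2: "(b l)\<^sup>2 = v l * m l" if "l < d" for l
        using v0[OF that] m0[of l] by (simp add: b_def)
      have "ennreal (\<Sum>l<d. t l * (4 / 5 * (b l)\<^sup>2 * \<sigma>\<^sup>2 / (\<sigma>\<^sup>2 + (b l)\<^sup>2 * (real n * s l)))) \<le> worst_risk d n X \<sigma> r T est"
      proof (rule product_minimax_bound[where h = e and \<phi> = e, OF \<sigma> T r est])
        show "0 \<le> b l" if "l < d" for l using v0[OF that] m0[of l] by (simp add: b_def)
        show "(\<Sum>l<d. t l * (ip d u (e l))\<^sup>2) \<le> qf d T u" for u unfolding qf_eigen[OF symT eT] ..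
        show "sqnorm d (\<lambda>i. \<Sum>l<d. \<theta> l * e l i) \<le> r\<^sup>2" if \<theta>: "\<And>l. l < d \<Longrightarrow> \<bar>\<theta> l\<bar> \<le> b l" for \<theta>
        proof -
          have "sqnorm d (\<lambda>i. \<Sum>l<d. \<theta> l * e l i) = (\<Sum>l<d. (\<theta> l)\<^sup>2)"
            unfolding parseval_sqnorm[OF on] by (intro sum.cong refl) (simp add: ip_lincomb[OF on])
          also have "\<dots> \<le> (\<Sum>l<d. v l * m l)"
          proof (rule sum_mono)
            fix l assume "l \<in> {..<d}"
            then have l: "l < d" by simp
            have "\<bar>\<theta> l\<bar>\<^sup>2 \<le> (b l)\<^sup>2" by (intro power_mono \<theta> l) simp
            then show "(\<theta> l)\<^sup>2 \<le> v l * m l" by (simp add: b2[OF l])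
          qed
          finally show ?thesis unfolding wl[symmetric] m_def .
        qed
      qed (use t0 s0 n sqnorm_design_basis[OF n eS] orthonormal_ip[OF on] in auto)
      also have "(\<Sum>l<d. t l * (4 / 5 * (b l)\<^sup>2 * \<sigma>\<^sup>2 / (\<sigma>\<^sup>2 + (b l)\<^sup>2 * (real n * s l)))) = 4 / 5 * V"
        unfolding V_def sum_distrib_left
      proof (rule sum.cong[OF refl])
        fix l assume "l \<in> {..<d}"
        then have l: "l < d" by simp
        have vs: "v l * (real n * s l) = \<sigma>\<^sup>2" using s0[OF l] n by (simp add: v_def)
        have "(b l)\<^sup>2 * (real n * s l) = m l * \<sigma>\<^sup>2" unfolding b2[OF l] vs[symmetric] by (simp only: mult_ac)
        then have "\<sigma>\<^sup>2 + (b l)\<^sup>2 * (real n * s l) = \<sigma>\<^sup>2 * (m l + 1)" by (simp add: algebra_simps)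
        moreover have "\<sigma>\<^sup>2 \<noteq> 0" "m l + 1 \<noteq> 0" using \<sigma> m0[of l] by auto
        ultimately have "4 / 5 * (b l)\<^sup>2 * \<sigma>\<^sup>2 / (\<sigma>\<^sup>2 + (b l)\<^sup>2 * (real n * s l)) = 4 / 5 * (v l * c l)"
          unfolding b2[OF l] c_def by simp
        then show "t l * (4 / 5 * (b l)\<^sup>2 * \<sigma>\<^sup>2 / (\<sigma>\<^sup>2 + (b l)\<^sup>2 * (real n * s l))) = 4 / 5 * (t l * (v l * c l))"
          by (simp only: mult_ac)
      qed
      finally show ?thesis .
    qed
    show ?thesis by (rule linear_minimax_le_minimax[OF lower upper])
  qed
qed

section \<open>Targets of rank one\<close>

lemma rank_one_factor:
  assumes T: "mpsd d T" and rank: "mrank d d T = 1"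
  obtains a where "\<And>i j. i < d \<Longrightarrow> j < d \<Longrightarrow> T i j = a i * a j"
proof -
  define ind where "ind J \<longleftrightarrow> (\<forall>c :: nat \<Rightarrow> real. (\<forall>i<d. (\<Sum>j\<in>J. c j * T i j) = 0) \<longrightarrow> (\<forall>j\<in>J. c j = 0))" for J
  define \<N> where "\<N> = {card J | J. J \<subseteq> {..<d} \<and> ind J}"
  have rk: "Max \<N> = 1" using rank unfolding mrank_def \<N>_def ind_def .
  have "\<N> \<subseteq> {..d}" unfolding \<N>_def using card_mono[of "{..<d}"] by fastforce
  then have fin: "finite \<N>" by (rule finite_subset) simp
  have "card {} \<in> \<N>" unfolding \<N>_def by (intro CollectI exI[of _ "{}"]) (simp add: ind_def)
  then have "Max \<N> \<in> \<N>" using fin by (intro Max_in) auto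
  then have "1 \<in> \<N>" by (simp only: rk)
  then obtain J where J: "J \<subseteq> {..<d}" "ind J" "card J = 1" unfolding \<N>_def by auto
  then obtain p where Jp: "J = {p}" by (auto simp: card_1_singleton_iff)
  have p: "p < d" using J Jp by auto
  have col: "\<exists>i<d. T i p \<noteq> 0"
  proof (rule ccontr)
    assume "\<not> (\<exists>i<d. T i p \<noteq> 0)"
    then have "\<forall>i<d. (\<Sum>j\<in>J. (1::real) * T i j) = 0" by (simp add: Jp)
    with J(2) have "\<forall>j\<in>J. (1::real) = 0" unfolding ind_def by (elim allE[of _ "\<lambda>_. 1"]) blast
    then show False by (simp add: Jp)
  qed
  have "\<exists>\<kappa>. \<forall>i<d. T i j = \<kappa> * T i p" if j: "j < d" for j
  proof (cases "j = p")
    case True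
    then show ?thesis by (intro exI[of _ 1]) simp
  next
    case False
    \<comment> \<open>A second independent column would raise the maximum in \<open>mrank\<close>
      above one, so every column is a multiple of column \<open>p\<close>; symmetry and
      \<open>T p p \<ge> 0\<close> then give the outer product.\<close>
    have "\<not> ind {p, j}"
    proof
      assume "ind {p, j}"
      then have "card {p, j} \<in> \<N>" using p j unfolding \<N>_def by blast
      then have "card {p, j} \<le> Max \<N>" by (rule Max_ge[OF fin])
      then show False using False rk by simp
    qed
    then obtain c :: "nat \<Rightarrow> real" where c: "\<forall>i<d. (\<Sum>l\<in>{p, j}. c l * T i l) = 0" and nz: "c p \<noteq> 0 \<or> c j \<noteq> 0"
      unfolding ind_def by auto
    have c': "c p * T i p + c j * T i j = 0" if "i < d" for i using c that False by simp
    have cj: "c j \<noteq> 0" using nz c' col by force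
    have "T i j = (- c p / c j) * T i p" if "i < d" for i using c'[OF that] cj by (simp add: field_simps)
    then show ?thesis by blast
  qed
  then obtain \<kappa> where \<kappa>: "\<And>i j. i < d \<Longrightarrow> j < d \<Longrightarrow> T i j = \<kappa> j * T i p" by metis
  have sym: "T i j = T j i" if "i < d" "j < d" for i j using T that by (simp add: mpsd_def msym_def)
  have Tpp: "0 \<le> T p p"
  proof -
    define x :: "nat \<Rightarrow> real" where "x = (\<lambda>i. if i = p then 1 else 0)"
    have mvx: "mv d T x i = T i p" for i
      using ip_unit[OF p, of "T i"] by (simp add: mv_def ip_def x_def)
    have "qf d T x = ip d x (\<lambda>i. T i p)" unfolding qf_def by (rule ip_cong) (simp_all add: mvx)
    also have "\<dots> = ip d (\<lambda>i. T i p) x" by (rule ip_commute)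
    also have "\<dots> = T p p" unfolding x_def by (rule ip_unit[OF p])
    finally have "qf d T x = T p p" .
    then show ?thesis using mpsd_qf[OF T, of x] by simp
  qed
  have "T i j = (\<kappa> i * sqrt (T p p)) * (\<kappa> j * sqrt (T p p))" if "i < d" "j < d" for i j
  proof -
    have "T i j = \<kappa> j * (\<kappa> i * T p p)" using \<kappa>[OF that] sym[OF that(1) p] \<kappa>[OF p that(1)] by simp
    also have "T p p = sqrt (T p p) * sqrt (T p p)" using Tpp by simp
    finally show ?thesis by (simp only: mult_ac)
  qed
  then show ?thesis by (rule that)
qed

text \<open>Only the functional \<open>ip d u a\<close> is penalised. The ridge estimator with
  factors \<open>r\<^sup>2 / (r\<^sup>2 + v l)\<close> has error functional
  \<open>- ip d u h\<close>, which over the ball is largest at multiples of \<open>h\<close>. Hence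
  its risk is attained on the diameter in direction \<open>h\<close>, and there it coincides with
  the linear minimax risk of that segment.\<close>

theorem linear_minimax_rank_one:
  assumes n: "n > 0" and \<sigma>: "\<sigma> > 0" and T: "mpsd d T" and r: "r > 0" and inv: "minvertible d (emp_cov n X)"
    and rank: "mrank d d T = 1"
  shows "linear_minimax d n X \<sigma> r T \<le> ennreal (5 / 4) * minimax d n X \<sigma> r T"
proof -
  obtain a where a: "\<And>i j. i < d \<Longrightarrow> j < d \<Longrightarrow> T i j = a i * a j"
    by (rule rank_one_factor[OF T rank]) (rule that)
  have qfT: "qf d T u = (ip d u a)\<^sup>2" for u
  proof -
    have "qf d T u = (\<Sum>i<d. \<Sum>j<d. (u i * a i) * (u j * a j))"
      unfolding qf_def sum_sum_ip[symmetric] by (intro sum.cong refl) (simp add: a)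
    then show ?thesis unfolding power2_eq_square ip_def sum_product .
  qed
  obtain e s where eS: "eigenbasis d (emp_cov n X) e s" by (rule eigenbasis_exists[OF emp_cov_sym]) (rule that)
  then have on: "orthonormal d d e" by (simp add: eigenbasis_def)
  have s0: "0 < s l" if "l < d" for l by (rule emp_cov_eigen_pos[OF inv eS that])
  define v where "v l = \<sigma>\<^sup>2 / (real n * s l)" for l
  have v0: "0 < v l" if "l < d" for l using s0[OF that] n \<sigma> by (simp add: v_def)
  have vs: "v l * (real n * s l) = \<sigma>\<^sup>2" if "l < d" for l using s0[OF that] n by (simp add: v_def)
  have rv: "0 < r\<^sup>2 + v l" if "l < d" for l using v0[OF that] r by (simp add: add_pos_pos)
  define \<alpha> where "\<alpha> l = ip d a (e l)" for l
  define g where "g l = \<alpha> l * v l / (r\<^sup>2 + v l)" for l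
  define D where "D = (\<Sum>l<d. \<alpha> l * g l)"
  define h where "h = (\<lambda>i. \<Sum>l<d. g l * e l i)"
  have ua: "ip d u a = (\<Sum>l<d. ip d u (e l) * \<alpha> l)" for u unfolding \<alpha>_def by (rule parseval[OF on])
  have ha: "ip d h a = D"
    unfolding ua D_def h_def by (intro sum.cong refl) (simp add: ip_lincomb[OF on] mult.commute)
  have Dl: "0 \<le> \<alpha> l * g l" if "l < d" for l
  proof -
    have "\<alpha> l * g l = (\<alpha> l)\<^sup>2 * (v l / (r\<^sup>2 + v l))" by (simp add: g_def power2_eq_square)
    then show ?thesis using v0[OF that] rv[OF that] by simp
  qed
  show ?thesis
  proof (cases "\<exists>l<d. \<alpha> l \<noteq> 0")
    case False
    then have "qf d T u = 0" for u by (simp add: qfT ua)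
    then show ?thesis by (rule linear_minimax_degenerate[OF \<sigma> T r])
  next
    case True
    then obtain k where k: "k < d" "\<alpha> k \<noteq> 0" by blast
    have gk: "g k \<noteq> 0" using k v0[OF k(1)] rv[OF k(1)] by (simp add: g_def)
    define q where "q = (\<Sum>l<d. (g l)\<^sup>2)"
    have q: "q > 0" unfolding q_def using k(1) gk by (intro sum_pos2[of _ k]) auto
    have D: "D > 0"
      unfolding D_def using k gk Dl[OF k(1)] Dl by (intro sum_pos2[of _ k]) (auto simp: order.strict_iff_order)
    have upper: "worst_risk d n X \<sigma> r T (mv n (shrink d n X e (\<lambda>l. r\<^sup>2 / (r\<^sup>2 + v l) / (real n * s l)))) \<le> ennreal (r\<^sup>2 * D)"
      (is "worst_risk d n X \<sigma> r T (mv n ?A) \<le> _")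
    proof -
      have bias: "ip d (\<lambda>i. mv n ?A (mv d X u) i - u i) (e l) = - (v l / (r\<^sup>2 + v l)) * ip d u (e l)" if l: "l < d" for u l
      proof -
        have "r\<^sup>2 / (r\<^sup>2 + v l) / (real n * s l) * (real n * s l) = r\<^sup>2 / (r\<^sup>2 + v l)" using s0[OF l] n by simp
        moreover have "r\<^sup>2 / (r\<^sup>2 + v l) = 1 - v l / (r\<^sup>2 + v l)" using rv[OF l] by (simp add: field_simps)
        ultimately show ?thesis unfolding ip_diff_left shrink_design[OF n eS l] by (simp add: left_diff_distrib)
      qed
      have "worst_risk d n X \<sigma> r T (mv n ?A) \<le> ennreal (r\<^sup>2 * q + \<sigma>\<^sup>2 * variance_sum d n T ?A)"
      proof (rule worst_risk_linear_le[OF \<sigma> T r])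
        fix u
        define w where "w = (\<lambda>i. mv n ?A (mv d X u) i - u i)"
        have "ip d w a = (\<Sum>l<d. - (ip d u (e l) * g l))"
          unfolding ua
        proof (rule sum.cong[OF refl])
          fix l assume "l \<in> {..<d}"
          then have l: "l < d" by simp
          show "ip d w (e l) * \<alpha> l = - (ip d u (e l) * g l)"
            unfolding w_def bias[OF l] g_def by (simp add: mult_ac)
        qed
        also have "\<dots> = - (\<Sum>l<d. ip d u (e l) * ip d h (e l))"
          unfolding sum_negf h_def by (intro arg_cong[where f = uminus] sum.cong refl) (simp add: ip_lincomb[OF on])
        also have "\<dots> = - ip d u h" unfolding parseval[OF on, of u h] ..
        finally have "qf d T w = (ip d u h)\<^sup>2" by (simp add: qfT)
        also have "\<dots> \<le> sqnorm d u * sqnorm d h" by (rule ip_cauchy_schwarz)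
        also have "sqnorm d h = q"
          unfolding parseval_sqnorm[OF on] q_def h_def by (intro sum.cong refl) (simp add: ip_lincomb[OF on])
        finally show "qf d T (\<lambda>i. mv n ?A (mv d X u) i - u i) \<le> q * sqnorm d u" by (simp add: w_def mult.commute)
      qed (use q in simp)
      also have "r\<^sup>2 * q + \<sigma>\<^sup>2 * variance_sum d n T ?A = r\<^sup>2 * D"
      proof -
        define \<gamma> where "\<gamma> l = \<alpha> l * (r\<^sup>2 / (r\<^sup>2 + v l) / (real n * s l))" for l
        have "variance_sum d n T ?A = (\<Sum>k<n. (\<Sum>l<d. (r\<^sup>2 / (r\<^sup>2 + v l) / (real n * s l) * mv d X (e l) k) * \<alpha> l)\<^sup>2)"
          unfolding variance_sum_def qfT ua
        proof (rule sum.cong[OF refl], rule arg_cong[where f = "\<lambda>x. x\<^sup>2"], rule sum.cong[OF refl])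
          fix k l assume "l \<in> {..<d}"
          then have l: "l < d" by simp
          show "ip d (\<lambda>i. ?A i k) (e l) * \<alpha> l = (r\<^sup>2 / (r\<^sup>2 + v l) / (real n * s l) * mv d X (e l) k) * \<alpha> l"
            unfolding shrink_column[OF on l] ..
        qed
        also have "\<dots> = (\<Sum>k<n. (\<Sum>l<d. \<gamma> l * mv d X (e l) k)\<^sup>2)"
          unfolding \<gamma>_def by (simp only: mult_ac)
        also have "\<dots> = sqnorm n (mv d X (\<lambda>i. \<Sum>l<d. \<gamma> l * e l i))"
          unfolding sqnorm_def mv_sum mv_scale ..
        finally have var: "variance_sum d n T ?A = real n * (\<Sum>l<d. s l * (\<gamma> l)\<^sup>2)"
          unfolding sqnorm_design[OF n eS] .
        have "\<sigma>\<^sup>2 * variance_sum d n T ?A = (\<Sum>l<d. \<sigma>\<^sup>2 * (real n * (s l * (\<gamma> l)\<^sup>2)))"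
          unfolding var sum_distrib_left ..
        moreover have "r\<^sup>2 * (g l)\<^sup>2 + \<sigma>\<^sup>2 * (real n * (s l * (\<gamma> l)\<^sup>2)) = r\<^sup>2 * (\<alpha> l * g l)" if l: "l < d" for l
        proof -
          define z where "z = real n * s l"
          have z: "z \<noteq> 0" using n s0[OF l] by (simp add: z_def)
          define y where "y = r\<^sup>2 + v l"
          have y: "y \<noteq> 0" using rv[OF l] by (simp add: y_def)
          have "\<sigma>\<^sup>2 * (real n * (s l * (\<gamma> l)\<^sup>2)) = (v l * z) * z * (\<alpha> l * (r\<^sup>2 / y / z))\<^sup>2"
            unfolding vs[OF l, symmetric] \<gamma>_def z_def[symmetric] y_def[symmetric] by (simp only: z_def mult_ac)
          also have "\<dots> = v l * (\<alpha> l)\<^sup>2 * (r\<^sup>2)\<^sup>2 / y\<^sup>2" using z by (simp add: power_mult_distrib power_divide power2_eq_square[of z])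
          finally have eq: "\<sigma>\<^sup>2 * (real n * (s l * (\<gamma> l)\<^sup>2)) = v l * (\<alpha> l)\<^sup>2 * (r\<^sup>2)\<^sup>2 / y\<^sup>2" .
          have id: "R * (A * w / Y)\<^sup>2 + w * A\<^sup>2 * R\<^sup>2 / Y\<^sup>2 = R * A\<^sup>2 * w * (R + w) / Y\<^sup>2" for R A w Y :: real
            by (simp add: power_mult_distrib power_divide power2_eq_square add_divide_distrib algebra_simps)
          have "r\<^sup>2 * (g l)\<^sup>2 + \<sigma>\<^sup>2 * (real n * (s l * (\<gamma> l)\<^sup>2)) = r\<^sup>2 * (\<alpha> l)\<^sup>2 * v l * (r\<^sup>2 + v l) / y\<^sup>2"
            unfolding eq g_def y_def by (rule id)
          also have "\<dots> = r\<^sup>2 * (\<alpha> l * g l)"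
            unfolding g_def y_def[symmetric] using y by (simp add: power2_eq_square[of y] power2_eq_square[of "\<alpha> l"])
          finally show ?thesis .
        qed
        ultimately show ?thesis
          unfolding q_def D_def sum_distrib_left by (simp add: sum.distrib[symmetric])
      qed
      finally show ?thesis .
    qed
    have lower: "ennreal (4 / 5 * (r\<^sup>2 * D)) \<le> worst_risk d n X \<sigma> r T est"
      if est: "\<And>i. i < d \<Longrightarrow> (\<lambda>y. est y i) \<in> borel_measurable (Rn n)" for est :: "(nat \<Rightarrow> real) \<Rightarrow> nat \<Rightarrow> real"
    proof -
      \<comment> \<open>The half-width at which \<open>b * h\<close> reaches the boundary of the
        ball, \<open>q\<close> being the squared norm of \<open>h\<close>.\<close>
      define b where "b = r / sqrt q"
      have b2: "b\<^sup>2 = r\<^sup>2 / q" using q by (simp add: b_def power_divide)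
      define S where "S = real n * (\<Sum>l<d. s l * (g l)\<^sup>2)"
      have S: "sqnorm n (mv d X h) = S" unfolding h_def S_def by (rule sqnorm_design[OF n eS])
      have Spos: "S > 0"
      proof -
        have "0 \<le> s i * (g i)\<^sup>2" if "i < d" for i using s0[OF that] by simp
        then show ?thesis
          unfolding S_def using n k(1) gk s0[OF k(1)] by (intro mult_pos_pos sum_pos2[of _ k]) auto
      qed
      have qh: "sqnorm d h = q"
        unfolding parseval_sqnorm[OF on] q_def h_def by (intro sum.cong refl) (simp add: ip_lincomb[OF on])
      \<comment> \<open>As \<open>ip d h a = D\<close>, the functional has to be
        \<open>a / D\<close> to be biorthogonal to \<open>h\<close>; the weight
        \<open>D\<^sup>2\<close> restores the loss.\<close>
      have "ennreal (\<Sum>l<Suc 0. D\<^sup>2 * (4 / 5 * b\<^sup>2 * \<sigma>\<^sup>2 / (\<sigma>\<^sup>2 + b\<^sup>2 * S))) \<le> worst_risk d n X \<sigma> r T est"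
      proof (rule product_minimax_bound[where h = "\<lambda>_. h" and \<phi> = "\<lambda>_ i. (1 / D) * a i", OF \<sigma> T r est])
        show "(\<Sum>l<Suc 0. D\<^sup>2 * (ip d u (\<lambda>i. (1 / D) * a i))\<^sup>2) \<le> qf d T u" for u
          unfolding qfT ip_scale_right using D by (simp add: power_divide)
        show "ip d h (\<lambda>i. (1 / D) * a i) = (if j = l then 1 else 0)" if "j < Suc 0" "l < Suc 0" for j l
          unfolding ip_scale_right ha using D that by simp
        show "sqnorm d (\<lambda>i. \<Sum>l<Suc 0. \<theta> l * h i) \<le> r\<^sup>2" if \<theta>: "\<And>l. l < Suc 0 \<Longrightarrow> \<bar>\<theta> l\<bar> \<le> b" for \<theta>
        proof -
          have "\<bar>\<theta> 0\<bar>\<^sup>2 \<le> b\<^sup>2" using \<theta>[of 0] by (intro power_mono) auto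
          then have "(\<theta> 0)\<^sup>2 * q \<le> r\<^sup>2 / q * q" using q by (intro mult_right_mono) (auto simp: b2)
          then show ?thesis using q by (simp add: sqnorm_scale qh)
        qed
      qed (use q r S Spos in \<open>auto simp: b_def\<close>)
      also have "(\<Sum>l<Suc 0. D\<^sup>2 * (4 / 5 * b\<^sup>2 * \<sigma>\<^sup>2 / (\<sigma>\<^sup>2 + b\<^sup>2 * S))) = 4 / 5 * (r\<^sup>2 * D)"
      proof -
        \<comment> \<open>The balance identity
          \<open>\<sigma>\<^sup>2 * q + r\<^sup>2 * S = \<sigma>\<^sup>2 * D\<close> makes the
          linear risk of the segment equal to \<open>r\<^sup>2 * D\<close>, the risk of the ridge
          estimator.\<close>
        have "\<sigma>\<^sup>2 * q + r\<^sup>2 * S = (\<Sum>l<d. \<sigma>\<^sup>2 * (g l)\<^sup>2 + r\<^sup>2 * (real n * (s l * (g l)\<^sup>2)))"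
          unfolding q_def S_def by (simp only: sum_distrib_left sum.distrib)
        also have "\<dots> = (\<Sum>l<d. \<sigma>\<^sup>2 * (\<alpha> l * g l))"
        proof (rule sum.cong[OF refl])
          fix l assume "l \<in> {..<d}"
          then have l: "l < d" by simp
          define z where "z = real n * s l"
          have "\<sigma>\<^sup>2 * (g l)\<^sup>2 + r\<^sup>2 * (real n * (s l * (g l)\<^sup>2)) = z * (g l * ((r\<^sup>2 + v l) * g l))"
            unfolding vs[OF l, symmetric] z_def[symmetric] by (simp add: z_def power2_eq_square algebra_simps)
          also have "(r\<^sup>2 + v l) * g l = \<alpha> l * v l" using rv[OF l] by (simp add: g_def)
          also have "z * (g l * (\<alpha> l * v l)) = (v l * z) * (\<alpha> l * g l)" by (simp only: mult_ac)
          also have "v l * z = \<sigma>\<^sup>2" unfolding z_def by (rule vs[OF l])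
          finally show "\<sigma>\<^sup>2 * (g l)\<^sup>2 + r\<^sup>2 * (real n * (s l * (g l)\<^sup>2)) = \<sigma>\<^sup>2 * (\<alpha> l * g l)" .
        qed
        also have "\<dots> = \<sigma>\<^sup>2 * D" unfolding D_def sum_distrib_left ..
        finally have den: "\<sigma>\<^sup>2 * q + r\<^sup>2 * S = \<sigma>\<^sup>2 * D" .
        have "\<sigma>\<^sup>2 + b\<^sup>2 * S = (\<sigma>\<^sup>2 * q + r\<^sup>2 * S) / q" unfolding b2 using q by (simp add: add_divide_distrib)
        then have "\<sigma>\<^sup>2 + b\<^sup>2 * S = \<sigma>\<^sup>2 * D / q" unfolding den .
        then show ?thesis unfolding b2 using q D \<sigma> by (simp add: power2_eq_square)
      qed
      finally show ?thesis .
    qed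
    show ?thesis by (rule linear_minimax_le_minimax[OF lower upper])
  qed
qed

theorem theorem3:
  "\<exists>c\<^sub>0 > 0. \<exists>K\<^sub>1 K\<^sub>2 :: real.
   \<forall>(d::nat) (nS::nat) (nU::nat) (\<sigma>::real) (r::real) (\<rho>::real) (\<delta>::real)
     (XS :: nat \<Rightarrow> nat \<Rightarrow> real) (PT :: (nat \<Rightarrow> real) measure).
     d \<ge> 1 \<longrightarrow> nS \<ge> 1 \<longrightarrow> nU \<ge> 1 \<longrightarrow> \<sigma> > 0 \<longrightarrow> r > 0 \<longrightarrow> \<rho> > 0 \<longrightarrow>
     0 < \<delta> \<longrightarrow> \<delta> < 1 \<longrightarrow>
     minvertible d (emp_cov nS XS) \<longrightarrow>
     mean_zero_l2 d PT \<longrightarrow> subgaussian d \<rho> PT \<longrightarrow>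
     real nU \<ge> c\<^sub>0 * \<rho> ^ 4 * (real d + ln (1 / \<delta>)) \<longrightarrow>
     (let SigS = emp_cov nS XS;
          SigT = second_moment PT;
          PU = PiM {..<nU} (\<lambda>_. PT);
          eps = sqrt (\<rho> ^ 4 * (real d + ln (1 / \<delta>)) / real nU)
      in \<exists>E \<in> sets PU. measure PU E \<ge> 1 - \<delta> \<and>
         (\<forall>XU \<in> E. \<forall>C \<tau>. sdp_optimal d nS \<sigma> r SigS (emp_cov nU XU) C \<tau> \<longrightarrow>
            worst_risk d nS XS \<sigma> r SigT (sdp_estimator d nS XS C)
              \<le> ennreal (1 + K\<^sub>1 * eps) * linear_minimax d nS XS \<sigma> r SigT
          \<and> ((\<forall>i<d. \<forall>j<d. mmul d SigT SigS i j = mmul d SigS SigT i j) \<or> mrank d d SigT = 1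
              \<longrightarrow> worst_risk d nS XS \<sigma> r SigT (sdp_estimator d nS XS C)
                    \<le> ennreal (5/4 + K\<^sub>2 * eps) * minimax d nS XS \<sigma> r SigT)))"
\<comment> \<open>The covariance bound gives \<open>\<eta> = 260 * eps\<close>, so 1040 is 4 times
  260 and 1300 is 5/4 times 1040. As 300000 exceeds the square of 540, \<open>eps\<close> is at most
  1/540, and this puts \<open>\<eta>\<close> below 1/2.\<close>
proof (rule exI[of _ 300000], rule conjI, simp, rule exI[of _ 1040], rule exI[of _ 1300], intro allI impI)
  fix d nS nU :: nat and \<sigma> r \<rho> \<delta> :: real and XS :: "nat \<Rightarrow> nat \<Rightarrow> real" and PT :: "(nat \<Rightarrow> real) measure"
  assume d: "d \<ge> 1" and nS: "nS \<ge> 1" and nU: "nU \<ge> 1" and \<sigma>: "\<sigma> > 0" and r: "r > 0" and \<rho>: "\<rho> > 0"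
    and \<delta>: "0 < \<delta>" "\<delta> < 1" and inv: "minvertible d (emp_cov nS XS)"
    and P: "mean_zero_l2 d PT" "subgaussian d \<rho> PT"
    and large: "real nU \<ge> 300000 * \<rho> ^ 4 * (real d + ln (1 / \<delta>))"
  define T where "T = second_moment PT"
  define eps where "eps = sqrt (\<rho> ^ 4 * (real d + ln (1 / \<delta>)) / real nU)"
  have d0: "d > 0" and n0: "nS > 0" and m0: "nU > 0" using d nS nU by auto
  have T: "mpsd d T" unfolding T_def by (rule second_moment_psd[OF P(1)])
  have eps0: "0 \<le> eps" using \<delta> \<rho> by (simp add: eps_def)
  have "\<rho> ^ 4 * (real d + ln (1 / \<delta>)) / real nU \<le> (1 / 540)\<^sup>2"
  proof -
    have "\<rho> ^ 4 * (real d + ln (1 / \<delta>)) * 300000 \<le> real nU" using large by (simp only: mult_ac)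
    then have "\<rho> ^ 4 * (real d + ln (1 / \<delta>)) \<le> real nU / 300000" by simp
    also have "\<dots> \<le> (1 / 540)\<^sup>2 * real nU" by (simp add: power2_eq_square)
    finally show ?thesis using m0 by (simp only: pos_divide_le_eq of_nat_0_less_iff)
  qed
  then have "eps \<le> 1 / 540" unfolding eps_def by (intro real_le_lsqrt) auto
  then have eta: "0 \<le> 260 * eps" "260 * eps \<le> 1 / 2" using eps0 by auto
  obtain E where E: "E \<in> sets (PiM {..<nU} (\<lambda>_. PT))" "1 - \<delta> \<le> measure (PiM {..<nU} (\<lambda>_. PT)) E"
    "\<And>XU u. XU \<in> E \<Longrightarrow> \<bar>qf d (emp_cov nU XU) u - qf d T u\<bar> \<le> 260 * eps * qf d T u"
    using covariance_concentration[OF d0 m0 P \<rho> \<delta> large] unfolding T_def eps_def by blast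
  have "worst_risk d nS XS \<sigma> r T (sdp_estimator d nS XS C) \<le> ennreal (1 + 1040 * eps) * linear_minimax d nS XS \<sigma> r T
    \<and> ((\<forall>i<d. \<forall>j<d. mmul d T (emp_cov nS XS) i j = mmul d (emp_cov nS XS) T i j) \<or> mrank d d T = 1
        \<longrightarrow> worst_risk d nS XS \<sigma> r T (sdp_estimator d nS XS C) \<le> ennreal (5/4 + 1300 * eps) * minimax d nS XS \<sigma> r T)"
    if XU: "XU \<in> E" and opt: "sdp_optimal d nS \<sigma> r (emp_cov nS XS) (emp_cov nU XU) C \<tau>" for XU C \<tau>
  proof (intro conjI impI)
    have "worst_risk d nS XS \<sigma> r T (sdp_estimator d nS XS C) \<le> ennreal (1 + 4 * (260 * eps)) * linear_minimax d nS XS \<sigma> r T"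
      by (rule sdp_linear_bound[OF d0 n0 \<sigma> r inv T emp_cov_sym eta E(3)[OF XU] opt])
    then show lin: "worst_risk d nS XS \<sigma> r T (sdp_estimator d nS XS C) \<le> ennreal (1 + 1040 * eps) * linear_minimax d nS XS \<sigma> r T"
      by simp
    assume "(\<forall>i<d. \<forall>j<d. mmul d T (emp_cov nS XS) i j = mmul d (emp_cov nS XS) T i j) \<or> mrank d d T = 1"
    then have mm: "linear_minimax d nS XS \<sigma> r T \<le> ennreal (5/4) * minimax d nS XS \<sigma> r T"
      using linear_minimax_commuting[OF n0 \<sigma> T r inv] linear_minimax_rank_one[OF n0 \<sigma> T r inv] by blast
    have "worst_risk d nS XS \<sigma> r T (sdp_estimator d nS XS C)
      \<le> ennreal (1 + 1040 * eps) * (ennreal (5/4) * minimax d nS XS \<sigma> r T)"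
      by (rule order_trans[OF lin mult_left_mono[OF mm]]) simp
    also have "\<dots> = ennreal ((1 + 1040 * eps) * (5/4)) * minimax d nS XS \<sigma> r T"
      using eps0 by (subst ennreal_mult) (auto simp: mult.assoc)
    also have "(1 + 1040 * eps) * (5/4) = 5/4 + 1300 * eps" by simp
    finally show "worst_risk d nS XS \<sigma> r T (sdp_estimator d nS XS C) \<le> ennreal (5/4 + 1300 * eps) * minimax d nS XS \<sigma> r T" .
  qed
  then show "let SigS = emp_cov nS XS;
          SigT = second_moment PT;
          PU = PiM {..<nU} (\<lambda>_. PT);
          eps = sqrt (\<rho> ^ 4 * (real d + ln (1 / \<delta>)) / real nU)
      in \<exists>E \<in> sets PU. measure PU E \<ge> 1 - \<delta> \<and>
         (\<forall>XU \<in> E. \<forall>C \<tau>. sdp_optimal d nS \<sigma> r SigS (emp_cov nU XU) C \<tau> \<longrightarrow>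
            worst_risk d nS XS \<sigma> r SigT (sdp_estimator d nS XS C)
              \<le> ennreal (1 + 1040 * eps) * linear_minimax d nS XS \<sigma> r SigT
          \<and> ((\<forall>i<d. \<forall>j<d. mmul d SigT SigS i j = mmul d SigS SigT i j) \<or> mrank d d SigT = 1
              \<longrightarrow> worst_risk d nS XS \<sigma> r SigT (sdp_estimator d nS XS C)
                    \<le> ennreal (5/4 + 1300 * eps) * minimax d nS XS \<sigma> r SigT))"
    unfolding Let_def T_def[symmetric] eps_def[symmetric] using E(1,2) by blast
qed

end
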